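(* Let $G=\mathrm{SL}(3,\mathbb{R})$. Up to conjugation by automorphisms of $G$, the only minimal Cartan-decomposition subgroups of $G$ are: (i) the group $A$ of diagonal matrices in $G$ with positive diagonal entries; (ii) $\left\{\begin{pmatrix}1&r&s\\0&1&r\\0&0&1\end{pmatrix} : r,s\in\mathbb{R}\right\}$; (iii) $\left\{\begin{pmatrix}e^t&te^t&s\\0&e^t&r\\0&0&e^{-2t}\end{pmatrix} : r,s,t\in\mathbb{R}\right\}$; (iv) subgroups of the form $\left\{\begin{pmatrix}e^{pt}&r&0\\0&e^{qt}&0\\0&0&e^{-(p+q)t}\end{pmatrix} : r,t\in\mathbb{R}\right\}$, where $p$ and $q$ are fixed real numbers with $\max\{p,q\}=1$ and $\min\{p,q\}\ge -1/2$; (v) subgroups of the form $\left\{\begin{pmatrix}e^{t}\cos pt&e^{t}\sin pt&s\\-e^{t}\sin pt&e^{t}\cos pt&r\\0&0&e^{-2t}\end{pmatrix} : r,s,t\in\mathbb{R}\right\}$, where $p$ is a fixed nonzero real number.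
   Context: A closed subgroup $H$ of a Lie group $G$ is a Cartan-decomposition subgroup of $G$ if $H$ is connected and there is a compact subset $C$ of $G$ (not necessarily a subgroup) such that $CHC=G$. A Cartan-decomposition subgroup is minimal if it does not properly contain another Cartan-decomposition subgroup of $G$. *)

theory Defs
  imports "HOL-Analysis.Analysis" "HOL-Algebra.Coset"
begin

definition SL3 :: "(real^3^3) monoid"
  where "SL3 = \<lparr>carrier = {g. det g = 1}, mult = (**), one = mat 1\<rparr>"

lemma group_SL3: "group SL3"
proof (rule groupI)
  fix x assume "x \<in> carrier SL3"
  then have x: "det x = 1" by (simp add: SL3_def)
  then have "invertible x" by (simp add: invertible_det_nz)
  then obtain y where y: "y ** x = mat 1" by (auto simp: invertible_def)
  have "det y * det x = 1" using y by (metis det_I det_mul)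
  with x y show "\<exists>y\<in>carrier SL3. y \<otimes>\<^bsub>SL3\<^esub> x = \<one>\<^bsub>SL3\<^esub>" by (auto simp: SL3_def)
qed (simp_all add: SL3_def det_mul matrix_mul_assoc)

text \<open>A Lie group is represented by its underlying group, topologised as a subspace of the ambient
  type.\<close>

definition cartan_decomposition_subgroup :: "'a::topological_space monoid \<Rightarrow> 'a set \<Rightarrow> bool"
  where "cartan_decomposition_subgroup G H \<longleftrightarrow>
    subgroup H G \<and> closedin (top_of_set (carrier G)) H \<and> connected H \<and>
    (\<exists>C. compact C \<and> C \<subseteq> carrier G \<and> C <#>\<^bsub>G\<^esub> H <#>\<^bsub>G\<^esub> C = carrier G)"

definition minimal_cartan_decomposition_subgroup :: "'a::topological_space monoid \<Rightarrow> 'a set \<Rightarrow> bool"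
  where "minimal_cartan_decomposition_subgroup G H \<longleftrightarrow>
    cartan_decomposition_subgroup G H \<and>
    \<not> (\<exists>K. cartan_decomposition_subgroup G K \<and> K \<subset> H)"

text \<open>Automorphisms in the category of Lie groups. As continuous homomorphisms between Lie groups are
  smooth, these are the group automorphisms that are homeomorphisms.\<close>

definition lie_automorphisms :: "'a::topological_space monoid \<Rightarrow> ('a \<Rightarrow> 'a) set"
  where "lie_automorphisms G =
    {f \<in> iso G G. homeomorphic_map (top_of_set (carrier G)) (top_of_set (carrier G)) f}"

definition matrix3 :: "real list list \<Rightarrow> real^3^3"
  where "matrix3 xss = vector (map vector xss)"

lemma matrix3_nth:
  "matrix3 [[a, b, c], [d, e, f], [g, h, k]] $ 1 = vector [a, b, c]"
  "matrix3 [[a, b, c], [d, e, f], [g, h, k]] $ 2 = vector [d, e, f]"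
  "matrix3 [[a, b, c], [d, e, f], [g, h, k]] $ 3 = vector [g, h, k]"
  by (simp_all add: matrix3_def)

definition positive_diagonal_subgroup :: "(real^3^3) set"
  where "positive_diagonal_subgroup =
    {g \<in> carrier SL3. (\<forall>i j. i \<noteq> j \<longrightarrow> g $ i $ j = 0) \<and> (\<forall>i. g $ i $ i > 0)}"

definition unipotent_subgroup :: "(real^3^3) set"
  where "unipotent_subgroup =
    {matrix3 [[1, r, s],
              [0, 1, r],
              [0, 0, 1]] | r s. True}"

definition jordan_subgroup :: "(real^3^3) set"
  where "jordan_subgroup =
    {matrix3 [[exp t, t * exp t, s],
              [0,     exp t,     r],
              [0,     0,         exp (- 2 * t)]] | r s t. True}"

definition diagonal_root_subgroup :: "real \<Rightarrow> real \<Rightarrow> (real^3^3) set"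
  where "diagonal_root_subgroup p q =
    {matrix3 [[exp (p * t), r,           0],
              [0,           exp (q * t), 0],
              [0,           0,           exp (- (p + q) * t)]] | r t. True}"

definition spiral_subgroup :: "real \<Rightarrow> (real^3^3) set"
  where "spiral_subgroup p =
    {matrix3 [[exp t * cos (p * t),     exp t * sin (p * t), s],
              [- (exp t * sin (p * t)), exp t * cos (p * t), r],
              [0,                       0,                   exp (- 2 * t)]] | r s t. True}"

end

theory Submission imports Defs begin

text \<open>The proof works with the Lie algebra of a closed connected subgroup \<open>H\<close>, the set of all \<open>X\<close> with
  \<open>exp (t X) \<in> H\<close> for every \<open>t\<close>, which determines \<open>H\<close>. Writing \<open>N\<close> for the sum of the absolute values of the
  entries, \<open>CHC = G\<close> for a compact \<open>C\<close> means that up to bounded factors the pairs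
  \<open>(N h, N h\<inverse>)\<close> with \<open>h \<in> H\<close> take all values occurring in \<open>G\<close>, since these pairs determine the singular
  values up to bounded factors. For the listed groups this is checked directly. Conversely, if \<open>H\<close> is a
  Cartan-decomposition subgroup, the elements of \<open>H\<close> corresponding to \<open>diag(T, T, 1/T^2)\<close> with \<open>T\<close> tending to
  infinity show that the Lie algebra contains a nilpotent of rank one or has a common eigenvector; dually
  the same holds with a common invariant plane. Each case reduces to planar or triangular Lie algebras, which
  can be put into normal form: they contain a conjugate of a listed Lie algebra, or that of the inverse transpose of one,
  or else the pairs \<open>(N h, N h\<inverse>)\<close> miss part of the Weyl chamber. A listed
  group contains no smaller Cartan-decomposition subgroup because the Lie algebras of the listed groups have dimension two
  or three, and those of dimension three contain no conjugate of one of dimension two.\<close>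

section \<open>Powers and exponentials in Banach algebras\<close>

text \<open>The three singular values of an element of SL(3) have product one, so two numbers
  determine them: the largest, comparable to \<open>N h\<close>, and the inverse of the smallest,
  comparable to \<open>N (adj h)\<close>. Up to bounded factors the possible pairs (x, y) fill the
  chamber x <= y^2, y <= x^2, which has two walls and is folded onto itself by inversion. No
  structure theory of Lie algebras is used. The elements diag(T, T, 1/T^2) run along one wall, and
  conjugation by them singles out a rank-one limit; using it once for H and once for its image under
  the inverse transpose leaves only flags and block decompositions, which explicit matrices can
  handle. The negative cases need three different mechanisms: missing a wall, staying close to the
  walls, and being contained in a one-parameter group, whose pairs follow only two asymptotic rays.
  Lie algebras are obtained directly from limits in the matrix algebra, through Euler's limit for
  the exponential, and the comparison of a group with its Lie algebra needs only an open mapping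
  argument at the identity.\<close>

lemma norm_power_diff_le:
  fixes a b :: "'a::real_normed_algebra_1"
  assumes "norm a \<le> M" "norm b \<le> M"
  shows "norm (a ^ Suc k - b ^ Suc k) \<le> real (Suc k) * M ^ k * norm (a - b)"
proof (induction k)
  case (Suc k)
  have M: "0 \<le> M" using assms(1) norm_ge_zero order_trans by blast
  have "a ^ Suc (Suc k) - b ^ Suc (Suc k) = a * (a ^ Suc k - b ^ Suc k) + (a - b) * b ^ Suc k"
    by (simp add: algebra_simps)
  then have "norm (a ^ Suc (Suc k) - b ^ Suc (Suc k))
      \<le> norm a * norm (a ^ Suc k - b ^ Suc k) + norm (a - b) * norm (b ^ Suc k)"
    by (metis norm_triangle_le add_mono norm_mult_ineq)
  also have "\<dots> \<le> M * (real (Suc k) * M ^ k * norm (a - b)) + norm (a - b) * M ^ Suc k"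
  proof (intro add_mono mult_mono)
    show "norm (b ^ Suc k) \<le> M ^ Suc k"
      using norm_power_ineq[of b "Suc k"] power_mono[OF assms(2)] norm_ge_zero order_trans by blast
  qed (use Suc assms M in auto)
  also have "\<dots> = real (Suc (Suc k)) * M ^ Suc k * norm (a - b)"
    by (simp add: algebra_simps)
  finally show ?case .
qed simp

lemma exp_power_scaleR:
  fixes x :: "'a::{real_normed_algebra_1,banach}"
  shows "exp x ^ n = exp (real n *\<^sub>R x)"
proof (induction n)
  case (Suc n)
  have "exp (real (Suc n) *\<^sub>R x) = exp (x + real n *\<^sub>R x)"
    by (simp add: algebra_simps)
  also have "\<dots> = exp x * exp (real n *\<^sub>R x)"
    by (rule exp_add_commuting) simp
  finally show ?case using Suc by simp
qed simp


text \<open>The power series are compared term by term after the constant terms cancel; the factor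
  \<open>Suc n\<close> from the power estimate cancels against the factorial, which leaves the
  series of \<open>exp M\<close>.\<close>

lemma norm_exp_minus_exp_le:
  fixes a b :: "'a::{real_normed_algebra_1,banach}"
  assumes "norm a \<le> M" "norm b \<le> M"
  shows "norm (exp a - exp b) \<le> exp M * norm (a - b)"
proof -
  define f where "f x n = inverse (fact (Suc n)) *\<^sub>R (x ^ Suc n)" for x :: 'a and n
  have summ: "summable (f x)" for x
    unfolding f_def using summable_exp_generic[of x, THEN summable_ignore_initial_segment, of 1] by simp
  have "exp a - exp b = (\<Sum>n. f a n - f b n)"
    unfolding suminf_diff[OF summ summ, symmetric] unfolding f_def exp_first_term[of a] exp_first_term[of b] by (simp only: add_diff_cancel_left)
  also have "norm \<dots> \<le> (\<Sum>n. (inverse (fact n) *\<^sub>R M ^ n) * norm (a - b))"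
  proof (rule norm_suminf_le)
    fix n
    have "norm (f a n - f b n) = inverse (fact (Suc n)) * norm (a ^ Suc n - b ^ Suc n)"
      by (simp add: f_def scaleR_diff_right[symmetric] del: power_Suc fact_Suc)
    also have "\<dots> \<le> inverse (fact (Suc n)) * (real (Suc n) * M ^ n * norm (a - b))"
      by (intro mult_left_mono norm_power_diff_le assms) auto
    finally show "norm (f a n - f b n) \<le> (inverse (fact n) *\<^sub>R M ^ n) * norm (a - b)"
      by (simp add: divide_simps)
  qed (intro summable_mult2 summable_exp_generic)
  also have "\<dots> = exp M * norm (a - b)"
    using suminf_mult2[OF summable_exp_generic[of M], symmetric] by (simp add: exp_def divide_inverse mult.commute)
  finally show ?thesis .
qed

lemma continuous_on_exp_banach:
  "continuous_on UNIV (exp :: 'a::{real_normed_algebra_1,banach} \<Rightarrow> 'a)"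
  unfolding continuous_on_eq_continuous_at[OF open_UNIV]
proof
  fix x :: 'a
  have ev: "\<forall>\<^sub>F y in at x. norm (exp y - exp x) \<le> exp (norm x + 1) * norm (y - x)"
    unfolding eventually_at
  proof (intro exI[of _ 1] conjI ballI impI)
    fix y assume "y \<noteq> x \<and> dist y x < 1"
    then have "norm y \<le> norm x + 1"
      by (metis dist_norm norm_triangle_sub order.strict_implies_order add_left_mono order_trans)
    then show "norm (exp y - exp x) \<le> exp (norm x + 1) * norm (y - x)"
      by (intro norm_exp_minus_exp_le) auto
  qed simp
  have "((\<lambda>y. exp (norm x + 1) * norm (y - x)) \<longlongrightarrow> exp (norm x + 1) * norm (x - x)) (at x)"
    by (intro tendsto_intros)
  then have "((\<lambda>y. exp y - exp x) \<longlongrightarrow> 0) (at x)"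
    using ev by (intro Lim_null_comparison[OF ev]) simp
  then show "isCont exp x"
    by (simp add: isCont_def LIM_zero_iff)
qed

text \<open>The tail of the series is dominated by the scalar tail, so the claim reduces to the real
  inequality exp s <= 1 + s + s^2 on [0, 1].\<close>

lemma norm_exp_minus_one_minus_le:
  fixes x :: "'a::{real_normed_algebra_1,banach}"
  assumes "norm x \<le> 1"
  shows "norm (exp x - 1 - x) \<le> (norm x)\<^sup>2"
proof -
  have summ: "summable (\<lambda>n. inverse (fact (n + 2)) *\<^sub>R y ^ (n + 2))" for y :: "'b::{real_normed_algebra_1,banach}"
    by (rule summable_exp_generic[THEN summable_ignore_initial_segment])
  have "exp x - 1 - x = (\<Sum>n. inverse (fact (n + 2)) *\<^sub>R x ^ (n + 2))"
    by (subst exp_first_two_terms) simp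
  also have "norm \<dots> \<le> (\<Sum>n. inverse (fact (n + 2)) *\<^sub>R norm x ^ (n + 2))"
  proof (rule norm_suminf_le)
    show "norm (inverse (fact (n + 2)) *\<^sub>R x ^ (n + 2)) \<le> inverse (fact (n + 2)) *\<^sub>R norm x ^ (n + 2)" for n
      unfolding norm_scaleR real_scaleR_def
      by (intro mult_mono norm_power_ineq) auto
  qed (rule summ)
  also have "\<dots> = exp (norm x) - 1 - norm x"
    using exp_first_two_terms[of "norm x"] by simp
  also have "\<dots> \<le> (norm x)\<^sup>2"
    using exp_bound[of "norm x"] assms by simp
  finally show ?thesis .
qed

lemma exp_has_derivative_0:
  "((exp :: 'a::{real_normed_algebra_1,banach} \<Rightarrow> 'a) has_derivative (\<lambda>x. x)) (at 0)"
proof (rule has_derivativeI)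
  have ev: "\<forall>\<^sub>F y :: 'a in at 0. norm ((exp y - exp 0 - (y - 0)) /\<^sub>R norm (y - 0)) \<le> norm y"
    unfolding eventually_at
  proof (intro exI[of _ 1] conjI ballI impI)
    fix y :: 'a assume "y \<noteq> 0 \<and> dist y 0 < 1"
    then show "norm ((exp y - exp 0 - (y - 0)) /\<^sub>R norm (y - 0)) \<le> norm y"
      using norm_exp_minus_one_minus_le[of y] unfolding norm_scaleR exp_zero diff_0_right
      by (simp add: pos_divide_le_eq power2_eq_square divide_inverse_commute[symmetric])
  qed simp
  show "((\<lambda>y. (exp y - exp 0 - (y - 0 :: 'a)) /\<^sub>R norm (y - 0)) \<longlongrightarrow> 0) (at 0)"
    by (rule Lim_null_comparison[OF ev]) (rule tendsto_eq_intros, rule tendsto_ident_at, simp)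
qed simp

lemma exp_difference_quotient:
  fixes X :: "'a::{real_normed_algebra_1,banach}"
  assumes c: "filterlim c at_top sequentially"
  shows "(\<lambda>n. c n *\<^sub>R (exp ((1 / c n) *\<^sub>R X) - 1)) \<longlonglongrightarrow> X"
proof -
  have lim: "(\<lambda>n. norm X ^ 2 / c n) \<longlonglongrightarrow> 0"
    by (rule real_tendsto_divide_at_top[OF tendsto_const c])
  have ev: "\<forall>\<^sub>F n in sequentially. norm (c n *\<^sub>R (exp ((1 / c n) *\<^sub>R X) - 1) - X) \<le> norm X ^ 2 / c n"
    using filterlim_at_top[THEN iffD1, OF c, rule_format, of "norm X + 1"]
  proof eventually_elim
    case (elim n)
    then have pos: "c n > 0" by (smt (verit) norm_ge_zero)
    have small: "norm ((1 / c n) *\<^sub>R X) \<le> 1"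
      using elim pos by simp
    have "c n *\<^sub>R (exp ((1 / c n) *\<^sub>R X) - 1) - X = c n *\<^sub>R (exp ((1 / c n) *\<^sub>R X) - 1 - (1 / c n) *\<^sub>R X)"
      using pos by (simp add: algebra_simps)
    also have "norm \<dots> \<le> c n * (norm ((1 / c n) *\<^sub>R X))\<^sup>2"
      using norm_exp_minus_one_minus_le[OF small] pos by simp
    also have "\<dots> = norm X ^ 2 / c n"
      using pos by (simp add: power2_eq_square field_simps)
    finally show ?case .
  qed
  have "(\<lambda>n. c n *\<^sub>R (exp ((1 / c n) *\<^sub>R X) - 1) - X) \<longlonglongrightarrow> 0"
    by (rule Lim_null_comparison[OF ev lim])
  then show ?thesis by (simp add: LIM_zero_iff)
qed

text \<open>Euler's limit (1 + X/c)^(tc), with 1 + X/c replaced by any \<open>h n\<close> that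
  agrees with it to first order. The powers of \<open>h n\<close> are compared with those of
  exp(X/c), for which the limit is only a statement about scalars. The exponent is a successor so
  that the powers lie in every semigroup containing \<open>h n\<close>, with or without
  identity.\<close>

lemma power_floor_tendsto_exp:
  fixes h :: "nat \<Rightarrow> 'a::{real_normed_algebra_1,banach}"
  assumes c: "filterlim c at_top sequentially"
    and h: "(\<lambda>n. c n *\<^sub>R (h n - 1)) \<longlonglongrightarrow> X" and t: "0 \<le> t"
  shows "(\<lambda>n. h n ^ Suc (nat \<lfloor>t * c n\<rfloor>)) \<longlonglongrightarrow> exp (t *\<^sub>R X)"
proof -
  define k where "k n = nat \<lfloor>t * c n\<rfloor>" for n
  define e where "e n = exp ((1 / c n) *\<^sub>R X)" for n
  \<comment> \<open>The margin 1 makes \<open>D\<close> an eventual bound for c(h - 1) as well as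
    for X, so both bases have norm at most exp(D/c) and their powers up to tc stay below
    exp(Dt).\<close>
  define D where "D = norm X + 1"
  have D: "D > 0" using norm_ge_zero[of X] by (simp add: D_def add_nonneg_pos)
  have cpos: "\<forall>\<^sub>F n in sequentially. c n > 1"
    using c by (simp add: filterlim_at_top_dense)
  have bnd: "\<forall>\<^sub>F n in sequentially. norm (c n *\<^sub>R (h n - 1)) < D"
    using tendsto_norm[OF h] by (rule order_tendstoD) (simp add: D_def)
  have ev: "\<forall>\<^sub>F n in sequentially. norm (h n ^ Suc (k n) - e n ^ Suc (k n))
      \<le> (t + 1) * exp (D * t) * norm (c n *\<^sub>R (h n - 1) - c n *\<^sub>R (e n - 1))"
    using cpos bnd
  proof eventually_elim
    case (elim n)
    have hD: "c n * norm (h n - 1) < D"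
      using elim unfolding norm_scaleR by (smt (verit))
    have kle: "real (k n) \<le> t * c n" unfolding k_def using t elim by simp
    have "norm (h n) \<le> 1 + norm (h n - 1)"
      by (metis norm_one norm_triangle_sub)
    also have "norm (h n - 1) \<le> D / c n"
      using elim(1) hD by (simp add: field_simps)
    also have "1 + D / c n \<le> exp (D / c n)" by (rule exp_ge_add_one_self)
    finally have 1: "norm (h n) \<le> exp (D / c n)" by simp
    have "norm (e n) \<le> exp (norm ((1 / c n) *\<^sub>R X))" unfolding e_def by (rule norm_exp)
    also have "\<dots> \<le> exp (D / c n)" using elim by (simp add: D_def divide_right_mono)
    finally have 2: "norm (e n) \<le> exp (D / c n)" .
    have "norm (h n ^ Suc (k n) - e n ^ Suc (k n)) \<le> real (Suc (k n)) * exp (D / c n) ^ k n * norm (h n - e n)"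
      by (rule norm_power_diff_le[OF 1 2])
    also have "\<dots> \<le> ((t + 1) * c n) * exp (D * t) * norm (h n - e n)"
    proof (intro mult_right_mono mult_mono)
      show "real (Suc (k n)) \<le> (t + 1) * c n" using kle elim by (simp add: algebra_simps)
      have "exp (D / c n) ^ k n = exp (real (k n) * (D / c n))" by (rule exp_of_nat_mult[symmetric])
      also have "real (k n) * (D / c n) \<le> (t * c n) * (D / c n)"
        using D elim by (intro mult_right_mono[OF kle]) simp
      also have "\<dots> = D * t" using elim by simp
      finally show "exp (D / c n) ^ k n \<le> exp (D * t)" by simp
    qed (use t elim in auto)
    also have "\<dots> = (t + 1) * exp (D * t) * norm (c n *\<^sub>R (h n - e n))"
      using elim by simp
    also have "c n *\<^sub>R (h n - e n) = c n *\<^sub>R (h n - 1) - c n *\<^sub>R (e n - 1)"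
      by (simp add: algebra_simps)
    finally show ?case .
  qed
  have "(\<lambda>n. (t + 1) * exp (D * t) * norm (c n *\<^sub>R (h n - 1) - c n *\<^sub>R (e n - 1)))
      \<longlonglongrightarrow> (t + 1) * exp (D * t) * norm (X - X)"
    unfolding e_def by (intro tendsto_intros h exp_difference_quotient[OF c])
  then have diff: "(\<lambda>n. h n ^ Suc (k n) - e n ^ Suc (k n)) \<longlonglongrightarrow> 0"
    by (intro Lim_null_comparison[OF ev]) simp
  have "(\<lambda>n. real (Suc (k n)) / c n) \<longlonglongrightarrow> t"
  proof (rule tendsto_sandwich)
    show "\<forall>\<^sub>F n in sequentially. t \<le> real (Suc (k n)) / c n"
      using cpos
    proof eventually_elim
      case (elim n)
      then show ?case unfolding k_def by (simp add: pos_le_divide_eq) linarith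
    qed
    show "\<forall>\<^sub>F n in sequentially. real (Suc (k n)) / c n \<le> t + 1 / c n"
      using cpos
    proof eventually_elim
      case (elim n)
      have "real (k n) \<le> t * c n" unfolding k_def using t elim by simp
      then show ?case using elim by (simp add: field_simps)
    qed
    have "(\<lambda>n. 1 / c n) \<longlonglongrightarrow> 0" by (rule real_tendsto_divide_at_top[OF tendsto_const c])
    then show "(\<lambda>n. t + 1 / c n) \<longlonglongrightarrow> t" by (auto intro: tendsto_eq_intros)
  qed simp
  then have "(\<lambda>n. (real (Suc (k n)) / c n) *\<^sub>R X) \<longlonglongrightarrow> t *\<^sub>R X"
    by (intro tendsto_intros)
  then have "(\<lambda>n. exp ((real (Suc (k n)) / c n) *\<^sub>R X)) \<longlonglongrightarrow> exp (t *\<^sub>R X)"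
    by (rule continuous_on_tendsto_compose[OF continuous_on_exp_banach]) auto
  then have "(\<lambda>n. e n ^ Suc (k n)) \<longlonglongrightarrow> exp (t *\<^sub>R X)"
    by (simp only: e_def exp_power_scaleR scaleR_scaleR times_divide_eq_right mult_1_right)
  from tendsto_add[OF diff this] show ?thesis unfolding k_def by (simp only: diff_add_cancel add_0_left)
qed

section \<open>The exponential of a real matrix\<close>

text \<open>A copy of the square matrices on which the matrix product and the operator norm are the
  class operations. The Euclidean norm of the vector type gives the n x n identity matrix norm sqrt
  n, so it cannot serve for a unital normed algebra; the copy makes the abstract exponential
  available.\<close>

typedef 'n sqmat = "UNIV :: (real^'n^'n) set" morphisms mat_of of_mat by simp

lemmas sqmat_simps = of_mat_inverse[OF UNIV_I] mat_of_inverse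
declare sqmat_simps[simp]

lemma sqmat_eqI: "mat_of A = mat_of B \<Longrightarrow> A = B"
  by (simp add: mat_of_inject)

instantiation sqmat :: (finite) real_vector
begin
definition "0 = of_mat 0"
definition "A + B = of_mat (mat_of A + mat_of B)"
definition "A - B = of_mat (mat_of A - mat_of B)"
definition "- A = of_mat (- mat_of A)"
definition "r *\<^sub>R A = of_mat (r *\<^sub>R mat_of A)"
instance
  by standard (auto simp: zero_sqmat_def plus_sqmat_def minus_sqmat_def uminus_sqmat_def scaleR_sqmat_def
      algebra_simps)
end

lemma matrix_add_rdistrib: "(A + B) ** C = A ** C + B ** (C :: real^'n^'m)"
  by (vector matrix_matrix_mult_def sum.distrib[symmetric] field_simps)

instantiation sqmat :: (finite) ring_1
begin
definition "1 = of_mat (mat 1)"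
definition "A * B = of_mat (mat_of A ** mat_of B)"
instance
proof
  have "mat 1 \<noteq> (0 :: real^'a^'a)" by (auto simp: vec_eq_iff mat_def)
  then show "(0 :: 'a sqmat) \<noteq> 1"
    by (simp add: zero_sqmat_def one_sqmat_def of_mat_inject)
qed (auto simp: plus_sqmat_def times_sqmat_def one_sqmat_def
      matrix_mul_assoc matrix_add_ldistrib matrix_add_rdistrib)
end

lemma mat_of_simps [simp]:
  "mat_of 0 = 0" "mat_of 1 = mat 1" "mat_of (A + B) = mat_of A + mat_of B"
  "mat_of (A - B) = mat_of A - mat_of B" "mat_of (- A) = - mat_of A"
  "mat_of (r *\<^sub>R A) = r *\<^sub>R mat_of A" "mat_of (A * B) = mat_of A ** mat_of B"
  by (simp_all add: zero_sqmat_def one_sqmat_def plus_sqmat_def minus_sqmat_def uminus_sqmat_def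
      scaleR_sqmat_def times_sqmat_def)

instantiation sqmat :: (finite) real_normed_algebra_1
begin
definition "norm A = onorm ((*v) (mat_of A))"
definition "dist A B = norm (A - B)" for A :: "'a sqmat"
definition "sgn A = A /\<^sub>R norm A" for A :: "'a sqmat"
definition "(uniformity :: ('a sqmat \<times> 'a sqmat) filter) = (INF e\<in>{0 <..}. principal {(x, y). dist x y < e})"
definition "open (U :: 'a sqmat set) \<longleftrightarrow> (\<forall>x\<in>U. eventually (\<lambda>(x', y). x' = x \<longrightarrow> y \<in> U) uniformity)"
instance
proof
  fix A B :: "'a sqmat" and r :: real
  have bl: "bounded_linear ((*v) (mat_of A))" for A :: "'a sqmat" by simp
  show "dist A B = norm (A - B)" by (rule dist_sqmat_def)
  show "sgn A = A /\<^sub>R norm A" by (rule sgn_sqmat_def)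
  show "norm A = 0 \<longleftrightarrow> A = 0"
    unfolding norm_sqmat_def onorm_eq_0[OF bl]
    using matrix_eq[of "mat_of A" 0] by (auto simp: zero_sqmat_def intro!: sqmat_eqI)
  show "norm (A + B) \<le> norm A + norm B"
    unfolding norm_sqmat_def mat_of_simps matrix_vector_mult_add_rdistrib[abs_def]
    by (rule onorm_triangle[OF bl bl])
  show "norm (r *\<^sub>R A) = \<bar>r\<bar> * norm A"
    unfolding norm_sqmat_def mat_of_simps scaleR_matrix_vector_assoc[abs_def, symmetric]
    by (rule onorm_scaleR[OF bl])
  show "norm (A * B) \<le> norm A * norm B"
    unfolding norm_sqmat_def mat_of_simps
    using onorm_compose[OF bl bl, of A B] unfolding o_def matrix_vector_mul_assoc .
  have "(*v) (mat 1 :: real^'a^'a) = (\<lambda>x. x)" by auto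
  then show "norm (1 :: 'a sqmat) = 1"
    unfolding norm_sqmat_def mat_of_simps by (simp add: onorm_id)
qed (simp_all add: uniformity_sqmat_def open_sqmat_def times_sqmat_def plus_sqmat_def scaleR_sqmat_def
      matrix_scalar_ac scalar_matrix_assoc[unfolded scalar_mult_eq_scaleR])
end


lemma norm_matrix_le_sum:
  fixes A :: "real^'n^'m"
  shows "norm A \<le> (\<Sum>i\<in>UNIV. \<Sum>j\<in>UNIV. \<bar>A $ i $ j\<bar>)"
proof -
  have "norm A \<le> (\<Sum>i\<in>UNIV. norm (A $ i))"
    unfolding norm_vec_def by (rule L2_set_le_sum) simp
  also have "\<dots> \<le> (\<Sum>i\<in>UNIV. \<Sum>j\<in>UNIV. \<bar>A $ i $ j\<bar>)"
    by (intro sum_mono norm_le_l1_cart)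
  finally show ?thesis .
qed

lemma bounded_linear_mat_of: "bounded_linear (mat_of :: 'n::finite sqmat \<Rightarrow> real^'n^'n)"
proof (rule bounded_linear_intro[where K = "real CARD('n) * real CARD('n)"])
  fix A :: "'n sqmat"
  have "norm (mat_of A) \<le> (\<Sum>i\<in>UNIV. \<Sum>j\<in>UNIV. \<bar>mat_of A $ i $ j\<bar>)"
    by (rule norm_matrix_le_sum)
  also have "\<dots> \<le> (\<Sum>i\<in>(UNIV::'n set). \<Sum>j\<in>(UNIV::'n set). norm A)"
    unfolding norm_sqmat_def by (intro sum_mono matrix_component_le_onorm)
  finally show "norm (mat_of A) \<le> norm A * (real CARD('n) * real CARD('n))"
    by (simp add: algebra_simps)
qed simp_all

lemma bounded_linear_of_mat: "bounded_linear (of_mat :: real^'n^'n \<Rightarrow> 'n::finite sqmat)"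
proof (rule bounded_linear_intro[where K = "real CARD('n) * real CARD('n)"])
  fix A :: "real^'n^'n"
  have le: "\<bar>A $ i $ j\<bar> \<le> norm A" for i j
    by (metis component_le_norm_cart Finite_Cartesian_Product.norm_nth_le order_trans)
  have "norm (of_mat A :: 'n sqmat) \<le> (\<Sum>i\<in>UNIV. \<Sum>j\<in>UNIV. \<bar>A $ i $ j\<bar>)"
    unfolding norm_sqmat_def by (simp add: onorm_le_matrix_component_sum)
  also have "\<dots> \<le> (\<Sum>i\<in>(UNIV::'n set). \<Sum>j\<in>(UNIV::'n set). norm A)"
    by (intro sum_mono le)
  finally show "norm (of_mat A :: 'n sqmat) \<le> norm A * (real CARD('n) * real CARD('n))"
    by (simp add: algebra_simps)
qed (auto intro!: sqmat_eqI)

instance sqmat :: (finite) banach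
proof
  fix X :: "nat \<Rightarrow> 'a sqmat" assume "Cauchy X"
  then have "Cauchy (\<lambda>n. mat_of (X n))"
    by (rule bounded_linear.Cauchy[OF bounded_linear_mat_of])
  then obtain L where "(\<lambda>n. mat_of (X n)) \<longlonglongrightarrow> L"
    by (meson Cauchy_convergent convergentD)
  then have "(\<lambda>n. of_mat (mat_of (X n)) :: 'a sqmat) \<longlonglongrightarrow> of_mat L"
    by (rule bounded_linear.tendsto[OF bounded_linear_of_mat])
  then show "convergent X" by (auto simp: convergent_def)
qed

definition mexp :: "real^'n^'n \<Rightarrow> real^'n::finite^'n"
  where "mexp A = mat_of (exp (of_mat A))"

lemma of_mat_simps:
  "of_mat (mat 1) = (1 :: 'n::finite sqmat)" "of_mat 0 = (0 :: 'n sqmat)"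
  "of_mat (A + B) = (of_mat A + of_mat B :: 'n sqmat)" "of_mat (A - B) = (of_mat A - of_mat B :: 'n sqmat)"
  "of_mat (r *\<^sub>R A) = (r *\<^sub>R of_mat A :: 'n sqmat)" "of_mat (A ** B) = (of_mat A * of_mat B :: 'n sqmat)"
  by (auto intro!: sqmat_eqI)

lemma mexp_0 [simp]: "mexp 0 = mat 1"
  by (simp add: mexp_def of_mat_simps)

lemma mexp_add: "mexp ((s + t) *\<^sub>R X) = mexp (s *\<^sub>R X) ** mexp (t *\<^sub>R X)"
proof -
  have "exp (of_mat ((s + t) *\<^sub>R X)) = exp (of_mat (s *\<^sub>R X)) * exp (of_mat (t *\<^sub>R X))"
    by (subst exp_add_commuting[symmetric]) (simp_all add: of_mat_simps scaleR_add_left)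
  then show ?thesis by (simp add: mexp_def)
qed

lemma continuous_on_mexp: "continuous_on UNIV mexp"
  unfolding mexp_def
  by (intro bounded_linear.continuous_on[OF bounded_linear_mat_of]
      continuous_on_compose2[OF continuous_on_exp_banach]
      bounded_linear.continuous_on[OF bounded_linear_of_mat] continuous_on_id) auto

lemma mexp_has_derivative_0: "(mexp has_derivative (\<lambda>X. X)) (at 0)"
proof -
  have "((\<lambda>X. of_mat X) has_derivative (\<lambda>X. of_mat X)) (at (0 :: real^'a^'a))"
    by (rule bounded_linear_imp_has_derivative[OF bounded_linear_of_mat])
  from has_derivative_compose[OF this, of exp "\<lambda>X. X"] exp_has_derivative_0
  have "((\<lambda>X. exp (of_mat X)) has_derivative (\<lambda>X. of_mat X)) (at (0 :: real^'a^'a))"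
    by (simp add: of_mat_simps)
  from bounded_linear.has_derivative[OF bounded_linear_mat_of this] show ?thesis
    by (simp add: mexp_def[abs_def])
qed

lemma mexp_has_vector_derivative_0: "((\<lambda>t. mexp (t *\<^sub>R X)) has_vector_derivative X) (at 0)"
proof -
  have "((\<lambda>t::real. t *\<^sub>R X) has_derivative (\<lambda>t. t *\<^sub>R X)) (at 0)"
    by (intro derivative_eq_intros) auto
  from has_derivative_compose[OF this, of mexp "\<lambda>X. X"] mexp_has_derivative_0 show ?thesis
    by (simp add: has_vector_derivative_def)
qed

lemma mpow_closed:
  assumes mult: "\<And>x y. x \<in> H \<Longrightarrow> y \<in> H \<Longrightarrow> x ** y \<in> H" and "x \<in> H"
  shows "mat_of (of_mat x ^ Suc n) \<in> H"
  by (induction n) (use assms in auto)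

text \<open>Powers of \<open>h n\<close> stay in the semigroup, and by Euler's limit suitable powers
  converge to the exponential. Besides tangent vectors of groups, this serves for sets defined by
  entry equations, where only products have to be checked.\<close>

lemma mexp_in_closed_semigroup:
  fixes h :: "nat \<Rightarrow> real^'n::finite^'n"
  assumes cl: "closed H" and mult: "\<And>x y. x \<in> H \<Longrightarrow> y \<in> H \<Longrightarrow> x ** y \<in> H"
    and h: "\<And>n. h n \<in> H" and c: "filterlim c at_top sequentially"
    and lim: "(\<lambda>n. c n *\<^sub>R (h n - mat 1)) \<longlonglongrightarrow> X" and t: "0 \<le> t"
  shows "mexp (t *\<^sub>R X) \<in> H"
proof -
  have "(\<lambda>n. of_mat (c n *\<^sub>R (h n - mat 1)) :: 'n sqmat) \<longlonglongrightarrow> of_mat X"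
    by (rule bounded_linear.tendsto[OF bounded_linear_of_mat lim])
  then have "(\<lambda>n. c n *\<^sub>R (of_mat (h n) - 1) :: 'n sqmat) \<longlonglongrightarrow> of_mat X"
    by (simp add: of_mat_simps)
  from power_floor_tendsto_exp[OF c this t]
  have "(\<lambda>n. mat_of (of_mat (h n) ^ Suc (nat \<lfloor>t * c n\<rfloor>))) \<longlonglongrightarrow> mat_of (exp (t *\<^sub>R of_mat X))"
    by (rule bounded_linear.tendsto[OF bounded_linear_mat_of])
  then have lim': "(\<lambda>n. mat_of (of_mat (h n) ^ Suc (nat \<lfloor>t * c n\<rfloor>))) \<longlonglongrightarrow> mexp (t *\<^sub>R X)"
    by (simp only: mexp_def of_mat_simps)
  have mem: "mat_of (of_mat (h n) ^ Suc (nat \<lfloor>t * c n\<rfloor>)) \<in> H" for n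
    by (rule mpow_closed[OF mult h])
  show ?thesis
    by (rule closed_sequentially[OF cl mem lim'])
qed

lemma one_parameter_group_power:
  assumes hom: "\<And>s t. \<gamma> (s + t) = \<gamma> s ** \<gamma> t"
  shows "mat_of (of_mat (\<gamma> s) ^ Suc n) = \<gamma> (real (Suc n) * s)"
proof (induction n)
  case (Suc n)
  then show ?case using hom[of s "real (Suc n) * s"] by (simp add: algebra_simps)
qed simp

text \<open>The value at t is the n-th power of the value at t/n, which is 1 + tX/n to first order,
  so Euler's limit applies; negative t follow by inversion. Every closed formula for an exponential
  below is verified through this: a homomorphism law and a derivative at 0 replace a differential
  equation.\<close>

lemma one_parameter_group_eq_mexp:
  fixes \<gamma> :: "real \<Rightarrow> real^'n::finite^'n"
  assumes hom: "\<And>s t. \<gamma> (s + t) = \<gamma> s ** \<gamma> t" and one: "\<gamma> 0 = mat 1"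
    and der: "(\<gamma> has_vector_derivative X) (at 0)"
  shows "mexp (t *\<^sub>R X) = \<gamma> t"
proof -
  have der_lim: "((\<lambda>h. inverse h *\<^sub>R (\<gamma> h - mat 1)) \<longlongrightarrow> X) (at 0)"
  proof -
    have "((\<lambda>h. (\<gamma> h - \<gamma> 0 - (h - 0) *\<^sub>R X) /\<^sub>R norm (h - 0)) \<longlongrightarrow> 0) (at 0)"
      using der unfolding has_vector_derivative_def has_derivative_at_within by blast
    from tendsto_norm_zero[OF this]
    have "((\<lambda>h. norm ((\<gamma> h - mat 1 - h *\<^sub>R X) /\<^sub>R \<bar>h\<bar>)) \<longlongrightarrow> 0) (at 0)"
      unfolding one diff_0_right real_norm_def .
    moreover have "norm ((\<gamma> h - mat 1 - h *\<^sub>R X) /\<^sub>R \<bar>h\<bar>) = norm (inverse h *\<^sub>R (\<gamma> h - mat 1) - X)" if "h \<noteq> 0" for h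
    proof -
      have "inverse h *\<^sub>R (\<gamma> h - mat 1) - X = inverse h *\<^sub>R (\<gamma> h - mat 1 - h *\<^sub>R X)"
        using that by (simp add: algebra_simps)
      then show ?thesis by simp
    qed
    ultimately have "((\<lambda>h. norm (inverse h *\<^sub>R (\<gamma> h - mat 1) - X)) \<longlongrightarrow> 0) (at 0)"
      by (subst (asm) tendsto_cong[where g = "\<lambda>h. norm (inverse h *\<^sub>R (\<gamma> h - mat 1) - X)"])
        (auto simp: eventually_at_filter)
    then show ?thesis
      by (simp add: tendsto_norm_zero_iff LIM_zero_iff)
  qed
  have pos: "mexp (t *\<^sub>R X) = \<gamma> t" if t: "t > 0" for t
  proof -
    define c where "c n = real (Suc n) / t" for n
    have c: "filterlim c at_top sequentially"
      unfolding filterlim_at_top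
    proof
      fix Z
      show "\<forall>\<^sub>F n in sequentially. Z \<le> c n"
        unfolding eventually_sequentially
      proof (intro exI[of _ "nat \<lceil>Z * t\<rceil>"] allI impI)
        fix n assume "nat \<lceil>Z * t\<rceil> \<le> n"
        then have "Z * t \<le> real n" by linarith
        then show "Z \<le> c n" using t by (simp add: c_def pos_le_divide_eq)
      qed
    qed
    have "filterlim (\<lambda>n. inverse (c n)) (at 0) sequentially"
      using tendsto_inverse_0_at_top[OF c] t
      by (intro filterlim_atI) (auto simp: c_def)
    from filterlim_compose[OF der_lim this]
    have "(\<lambda>n. c n *\<^sub>R (\<gamma> (inverse (c n)) - mat 1)) \<longlonglongrightarrow> X" by simp
    then have "(\<lambda>n. of_mat (c n *\<^sub>R (\<gamma> (inverse (c n)) - mat 1)) :: 'n sqmat) \<longlonglongrightarrow> of_mat X"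
      by (rule bounded_linear.tendsto[OF bounded_linear_of_mat])
    then have lim: "(\<lambda>n. c n *\<^sub>R (of_mat (\<gamma> (inverse (c n))) - 1) :: 'n sqmat) \<longlonglongrightarrow> of_mat X"
      by (simp add: of_mat_simps)
    have fl: "nat \<lfloor>t * c n\<rfloor> = Suc n" for n
      using t by (simp add: c_def)
    have "(\<lambda>n. of_mat (\<gamma> (inverse (c n))) ^ Suc (Suc n)) \<longlonglongrightarrow> (exp (t *\<^sub>R of_mat X) :: 'n sqmat)"
      using power_floor_tendsto_exp[OF c lim, of t] t unfolding fl by simp
    then have "(\<lambda>n. mat_of (of_mat (\<gamma> (inverse (c n))) ^ Suc (Suc n) :: 'n sqmat)) \<longlonglongrightarrow> mat_of (exp (t *\<^sub>R of_mat X))"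
      by (rule bounded_linear.tendsto[OF bounded_linear_mat_of])
    then have l1: "(\<lambda>n. \<gamma> (real (Suc (Suc n)) * inverse (c n))) \<longlonglongrightarrow> mexp (t *\<^sub>R X)"
      unfolding one_parameter_group_power[of \<gamma>, OF hom] mexp_def of_mat_simps .
    \<comment> \<open>Euler's limit carries one factor more than the time t requires; this extra
      factor is the value at 1/c, which tends to the identity.\<close>
    have eq: "real (Suc (Suc n)) * inverse (c n) = inverse (c n) + t" for n
      using t by (simp add: c_def field_simps)
    have "\<gamma> \<midarrow>0\<rightarrow> \<gamma> 0"
      using der has_vector_derivative_continuous isCont_def by blast
    from filterlim_compose[OF this \<open>filterlim (\<lambda>n. inverse (c n)) (at 0) sequentially\<close>]
    have "(\<lambda>n. \<gamma> (inverse (c n))) \<longlonglongrightarrow> mat 1" using one by simp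
    then have "(\<lambda>n. of_mat (\<gamma> (inverse (c n))) * of_mat (\<gamma> t) :: 'n sqmat) \<longlonglongrightarrow> of_mat (mat 1) * of_mat (\<gamma> t)"
      by (intro tendsto_mult tendsto_const bounded_linear.tendsto[OF bounded_linear_of_mat])
    then have "(\<lambda>n. mat_of (of_mat (\<gamma> (inverse (c n))) * of_mat (\<gamma> t) :: 'n sqmat)) \<longlonglongrightarrow> mat_of (of_mat (mat 1) * of_mat (\<gamma> t) :: 'n sqmat)"
      by (rule bounded_linear.tendsto[OF bounded_linear_mat_of])
    then have "(\<lambda>n. \<gamma> (inverse (c n) + t)) \<longlonglongrightarrow> \<gamma> t"
      by (simp add: hom)
    with l1 show ?thesis unfolding eq using LIMSEQ_unique by blast
  qed
  consider "t > 0" | "t = 0" | "t < 0" by linarith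
  then show ?thesis
  proof cases
    case 3
    have g: "\<gamma> (- t) ** \<gamma> t = mat 1" and "mexp (t *\<^sub>R X) ** mexp ((- t) *\<^sub>R X) = mat 1"
      using hom[of "- t" t] one mexp_add[of t "- t" X] by simp_all
    then have "mexp (t *\<^sub>R X) ** \<gamma> (- t) = mat 1" using pos[of "- t"] 3 by simp
    then have "mexp (t *\<^sub>R X) ** (\<gamma> (- t) ** \<gamma> t) = \<gamma> t"
      by (simp add: matrix_mul_assoc)
    then show ?thesis using g by simp
  qed (use pos one in auto)
qed

lemma bounded_bilinear_matrix_mult:
  "bounded_bilinear ((**) :: real^'n^'m \<Rightarrow> real^'p^'n \<Rightarrow> real^'p^'m)"
  unfolding bilinear_conv_bounded_bilinear[symmetric] bilinear_def
  by (auto intro!: linearI simp: matrix_add_ldistrib matrix_add_rdistrib)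
    (simp_all add: vec_eq_iff matrix_matrix_mult_def sum_distrib_left mult_ac)

lemmas tendsto_matrix_mult [tendsto_intros] = bounded_bilinear.tendsto[OF bounded_bilinear_matrix_mult]
lemmas continuous_on_matrix_mult [continuous_intros] =
  bounded_bilinear.continuous_on[OF bounded_bilinear_matrix_mult]
lemmas has_derivative_matrix_mult = bounded_bilinear.FDERIV[OF bounded_bilinear_matrix_mult]
lemmas matrix_mult_diff_left = bounded_bilinear.diff_left[OF bounded_bilinear_matrix_mult]
lemmas matrix_mult_diff_right = bounded_bilinear.diff_right[OF bounded_bilinear_matrix_mult]
lemmas matrix_mult_scaleR_left = bounded_bilinear.scaleR_left[OF bounded_bilinear_matrix_mult]
lemmas matrix_mult_scaleR_right = bounded_bilinear.scaleR_right[OF bounded_bilinear_matrix_mult]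
lemmas matrix_mult_minus_left = bounded_bilinear.minus_left[OF bounded_bilinear_matrix_mult]
lemmas matrix_mult_minus_right = bounded_bilinear.minus_right[OF bounded_bilinear_matrix_mult]
lemmas matrix_mult_zero_left = bounded_bilinear.zero_left[OF bounded_bilinear_matrix_mult]
lemmas matrix_mult_zero_right = bounded_bilinear.zero_right[OF bounded_bilinear_matrix_mult]

lemma matrix_inverse_unique:
  fixes x y :: "real^'n^'n"
  assumes "x ** y = mat 1" "z ** x = mat 1"
  shows "y = z"
  by (metis assms matrix_mul_assoc matrix_mul_lid matrix_mul_rid)

lemma mexp_minus: "mexp X ** mexp (- X) = mat 1" "mexp (- X) ** mexp X = mat 1"
  using mexp_add[of 1 "-1" X] mexp_add[of "-1" 1 X] by simp_all

text \<open>The curve P exp(tX) Q is again a one-parameter group, with derivative P X Q at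
  0.\<close>

lemma mexp_conj:
  fixes P Q X :: "real^'n::finite^'n"
  assumes PQ: "P ** Q = mat 1"
  shows "mexp (P ** X ** Q) = P ** mexp X ** Q"
proof -
  have QP: "Q ** P = mat 1" using PQ matrix_left_right_inverse by blast
  have "mexp (1 *\<^sub>R (P ** X ** Q)) = P ** mexp (1 *\<^sub>R X) ** Q"
  proof (rule one_parameter_group_eq_mexp)
    fix s t
    have "P ** mexp (s *\<^sub>R X) ** Q ** (P ** mexp (t *\<^sub>R X) ** Q)
        = P ** mexp (s *\<^sub>R X) ** (Q ** P) ** mexp (t *\<^sub>R X) ** Q"
      by (simp only: matrix_mul_assoc)
    then show "P ** mexp ((s + t) *\<^sub>R X) ** Q = P ** mexp (s *\<^sub>R X) ** Q ** (P ** mexp (t *\<^sub>R X) ** Q)"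
      by (simp add: QP mexp_add matrix_mul_assoc)
  next
    have "bounded_linear (\<lambda>Y. P ** Y ** Q)"
      using bounded_linear_compose[OF bounded_bilinear.bounded_linear_left[OF bounded_bilinear_matrix_mult]
          bounded_bilinear.bounded_linear_right[OF bounded_bilinear_matrix_mult]] .
    then show "((\<lambda>t. P ** mexp (t *\<^sub>R X) ** Q) has_vector_derivative P ** X ** Q) (at 0)"
      using bounded_linear.has_vector_derivative mexp_has_vector_derivative_0 by blast
  qed (simp add: PQ)
  then show ?thesis by simp
qed

lemma mexp_transpose: "mexp (- transpose X) = transpose (mexp (- X))"
proof -
  have bl: "bounded_linear (transpose :: real^'n^'n \<Rightarrow> _)"
    unfolding linear_conv_bounded_linear[symmetric]
    by (auto intro!: linearI simp: transpose_def vec_eq_iff)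
  have "mexp (1 *\<^sub>R (- transpose X)) = transpose (mexp (1 *\<^sub>R (- X)))"
  proof (rule one_parameter_group_eq_mexp)
    fix s t
    show "transpose (mexp ((s + t) *\<^sub>R (- X))) = transpose (mexp (s *\<^sub>R (- X))) ** transpose (mexp (t *\<^sub>R (- X)))"
      by (metis add.commute matrix_transpose_mul mexp_add)
    have "((\<lambda>t. transpose (mexp (t *\<^sub>R (- X)))) has_vector_derivative transpose (- X)) (at 0)"
      by (rule bounded_linear.has_vector_derivative[OF bl mexp_has_vector_derivative_0])
    moreover have "transpose (- X) = - transpose X" by (simp add: transpose_def vec_eq_iff)
    ultimately show "((\<lambda>t. transpose (mexp (t *\<^sub>R (- X)))) has_vector_derivative - transpose X) (at 0)" by simp
  qed simp
  then show ?thesis by simp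
qed

lemma mexp_difference_quotient:
  assumes "filterlim c at_top sequentially"
  shows "(\<lambda>n. c n *\<^sub>R (mexp ((1 / c n) *\<^sub>R X) - mat 1)) \<longlonglongrightarrow> X"
  using bounded_linear.tendsto[OF bounded_linear_mat_of exp_difference_quotient[OF assms, of "of_mat X"]]
  by (simp add: mexp_def of_mat_simps)

section \<open>Closed matrix groups and their Lie algebras\<close>

definition matrix_subgroup :: "(real^'n^'n) set \<Rightarrow> bool"
  where "matrix_subgroup H \<longleftrightarrow> mat 1 \<in> H \<and> (\<forall>x\<in>H. \<forall>y\<in>H. x ** y \<in> H) \<and>
    (\<forall>x\<in>H. \<exists>y\<in>H. x ** y = mat 1)"

definition lie :: "(real^'n::finite^'n) set \<Rightarrow> (real^'n^'n) set"
  where "lie H = {X. \<forall>t. mexp (t *\<^sub>R X) \<in> H}"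

lemma matrix_subgroup_inverse:
  assumes "matrix_subgroup H" "x \<in> H" "y ** x = mat 1"
  shows "y \<in> H"
  using assms matrix_inverse_unique unfolding matrix_subgroup_def by metis

text \<open>Suitable powers of \<open>h n\<close> approximate exp(tX) for t >= 0, and inverses give
  the rest. Sums of elements and the limit direction near the identity are both recognised as Lie
  algebra elements in this way.\<close>

lemma lieI_tangent:
  fixes H :: "(real^'n::finite^'n) set"
  assumes H: "matrix_subgroup H" "closed H"
    and h: "\<And>n. h n \<in> H" and c: "filterlim c at_top sequentially"
    and lim: "(\<lambda>n. c n *\<^sub>R (h n - mat 1)) \<longlonglongrightarrow> X"
  shows "X \<in> lie H"
proof -
  have pos: "mexp (t *\<^sub>R X) \<in> H" if "t \<ge> 0" for t
    by (rule mexp_in_closed_semigroup[OF H(2) _ h c lim that]) (use H in \<open>auto simp: matrix_subgroup_def\<close>)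
  have "mexp (t *\<^sub>R X) \<in> H" for t
  proof (cases "t \<ge> 0")
    case False
    then have "mexp ((- t) *\<^sub>R X) \<in> H" by (intro pos) auto
    moreover have "mexp (t *\<^sub>R X) ** mexp ((- t) *\<^sub>R X) = mat 1"
      using mexp_add[of t "- t" X] by simp
    ultimately show ?thesis using matrix_subgroup_inverse[OF H(1)] by blast
  qed (rule pos)
  then show ?thesis by (simp add: lie_def)
qed

lemma filterlim_real_Suc: "filterlim (\<lambda>n. real (Suc n)) at_top sequentially"
  by (rule filterlim_compose[OF filterlim_real_sequentially filterlim_Suc])

text \<open>Closure under addition is the only real content: the products exp(X/n) exp(Y/n) lie in H
  and leave the identity in direction X + Y.\<close>

lemma subspace_lie:
  assumes H: "matrix_subgroup H" "closed H"
  shows "subspace (lie H)"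
  unfolding subspace_def
proof (intro conjI ballI allI)
  show "0 \<in> lie H" using H by (simp add: lie_def matrix_subgroup_def)
next
  fix X Y assume X: "X \<in> lie H" and Y: "Y \<in> lie H"
  define c where "c n = real (Suc n)" for n
  have c: "filterlim c at_top sequentially" unfolding c_def by (rule filterlim_real_Suc)
  have "(\<lambda>n. inverse (c n)) \<longlonglongrightarrow> 0" by (rule tendsto_inverse_0_at_top[OF c])
  then have "(\<lambda>n. (1 / c n) *\<^sub>R Y) \<longlonglongrightarrow> 0 *\<^sub>R Y" by (intro tendsto_intros) (simp add: divide_inverse)
  then have "(\<lambda>n. mexp ((1 / c n) *\<^sub>R Y)) \<longlonglongrightarrow> mexp (0 *\<^sub>R Y)"
    by (rule continuous_on_tendsto_compose[OF continuous_on_mexp]) auto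
  then have Y1: "(\<lambda>n. mexp ((1 / c n) *\<^sub>R Y)) \<longlonglongrightarrow> mat 1" by simp
  have "(\<lambda>n. (c n *\<^sub>R (mexp ((1 / c n) *\<^sub>R X) - mat 1)) ** mexp ((1 / c n) *\<^sub>R Y)
      + c n *\<^sub>R (mexp ((1 / c n) *\<^sub>R Y) - mat 1)) \<longlonglongrightarrow> X ** mat 1 + Y"
    by (intro tendsto_intros mexp_difference_quotient c Y1)
  moreover have "(c n *\<^sub>R (x - mat 1)) ** y + c n *\<^sub>R (y - mat 1) = c n *\<^sub>R (x ** y - mat 1)" for n and x y :: "real^'a^'a"
    by (simp add: matrix_mult_scaleR_left matrix_mult_diff_left scaleR_diff_right)
  ultimately have "(\<lambda>n. c n *\<^sub>R (mexp ((1 / c n) *\<^sub>R X) ** mexp ((1 / c n) *\<^sub>R Y) - mat 1)) \<longlonglongrightarrow> X + Y"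
    by simp
  then show "X + Y \<in> lie H"
    by (rule lieI_tangent[OF H _ c, rotated]) (use X Y H in \<open>auto simp: lie_def matrix_subgroup_def\<close>)
next
  fix c X assume "X \<in> lie H"
  then show "c *\<^sub>R X \<in> lie H" by (auto simp: lie_def)
qed

lemma lie_conj:
  assumes H: "matrix_subgroup H" and g: "g \<in> H" "g ** k = mat 1" and X: "X \<in> lie H"
  shows "g ** X ** k \<in> lie H"
  unfolding lie_def
proof (intro CollectI allI)
  fix t
  have k: "k \<in> H" using matrix_subgroup_inverse[OF H g(1)] g(2) matrix_left_right_inverse by blast
  have "mexp (t *\<^sub>R (g ** X ** k)) = g ** mexp (t *\<^sub>R X) ** k"
    using mexp_conj[OF g(2), of "t *\<^sub>R X"] by (simp add: matrix_mult_scaleR_left matrix_mult_scaleR_right)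
  also have "\<dots> \<in> H" using H g k X by (auto simp: lie_def matrix_subgroup_def)
  finally show "mexp (t *\<^sub>R (g ** X ** k)) \<in> H" .
qed

text \<open>The bracket is the derivative at 0 of the conjugates of Y by exp(sX). Their difference
  quotients lie in the Lie algebra, and so does the limit, because a finite-dimensional subspace is
  closed.\<close>

lemma lie_bracket:
  assumes H: "matrix_subgroup H" "closed H" and X: "X \<in> lie H" and Y: "Y \<in> lie H"
  shows "X ** Y - Y ** X \<in> lie H"
proof -
  define c where "c n = real (Suc n)" for n
  have c: "filterlim c at_top sequentially" unfolding c_def by (rule filterlim_real_Suc)
  define E where "E n = mexp ((1 / c n) *\<^sub>R X)" for n
  define F where "F n = mexp ((1 / c n) *\<^sub>R (- X))" for n
  have E: "E n ** F n = mat 1" for n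
    unfolding E_def F_def using mexp_minus[of "(1 / c n) *\<^sub>R X"] by simp
  have mem: "c n *\<^sub>R (E n ** Y ** F n - Y) \<in> lie H" for n
  proof -
    have "E n \<in> H" using X by (simp add: E_def lie_def)
    then have "E n ** Y ** F n \<in> lie H" by (rule lie_conj[OF H(1) _ E Y])
    then show ?thesis using subspace_lie[OF H] Y by (intro subspace_scale subspace_diff)
  qed
  have "(\<lambda>n. inverse (c n)) \<longlonglongrightarrow> 0" by (rule tendsto_inverse_0_at_top[OF c])
  then have "(\<lambda>n. (1 / c n) *\<^sub>R (- X)) \<longlonglongrightarrow> 0 *\<^sub>R (- X)" by (intro tendsto_intros) (simp add: divide_inverse)
  then have "F \<longlonglongrightarrow> mexp (0 *\<^sub>R (- X))" unfolding F_def
    by (rule continuous_on_tendsto_compose[OF continuous_on_mexp]) auto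
  then have F1: "F \<longlonglongrightarrow> mat 1" by simp
  have "(\<lambda>n. (c n *\<^sub>R (E n - mat 1)) ** Y ** F n + Y ** (c n *\<^sub>R (F n - mat 1))) \<longlonglongrightarrow> X ** Y ** mat 1 + Y ** (- X)"
    unfolding E_def using F1 unfolding F_def
    by (intro tendsto_intros mexp_difference_quotient[OF c])
  moreover have "(c n *\<^sub>R (e - mat 1)) ** Y ** f + Y ** (c n *\<^sub>R (f - mat 1)) = c n *\<^sub>R (e ** Y ** f - Y)" for n e f
    by (simp add: matrix_mult_scaleR_left matrix_mult_scaleR_right matrix_mult_diff_left matrix_mult_diff_right scaleR_diff_right)
  ultimately have "(\<lambda>n. c n *\<^sub>R (E n ** Y ** F n - Y)) \<longlonglongrightarrow> X ** Y - Y ** X"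
    by (simp add: matrix_mult_minus_right)
  then show ?thesis
    by (rule closed_sequentially[OF closed_subspace[OF subspace_lie[OF H]] mem])
qed

text \<open>Near the identity, every matrix is \<open>mexp (p X) ** (mat 1 + (X - p X))\<close> with \<open>p\<close> a projection onto
  the Lie algebra. An element of \<open>H\<close> close to the identity but outside \<open>Q\<close> would leave a nonzero second
  factor in \<open>H\<close>, and the directions of these factors would accumulate at a tangent direction
  of \<open>H\<close> transverse to the Lie algebra.\<close>

lemma lie_generates_neighbourhood:
  fixes H Q :: "(real^'n::finite^'n) set"
  assumes H: "matrix_subgroup H" "closed H" and Q: "matrix_subgroup Q"
    and HQ: "\<And>X. X \<in> lie H \<Longrightarrow> mexp X \<in> Q"
  shows "\<exists>e>0. \<forall>x\<in>H. dist x (mat 1) < e \<longrightarrow> x \<in> Q"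
proof (rule ccontr)
  assume neg: "\<not> ?thesis"
  have sub: "subspace (lie H)" by (rule subspace_lie[OF H])
  obtain p where p: "range p \<subseteq> lie H" "linear p" "\<And>X. X \<in> lie H \<Longrightarrow> p X = X"
    using linear_exists_left_inverse_on[OF linear_id sub] by auto
  have blp: "bounded_linear p" using p(2) linear_conv_bounded_linear by blast
  define f where "f X = mexp (p X) ** (mat 1 + (X - p X))" for X
  have contf: "continuous_on UNIV f"
    unfolding f_def
    by (intro continuous_intros continuous_on_compose2[OF continuous_on_mexp] bounded_linear.continuous_on[OF blp]) auto
  have "(p has_derivative p) (at 0)" by (rule bounded_linear_imp_has_derivative[OF blp])
  moreover have "p 0 = 0" by (rule linear_0[OF p(2)])
  ultimately have "((\<lambda>X. mexp (p X)) has_derivative p) (at 0)"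
    using has_derivative_compose[of p p 0 UNIV mexp "\<lambda>X. X"] mexp_has_derivative_0 by simp
  moreover have "((\<lambda>X. mat 1 + (X - p X)) has_derivative (\<lambda>X. 0 + (X - p X))) (at 0)"
    by (intro derivative_intros bounded_linear_imp_has_derivative[OF blp])
  ultimately have "(f has_derivative (\<lambda>X. mexp (p 0) ** (0 + (X - p X)) + p X ** (mat 1 + (0 - p 0)))) (at 0)"
    unfolding f_def by (rule has_derivative_matrix_mult)
  then have derf: "(f has_derivative (\<lambda>X. X)) (at 0)" by (simp add: \<open>p 0 = 0\<close>)
  have ex: "\<exists>X. norm X < 1 / Suc n \<and> f X \<in> H \<and> f X \<notin> Q" for n
  proof -
    \<comment> \<open>The derivative of \<open>f\<close> is known at 0 alone, so an inverse function
      theorem is out of reach; an open mapping theorem for a continuous map with invertible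
      derivative at a single point suffices.\<close>
    have "f 0 \<in> interior (f ` ball 0 (1 / Suc n))"
      by (rule sussmann_open_mapping[OF open_UNIV contf _ derf bounded_linear_ident]) auto
    then obtain e where e: "e > 0" "ball (f 0) e \<subseteq> f ` ball 0 (1 / Suc n)"
      unfolding mem_interior by blast
    have "f 0 = mat 1" by (simp add: f_def \<open>p 0 = 0\<close>)
    obtain x where x: "x \<in> H" "dist x (mat 1) < e" "x \<notin> Q" using neg e(1) by blast
    then have "x \<in> f ` ball 0 (1 / Suc n)"
      using e(2) \<open>f 0 = mat 1\<close> by (auto simp: dist_commute)
    then show ?thesis using x by (auto simp: dist_norm)
  qed
  then obtain X where X: "\<And>n. norm (X n) < 1 / Suc n" "\<And>n. f (X n) \<in> H" "\<And>n. f (X n) \<notin> Q" by metis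
  define Z where "Z n = X n - p (X n)" for n
  have X0: "X \<longlonglongrightarrow> 0"
  proof (rule Lim_null_comparison)
    show "\<forall>\<^sub>F n in sequentially. norm (X n) \<le> 1 / Suc n" using X(1) by (simp add: less_imp_le)
    show "(\<lambda>n. 1 / Suc n) \<longlonglongrightarrow> 0" using LIMSEQ_inverse_real_of_nat by (simp add: divide_inverse)
  qed
  have "Z \<longlonglongrightarrow> 0 - p 0"
    unfolding Z_def by (intro tendsto_intros X0 bounded_linear.tendsto[OF blp])
  then have Z0: "Z \<longlonglongrightarrow> 0" by (simp add: \<open>p 0 = 0\<close>)
  have ZH: "mat 1 + Z n \<in> H" and Zn0: "Z n \<noteq> 0" for n
  proof -
    have pl: "p (X n) \<in> lie H" using p(1) by blast
    have "mexp (p (X n)) \<in> H" using pl unfolding lie_def by (metis (mono_tags, lifting) mem_Collect_eq scaleR_one)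
    moreover have "- p (X n) \<in> lie H" using pl sub subspace_neg by blast
    then have mH: "mexp (- p (X n)) \<in> H" unfolding lie_def by (metis (mono_tags, lifting) mem_Collect_eq scaleR_one)
    have "mat 1 + Z n = mexp (- p (X n)) ** f (X n)"
      unfolding f_def Z_def by (simp add: matrix_mul_assoc mexp_minus)
    then show "mat 1 + Z n \<in> H" using H(1) X(2) mH by (simp add: matrix_subgroup_def)
    show "Z n \<noteq> 0"
    proof
      assume "Z n = 0"
      then have "f (X n) = mexp (p (X n))" by (simp add: f_def Z_def)
      then show False using X(3) HQ pl by metis
    qed
  qed
  define u where "u n = Z n /\<^sub>R norm (Z n)" for n
  have "u n \<in> sphere 0 1" for n using Zn0 by (simp add: u_def)
  then obtain l r where l: "l \<in> sphere 0 1" and r: "strict_mono r" "(u \<circ> r) \<longlonglongrightarrow> l"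
    using compact_sphere[of 0 1] unfolding compact_def by metis
  have lie_l: "l \<in> lie H"
  proof (rule lieI_tangent[OF H])
    show "mat 1 + Z (r n) \<in> H" for n by (rule ZH)
    have "filterlim (\<lambda>n. norm (Z (r n))) (at_right 0) sequentially"
      unfolding filterlim_at using LIMSEQ_subseq_LIMSEQ[OF Z0 r(1)] Zn0
      by (auto intro!: tendsto_norm_zero simp: o_def)
    then show "filterlim (\<lambda>n. inverse (norm (Z (r n)))) at_top sequentially"
      by (rule filterlim_compose[OF filterlim_inverse_at_top_right])
    show "(\<lambda>n. inverse (norm (Z (r n))) *\<^sub>R (mat 1 + Z (r n) - mat 1)) \<longlonglongrightarrow> l"
      using r(2) by (simp add: u_def o_def)
  qed
  have pZ: "p (u n) = 0" for n
  proof -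
    have "p (X n) \<in> lie H" using p(1) by blast
    then have "p (Z n) = 0" unfolding Z_def linear_diff[OF p(2)] using p(3) by simp
    then show ?thesis unfolding u_def linear_scale[OF p(2)] by simp
  qed
  have "(\<lambda>n. p ((u \<circ> r) n)) \<longlonglongrightarrow> p l" by (rule bounded_linear.tendsto[OF blp r(2)])
  then have "(\<lambda>n. 0) \<longlonglongrightarrow> p l" by (simp add: pZ)
  \<comment> \<open>The limit direction is both killed and fixed by \<open>p\<close>: each
    \<open>Z n\<close> is in the kernel of the projection, while \<open>l\<close> lies in the Lie
    algebra.\<close>
  then have "p l = 0" by (simp add: LIMSEQ_const_iff)
  then have "l = 0" using p(3)[OF lie_l] by simp
  then show False using l by simp
qed

text \<open>For z near x in H the quotient x^(-1) z is close to the identity, hence in Q, so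
  membership in Q is locally constant on H and connectedness finishes. It is used both to trap H in
  an explicit matrix group and to show that equal Lie algebras give equal groups.\<close>

lemma connected_subset_if_lie_subset:
  fixes H Q :: "(real^'n::finite^'n) set"
  assumes H: "matrix_subgroup H" "closed H" and conn: "connected H" and Q: "matrix_subgroup Q"
    and HQ: "\<And>X. X \<in> lie H \<Longrightarrow> mexp X \<in> Q"
  shows "H \<subseteq> Q"
proof -
  obtain e where e: "e > 0" "\<And>x. x \<in> H \<Longrightarrow> dist x (mat 1) < e \<Longrightarrow> x \<in> Q"
    using lie_generates_neighbourhood[OF H Q HQ] by blast
  have near: "\<exists>d>0. \<forall>z\<in>H. dist x z < d \<longrightarrow> (z \<in> Q \<longleftrightarrow> x \<in> Q)" if x: "x \<in> H" for x
  proof -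
    obtain y where y: "y \<in> H" "x ** y = mat 1" using H(1) x by (auto simp: matrix_subgroup_def)
    then have yx: "y ** x = mat 1" using matrix_left_right_inverse by blast
    have "continuous_on UNIV (\<lambda>z. y ** z)" by (intro continuous_intros)
    then obtain d where d: "d > 0" "\<And>z. dist z x < d \<Longrightarrow> dist (y ** z) (y ** x) < e"
      unfolding continuous_on_iff using e(1) by (metis UNIV_I)
    have "z \<in> Q \<longleftrightarrow> x \<in> Q" if z: "z \<in> H" "dist x z < d" for z
    proof -
      have "y ** z \<in> H" using H(1) y z by (simp add: matrix_subgroup_def)
      then have w: "y ** z \<in> Q" using d(2)[of z] z yx by (intro e(2)) (auto simp: dist_commute)
      have z1: "x ** (y ** z) = z" by (simp add: matrix_mul_assoc y(2))
      obtain w' where w': "w' \<in> Q" "(y ** z) ** w' = mat 1" using Q w by (auto simp: matrix_subgroup_def)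
      have "z ** w' = x" using z1 w' by (metis matrix_mul_assoc matrix_mul_rid)
      then show ?thesis using z1 w w' Q unfolding matrix_subgroup_def by metis
    qed
    then show ?thesis using d(1) by blast
  qed
  have op: "openin (top_of_set H) (H \<inter> Q)"
    unfolding openin_contains_ball
  proof (intro conjI ballI)
    fix x assume x: "x \<in> H \<inter> Q"
    then obtain d where "d > 0" "\<forall>z\<in>H. dist x z < d \<longrightarrow> (z \<in> Q \<longleftrightarrow> x \<in> Q)" using near by blast
    then show "\<exists>d. 0 < d \<and> ball x d \<inter> H \<subseteq> H \<inter> Q"
      using x by (intro exI[of _ d]) auto
  qed simp
  have op2: "openin (top_of_set H) (H - Q)"
    unfolding openin_contains_ball
  proof (intro conjI ballI)
    fix x assume x: "x \<in> H - Q"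
    then obtain d where "d > 0" "\<forall>z\<in>H. dist x z < d \<longrightarrow> (z \<in> Q \<longleftrightarrow> x \<in> Q)" using near by blast
    then show "\<exists>d. 0 < d \<and> ball x d \<inter> H \<subseteq> H - Q"
      using x by (intro exI[of _ d]) auto
  qed auto
  have "closedin (top_of_set H) (H \<inter> Q)"
  proof -
    have "H \<inter> Q = H - (H - Q)" by blast
    then show ?thesis using closedin_diff[OF closedin_self op2] by simp
  qed
  moreover have "mat 1 \<in> H \<inter> Q" using H(1) Q by (simp add: matrix_subgroup_def)
  ultimately show ?thesis using conn op unfolding connected_clopen by blast
qed

section \<open>Three by three matrices\<close>

abbreviation m3 where
  "m3 a b c d e f g h k \<equiv> matrix3 [[a, b, c], [d, e, f], [g, h, k]]"

lemma m3_nth [simp]: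
  "m3 a b c d e f g h k $ 1 $ 1 = a" "m3 a b c d e f g h k $ 1 $ 2 = b" "m3 a b c d e f g h k $ 1 $ 3 = c"
  "m3 a b c d e f g h k $ 2 $ 1 = d" "m3 a b c d e f g h k $ 2 $ 2 = e" "m3 a b c d e f g h k $ 2 $ 3 = f"
  "m3 a b c d e f g h k $ 3 $ 1 = g" "m3 a b c d e f g h k $ 3 $ 2 = h" "m3 a b c d e f g h k $ 3 $ 3 = k"
  by (simp_all add: matrix3_nth vector_3)

lemma matrix3_eqI:
  fixes X Y :: "real^3^3"
  assumes "X $ 1 $ 1 = Y $ 1 $ 1" "X $ 1 $ 2 = Y $ 1 $ 2" "X $ 1 $ 3 = Y $ 1 $ 3"
    "X $ 2 $ 1 = Y $ 2 $ 1" "X $ 2 $ 2 = Y $ 2 $ 2" "X $ 2 $ 3 = Y $ 2 $ 3"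
    "X $ 3 $ 1 = Y $ 3 $ 1" "X $ 3 $ 2 = Y $ 3 $ 2" "X $ 3 $ 3 = Y $ 3 $ 3"
  shows "X = Y"
  using assms by (simp add: vec_eq_iff forall_3)

lemma m3_collapse:
  "m3 (X $ 1 $ 1) (X $ 1 $ 2) (X $ 1 $ 3) (X $ 2 $ 1) (X $ 2 $ 2) (X $ 2 $ 3) (X $ 3 $ 1) (X $ 3 $ 2) (X $ 3 $ 3) = X"
  by (rule matrix3_eqI) simp_all

lemma m3_cases:
  obtains a b c d e f g h k where "X = m3 a b c d e f g h k"
  using m3_collapse[symmetric] by blast

lemma m3_eq_iff [simp]:
  "m3 a b c d e f g h k = m3 a' b' c' d' e' f' g' h' k' \<longleftrightarrow>
    a = a' \<and> b = b' \<and> c = c' \<and> d = d' \<and> e = e' \<and> f = f' \<and> g = g' \<and> h = h' \<and> k = k'"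
  by (metis m3_nth)

lemma m3_mult [simp]:
  "m3 a b c d e f g h k ** m3 a' b' c' d' e' f' g' h' k' =
    m3 (a * a' + b * d' + c * g') (a * b' + b * e' + c * h') (a * c' + b * f' + c * k')
       (d * a' + e * d' + f * g') (d * b' + e * e' + f * h') (d * c' + e * f' + f * k')
       (g * a' + h * d' + k * g') (g * b' + h * e' + k * h') (g * c' + h * f' + k * k')"
  by (rule matrix3_eqI) (simp_all add: matrix_matrix_mult_def sum_3)

lemma m3_add [simp]:
  "m3 a b c d e f g h k + m3 a' b' c' d' e' f' g' h' k' =
    m3 (a + a') (b + b') (c + c') (d + d') (e + e') (f + f') (g + g') (h + h') (k + k')"
  by (rule matrix3_eqI) simp_all

lemma m3_diff [simp]:
  "m3 a b c d e f g h k - m3 a' b' c' d' e' f' g' h' k' =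
    m3 (a - a') (b - b') (c - c') (d - d') (e - e') (f - f') (g - g') (h - h') (k - k')"
  by (rule matrix3_eqI) simp_all

lemma m3_minus [simp]: "- m3 a b c d e f g h k = m3 (- a) (- b) (- c) (- d) (- e) (- f) (- g) (- h) (- k)"
  by (rule matrix3_eqI) simp_all

lemma m3_scaleR [simp]:
  "r *\<^sub>R m3 a b c d e f g h k = m3 (r * a) (r * b) (r * c) (r * d) (r * e) (r * f) (r * g) (r * h) (r * k)"
  by (rule matrix3_eqI) simp_all

lemma m3_transpose [simp]: "transpose (m3 a b c d e f g h k) = m3 a d g b e h c f k"
  by (rule matrix3_eqI) (simp_all add: transpose_def)

lemma m3_one: "(mat 1 :: real^3^3) = m3 1 0 0 0 1 0 0 0 1"
  by (rule matrix3_eqI) (simp_all add: mat_def)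

lemma m3_zero: "(0 :: real^3^3) = m3 0 0 0 0 0 0 0 0 0"
  by (rule matrix3_eqI) simp_all

lemma m3_det [simp]:
  "det (m3 a b c d e f g h k) = a * e * k + b * f * g + c * d * h - a * f * h - b * d * k - c * e * g"
  by (simp add: det_3)

lemma matrix3_mult_nth:
  fixes X Y :: "real^3^3"
  shows "(X ** Y) $ i $ j = X $ i $ 1 * Y $ 1 $ j + X $ i $ 2 * Y $ 2 $ j + X $ i $ 3 * Y $ 3 $ j"
  by (simp add: matrix_matrix_mult_def sum_3)

lemma continuous_on_m3 [continuous_intros]:
  assumes "continuous_on S a" "continuous_on S b" "continuous_on S c" "continuous_on S d" "continuous_on S e"
    "continuous_on S f" "continuous_on S g" "continuous_on S h" "continuous_on S k"
  shows "continuous_on S (\<lambda>x. m3 (a x) (b x) (c x) (d x) (e x) (f x) (g x) (h x) (k x))"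
proof -
  have "continuous_on S (\<lambda>x. \<chi> i j. m3 (a x) (b x) (c x) (d x) (e x) (f x) (g x) (h x) (k x) $ i $ j)"
    apply (intro continuous_on_vec_lambda)
    subgoal for i j using exhaust_3[of i] exhaust_3[of j] assms by auto
    done
  then show ?thesis by simp
qed

lemma has_vector_derivative_m3:
  assumes "(a has_real_derivative a') (at t)" "(b has_real_derivative b') (at t)" "(c has_real_derivative c') (at t)"
    "(d has_real_derivative d') (at t)" "(e has_real_derivative e') (at t)" "(f has_real_derivative f') (at t)"
    "(g has_real_derivative g') (at t)" "(h has_real_derivative h') (at t)" "(k has_real_derivative k') (at t)"
  shows "((\<lambda>t. m3 (a t) (b t) (c t) (d t) (e t) (f t) (g t) (h t) (k t)) has_vector_derivative
    m3 a' b' c' d' e' f' g' h' k') (at t)"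
proof -
  have axes: "m3 a b c d e f g h k = a *\<^sub>R m3 1 0 0 0 0 0 0 0 0 + b *\<^sub>R m3 0 1 0 0 0 0 0 0 0 + c *\<^sub>R m3 0 0 1 0 0 0 0 0 0
      + d *\<^sub>R m3 0 0 0 1 0 0 0 0 0 + e *\<^sub>R m3 0 0 0 0 1 0 0 0 0 + f *\<^sub>R m3 0 0 0 0 0 1 0 0 0
      + g *\<^sub>R m3 0 0 0 0 0 0 1 0 0 + h *\<^sub>R m3 0 0 0 0 0 0 0 1 0 + k *\<^sub>R m3 0 0 0 0 0 0 0 0 1" for a b c d e f g h k
    by simp
  have sc: "((\<lambda>t. p t *\<^sub>R B) has_vector_derivative p' *\<^sub>R B) (at t)" if "(p has_real_derivative p') (at t)" for p p' and B :: "real^3^3"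
    using has_vector_derivative_scaleR[OF that has_vector_derivative_const[of B]] by simp
  show ?thesis
    by (subst axes, subst (2) axes) (intro has_vector_derivative_add sc assms)
qed

text \<open>The adjugate: on determinant one it is the inverse, and being polynomial in the entries
  it is continuous everywhere and comes with growth bounds.\<close>

definition adj :: "real^3^3 \<Rightarrow> real^3^3"
  where "adj X = m3
    (X$2$2 * X$3$3 - X$2$3 * X$3$2) (X$1$3 * X$3$2 - X$1$2 * X$3$3) (X$1$2 * X$2$3 - X$1$3 * X$2$2)
    (X$2$3 * X$3$1 - X$2$1 * X$3$3) (X$1$1 * X$3$3 - X$1$3 * X$3$1) (X$1$3 * X$2$1 - X$1$1 * X$2$3)
    (X$2$1 * X$3$2 - X$2$2 * X$3$1) (X$1$2 * X$3$1 - X$1$1 * X$3$2) (X$1$1 * X$2$2 - X$1$2 * X$2$1)"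

lemma adj_m3 [simp]: "adj (m3 a b c d e f g h k) =
    m3 (e * k - f * h) (c * h - b * k) (b * f - c * e) (f * g - d * k) (a * k - c * g) (c * d - a * f)
       (d * h - e * g) (b * g - a * h) (a * e - b * d)"
  by (simp add: adj_def)

lemma adj_right: assumes "det X = 1" shows "X ** adj X = mat 1"
proof (cases X rule: m3_cases)
  case (1 a b c d e f g h k)
  then have d: "a * e * k + b * f * g + c * d * h - a * f * h - b * d * k - c * e * g = 1"
    using assms by simp
  have "a * (e * k - f * h) + b * (f * g - d * k) + c * (d * h - e * g) = 1"
    "a * (c * h - b * k) + b * (a * k - c * g) + c * (b * g - a * h) = 0"
    "a * (b * f - c * e) + b * (c * d - a * f) + c * (a * e - b * d) = 0"
    "d * (e * k - f * h) + e * (f * g - d * k) + f * (d * h - e * g) = 0"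
    "d * (c * h - b * k) + e * (a * k - c * g) + f * (b * g - a * h) = 1"
    "d * (b * f - c * e) + e * (c * d - a * f) + f * (a * e - b * d) = 0"
    "g * (e * k - f * h) + h * (f * g - d * k) + k * (d * h - e * g) = 0"
    "g * (c * h - b * k) + h * (a * k - c * g) + k * (b * g - a * h) = 0"
    "g * (b * f - c * e) + h * (c * d - a * f) + k * (a * e - b * d) = 1"
    using d by (simp_all add: algebra_simps)
  then show ?thesis unfolding 1 by (simp add: m3_one)
qed

lemma adj_left: "det X = 1 \<Longrightarrow> adj X ** X = mat 1"
  using adj_right matrix_left_right_inverse by blast

lemma adj_unique: "det X = 1 \<Longrightarrow> X ** Y = mat 1 \<Longrightarrow> Y = adj X"
  using adj_left matrix_inverse_unique by blast

lemma adj_unique': "det X = 1 \<Longrightarrow> Y ** X = mat 1 \<Longrightarrow> Y = adj X"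
  using adj_unique matrix_left_right_inverse by blast

lemma det_adj: "det X = 1 \<Longrightarrow> det (adj X) = 1"
  by (metis adj_right det_I det_mul mult_1)

lemma adj_adj: "det X = 1 \<Longrightarrow> adj (adj X) = X"
  using adj_left adj_unique det_adj by metis

lemma adj_mult: "adj (X ** Y) = adj Y ** adj X"
  by (cases X rule: m3_cases, cases Y rule: m3_cases) (simp add: algebra_simps)

lemma adj_one: "adj (mat 1) = mat 1"
  by (simp add: m3_one)

lemma continuous_on_adj: "continuous_on UNIV adj"
  unfolding adj_def by (intro continuous_intros)

lemma matrix_subgroup_adj:
  assumes "matrix_subgroup H" "x \<in> H" "det x = 1"
  shows "adj x \<in> H"
  using matrix_subgroup_inverse[OF assms(1,2) adj_left[OF assms(3)]] .

definition N :: "real^3^3 \<Rightarrow> real"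
  where "N X = (\<Sum>i\<in>UNIV. \<Sum>j\<in>UNIV. \<bar>X $ i $ j\<bar>)"

lemma N_m3 [simp]: "N (m3 a b c d e f g h k) =
    \<bar>a\<bar> + \<bar>b\<bar> + \<bar>c\<bar> + \<bar>d\<bar> + \<bar>e\<bar> + \<bar>f\<bar> + \<bar>g\<bar> + \<bar>h\<bar> + \<bar>k\<bar>"
  by (simp add: N_def sum_3)

lemma N_nonneg [simp]: "0 \<le> N X" by (simp add: N_def sum_nonneg)

lemma N_entry: "\<bar>X $ i $ j\<bar> \<le> N X"
proof (cases X rule: m3_cases)
  case (1 a b c d e f g h k)
  then show ?thesis using exhaust_3[of i] exhaust_3[of j] by auto
qed

lemma N_mult: "N (X ** Y) \<le> N X * N Y"
proof -
  have "N (X ** Y) \<le> (\<Sum>i\<in>UNIV. \<Sum>j\<in>UNIV. \<Sum>k\<in>UNIV. \<bar>X $ i $ k\<bar> * \<bar>Y $ k $ j\<bar>)"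
    unfolding N_def matrix_matrix_mult_def
    by (intro sum_mono) (simp add: abs_mult[symmetric] del: abs_mult)
  also have "\<dots> = (\<Sum>i\<in>UNIV. \<Sum>k\<in>UNIV. \<bar>X $ i $ k\<bar> * (\<Sum>j\<in>UNIV. \<bar>Y $ k $ j\<bar>))"
    unfolding sum_distrib_left by (intro sum.cong refl sum.swap)
  also have "\<dots> \<le> (\<Sum>i\<in>UNIV. \<Sum>k\<in>UNIV. \<bar>X $ i $ k\<bar> * N Y)"
  proof (intro sum_mono mult_left_mono)
    show "(\<Sum>j\<in>UNIV. \<bar>Y $ k $ j\<bar>) \<le> N Y" for k
      unfolding N_def by (rule member_le_sum[of k UNIV "\<lambda>k. \<Sum>j\<in>UNIV. \<bar>Y $ k $ j\<bar>"]) (auto intro: sum_nonneg)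
  qed simp
  also have "\<dots> = N X * N Y" by (simp add: N_def sum_distrib_right)
  finally show ?thesis .
qed

text \<open>Nine cofactors, each a difference of two products of entries, give the constant 18. This
  is one of the two inequalities that bound the Weyl chamber; the other one follows by applying it
  to the inverse.\<close>

lemma N_adj_le: "N (adj X) \<le> 18 * (N X)\<^sup>2"
proof -
  have e: "\<bar>p * q - r * s\<bar> \<le> 2 * (N X)\<^sup>2"
    if "\<bar>p\<bar> \<le> N X" "\<bar>q\<bar> \<le> N X" "\<bar>r\<bar> \<le> N X" "\<bar>s\<bar> \<le> N X" for p q r s
  proof -
    have "\<bar>p * q\<bar> \<le> N X * N X" "\<bar>r * s\<bar> \<le> N X * N X"
      unfolding abs_mult using that by (auto intro: mult_mono)
    then show ?thesis unfolding power2_eq_square by linarith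
  qed
  have "N (adj X) \<le> (\<Sum>i\<in>(UNIV::3 set). \<Sum>j\<in>(UNIV::3 set). 2 * (N X)\<^sup>2)"
    unfolding N_def[of "adj X"]
    apply (intro sum_mono)
    subgoal for i j using exhaust_3[of i] exhaust_3[of j] by (auto simp: adj_def intro!: e N_entry)
    done
  then show ?thesis by simp
qed

lemma continuous_on_N: "continuous_on UNIV N"
  unfolding N_def by (intro continuous_intros)

lemma N_pos: assumes "det X = 1" shows "N X > 0"
proof (rule ccontr)
  assume "\<not> N X > 0"
  then have "N X = 0" using N_nonneg[of X] by linarith
  then have "X $ i $ j = 0" for i j using N_entry[of X i j] by simp
  then show False using assms by (simp add: det_3)
qed

section \<open>Cartan-decomposition subgroups of \<open>SL(3,\<real>)\<close>\<close>

lemma SL3_simps [simp]: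
  "carrier SL3 = {g. det g = 1}" "x \<otimes>\<^bsub>SL3\<^esub> y = x ** y" "\<one>\<^bsub>SL3\<^esub> = mat 1"
  by (simp_all add: SL3_def)

lemma SL3_inv: assumes "det x = 1" shows "inv\<^bsub>SL3\<^esub> x = adj x"
  using group.inv_equality[OF group_SL3, of "adj x" x] assms by (simp add: adj_left det_adj)

lemma subgroup_SL3_iff: "subgroup H SL3 \<longleftrightarrow> matrix_subgroup H \<and> H \<subseteq> {g. det g = 1}"
proof
  assume H: "subgroup H SL3"
  then have sub: "H \<subseteq> {g. det g = 1}" using subgroup.subset by fastforce
  moreover have "matrix_subgroup H"
    unfolding matrix_subgroup_def
  proof (intro conjI ballI)
    show "mat 1 \<in> H" using subgroup.one_closed[OF H] by simp
    show "x ** y \<in> H" if "x \<in> H" "y \<in> H" for x y using subgroup.m_closed[OF H that] by simp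
    show "\<exists>y\<in>H. x ** y = mat 1" if "x \<in> H" for x
      using subgroup.m_inv_closed[OF H that] SL3_inv adj_right sub that by fastforce
  qed
  ultimately show "matrix_subgroup H \<and> H \<subseteq> {g. det g = 1}" by blast
next
  assume H: "matrix_subgroup H \<and> H \<subseteq> {g. det g = 1}"
  show "subgroup H SL3"
  proof (rule group.subgroupI[OF group_SL3])
    show "H \<noteq> {}" using H by (auto simp: matrix_subgroup_def)
    show "inv\<^bsub>SL3\<^esub> x \<in> H" if "x \<in> H" for x
      using that H SL3_inv matrix_subgroup_adj by fastforce
  qed (use H in \<open>auto simp: matrix_subgroup_def\<close>)
qed

lemma closed_SL3: "closed {g :: real^3^3. det g = 1}"
proof -
  have "continuous_on UNIV (det :: real^3^3 \<Rightarrow> real)"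
    unfolding det_3 by (intro continuous_intros)
  then show ?thesis
    using continuous_closed_preimage_constant[of UNIV "det :: real^3^3 \<Rightarrow> real" 1] by simp
qed

text \<open>SL(3) is closed among all matrices, so relative closedness is closedness, and the
  product of sets is unfolded into factorisations of single elements. Most later work uses this
  form.\<close>

lemma cds_iff:
  "cartan_decomposition_subgroup SL3 H \<longleftrightarrow>
    matrix_subgroup H \<and> H \<subseteq> {g. det g = 1} \<and> closed H \<and> connected H \<and>
    (\<exists>C. compact C \<and> C \<subseteq> {g. det g = 1} \<and>
      (\<forall>g. det g = 1 \<longrightarrow> (\<exists>c\<in>C. \<exists>h\<in>H. \<exists>c'\<in>C. g = c ** h ** c')))"
proof -
  have cl: "closedin (top_of_set {g. det g = 1}) H \<longleftrightarrow> closed H" if "H \<subseteq> {g. det g = 1}"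
    using that closed_SL3 by (metis closedin_closed_subset closed_subset closedin_closed_trans)
  have CHC: "C <#>\<^bsub>SL3\<^esub> H <#>\<^bsub>SL3\<^esub> C = {g. det g = 1} \<longleftrightarrow>
      (\<forall>g. det g = 1 \<longrightarrow> (\<exists>c\<in>C. \<exists>h\<in>H. \<exists>c'\<in>C. g = c ** h ** c'))"
    if "H \<subseteq> {g. det g = 1}" "C \<subseteq> {g. det g = 1}" for C
  proof -
    have eq: "C <#>\<^bsub>SL3\<^esub> H <#>\<^bsub>SL3\<^esub> C = {g. \<exists>c\<in>C. \<exists>h\<in>H. \<exists>c'\<in>C. g = c ** h ** c'}"
      unfolding set_mult_def SL3_simps by blast
    have "det (c ** h ** c') = 1" if "c \<in> C" "h \<in> H" "c' \<in> C" for c h c'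
      using that \<open>H \<subseteq> _\<close> \<open>C \<subseteq> _\<close> by (auto simp: det_mul subset_iff)
    then have "{g. \<exists>c\<in>C. \<exists>h\<in>H. \<exists>c'\<in>C. g = c ** h ** c'} \<subseteq> {g. det g = 1}" by blast
    then show ?thesis unfolding eq by blast
  qed
  show ?thesis
  proof (cases "H \<subseteq> {g. det g = 1}")
    case True
    have "(\<exists>C. compact C \<and> C \<subseteq> {g. det g = 1} \<and> C <#>\<^bsub>SL3\<^esub> H <#>\<^bsub>SL3\<^esub> C = {g. det g = 1}) \<longleftrightarrow>
        (\<exists>C. compact C \<and> C \<subseteq> {g. det g = 1} \<and>
          (\<forall>g. det g = 1 \<longrightarrow> (\<exists>c\<in>C. \<exists>h\<in>H. \<exists>c'\<in>C. g = c ** h ** c')))"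
      by (intro ex_cong1 conj_cong refl CHC[OF True])
    then show ?thesis
      unfolding cartan_decomposition_subgroup_def subgroup_SL3_iff SL3_simps cl[OF True] by argo
  next
    case False
    then show ?thesis
      unfolding cartan_decomposition_subgroup_def subgroup_SL3_iff by simp
  qed
qed

lemma compact_bound_N:
  assumes "compact C"
  shows "\<exists>R\<ge>1. \<forall>c\<in>C. N c \<le> R \<and> N (adj c) \<le> R"
proof -
  have "compact (N ` C)" "compact ((\<lambda>c. N (adj c)) ` C)"
    using assms continuous_on_N continuous_on_adj
    by (auto intro!: compact_continuous_image continuous_on_compose2[OF continuous_on_N] intro: continuous_on_subset)
  then obtain a b where "\<forall>x\<in>N ` C. \<bar>x\<bar> \<le> a" "\<forall>x\<in>(\<lambda>c. N (adj c)) ` C. \<bar>x\<bar> \<le> b"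
    unfolding compact_eq_bounded_closed bounded_real by blast
  then have "\<forall>c\<in>C. N c \<le> max 1 (max a b) \<and> N (adj c) \<le> max 1 (max a b)" by fastforce
  then show ?thesis by (metis max.cobounded1)
qed

text \<open>Multiplying by the bounded elements c and c' changes \<open>N\<close> of an element and
  of its inverse by at most a constant factor. The growth obstructions below use a
  Cartan-decomposition subgroup only through this consequence.\<close>

lemma cds_approx:
  assumes "cartan_decomposition_subgroup SL3 H"
  shows "\<exists>R\<ge>1. \<forall>g. det g = 1 \<longrightarrow> (\<exists>h\<in>H. N h \<le> R * N g \<and> N g \<le> R * N h \<and>
    N (adj h) \<le> R * N (adj g) \<and> N (adj g) \<le> R * N (adj h))"
proof -
  obtain C where C: "compact C" "C \<subseteq> {g. det g = 1}" and H: "H \<subseteq> {g. det g = 1}"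
    and G: "\<And>g. det g = 1 \<Longrightarrow> \<exists>c\<in>C. \<exists>h\<in>H. \<exists>c'\<in>C. g = c ** h ** c'"
    using assms unfolding cds_iff by blast
  obtain R where R: "R \<ge> 1" "\<And>c. c \<in> C \<Longrightarrow> N c \<le> R" "\<And>c. c \<in> C \<Longrightarrow> N (adj c) \<le> R"
    using compact_bound_N[OF C(1)] by blast
  have tri: "N (x ** y ** z) \<le> R\<^sup>2 * N y" if "N x \<le> R" "N z \<le> R" for x y z
  proof -
    have "N (x ** y ** z) \<le> N x * N y * N z"
      using N_mult[of "x ** y" z] N_mult[of x y] mult_right_mono[OF N_mult[of x y] N_nonneg[of z]] by linarith
    also have "\<dots> \<le> R * N y * R" using that R(1) by (intro mult_mono) auto
    finally show ?thesis by (simp add: power2_eq_square mult_ac)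
  qed
  have "\<exists>h\<in>H. N h \<le> R\<^sup>2 * N g \<and> N g \<le> R\<^sup>2 * N h \<and> N (adj h) \<le> R\<^sup>2 * N (adj g) \<and> N (adj g) \<le> R\<^sup>2 * N (adj h)"
    if g: "det g = 1" for g
  proof -
    obtain c h c' where h: "c \<in> C" "h \<in> H" "c' \<in> C" "g = c ** h ** c'" using G[OF g] by blast
    have d: "det c = 1" "det c' = 1" "det h = 1" using C(2) H h by auto
    have h2: "h = adj c ** g ** adj c'"
      unfolding h(4) using adj_left[OF d(1)] adj_right[OF d(2)]
      by (metis matrix_mul_assoc matrix_mul_lid matrix_mul_rid)
    show ?thesis
    proof (intro bexI[of _ h] conjI h(2))
      show "N h \<le> R\<^sup>2 * N g" unfolding h2 by (intro tri R h)
      show "N g \<le> R\<^sup>2 * N h" unfolding h(4) by (intro tri R h)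
      have "adj h = c' ** adj g ** c"
        unfolding h2 adj_mult using d by (simp add: adj_adj matrix_mul_assoc)
      then show "N (adj h) \<le> R\<^sup>2 * N (adj g)" using tri R h by metis
      have "adj g = adj c' ** adj h ** adj c" unfolding h(4) adj_mult by (simp add: matrix_mul_assoc)
      then show "N (adj g) \<le> R\<^sup>2 * N (adj h)" using tri R h by metis
    qed
  qed
  moreover have "R\<^sup>2 \<ge> 1" using R(1) by simp
  ultimately show ?thesis by blast
qed

text \<open>Tested on diag(T, T, 1/T^2), where (N g)^2 and N(g^(-1)) are both of order T^2 while N g
  is only of order T. An element of H close to it would satisfy the premise of \<open>far\<close>
  and, for large T, violate its conclusion.\<close>

lemma not_cds_wall:
  assumes far: "\<And>R. R \<ge> 1 \<Longrightarrow> \<exists>C. \<forall>h\<in>H. (N h)\<^sup>2 \<le> R * N (adj h) \<longrightarrow> N (adj h) \<le> C * N h"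
  shows "\<not> cartan_decomposition_subgroup SL3 H"
proof
  assume "cartan_decomposition_subgroup SL3 H"
  then obtain R where R: "R \<ge> 1" "\<And>g. det g = 1 \<Longrightarrow> \<exists>h\<in>H. N h \<le> R * N g \<and> N g \<le> R * N h \<and>
    N (adj h) \<le> R * N (adj g) \<and> N (adj g) \<le> R * N (adj h)" using cds_approx by meson
  have "9 * R ^ 3 \<ge> 1" using R(1) one_le_power[of R 3] by linarith
  then obtain C0 where C0: "\<And>h. h \<in> H \<Longrightarrow> (N h)\<^sup>2 \<le> (9 * R ^ 3) * N (adj h) \<Longrightarrow> N (adj h) \<le> C0 * N h"
    using far by blast
  define C where "C = max C0 1"
  have C: "N (adj h) \<le> C * N h" if "h \<in> H" "(N h)\<^sup>2 \<le> (9 * R ^ 3) * N (adj h)" for h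
    using C0[OF that] mult_right_mono[of C0 C "N h"] by (auto simp: C_def)
  have "C \<ge> 1" by (simp add: C_def)
  \<comment> \<open>One more than the bound 3 C R^2 on T that the estimates force.\<close>
  define T where "T = 3 * C * R\<^sup>2 + 1"
  have T: "T \<ge> 1" using \<open>C \<ge> 1\<close> R(1) by (simp add: T_def)
  define g where "g = m3 T 0 0 0 T 0 0 0 (1 / T\<^sup>2)"
  have "det g = 1" using T by (simp add: g_def power2_eq_square)
  have "1 / T\<^sup>2 \<le> T" "1 / T \<le> T\<^sup>2"
    using T one_le_power[OF T, of 3] by (simp_all add: divide_le_eq power2_eq_square power3_eq_cube)
  then have Ng: "N g \<le> 3 * T" using T by (simp add: g_def)
  have Ag: "N (adj g) \<ge> T\<^sup>2"
  proof -
    have "adj g = m3 (1 / T) 0 0 0 (1 / T) 0 0 0 (T\<^sup>2)"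
      using T by (simp add: g_def power2_eq_square)
    then show ?thesis using T by simp
  qed
  obtain h where h: "h \<in> H" "N h \<le> R * N g" "N (adj g) \<le> R * N (adj h)" using R(2)[OF \<open>det g = 1\<close>] by blast
  have Nh: "N h \<le> 3 * R * T" using order_trans[OF h(2) mult_left_mono[OF Ng, of R]] R(1) by (simp add: mult_ac)
  have "(N h)\<^sup>2 \<le> (3 * R * T)\<^sup>2" using Nh by (intro power_mono) auto
  also have "\<dots> = 9 * R\<^sup>2 * T\<^sup>2" by (simp add: power_mult_distrib)
  also have "\<dots> \<le> 9 * R\<^sup>2 * (R * N (adj h))" using Ag h(3) by (intro mult_left_mono) auto
  finally have "(N h)\<^sup>2 \<le> (9 * R ^ 3) * N (adj h)" by (simp add: power2_eq_square power3_eq_cube mult_ac)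
  then have "N (adj h) \<le> C * N h" by (rule C[OF h(1)])
  also have "\<dots> \<le> C * (3 * R * T)" using Nh \<open>C \<ge> 1\<close> by (intro mult_left_mono) auto
  finally have "R * N (adj h) \<le> R * (C * (3 * R * T))" using R(1) by (intro mult_left_mono) auto
  then have "T * T \<le> (3 * C * R\<^sup>2) * T" using Ag h(3) by (simp add: power2_eq_square mult_ac)
  then have "T \<le> 3 * C * R\<^sup>2" using T by simp
  then show False by (simp add: T_def)
qed

text \<open>Tested on diag(T, 1, 1/T), for which N of the element and of its inverse are both of
  order T: this is the middle of the chamber, while the hypothesis keeps H close to the two
  walls.\<close>

lemma not_cds_middle:
  assumes "\<And>h. h \<in> H \<Longrightarrow> (N h)\<^sup>2 \<le> C * N (adj h) \<or> (N (adj h))\<^sup>2 \<le> C * N h"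
  shows "\<not> cartan_decomposition_subgroup SL3 H"
proof
  assume "cartan_decomposition_subgroup SL3 H"
  then obtain R where R: "R \<ge> 1" "\<And>g. det g = 1 \<Longrightarrow> \<exists>h\<in>H. N h \<le> R * N g \<and> N g \<le> R * N h \<and>
    N (adj h) \<le> R * N (adj g) \<and> N (adj g) \<le> R * N (adj h)" using cds_approx by meson
  define T where "T = 3 * max C 1 * R ^ 3 + 1"
  have T: "T \<ge> 1" using R(1) by (simp add: T_def)
  define g where "g = m3 T 0 0 0 1 0 0 0 (1 / T)"
  have "det g = 1" using T by (simp add: g_def)
  have "1 / T \<le> T" using T mult_mono[OF T T] by (simp add: divide_le_eq)
  then have Ng: "N g \<le> 3 * T" "T \<le> N g" "N (adj g) \<le> 3 * T" "T \<le> N (adj g)"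
    using T by (simp_all add: g_def)
  obtain h where h: "h \<in> H" "N h \<le> R * N g" "N g \<le> R * N h" "N (adj h) \<le> R * N (adj g)" "N (adj g) \<le> R * N (adj h)"
    using R(2)[OF \<open>det g = 1\<close>] by blast
  have contra: False if x: "x\<^sup>2 \<le> C * y" "T \<le> R * x" "y \<le> R * (3 * T)" "y \<ge> 0" for x y
  proof -
    have "T\<^sup>2 \<le> (R * x)\<^sup>2" using x T by (intro power_mono) auto
    also have "\<dots> = R\<^sup>2 * x\<^sup>2" by (simp add: power_mult_distrib)
    also have "\<dots> \<le> R\<^sup>2 * (max C 1 * (R * (3 * T)))"
    proof (intro mult_left_mono)
      have "C * y \<le> max C 1 * y" using x by (intro mult_right_mono) auto
      also have "\<dots> \<le> max C 1 * (R * (3 * T))" using x by (intro mult_left_mono) auto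
      finally show "x\<^sup>2 \<le> max C 1 * (R * (3 * T))" using x by linarith
    qed simp
    finally have "T * T \<le> (3 * max C 1 * R ^ 3) * T" by (simp add: power2_eq_square power3_eq_cube mult_ac)
    then have "T \<le> 3 * max C 1 * R ^ 3" using T by simp
    then show False by (simp add: T_def)
  qed
  have "R * N g \<le> R * (3 * T)" "R * N (adj g) \<le> R * (3 * T)" using Ng R(1) by (auto intro: mult_left_mono)
  then show False
    using assms[OF h(1)] contra[of "N h" "N (adj h)"] contra[of "N (adj h)" "N h"] h Ng by fastforce
qed

section \<open>Growth of one-parameter groups\<close>

text \<open>Fekete's argument: the limit is the infimum of f t / t over t >= 1. Writing t = nT + r
  with r in [0, T], subadditivity bounds f t by n f T plus a value on [0, T], which local
  boundedness controls.\<close>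

lemma fekete:
  fixes f :: "real \<Rightarrow> real"
  assumes sub: "\<And>s t. s \<ge> 0 \<Longrightarrow> t \<ge> 0 \<Longrightarrow> f (s + t) \<le> f s + f t"
    and bdd: "\<And>T. \<exists>B. \<forall>t\<in>{0..T}. f t \<le> B"
    and lower: "\<And>t. t \<ge> 0 \<Longrightarrow> c * t - K \<le> f t"
  shows "\<exists>\<alpha>\<ge>c. ((\<lambda>t. f t / t) \<longlongrightarrow> \<alpha>) at_top"
proof -
  define S where "S = (\<lambda>t. f t / t) ` {1..}"
  define \<alpha> where "\<alpha> = Inf S"
  have low: "f t / t \<ge> c - K / t" if "t \<ge> 1" for t
  proof -
    have "(c * t - K) / t \<le> f t / t" using lower[of t] that by (intro divide_right_mono) auto
    then show ?thesis using that by (simp add: diff_divide_distrib)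
  qed
  have bb: "bdd_below S"
  proof (rule bdd_belowI)
    fix x assume "x \<in> S"
    then obtain t where t: "t \<ge> 1" "x = f t / t" by (auto simp: S_def)
    have "K / t \<le> \<bar>K\<bar>"
    proof -
      have "K / t \<le> \<bar>K\<bar> / t" using t by (intro divide_right_mono) auto
      also have "\<dots> \<le> \<bar>K\<bar>" using t mult_left_mono[of 1 t "\<bar>K\<bar>"] by (simp add: divide_le_eq)
      finally show ?thesis .
    qed
    then show "c - \<bar>K\<bar> \<le> x" using low[OF t(1)] t(2) by linarith
  qed
  have Sne: "S \<noteq> {}" by (auto simp: S_def)
  have mult: "f (real n * T + r) \<le> real n * f T + f r" if "T \<ge> 0" "r \<ge> 0" for n T r
  proof (induction n)
    case (Suc n)
    have "f (T + (real n * T + r)) \<le> f T + f (real n * T + r)" using that by (intro sub) auto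
    then show ?case using Suc by (simp add: algebra_simps)
  qed simp
  have lim: "((\<lambda>t. f t / t) \<longlongrightarrow> \<alpha>) at_top"
  proof (rule order_tendstoI)
    fix a assume "a < \<alpha>"
    show "\<forall>\<^sub>F t in at_top. a < f t / t"
      using eventually_ge_at_top[of 1]
    proof eventually_elim
      case (elim t)
      then have "\<alpha> \<le> f t / t" unfolding \<alpha>_def by (intro cInf_lower bb) (auto simp: S_def)
      then show ?case using \<open>a < \<alpha>\<close> by simp
    qed
  next
    fix a assume "\<alpha> < a"
    then obtain T where T: "T \<ge> 1" "f T / T < a"
      unfolding \<alpha>_def using cInf_lessD[OF Sne] by (auto simp: S_def)
    define q where "q = f T / T"
    obtain B where B: "\<And>t. t \<in> {0..T} \<Longrightarrow> f t \<le> B" using bdd[of T] by blast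
    have "((\<lambda>t. q + (T * \<bar>q\<bar> + B) / t) \<longlongrightarrow> q + 0) at_top"
      by (intro tendsto_intros real_tendsto_divide_at_top[OF tendsto_const] filterlim_ident)
    then have "\<forall>\<^sub>F t in at_top. q + (T * \<bar>q\<bar> + B) / t < a"
      using T(2) by (intro order_tendstoD(2)) (auto simp: q_def)
    then show "\<forall>\<^sub>F t in at_top. f t / t < a"
      using eventually_ge_at_top[of T]
    proof eventually_elim
      case (elim t)
      define n where "n = nat \<lfloor>t / T\<rfloor>"
      define r where "r = t - real n * T"
      have "real n \<le> t / T" "t / T < real n + 1" unfolding n_def using elim T by auto
      then have nT: "real n * T \<le> t" "t < real n * T + T" using T by (auto simp: field_simps)
      then have r: "r \<in> {0..T}" by (auto simp: r_def)
      have "f t \<le> real n * f T + f r" using mult[of T r n] r T by (simp add: r_def)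
      also have "\<dots> \<le> real n * f T + B" using B[OF r] by simp
      also have "real n * f T = (real n * T) * q" using T by (simp add: q_def)
      also have "\<dots> = t * q + (real n * T - t) * q" by (simp add: algebra_simps)
      also have "(real n * T - t) * q \<le> \<bar>(real n * T - t) * q\<bar>" by simp
      also have "\<bar>(real n * T - t) * q\<bar> \<le> T * \<bar>q\<bar>"
        unfolding abs_mult using nT by (intro mult_right_mono) auto
      finally have "f t \<le> t * q + T * \<bar>q\<bar> + B" by simp
      then have "f t / t \<le> q + (T * \<bar>q\<bar> + B) / t" using elim T by (simp add: field_simps)
      then show ?case using elim by simp
    qed
  qed
  have "((\<lambda>t. c - K / t) \<longlongrightarrow> c - 0) at_top"
    by (intro tendsto_intros real_tendsto_divide_at_top[OF tendsto_const] filterlim_ident)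
  moreover have "\<forall>\<^sub>F t in at_top. c - K / t \<le> f t / t"
    using eventually_ge_at_top[of 1] by eventually_elim (rule low)
  ultimately have "c \<le> \<alpha>"
    using tendsto_le[OF _ lim] by fastforce
  then show ?thesis using lim by blast
qed

lemma continuous_on_mexp_line: "continuous_on UNIV (\<lambda>t. mexp (t *\<^sub>R X))"
  by (intro continuous_on_compose2[OF continuous_on_mexp] continuous_intros) auto

lemma ln_diff_le:
  fixes a b R :: real
  assumes "a > 0" "b > 0" "a \<le> R * b" "b \<le> R * a"
  shows "\<bar>ln a - ln b\<bar> \<le> ln R"
proof -
  have "0 < R * b" using assms by linarith
  then have R: "R > 0" using assms(2) zero_less_mult_pos2 by blast
  have "ln a \<le> ln (R * b)" "ln b \<le> ln (R * a)"
    by (rule ln_mono[OF assms(3) assms(1)], rule ln_mono[OF assms(4) assms(2)])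
  moreover have "ln (R * b) = ln R + ln b" "ln (R * a) = ln R + ln a"
    by (intro ln_mult_pos assms R)+
  ultimately show ?thesis by linarith
qed

text \<open>As t tends to infinity or to minus infinity, the logarithms of N(exp tX) and N(exp -tX)
  grow linearly with positive rates, alpha in the positive and beta in the negative direction, so
  the pairs follow two rays, of slopes beta/alpha and alpha/beta. A Cartan-decomposition subgroup
  would have to approach every slope between 1/2 and 2.\<close>

lemma not_cds_one_parameter_aux:
  assumes det: "\<And>t. det (mexp (t *\<^sub>R X)) = 1" and H: "H \<subseteq> range (\<lambda>t. mexp (t *\<^sub>R X))"
    and growth: "k > 0" "c > 0" "\<And>t. k * exp (c * t) \<le> N (mexp (t *\<^sub>R X))"
  shows "\<not> cartan_decomposition_subgroup SL3 H"
proof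
  assume "cartan_decomposition_subgroup SL3 H"
  then obtain R where R: "R \<ge> 1" "\<And>g. det g = 1 \<Longrightarrow> \<exists>h\<in>H. N h \<le> R * N g \<and> N g \<le> R * N h \<and>
    N (adj h) \<le> R * N (adj g) \<and> N (adj g) \<le> R * N (adj h)" using cds_approx by meson
  define f where "f t = ln (N (mexp (t *\<^sub>R X)))" for t
  have Np: "N (mexp (t *\<^sub>R X)) > 0" for t using N_pos det by blast
  have adjm: "adj (mexp (t *\<^sub>R X)) = mexp ((- t) *\<^sub>R X)" for t
    using adj_unique[OF det] mexp_minus(1)[of "t *\<^sub>R X"] by (metis scaleR_minus_left)
  have sub: "f (s + t) \<le> f s + f t" for s t
  proof -
    have "f (s + t) \<le> ln (N (mexp (s *\<^sub>R X)) * N (mexp (t *\<^sub>R X)))"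
      unfolding f_def mexp_add using N_mult Np[of "s + t", unfolded mexp_add] Np by (subst ln_le_cancel_iff) auto
    also have "\<dots> = f s + f t" unfolding f_def by (rule ln_mult_pos) (rule Np)+
    finally show ?thesis .
  qed
  have contf: "continuous_on S f" for S
    unfolding f_def using Np
    by (intro continuous_on_ln continuous_on_compose2[OF continuous_on_N] continuous_on_subset[OF continuous_on_mexp_line])
      (auto simp: less_imp_neq[THEN not_sym])
  have bdd: "\<exists>B. \<forall>t\<in>{a..b}. f t \<le> B" for a b
  proof -
    have "compact (f ` {a..b})" by (intro compact_continuous_image contf) simp
    then obtain B where "\<forall>x\<in>f ` {a..b}. \<bar>x\<bar> \<le> B" unfolding compact_eq_bounded_closed bounded_real by blast
    then show ?thesis by (intro exI[of _ B]) (auto dest!: abs_le_D1)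
  qed
  have low1: "c * t - (- ln k) \<le> f t" for t
  proof -
    have "ln (k * exp (c * t)) \<le> f t" unfolding f_def using growth Np by (subst ln_le_cancel_iff) auto
    then show ?thesis using growth by (simp add: ln_mult)
  qed
  \<comment> \<open>By the cofactor bound, growth at rate c in one direction forces growth at rate
    c/2 in the other.\<close>
  have low2: "c / 2 * t - (ln 18 - ln k) / 2 \<le> f (- t)" for t
  proof -
    have "N (mexp (t *\<^sub>R X)) \<le> 18 * (N (mexp ((- t) *\<^sub>R X)))\<^sup>2"
      using N_adj_le[of "mexp ((- t) *\<^sub>R X)"] adjm[of "- t"] by simp
    then have "f t \<le> ln (18 * (N (mexp ((- t) *\<^sub>R X)))\<^sup>2)"
      unfolding f_def using Np[of t] Np[of "- t"] by (subst ln_le_cancel_iff) auto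
    also have "\<dots> = ln 18 + 2 * f (- t)" using Np[of "- t"] by (simp add: f_def ln_mult ln_realpow)
    finally show ?thesis using low1[of t] by (simp add: field_simps)
  qed
  obtain \<alpha> where \<alpha>: "\<alpha> \<ge> c" "((\<lambda>t. f t / t) \<longlongrightarrow> \<alpha>) at_top"
    using fekete[of f c "- ln k"] sub bdd low1 by blast
  have "\<exists>\<beta>\<ge>c/2. ((\<lambda>t. f (- t) / t) \<longlongrightarrow> \<beta>) at_top"
  proof (rule fekete)
    show "f (- (s + t)) \<le> f (- s) + f (- t)" for s t using sub[of "- s" "- t"] by simp
    show "\<exists>B. \<forall>t\<in>{0..T}. f (- t) \<le> B" for T
    proof -
      obtain B where "\<forall>t\<in>{-T..0}. f t \<le> B" using bdd by blast
      then show ?thesis by (intro exI[of _ B]) auto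
    qed
  qed (rule low2)
  then obtain \<beta> where \<beta>: "\<beta> \<ge> c / 2" "((\<lambda>t. f (- t) / t) \<longlongrightarrow> \<beta>) at_top" by blast
  have pos: "\<alpha> > 0" "\<beta> > 0" using \<alpha> \<beta> growth by auto
  have ratio1: "((\<lambda>t. f (- t) / f t) \<longlongrightarrow> \<beta> / \<alpha>) at_top"
  proof -
    have "((\<lambda>t. (f (- t) / t) / (f t / t)) \<longlongrightarrow> \<beta> / \<alpha>) at_top" using \<alpha> \<beta> pos by (intro tendsto_intros) auto
    moreover have "\<forall>\<^sub>F t in at_top. (f (- t) / t) / (f t / t) = f (- t) / f t"
      using eventually_gt_at_top[of 0] by eventually_elim auto
    ultimately show ?thesis by (rule Lim_transform_eventually)
  qed
  have ratio2: "((\<lambda>t. f t / f (- t)) \<longlongrightarrow> \<alpha> / \<beta>) at_top"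
  proof -
    have "((\<lambda>t. (f t / t) / (f (- t) / t)) \<longlongrightarrow> \<alpha> / \<beta>) at_top" using \<alpha> \<beta> pos by (intro tendsto_intros) auto
    moreover have "\<forall>\<^sub>F t in at_top. (f t / t) / (f (- t) / t) = f t / f (- t)"
      using eventually_gt_at_top[of 0] by eventually_elim auto
    ultimately show ?thesis by (rule Lim_transform_eventually)
  qed
  define K where "K = ln R + ln 3"
  have app: "\<exists>t. \<bar>f t - s\<bar> \<le> K \<and> \<bar>f (- t) - \<theta> * s\<bar> \<le> K" if "s \<ge> 0" "1 \<le> \<theta>" "\<theta> \<le> 2" for s \<theta>
  proof -
    \<comment> \<open>The diagonal element of logarithmic size s whose inverse has logarithmic size
      theta s; the bounds 1 <= theta <= 2 make exp s its largest entry and exp(theta s) that of its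
      inverse.\<close>
    define g where "g = m3 (exp s) 0 0 0 (exp ((\<theta> - 1) * s)) 0 0 0 (exp (- \<theta> * s))"
    have ds: "det g = 1" unfolding g_def by (simp add: exp_add[symmetric] algebra_simps)
    have ag: "adj g = m3 (exp (- s)) 0 0 0 (exp ((1 - \<theta>) * s)) 0 0 0 (exp (\<theta> * s))"
      unfolding g_def by (simp add: exp_add[symmetric] algebra_simps)
    have m: "(\<theta> - 1) * s \<le> s" "- \<theta> * s \<le> s" "- s \<le> \<theta> * s" "(1 - \<theta>) * s \<le> \<theta> * s"
      using that mult_right_mono[of "\<theta> - 1" 1 s] mult_right_mono[of "- \<theta>" 1 s] mult_right_mono[of "-1" \<theta> s]
        mult_right_mono[of "1 - \<theta>" \<theta> s] by simp_all
    have Ng: "exp s \<le> N g" "N g \<le> 3 * exp s"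
      using m unfolding g_def N_m3 by (simp_all add: add_mono)
        (smt (verit) exp_le_cancel_iff mult_minus_left)
    have Na: "exp (\<theta> * s) \<le> N (adj g)" "N (adj g) \<le> 3 * exp (\<theta> * s)"
      using m unfolding ag N_m3 by (simp_all add: add_mono)
        (smt (verit) exp_le_cancel_iff mult_minus_left)
    obtain h where h: "h \<in> H" "N h \<le> R * N g" "N g \<le> R * N h" "N (adj h) \<le> R * N (adj g)" "N (adj g) \<le> R * N (adj h)"
      using R(2)[OF ds] by blast
    obtain t where t: "h = mexp (t *\<^sub>R X)" using H h(1) by blast
    have lnN: "\<bar>ln y - z\<bar> \<le> ln 3" if "exp z \<le> y" "y \<le> 3 * exp z" for y z :: real
    proof -
      have "y > 0" using that exp_gt_zero[of z] by linarith
      then have "\<bar>ln y - ln (exp z)\<bar> \<le> ln 3" by (intro ln_diff_le) (use that in auto)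
      then show ?thesis by simp
    qed
    have "\<bar>ln (N h) - ln (N g)\<bar> \<le> ln R" "\<bar>ln (N (adj h)) - ln (N (adj g))\<bar> \<le> ln R"
      using h N_pos[of g] N_pos[of "adj g"] N_pos[of h] N_pos[of "adj h"] ds det det_adj t by (auto intro!: ln_diff_le)
    moreover have "ln (N h) = f t" "ln (N (adj h)) = f (- t)" unfolding t adjm f_def by simp_all
    ultimately show ?thesis unfolding K_def using lnN[OF Ng] lnN[OF Na] by (intro exI[of _ t]) linarith
  qed
  have key: "\<theta> = \<beta> / \<alpha> \<or> \<theta> = \<alpha> / \<beta>" if th: "1 \<le> \<theta>" "\<theta> \<le> 2" for \<theta>
  proof (rule ccontr)
    assume ne: "\<not> ?thesis"
    define e where "e = min \<bar>\<theta> - \<beta> / \<alpha>\<bar> \<bar>\<theta> - \<alpha> / \<beta>\<bar> / 2"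
    have e: "e > 0" using ne by (auto simp: e_def)
    have e2: "2 * e \<le> \<bar>\<theta> - \<beta> / \<alpha>\<bar>" "2 * e \<le> \<bar>\<theta> - \<alpha> / \<beta>\<bar>" by (simp_all add: e_def)
    obtain M1 where M1: "\<And>t. t \<ge> M1 \<Longrightarrow> dist (f (- t) / f t) (\<beta> / \<alpha>) < e"
      using tendstoD[OF ratio1 e] unfolding eventually_at_top_linorder by blast
    obtain M2 where M2: "\<And>t. t \<ge> M2 \<Longrightarrow> dist (f t / f (- t)) (\<alpha> / \<beta>) < e"
      using tendstoD[OF ratio2 e] unfolding eventually_at_top_linorder by blast
    define M where "M = max M1 M2"
    obtain B where B: "\<And>t. t \<in> {- M .. M} \<Longrightarrow> f t \<le> B" using bdd by blast
    have Kpos: "K > 0" using R(1) ln_ge_zero[of R] ln_gt_zero[of 3] unfolding K_def by linarith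
    \<comment> \<open>Large enough that f t exceeds both its bound B on [-M, M], so that t lies
      outside this interval, and 3K/e, so that the quotient is within e of theta.\<close>
    define s where "s = K + \<bar>B\<bar> + 1 + 3 * K / e"
    have "s \<ge> 0" using Kpos e by (simp add: s_def)
    then obtain t where t: "\<bar>f t - s\<bar> \<le> K" "\<bar>f (- t) - \<theta> * s\<bar> \<le> K" using app th by blast
    have "3 * K / e \<ge> 0" using Kpos e by simp
    then have ft: "f t > B" "f t > 3 * K / e" "f t > 0" using t(1) by (auto simp: s_def)
    have "\<bar>f (- t) - \<theta> * f t\<bar> \<le> 3 * K"
    proof -
      have "\<bar>\<theta> * (s - f t)\<bar> \<le> 2 * K" unfolding abs_mult using th t(1) by (intro mult_mono) auto
      then show ?thesis using t(2) by (simp add: algebra_simps)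
    qed
    moreover have "\<bar>f (- t) / f t - \<theta>\<bar> = \<bar>f (- t) - \<theta> * f t\<bar> / f t"
    proof -
      have "f (- t) / f t - \<theta> = (f (- t) - \<theta> * f t) / f t" using ft(3) by (simp add: diff_divide_distrib)
      then show ?thesis using ft(3) by (simp add: abs_divide)
    qed
    ultimately have "\<bar>f (- t) / f t - \<theta>\<bar> \<le> 3 * K / f t" using ft(3) by (simp add: divide_right_mono)
    also have "\<dots> < e" using ft(2,3) e by (simp add: divide_less_eq mult.commute)
    finally have r: "\<bar>f (- t) / f t - \<theta>\<bar> < e" .
    have "t \<notin> {- M .. M}" using B ft(1) by fastforce
    then consider "t \<ge> M1" | "- t \<ge> M2" by (fastforce simp: M_def)
    then show False
    proof cases
      case 1
      then show False using M1[OF 1] r e2 unfolding dist_real_def by linarith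
    next
      case 2
      then show False using M2[OF 2] r e2 unfolding dist_real_def minus_minus by linarith
    qed
  qed
  \<comment> \<open>Three slopes for two possible values.\<close>
  have "1 = \<beta> / \<alpha> \<or> 1 = \<alpha> / \<beta>" "3 / 2 = \<beta> / \<alpha> \<or> 3 / 2 = \<alpha> / \<beta>" "2 = \<beta> / \<alpha> \<or> 2 = \<alpha> / \<beta>"
    by (rule key; simp)+
  then show False using pos by (auto simp: field_simps)
qed

lemma not_cds_one_parameter:
  assumes det: "\<And>t. det (mexp (t *\<^sub>R X)) = 1" and H: "H \<subseteq> range (\<lambda>t. mexp (t *\<^sub>R X))"
    and growth: "c \<noteq> 0" "\<And>t. exp (c * t) \<le> N (mexp (t *\<^sub>R X))"
  shows "\<not> cartan_decomposition_subgroup SL3 H"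
proof (cases "c > 0")
  case True
  show ?thesis by (rule not_cds_one_parameter_aux[OF det H, of 1 c]) (use True growth in auto)
next
  case False
  show ?thesis
  proof (rule not_cds_one_parameter_aux[of "- X" H 1 "- c"])
    show "det (mexp (t *\<^sub>R - X)) = 1" for t using det[of "- t"] by simp
    show "H \<subseteq> range (\<lambda>t. mexp (t *\<^sub>R - X))"
    proof
      fix h assume "h \<in> H"
      then obtain t where "h = mexp (t *\<^sub>R X)" using H by blast
      then show "h \<in> range (\<lambda>t. mexp (t *\<^sub>R - X))" by (intro image_eqI[of _ _ "- t"]) auto
    qed
    show "1 * exp (- c * t) \<le> N (mexp (t *\<^sub>R - X))" for t using growth(2)[of "- t"] by simp
  qed (use False growth in auto)
qed

lemma mexp_shift: "mexp (t *\<^sub>R (X - c *\<^sub>R mat 1)) = exp (- c * t) *\<^sub>R mexp (t *\<^sub>R X)"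
proof (rule one_parameter_group_eq_mexp)
  fix s t
  show "exp (- c * (s + t)) *\<^sub>R mexp ((s + t) *\<^sub>R X)
      = (exp (- c * s) *\<^sub>R mexp (s *\<^sub>R X)) ** (exp (- c * t) *\<^sub>R mexp (t *\<^sub>R X))"
    unfolding mexp_add distrib_left exp_add matrix_mult_scaleR_left matrix_mult_scaleR_right by simp
next
  have "((\<lambda>t. exp (- c * t)) has_real_derivative - c) (at 0)" by (auto intro!: derivative_eq_intros)
  from has_vector_derivative_scaleR[OF this mexp_has_vector_derivative_0[of X]]
  show "((\<lambda>t. exp (- c * t) *\<^sub>R mexp (t *\<^sub>R X)) has_vector_derivative X - c *\<^sub>R mat 1) (at 0)"
    by simp
qed simp

text \<open>The factors 1 + (t/n) X already lie in S, so their powers and the limit do. With S given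
  by entry equations stable under products this locates the exponential without computing
  it.\<close>

lemma mexp_in_closed_semigroup_line:
  fixes X :: "real^'n::finite^'n"
  assumes cl: "closed S" and mult: "\<And>x y. x \<in> S \<Longrightarrow> y \<in> S \<Longrightarrow> x ** y \<in> S"
    and line: "\<And>s. mat 1 + s *\<^sub>R X \<in> S"
  shows "mexp (t *\<^sub>R X) \<in> S"
proof -
  have "mexp (1 *\<^sub>R (t *\<^sub>R X)) \<in> S"
  proof (rule mexp_in_closed_semigroup[OF cl mult])
    show "mat 1 + (t / real (Suc n)) *\<^sub>R X \<in> S" for n by (rule line)
    show "filterlim (\<lambda>n. real (Suc n)) at_top sequentially" by (rule filterlim_real_Suc)
    show "(\<lambda>n. real (Suc n) *\<^sub>R (mat 1 + (t / real (Suc n)) *\<^sub>R X - mat 1)) \<longlonglongrightarrow> t *\<^sub>R X"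
      by simp
  qed auto
  then show ?thesis by simp
qed

text \<open>Subtracting the scalar matrix with the eigenvalue turns the first column of 1 + sX into
  the first unit vector, a condition stable under products; the scalar comes back as a factor by
  \<open>mexp_shift\<close>.\<close>

lemma mexp_eigenvalue_11:
  fixes X :: "real^3^3"
  assumes "X $ 2 $ 1 = 0" "X $ 3 $ 1 = 0"
  shows "mexp (t *\<^sub>R X) $ 1 $ 1 = exp (X $ 1 $ 1 * t)"
proof -
  let ?S = "{Y :: real^3^3. Y $ 1 $ 1 = 1 \<and> Y $ 2 $ 1 = 0 \<and> Y $ 3 $ 1 = 0}"
  have "mexp (t *\<^sub>R (X - X $ 1 $ 1 *\<^sub>R mat 1)) \<in> ?S"
  proof (rule mexp_in_closed_semigroup_line)
    show "closed ?S" by (intro closed_Collect_conj closed_Collect_eq continuous_intros)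
  qed (use assms in \<open>auto simp: matrix3_mult_nth mat_def\<close>)
  then have "exp (- X $ 1 $ 1 * t) * mexp (t *\<^sub>R X) $ 1 $ 1 = 1"
    unfolding mexp_shift by simp
  then show ?thesis by (simp add: exp_minus field_simps)
qed

lemma mexp_eigenvalue_33:
  fixes X :: "real^3^3"
  assumes "X $ 3 $ 1 = 0" "X $ 3 $ 2 = 0"
  shows "mexp (t *\<^sub>R X) $ 3 $ 3 = exp (X $ 3 $ 3 * t)"
proof -
  let ?S = "{Y :: real^3^3. Y $ 3 $ 3 = 1 \<and> Y $ 3 $ 1 = 0 \<and> Y $ 3 $ 2 = 0}"
  have "mexp (t *\<^sub>R (X - X $ 3 $ 3 *\<^sub>R mat 1)) \<in> ?S"
  proof (rule mexp_in_closed_semigroup_line)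
    show "closed ?S" by (intro closed_Collect_conj closed_Collect_eq continuous_intros)
  qed (use assms in \<open>auto simp: matrix3_mult_nth mat_def\<close>)
  then have "exp (- X $ 3 $ 3 * t) * mexp (t *\<^sub>R X) $ 3 $ 3 = 1"
    unfolding mexp_shift by simp
  then show ?thesis by (simp add: exp_minus field_simps)
qed

section \<open>Cartan decomposition up to bounded factors\<close>

lemma orthogonal_N_le:
  fixes U :: "real^3^3"
  assumes "orthogonal_matrix U"
  shows "N U \<le> 9"
proof -
  have e: "\<bar>U $ i $ j\<bar> \<le> 1" for i j
  proof -
    have "(transpose U ** U) $ j $ j = 1" using assms by (simp add: orthogonal_matrix_def mat_def)
    then have "(U $ 1 $ j)\<^sup>2 + (U $ 2 $ j)\<^sup>2 + (U $ 3 $ j)\<^sup>2 = 1"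
      by (simp add: matrix3_mult_nth transpose_def power2_eq_square)
    then have "(U $ i $ j)\<^sup>2 \<le> 1" using exhaust_3[of i]
      by (smt (verit) zero_le_power2)
    then show ?thesis by (simp add: abs_square_le_1)
  qed
  have "N U \<le> (\<Sum>i\<in>(UNIV::3 set). \<Sum>j\<in>(UNIV::3 set). 1)" unfolding N_def by (intro sum_mono e)
  then show ?thesis by simp
qed

lemma norm3_sq: "(norm (x :: real^3))\<^sup>2 = (x $ 1)\<^sup>2 + (x $ 2)\<^sup>2 + (x $ 3)\<^sup>2"
  unfolding power2_norm_eq_inner by (simp add: inner_vec_def sum_3 power2_eq_square)

lemma mv3_nth: "((M :: real^3^3) *v x) $ i = M $ i $ 1 * x $ 1 + M $ i $ 2 * x $ 2 + M $ i $ 3 * x $ 3"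
  by (simp add: matrix_vector_mult_def sum_3)

lemma orthogonal_norm: "orthogonal_matrix (U :: real^3^3) \<Longrightarrow> norm (U *v x) = norm x"
  using orthogonal_transformation_matrix[of "(*v) U"] orthogonal_transformation_norm[of "(*v) U"] by simp

text \<open>A unit vector u maximising |g u| and its normalised image are rotated to the first axis.
  Rotations, rather than orthogonal matrices of either sign, keep all factors in SL(3).\<close>

lemma first_singular_value:
  fixes g :: "real^3^3"
  assumes det: "det g = 1"
  shows "\<exists>U V \<sigma>. rotation_matrix U \<and> rotation_matrix V \<and> \<sigma> > 0 \<and>
    (\<forall>x. norm ((U ** g ** V) *v x) \<le> \<sigma> * norm x) \<and>
    (U ** g ** V) $ 1 $ 1 = \<sigma> \<and> (U ** g ** V) $ 2 $ 1 = 0 \<and> (U ** g ** V) $ 3 $ 1 = 0 \<and>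
    (U ** g ** V) $ 1 $ 2 = 0 \<and> (U ** g ** V) $ 1 $ 3 = 0"
proof -
  have "continuous_on (sphere 0 1) (\<lambda>x. norm (g *v x))" by (intro continuous_intros)
  moreover have "sphere 0 1 \<noteq> ({} :: (real^3) set)" by simp
  ultimately obtain u where u: "u \<in> sphere 0 1" "\<And>x. x \<in> sphere 0 1 \<Longrightarrow> norm (g *v x) \<le> norm (g *v u)"
    using continuous_attains_sup[OF compact_sphere] by metis
  define \<sigma> where "\<sigma> = norm (g *v u)"
  have bound: "norm (g *v x) \<le> \<sigma> * norm x" for x
  proof (cases "x = 0")
    case False
    have "norm (g *v (x /\<^sub>R norm x)) \<le> \<sigma>" unfolding \<sigma>_def by (rule u(2)) (use False in auto)
    then show ?thesis using False by (simp add: matrix_vector_mult_scaleR field_simps)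
  qed simp
  have inv: "adj g *v (g *v x) = x" for x
    by (simp add: matrix_vector_mul_assoc adj_left[OF det])
  have "u \<noteq> 0" using u(1) by auto
  then have "g *v u \<noteq> 0" using inv[of u] by auto
  then have \<sigma>: "\<sigma> > 0" by (simp add: \<sigma>_def)
  obtain V where V: "rotation_matrix V" "V *v axis 1 1 = u"
    using rotation_matrix_exists_basis[of u 1] u(1) by auto
  obtain W where W: "rotation_matrix W" "W *v axis 1 1 = g *v u /\<^sub>R \<sigma>"
    using rotation_matrix_exists_basis[of "g *v u /\<^sub>R \<sigma>" 1] \<sigma> by (auto simp: \<sigma>_def)
  define U where "U = transpose W"
  have U: "rotation_matrix U" using W(1) unfolding U_def rotation_matrix_def orthogonal_matrix_transpose by simp
  have UW: "U ** W = mat 1" using W(1) by (simp add: U_def rotation_matrix_def orthogonal_matrix_def)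
  define M where "M = U ** g ** V"
  have Mb: "norm (M *v x) \<le> \<sigma> * norm x" for x
  proof -
    have "M *v x = U *v (g *v (V *v x))" by (simp add: M_def matrix_vector_mul_assoc matrix_mul_assoc)
    then show ?thesis using bound[of "V *v x"] U V(1) by (simp add: orthogonal_norm rotation_matrix_def)
  qed
  have "M *v axis 1 1 = U *v (g *v (V *v axis 1 1))" by (simp add: M_def matrix_vector_mul_assoc matrix_mul_assoc)
  also have "\<dots> = \<sigma> *\<^sub>R (U *v (W *v axis 1 1))" using \<sigma> by (simp add: V W matrix_vector_mult_scaleR)
  also have "\<dots> = \<sigma> *\<^sub>R axis 1 1" by (simp add: matrix_vector_mul_assoc UW)
  finally have M1: "M *v axis 1 1 = \<sigma> *\<^sub>R axis 1 1" .
  have c: "M $ 1 $ 1 = \<sigma>" "M $ 2 $ 1 = 0" "M $ 3 $ 1 = 0"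
    using arg_cong[OF M1, of "\<lambda>v. v $ 1"] arg_cong[OF M1, of "\<lambda>v. v $ 2"] arg_cong[OF M1, of "\<lambda>v. v $ 3"]
    by (simp_all add: mv3_nth axis_def)
  \<comment> \<open>The bound is tested on the first row itself: its squared length is the first
    coordinate of the image, hence at most sigma times its length. As the diagonal entry is sigma,
    the remaining entries vanish.\<close>
  define x :: "real^3" where "x = M $ 1"
  have "(norm x)\<^sup>2 = (M *v x) $ 1" unfolding norm3_sq mv3_nth by (simp add: x_def power2_eq_square)
  also have "\<dots> \<le> norm (M *v x)" using component_le_norm_cart[of "M *v x" 1] by simp
  also have "\<dots> \<le> \<sigma> * norm x" by (rule Mb)
  finally have "norm x * norm x \<le> \<sigma> * norm x" by (simp add: power2_eq_square)
  then have "norm x \<le> \<sigma>" using \<sigma> by (cases "norm x = 0") auto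
  then have "(norm x)\<^sup>2 \<le> \<sigma>\<^sup>2" by (intro power_mono) auto
  then have "(M $ 1 $ 2)\<^sup>2 + (M $ 1 $ 3)\<^sup>2 \<le> 0" unfolding norm3_sq by (simp add: x_def c)
  then have "M $ 1 $ 2 = 0" "M $ 1 $ 3 = 0" by (simp_all add: sum_power2_le_zero_iff)
  then show ?thesis using U V(1) \<sigma> Mb c unfolding M_def by blast
qed

lemma rotation_matrix_mult:
  "rotation_matrix U \<Longrightarrow> rotation_matrix V \<Longrightarrow> rotation_matrix (U ** (V :: real^'n^'n))"
  by (simp add: rotation_matrix_def orthogonal_matrix_mul det_mul)

lemma rotation_plane: "rotation_matrix (m3 1 0 0 0 c (- s) 0 s c)" if "c\<^sup>2 + s\<^sup>2 = (1 :: real)"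
  using that by (simp add: rotation_matrix_def orthogonal_matrix m3_one power2_eq_square add.commute)

text \<open>After the first singular value splits off, the remaining planar block is treated by the
  same maximisation, now over an angle, so that both planar rotations can be written down.\<close>

lemma singular_value_decomposition:
  fixes g :: "real^3^3"
  assumes det: "det g = 1"
  shows "\<exists>U V a b c. rotation_matrix U \<and> rotation_matrix V \<and> a \<ge> b \<and> b \<ge> c \<and> c > 0 \<and> a * b * c = 1 \<and>
    U ** g ** V = m3 a 0 0 0 b 0 0 0 c"
proof -
  obtain U V \<sigma> where UV: "rotation_matrix U" "rotation_matrix V" "\<sigma> > 0"
    and bound: "\<And>x. norm ((U ** g ** V) *v x) \<le> \<sigma> * norm x"
    and z: "(U ** g ** V) $ 1 $ 1 = \<sigma>" "(U ** g ** V) $ 2 $ 1 = 0" "(U ** g ** V) $ 3 $ 1 = 0"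
      "(U ** g ** V) $ 1 $ 2 = 0" "(U ** g ** V) $ 1 $ 3 = 0"
    using first_singular_value[OF det] by blast
  define e f h k where "e = (U ** g ** V) $ 2 $ 2" and "f = (U ** g ** V) $ 2 $ 3"
    and "h = (U ** g ** V) $ 3 $ 2" and "k = (U ** g ** V) $ 3 $ 3"
  have M: "U ** g ** V = m3 \<sigma> 0 0 0 e f 0 h k"
    by (rule matrix3_eqI) (simp_all add: z e_def f_def h_def k_def)
  have "det (U ** g ** V) = 1" using UV det by (simp add: det_mul rotation_matrix_def)
  then have d: "\<sigma> * (e * k - f * h) = 1" unfolding M by (simp add: algebra_simps)
  define F where "F \<theta> = (e * cos \<theta> + f * sin \<theta>)\<^sup>2 + (h * cos \<theta> + k * sin \<theta>)\<^sup>2" for \<theta>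
  have "continuous_on {0..2*pi} F" unfolding F_def by (intro continuous_intros)
  then obtain \<theta> where \<theta>: "\<And>\<phi>. \<phi> \<in> {0..2*pi} \<Longrightarrow> F \<phi> \<le> F \<theta>"
    using continuous_attains_sup[of "{0..2*pi}" F] by (metis atLeastAtMost_iff compact_Icc empty_iff order_refl pi_ge_zero mult_nonneg_nonneg zero_le_numeral)
  define c s where "c = cos \<theta>" and "s = sin \<theta>"
  have cs: "c\<^sup>2 + s\<^sup>2 = 1" by (simp add: c_def s_def)
  define w1 w2 where "w1 = e * c + f * s" and "w2 = h * c + k * s"
  define \<tau> where "\<tau> = sqrt (w1\<^sup>2 + w2\<^sup>2)"
  have F\<tau>: "F \<theta> = \<tau>\<^sup>2" by (simp add: F_def \<tau>_def w1_def w2_def c_def s_def)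
  have max: "(e * x + f * y)\<^sup>2 + (h * x + k * y)\<^sup>2 \<le> \<tau>\<^sup>2 * (x\<^sup>2 + y\<^sup>2)" for x y
  proof (cases "x\<^sup>2 + y\<^sup>2 = 0")
    case False
    define r where "r = sqrt (x\<^sup>2 + y\<^sup>2)"
    have r: "r > 0" "r\<^sup>2 = x\<^sup>2 + y\<^sup>2" using False by (simp_all add: r_def sum_power2_gt_zero_iff)
    have "(x / r)\<^sup>2 + (y / r)\<^sup>2 = (x\<^sup>2 + y\<^sup>2) / r\<^sup>2" by (simp add: power_divide add_divide_distrib)
    then have "(x / r)\<^sup>2 + (y / r)\<^sup>2 = 1" using False unfolding r(2) by simp
    then obtain \<phi> where \<phi>: "0 \<le> \<phi>" "\<phi> \<le> 2 * pi" "x / r = cos \<phi>" "y / r = sin \<phi>"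
      using sincos_total_2pi_le by blast
    then have xy: "x = r * cos \<phi>" "y = r * sin \<phi>" using r by (auto simp: field_simps)
    have "(e * x + f * y)\<^sup>2 + (h * x + k * y)\<^sup>2 = r\<^sup>2 * F \<phi>"
      unfolding xy F_def by (simp add: power2_eq_square algebra_simps)
    also have "\<dots> \<le> r\<^sup>2 * \<tau>\<^sup>2" using \<theta>[of \<phi>] \<phi> F\<tau> by (intro mult_left_mono) auto
    finally show ?thesis by (simp add: r(2) mult.commute)
  qed (simp add: sum_power2_eq_zero_iff)
  have "\<tau>\<^sup>2 \<noteq> 0"
  proof
    assume "\<tau>\<^sup>2 = 0"
    then have "w1 = 0" "w2 = 0" by (simp_all add: \<tau>_def sum_power2_eq_zero_iff)
    then have "(e * k - f * h) * c = 0" "(e * k - f * h) * s = 0" unfolding w1_def w2_def by algebra+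
    then show False using d cs by auto
  qed
  then have "\<tau> \<noteq> 0" by auto
  moreover have "\<tau> \<ge> 0" by (simp add: \<tau>_def)
  ultimately have \<tau>: "\<tau> > 0" by linarith
  have w: "w1\<^sup>2 + w2\<^sup>2 = \<tau>\<^sup>2" by (simp add: \<tau>_def)
  define V' where "V' = m3 1 0 0 0 c (- s) 0 s c"
  \<comment> \<open>Rotates the image (w1, w2) of the maximising unit vector to the positive
    multiple tau of the axis.\<close>
  define U' where "U' = m3 1 0 0 0 (w1 / \<tau>) (w2 / \<tau>) 0 (- (w2 / \<tau>)) (w1 / \<tau>)"
  have V': "rotation_matrix V'" unfolding V'_def using rotation_plane[OF cs] .
  have "(w1 / \<tau>)\<^sup>2 + (- (w2 / \<tau>))\<^sup>2 = 1" using w \<tau> by (simp add: power_divide add_divide_distrib[symmetric])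
  from rotation_plane[OF this] have U': "rotation_matrix U'" unfolding U'_def by simp
  define v1 v2 where "v1 = f * c - e * s" and "v2 = k * c - h * s"
  define p q where "p = (w1 * v1 + w2 * v2) / \<tau>" and "q = (w1 * v2 - w2 * v1) / \<tau>"
  have MV: "(U ** g ** V) ** V' = m3 \<sigma> 0 0 0 w1 v1 0 w2 v2"
    unfolding M V'_def by (simp add: v1_def v2_def w1_def w2_def algebra_simps)
  have "(w1 * w1 + w2 * w2) / \<tau> = \<tau>" using w \<tau> by (simp add: power2_eq_square)
  then have "U' ** ((U ** g ** V) ** V') = m3 \<sigma> 0 0 0 \<tau> p 0 0 q"
    unfolding MV U'_def by (simp add: p_def q_def add_divide_distrib diff_divide_distrib)
  then have UMV: "U' ** (U ** g ** V) ** V' = m3 \<sigma> 0 0 0 \<tau> p 0 0 q"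
    by (simp add: matrix_mul_assoc)
  have vmax: "(w1 * x + v1 * y)\<^sup>2 + (w2 * x + v2 * y)\<^sup>2 \<le> \<tau>\<^sup>2 * (x\<^sup>2 + y\<^sup>2)" for x y
  proof -
    have "(c * x - s * y)\<^sup>2 + (s * x + c * y)\<^sup>2 = (c\<^sup>2 + s\<^sup>2) * (x\<^sup>2 + y\<^sup>2)"
      by (simp add: power2_eq_square algebra_simps)
    moreover have "e * (c * x - s * y) + f * (s * x + c * y) = w1 * x + v1 * y"
      "h * (c * x - s * y) + k * (s * x + c * y) = w2 * x + v2 * y"
      by (simp_all add: w1_def w2_def v1_def v2_def algebra_simps)
    ultimately show ?thesis using max[of "c * x - s * y" "s * x + c * y"] cs by simp
  qed
  have pq: "p\<^sup>2 + q\<^sup>2 = v1\<^sup>2 + v2\<^sup>2"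
  proof -
    have "(w1 * v1 + w2 * v2)\<^sup>2 + (w1 * v2 - w2 * v1)\<^sup>2 = (w1\<^sup>2 + w2\<^sup>2) * (v1\<^sup>2 + v2\<^sup>2)"
      by (simp add: power2_eq_square algebra_simps)
    then show ?thesis unfolding p_def q_def power_divide using \<tau> w by (simp add: add_divide_distrib[symmetric])
  qed
  \<comment> \<open>The rotated block has rows (tau, p) and (0, q); testing the maximality of tau on
    the vector (tau, p) leaves no room for p.\<close>
  have "p = 0"
  proof -
    have pt: "w1 * v1 + w2 * v2 = \<tau> * p" using \<tau> by (simp add: p_def)
    have "(w1 * \<tau> + v1 * p)\<^sup>2 + (w2 * \<tau> + v2 * p)\<^sup>2 = (w1\<^sup>2 + w2\<^sup>2) * \<tau>\<^sup>2 + 2 * \<tau> * p * (w1 * v1 + w2 * v2) + (v1\<^sup>2 + v2\<^sup>2) * p\<^sup>2"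
      by (simp add: power2_eq_square algebra_simps)
    also have "\<dots> = \<tau>\<^sup>2 * \<tau>\<^sup>2 + 2 * \<tau>\<^sup>2 * p\<^sup>2 + (p\<^sup>2 + q\<^sup>2) * p\<^sup>2"
      unfolding w pt pq[symmetric] by (simp add: power2_eq_square algebra_simps)
    finally have "\<tau>\<^sup>2 * p\<^sup>2 + (p\<^sup>2 + q\<^sup>2) * p\<^sup>2 \<le> 0"
      using vmax[of \<tau> p] by (simp add: algebra_simps)
    moreover have "(p\<^sup>2 + q\<^sup>2) * p\<^sup>2 \<ge> 0" by simp
    ultimately have "\<tau>\<^sup>2 * p\<^sup>2 \<le> 0" by linarith
    then show ?thesis using \<tau> by (simp add: mult_le_0_iff)
  qed
  have "rotation_matrix (U' ** U)" "rotation_matrix (V ** V')" using UV U' V' by (simp_all add: rotation_matrix_mult)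
  moreover have D: "(U' ** U) ** g ** (V ** V') = m3 \<sigma> 0 0 0 \<tau> 0 0 0 q"
    using UMV \<open>p = 0\<close> by (simp add: matrix_mul_assoc)
  moreover have det1: "\<sigma> * \<tau> * q = 1"
  proof -
    have "det ((U' ** U) ** g ** (V ** V')) = 1" using UV U' V' det by (simp add: det_mul rotation_matrix_def)
    then show ?thesis unfolding D by simp
  qed
  moreover have "q > 0"
  proof -
    have "(\<sigma> * \<tau>) * q > 0" using det1 by simp
    then show ?thesis using zero_less_mult_pos[of "\<sigma> * \<tau>" q] mult_pos_pos[OF UV(3) \<tau>] by simp
  qed
  moreover have "q \<le> \<tau>"
  proof -
    have "q\<^sup>2 \<le> \<tau>\<^sup>2" using vmax[of 0 1] pq by (simp add: \<open>p = 0\<close>)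
    then show ?thesis by (rule power2_le_imp_le) (use \<tau> in simp)
  qed
  \<comment> \<open>A unit vector in the plane of the block has an image of length tau, and sigma
    bounds all such images.\<close>
  moreover have "\<tau> \<le> \<sigma>"
  proof -
    define x :: "real^3" where "x = vector [0, c, s]"
    have "((U ** g ** V) *v x) $ 1 = 0" "((U ** g ** V) *v x) $ 2 = w1" "((U ** g ** V) *v x) $ 3 = w2"
      unfolding M mv3_nth by (simp_all add: x_def vector_3 w1_def w2_def)
    then have "(norm ((U ** g ** V) *v x))\<^sup>2 = \<tau>\<^sup>2" unfolding norm3_sq using w by simp
    then have "norm ((U ** g ** V) *v x) = \<tau>" using \<tau> by (simp add: power2_eq_iff_nonneg)
    moreover have "(norm x)\<^sup>2 = 1" unfolding norm3_sq using cs by (simp add: x_def vector_3)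
    then have "norm x = 1" using norm_ge_zero[of x] by (simp add: power2_eq_1_iff)
    ultimately show ?thesis using bound[of x] by simp
  qed
  ultimately show ?thesis by blast
qed


lemma N_triple: "N (x ** y ** z) \<le> N x * N y * N z"
  using N_mult[of "x ** y" z] mult_right_mono[OF N_mult[of x y] N_nonneg[of z]] by linarith

lemma N_orthogonal_triple:
  assumes "rotation_matrix U" "rotation_matrix V"
  shows "N (U ** y ** V) \<le> 81 * N y"
proof -
  have "N U * N y * N V \<le> 9 * N y * 9"
    using assms by (intro mult_mono orthogonal_N_le) (auto simp: rotation_matrix_def)
  then show ?thesis using N_triple[of U y V] by linarith
qed

lemma rotation_matrix_adj:
  assumes "rotation_matrix (U :: real^3^3)"
  shows "adj U = transpose U" "rotation_matrix (transpose U)"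
  subgoal using assms adj_unique'[of U "transpose U"] by (simp add: rotation_matrix_def orthogonal_matrix_def)
  subgoal using assms by (simp add: rotation_matrix_def)
  done

text \<open>An orthogonal matrix has entry sum at most 9, so the two rotations cost a factor 81; the
  three diagonal entries, each at most a (or 1/c for the inverse), cost another 3, which gives
  243.\<close>

lemma singular_value_bounds:
  assumes "rotation_matrix U" "rotation_matrix V" "U ** g ** V = m3 a 0 0 0 b 0 0 0 c"
    and abc: "a \<ge> b" "b \<ge> c" "c > 0" "a * b * c = 1" and det: "det g = 1"
  shows "a \<le> 81 * N g" "N g \<le> 243 * a" "1 / c \<le> 81 * N (adj g)" "N (adj g) \<le> 243 / c"
proof -
  have g: "g = transpose U ** m3 a 0 0 0 b 0 0 0 c ** transpose V"
  proof -
    have "transpose U ** (U ** g ** V) ** transpose V = g"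
      using assms(1,2) by (simp add: matrix_mul_assoc rotation_matrix_def orthogonal_matrix_def)
        (simp add: matrix_mul_assoc[symmetric])
    then show ?thesis unfolding assms(3) by simp
  qed
  have bc: "b * c = 1 / a" "a * c = 1 / b" "a * b = 1 / c"
    using abc by (simp_all add: field_simps)
  have adjg: "adj (m3 a 0 0 0 b 0 0 0 c) = m3 (1/a) 0 0 0 (1/b) 0 0 0 (1/c)"
    by (simp add: bc)
  have "a \<le> N (U ** g ** V)" unfolding assms(3) using abc by simp
  also have "\<dots> \<le> 81 * N g" by (rule N_orthogonal_triple[OF assms(1,2)])
  finally show "a \<le> 81 * N g" .
  have "N g \<le> 81 * N (m3 a 0 0 0 b 0 0 0 c)"
    unfolding g by (intro N_orthogonal_triple rotation_matrix_adj assms)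
  then show "N g \<le> 243 * a" using abc by simp
  have "1 / c \<le> N (adj (U ** g ** V))" unfolding assms(3) adjg using abc by simp
  also have "adj (U ** g ** V) = transpose V ** adj g ** transpose U"
    unfolding adj_mult using assms(1,2) by (simp add: rotation_matrix_adj matrix_mul_assoc)
  also have "N \<dots> \<le> 81 * N (adj g)" by (intro N_orthogonal_triple rotation_matrix_adj assms)
  finally show "1 / c \<le> 81 * N (adj g)" .
  have "adj g = V ** m3 (1/a) 0 0 0 (1/b) 0 0 0 (1/c) ** U"
  proof -
    have "adj (transpose U) = U" "adj (transpose V) = V"
      using rotation_matrix_adj[OF rotation_matrix_adj(2)[OF assms(1)]] rotation_matrix_adj[OF rotation_matrix_adj(2)[OF assms(2)]]
      by simp_all
    then show ?thesis by (subst g) (simp add: adj_mult adjg[simplified] matrix_mul_assoc del: m3_mult)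
  qed
  then have "N (adj g) \<le> 81 * N (m3 (1/a) 0 0 0 (1/b) 0 0 0 (1/c))"
    using N_orthogonal_triple[OF assms(2,1)] by metis
  moreover have "1 / a \<le> 1 / c" "1 / b \<le> 1 / c" using abc by (simp_all add: frac_le)
  ultimately show "N (adj g) \<le> 243 / c" using abc by simp
qed

lemma compact_bounded_SL3: "compact {c. det c = 1 \<and> N c \<le> K \<and> N (adj c) \<le> K}"
proof (rule compact_eq_bounded_closed[THEN iffD2, OF conjI])
  have "norm c \<le> K" if "N c \<le> K" for c
    using norm_matrix_le_sum[of c] that unfolding N_def by linarith
  then show "bounded {c. det c = 1 \<and> N c \<le> K \<and> N (adj c) \<le> K}"
    unfolding bounded_iff by blast
  have "closed {c. N c \<le> K}" "closed {c. N (adj c) \<le> K}"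
    using continuous_on_N continuous_on_compose2[OF continuous_on_N continuous_on_adj]
    by (auto intro!: closed_Collect_le)
  then show "closed {c. det c = 1 \<and> N c \<le> K \<and> N (adj c) \<le> K}"
    using closed_SL3 by (intro closed_Collect_conj)
qed

text \<open>Converse of the growth estimate for double cosets. With singular value decompositions of
  g and h, comparability of the two norms bounds the ratios of the largest and of the smallest
  singular values; the middle ratio follows from determinant one. The quotient of the diagonal parts
  is then a bounded factor.\<close>

lemma bounded_double_coset:
  assumes R: "R \<ge> 1"
  shows "\<exists>K. \<forall>g h. det g = 1 \<longrightarrow> det h = 1 \<longrightarrow> N g \<le> R * N h \<longrightarrow> N h \<le> R * N g \<longrightarrow>
    N (adj g) \<le> R * N (adj h) \<longrightarrow> N (adj h) \<le> R * N (adj g) \<longrightarrow>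
    (\<exists>c c'. (det c = 1 \<and> N c \<le> K \<and> N (adj c) \<le> K) \<and> (det c' = 1 \<and> N c' \<le> K \<and> N (adj c') \<le> K) \<and> g = c ** h ** c')"
proof -
  \<comment> \<open>81 and 243 are the costs of passing between \<open>N\<close> and a singular
    value for one element and back for the other; \<open>K\<close> then allows for two rotations
    around a diagonal matrix with entries at most L^2, or for a single rotation.\<close>
  define L where "L = 81 * 243 * R"
  have L: "L \<ge> 1" using R by (simp add: L_def)
  define K where "K = 81 * (3 * L\<^sup>2) + 9"
  have LL: "L \<le> L\<^sup>2" using L by (simp add: power2_eq_square)
  show ?thesis
  proof (intro exI[of _ K] allI impI)
    fix g h :: "real^3^3"
    assume dg: "det g = 1" and dh: "det h = 1" and gh: "N g \<le> R * N h" "N h \<le> R * N g"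
      "N (adj g) \<le> R * N (adj h)" "N (adj h) \<le> R * N (adj g)"
    obtain U V a b c where g: "rotation_matrix U" "rotation_matrix V" "a \<ge> b" "b \<ge> c" "c > 0" "a * b * c = 1"
      "U ** g ** V = m3 a 0 0 0 b 0 0 0 c" using singular_value_decomposition[OF dg] by blast
    obtain U' V' a' b' c' where h: "rotation_matrix U'" "rotation_matrix V'" "a' \<ge> b'" "b' \<ge> c'" "c' > 0" "a' * b' * c' = 1"
      "U' ** h ** V' = m3 a' 0 0 0 b' 0 0 0 c'" using singular_value_decomposition[OF dh] by blast
    note gb = singular_value_bounds[OF g(1,2,7,3-6) dg] and hb = singular_value_bounds[OF h(1,2,7,3-6) dh]
    have Rm: "R * x \<le> R * y" if "x \<le> y" for x y using that R by (intro mult_left_mono) auto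
    have pa: "a > 0" "a' > 0" "b > 0" "b' > 0" using g h by linarith+
    have aa: "a \<le> L * a'" "a' \<le> L * a"
      using gb(1) gh(1) Rm[OF hb(2)] hb(1) gh(2) Rm[OF gb(2)] by (auto simp: L_def)
    have cc: "1 / c \<le> L / c'" "1 / c' \<le> L / c"
      using gb(3) gh(3) Rm[OF hb(4)] hb(3) gh(4) Rm[OF gb(4)] by (auto simp: L_def)
    define x y z where "x = a / a'" and "y = b / b'" and "z = c / c'"
    have xyz: "x * y * z = 1" using g(6) h(6) pa h(5) g(5) by (simp add: x_def y_def z_def field_simps)
    have xp: "x > 0" "y > 0" "z > 0" using pa g(5) h(5) by (auto simp: x_def y_def z_def)
    have x: "x \<le> L" "1 / x \<le> L" using aa pa by (auto simp: x_def field_simps)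
    have z: "z \<le> L" "1 / z \<le> L" using cc g(5) h(5) by (auto simp: z_def field_simps)
    have yx: "y = (1 / x) * (1 / z)" "1 / y = x * z" using xyz xp by (auto simp: field_simps)
    have "(1 / x) * (1 / z) \<le> L * L" "x * z \<le> L * L" by (intro mult_mono; use x z xp L in auto)+
    then have y: "y \<le> L\<^sup>2" "1 / y \<le> L\<^sup>2" using yx by (simp_all add: power2_eq_square)
    define E where "E = m3 x 0 0 0 y 0 0 0 z"
    have dE: "det E = 1" using xyz by (simp add: E_def)
    have adjE: "adj E = m3 (1/x) 0 0 0 (1/y) 0 0 0 (1/z)"
    proof -
      have "y * z = 1 / x" "x * z = 1 / y" "x * y = 1 / z" using xyz xp by (simp_all add: field_simps)
      then show ?thesis by (simp add: E_def)
    qed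
    have NE: "N E \<le> 3 * L\<^sup>2" "N (adj E) \<le> 3 * L\<^sup>2"
      using x y z xp LL unfolding adjE by (auto simp: E_def)
    define k k' where "k = transpose U ** E ** U'" and "k' = V' ** transpose V"
    have "det (transpose U) = 1" "det U' = 1" "det V' = 1" "det (transpose V) = 1"
      using g(1,2) h(1,2) by (auto simp: rotation_matrix_def)
    then have dk: "det k = 1" "det k' = 1" using dE by (simp_all add: k_def k'_def det_mul)
    have UU: "transpose U ** U = mat 1" "V ** transpose V = mat 1" "U' ** transpose U' = mat 1" "transpose U' ** U' = mat 1"
      using g(1,2) h(1,2) by (simp_all add: rotation_matrix_def orthogonal_matrix_def)
    have ED: "E ** m3 a' 0 0 0 b' 0 0 0 c' = m3 a 0 0 0 b 0 0 0 c"
      using pa h(5) by (simp add: E_def x_def y_def z_def)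
    have "k ** h ** k' = transpose U ** (E ** (U' ** h ** V')) ** transpose V"
      by (simp add: k_def k'_def matrix_mul_assoc)
    also have "\<dots> = transpose U ** (U ** g ** V) ** transpose V" unfolding h(7) ED g(7) ..
    also have "\<dots> = (transpose U ** U) ** g ** (V ** transpose V)" by (simp only: matrix_mul_assoc)
    finally have gk: "g = k ** h ** k'" by (simp add: UU)
    have rk': "rotation_matrix k'" unfolding k'_def by (intro rotation_matrix_mult rotation_matrix_adj g h)
    then have Nk': "N k' \<le> K" "N (adj k') \<le> K"
      using orthogonal_N_le[of k'] orthogonal_N_le[of "transpose k'"] rotation_matrix_adj[OF rk'] 
      by (auto simp: K_def rotation_matrix_def intro: add_increasing)
    have "N k \<le> 81 * N E" unfolding k_def by (intro N_orthogonal_triple rotation_matrix_adj g h)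
    then have Nk: "N k \<le> K" using NE by (simp add: K_def)
    have "adj k = transpose U' ** adj E ** U"
      unfolding k_def adj_mult using rotation_matrix_adj[OF h(1)] rotation_matrix_adj[OF rotation_matrix_adj(2)[OF g(1)]]
      by (simp add: matrix_mul_assoc)
    then have "N (adj k) \<le> 81 * N (adj E)" using N_orthogonal_triple[OF rotation_matrix_adj(2)[OF h(1)] g(1)] by metis
    then have "N (adj k) \<le> K" using NE by (simp add: K_def)
    then show "\<exists>c c'. (det c = 1 \<and> N c \<le> K \<and> N (adj c) \<le> K) \<and> (det c' = 1 \<and> N c' \<le> K \<and> N (adj c') \<le> K) \<and> g = c ** h ** c'"
      using dk Nk Nk' gk by blast
  qed
qed

text \<open>The pair (a, 1/c) of singular values a >= b >= c with abc = 1 satisfies the chamber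
  inequalities, since 1/c = ab <= a^2 and a c^2 <= abc = 1. So it suffices that the pairs of H are
  dense in the chamber up to a constant factor.\<close>

lemma cds_if_dense:
  assumes H: "matrix_subgroup H" "H \<subseteq> {g. det g = 1}" "closed H" "connected H" and R: "R \<ge> 1"
    and dense: "\<And>x y. 1 \<le> x \<Longrightarrow> 1 \<le> y \<Longrightarrow> x \<le> y\<^sup>2 \<Longrightarrow> y \<le> x\<^sup>2 \<Longrightarrow>
      \<exists>h\<in>H. x \<le> R * N h \<and> N h \<le> R * x \<and> y \<le> R * N (adj h) \<and> N (adj h) \<le> R * y"
  shows "cartan_decomposition_subgroup SL3 H"
proof -
  define R' where "R' = 243 * R"
  have "R' \<ge> 1" using R by (simp add: R'_def)
  then obtain K where K: "\<And>g h. det g = 1 \<Longrightarrow> det h = 1 \<Longrightarrow> N g \<le> R' * N h \<Longrightarrow> N h \<le> R' * N g \<Longrightarrow>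
    N (adj g) \<le> R' * N (adj h) \<Longrightarrow> N (adj h) \<le> R' * N (adj g) \<Longrightarrow>
    (\<exists>c c'. (det c = 1 \<and> N c \<le> K \<and> N (adj c) \<le> K) \<and> (det c' = 1 \<and> N c' \<le> K \<and> N (adj c') \<le> K) \<and> g = c ** h ** c')"
    using bounded_double_coset by metis
  define C where "C = {c. det c = 1 \<and> N c \<le> K \<and> N (adj c) \<le> K}"
  have "\<exists>c\<in>C. \<exists>h\<in>H. \<exists>c'\<in>C. g = c ** h ** c'" if dg: "det g = 1" for g
  proof -
    obtain U V a b c where g: "rotation_matrix U" "rotation_matrix V" "a \<ge> b" "b \<ge> c" "c > 0" "a * b * c = 1"
      "U ** g ** V = m3 a 0 0 0 b 0 0 0 c" using singular_value_decomposition[OF dg] by blast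
    note gb = singular_value_bounds[OF g(1,2,7,3-6) dg]
    define y where "y = 1 / c"
    have pos: "a > 0" "b > 0" "y > 0" using g by (auto simp: y_def)
    have ab: "y = a * b" using g by (simp add: y_def field_simps)
    have "y \<le> a\<^sup>2" unfolding ab power2_eq_square using g pos by simp
    have "a \<le> y\<^sup>2"
    proof -
      have "a * c * c \<le> a * b * c" using g pos by (intro mult_right_mono mult_left_mono) auto
      then have "a * c\<^sup>2 \<le> 1" unfolding g(6) by (simp add: power2_eq_square)
      then show ?thesis using g(5) by (simp add: y_def power_divide pos_le_divide_eq)
    qed
    have "1 \<le> a"
    proof (rule ccontr)
      assume "\<not> 1 \<le> a"
      then have "a * b * c < 1" using g pos
        by (smt (verit) mult_less_cancel_left2 mult_less_cancel_right2 mult_pos_pos)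
      then show False using g(6) by simp
    qed
    have "1 \<le> y"
    proof (rule ccontr)
      assume "\<not> 1 \<le> y"
      then have "y * y < 1 * 1" using pos by (intro mult_strict_mono) auto
      then have "y\<^sup>2 < 1" by (simp add: power2_eq_square)
      then show False using \<open>a \<le> y\<^sup>2\<close> \<open>1 \<le> a\<close> by simp
    qed
    then obtain h where h: "h \<in> H" "a \<le> R * N h" "N h \<le> R * a" "y \<le> R * N (adj h)" "N (adj h) \<le> R * y"
      using dense[OF \<open>1 \<le> a\<close> _ \<open>a \<le> y\<^sup>2\<close> \<open>y \<le> a\<^sup>2\<close>] by blast
    have dh: "det h = 1" using h(1) H(2) by blast
    have Rm: "R * p \<le> R * q" if "p \<le> q" for p q using that R by (intro mult_left_mono) auto
    have 1: "N g \<le> R' * N h" using gb(2) h(2) by (simp add: R'_def)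
    have 2: "N (adj g) \<le> R' * N (adj h)" using gb(4) h(4) by (simp add: R'_def y_def)
    have "a \<le> 243 * N g" "y \<le> 243 * N (adj g)"
      using gb(1,3) N_nonneg[of g] N_nonneg[of "adj g"] unfolding y_def by linarith+
    then have "R * a \<le> R * (243 * N g)" "R * y \<le> R * (243 * N (adj g))" by (auto intro: Rm)
    then have 3: "N h \<le> R' * N g" "N (adj h) \<le> R' * N (adj g)" using h(3,5) by (auto simp: R'_def)
    obtain c1 c2 where "c1 \<in> C" "c2 \<in> C" "g = c1 ** h ** c2"
      using K[OF dg dh 1 3(1) 2 3(2)] unfolding C_def by blast
    then show ?thesis using h(1) by blast
  qed
  moreover have "compact C" unfolding C_def by (rule compact_bounded_SL3)
  moreover have "C \<subseteq> {g. det g = 1}" by (auto simp: C_def)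
  ultimately show ?thesis unfolding cds_iff using H by blast
qed

section \<open>The listed subgroups are Cartan-decomposition subgroups\<close>

lemma matrix_subgroupI:
  assumes "mat 1 \<in> H" "\<And>x y. x \<in> H \<Longrightarrow> y \<in> H \<Longrightarrow> x ** y \<in> H"
    and "\<And>x. x \<in> H \<Longrightarrow> det x = 1 \<and> adj x \<in> H"
  shows "matrix_subgroup (H :: (real^3^3) set)"
  unfolding matrix_subgroup_def using assms adj_right by blast

lemma continuous_on_det3 [continuous_intros]:
  "continuous_on S (f :: 'a::topological_space \<Rightarrow> real^3^3) \<Longrightarrow> continuous_on S (\<lambda>x. det (f x))"
  unfolding det_3 by (intro continuous_intros)

lemma closed_with_function:
  fixes f :: "'a::topological_space \<Rightarrow> real"
  assumes "closed S" "continuous_on S f"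
  shows "closed {x \<in> S. f x = 0}"
  using continuous_closed_preimage_constant[OF assms(2,1), of 0] .

text \<open>Inversion in H exchanges the two norms, so the half x <= y of the chamber is
  enough.\<close>

lemma inverse_closure_dense:
  assumes H: "matrix_subgroup H" "H \<subseteq> {g. det g = 1}"
    and dense: "\<And>x y. 1 \<le> x \<Longrightarrow> x \<le> y \<Longrightarrow> y \<le> x\<^sup>2 \<Longrightarrow>
      \<exists>h\<in>H. x \<le> R * N h \<and> N h \<le> R * x \<and> y \<le> R * N (adj h) \<and> N (adj h) \<le> R * y"
    and xy: "1 \<le> x" "1 \<le> y" "x \<le> y\<^sup>2" "y \<le> x\<^sup>2"
  shows "\<exists>h\<in>H. x \<le> R * N h \<and> N h \<le> R * x \<and> y \<le> R * N (adj h) \<and> N (adj h) \<le> R * y"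
proof (cases "x \<le> y")
  case False
  then obtain h where h: "h \<in> H" "y \<le> R * N h" "N h \<le> R * y" "x \<le> R * N (adj h)" "N (adj h) \<le> R * x"
    using dense[of y x] xy by auto
  have "det h = 1" using h(1) H(2) by blast
  then have "adj h \<in> H" "adj (adj h) = h" using H(1) h(1) by (auto intro: matrix_subgroup_adj adj_adj)
  then show ?thesis using h by metis
qed (use dense xy in blast)

lemma positive_diagonal_subgroup_eq:
  "positive_diagonal_subgroup = {m3 a 0 0 0 b 0 0 0 c | a b c. a > 0 \<and> b > 0 \<and> c > 0 \<and> a * b * c = 1}"
proof (intro equalityI subsetI)
  fix g assume g: "g \<in> positive_diagonal_subgroup"
  obtain a b c d e f h i j where m: "g = m3 a b c d e f h i j" by (rule m3_cases)
  have z: "b = 0" "c = 0" "d = 0" "f = 0" "h = 0" "i = 0" "a > 0" "e > 0" "j > 0"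
    using g unfolding positive_diagonal_subgroup_def forall_3 by (auto simp: m)
  moreover have "det g = 1" using g by (simp add: positive_diagonal_subgroup_def)
  ultimately have "a * e * j = 1" by (simp add: m)
  then show "g \<in> {m3 a 0 0 0 b 0 0 0 c | a b c. a > 0 \<and> b > 0 \<and> c > 0 \<and> a * b * c = 1}"
    using m z by blast
next
  fix g assume "g \<in> {m3 a 0 0 0 b 0 0 0 c | a b c. a > 0 \<and> b > 0 \<and> c > 0 \<and> a * b * c = (1::real)}"
  then show "g \<in> positive_diagonal_subgroup"
    unfolding positive_diagonal_subgroup_def forall_3 by auto
qed

lemma cds_positive_diagonal: "cartan_decomposition_subgroup SL3 positive_diagonal_subgroup" (is "cartan_decomposition_subgroup _ ?A")
proof -
  have sub: "?A \<subseteq> {g. det g = 1}" by (auto simp: positive_diagonal_subgroup_eq)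
  have grp: "matrix_subgroup ?A"
  proof (rule matrix_subgroupI)
    show "mat 1 \<in> ?A" unfolding positive_diagonal_subgroup_eq m3_one by auto
    show "x ** y \<in> ?A" if xy: "x \<in> ?A" "y \<in> ?A" for x y
    proof -
      obtain a b c a' b' c' where e: "x = m3 a 0 0 0 b 0 0 0 c" "y = m3 a' 0 0 0 b' 0 0 0 c'"
        and p: "a > 0" "b > 0" "c > 0" "a' > 0" "b' > 0" "c' > 0" "a * b * c = 1" "a' * b' * c' = 1"
        using xy unfolding positive_diagonal_subgroup_eq by blast
      have "(a * a') * (b * b') * (c * c') = (a * b * c) * (a' * b' * c')" by (simp only: mult_ac)
      then have "(a * a') * (b * b') * (c * c') = 1" unfolding p by simp
      moreover have "x ** y = m3 (a * a') 0 0 0 (b * b') 0 0 0 (c * c')" by (simp add: e)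
      ultimately show ?thesis unfolding positive_diagonal_subgroup_eq using p mult_pos_pos by blast
    qed
    show "det x = 1 \<and> adj x \<in> ?A" if xA: "x \<in> ?A" for x
    proof -
      obtain a b c where e: "x = m3 a 0 0 0 b 0 0 0 c" and p: "a > 0" "b > 0" "c > 0" "a * b * c = 1"
        using xA unfolding positive_diagonal_subgroup_eq by blast
      have "(b * c) * (a * c) * (a * b) = (a * b * c) * (a * b * c)" by (simp only: mult_ac)
      then have "(b * c) * (a * c) * (a * b) = 1" unfolding p by simp
      moreover have "adj x = m3 (b * c) 0 0 0 (a * c) 0 0 0 (a * b)" by (simp add: e)
      ultimately show ?thesis unfolding positive_diagonal_subgroup_eq using p mult_pos_pos by (auto simp: e)
    qed
  qed
  have "?A = {g. det g = 1 \<and> g$1$2 = 0 \<and> g$1$3 = 0 \<and> g$2$1 = 0 \<and> g$2$3 = 0 \<and> g$3$1 = 0 \<and> g$3$2 = 0 \<and>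
      0 \<le> g$1$1 \<and> 0 \<le> g$2$2 \<and> 0 \<le> g$3$3}" (is "_ = ?S")
  proof
    show "?S \<subseteq> ?A"
    proof
      fix g assume g: "g \<in> ?S"
      obtain a b c d e f h i j where m: "g = m3 a b c d e f h i j" by (rule m3_cases)
      have "a * e * j = 1" "0 \<le> a" "0 \<le> e" "0 \<le> j" using g by (auto simp: m)
      moreover from this have "a \<noteq> 0" "e \<noteq> 0" "j \<noteq> 0" by auto
      ultimately show "g \<in> ?A" unfolding positive_diagonal_subgroup_eq using g by (auto simp: m)
    qed
  qed (auto simp: positive_diagonal_subgroup_eq)
  moreover have "closed ?S"
    by (intro closed_Collect_conj closed_Collect_eq closed_Collect_le continuous_intros)
  ultimately have cl: "closed ?A" by simp
  have "?A = (\<lambda>p. m3 (exp (fst p)) 0 0 0 (exp (snd p)) 0 0 0 (exp (- fst p - snd p))) ` UNIV"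
  proof (intro equalityI subsetI)
    fix g assume "g \<in> ?A"
    then obtain a b c where g: "g = m3 a 0 0 0 b 0 0 0 c" "a > 0" "b > 0" "c > 0" "a * b * c = 1"
      unfolding positive_diagonal_subgroup_eq by blast
    have "exp (- ln a - ln b) = c" using g by (simp add: exp_diff exp_minus field_simps)
    then show "g \<in> (\<lambda>p. m3 (exp (fst p)) 0 0 0 (exp (snd p)) 0 0 0 (exp (- fst p - snd p))) ` UNIV"
      using g by (intro image_eqI[of _ _ "(ln a, ln b)"]) auto
  qed (auto simp: positive_diagonal_subgroup_eq exp_add[symmetric])
  moreover have "connected ((\<lambda>p. m3 (exp (fst p)) 0 0 0 (exp (snd p)) 0 0 0 (exp (- fst p - snd p))) ` (UNIV :: (real \<times> real) set))"
    by (intro connected_continuous_image continuous_intros connected_UNIV)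
  ultimately have conn: "connected ?A" by simp
  show ?thesis
  proof (rule cds_if_dense[OF grp sub cl conn, of 3])
    fix x y :: real assume xy: "1 \<le> x" "1 \<le> y" "x \<le> y\<^sup>2" "y \<le> x\<^sup>2"
    \<comment> \<open>Its largest entry is x and the largest entry of its inverse is y, by the
      chamber inequalities.\<close>
    define h where "h = m3 x 0 0 0 (y / x) 0 0 0 (1 / y)"
    have "h \<in> ?A" unfolding positive_diagonal_subgroup_eq h_def using xy by auto
    have a: "adj h = m3 (1 / x) 0 0 0 (x / y) 0 0 0 y" using xy by (simp add: h_def)
    have "y / x \<le> x" "x / y \<le> y" "1 / x \<le> y" "1 / y \<le> x"
      using xy mult_mono[of 1 x 1 y] by (simp_all add: divide_le_eq power2_eq_square mult.commute)
    then show "\<exists>h\<in>?A. x \<le> 3 * N h \<and> N h \<le> 3 * x \<and> y \<le> 3 * N (adj h) \<and> N (adj h) \<le> 3 * y"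
      using xy by (intro bexI[OF _ \<open>h \<in> ?A\<close>]) (unfold a, simp add: h_def)
  qed simp
qed

lemma cds_unipotent: "cartan_decomposition_subgroup SL3 unipotent_subgroup" (is "cartan_decomposition_subgroup _ ?U")
proof -
  have mem: "m3 1 r s 0 1 r 0 0 1 \<in> ?U" for r s by (auto simp: unipotent_subgroup_def)
  have sub: "?U \<subseteq> {g. det g = 1}" by (auto simp: unipotent_subgroup_def)
  have grp: "matrix_subgroup ?U"
  proof (rule matrix_subgroupI)
    show "mat 1 \<in> ?U" unfolding m3_one by (rule mem)
    show "x ** y \<in> ?U" if "x \<in> ?U" "y \<in> ?U" for x y
      using that by (auto simp: unipotent_subgroup_def)
    show "det x = 1 \<and> adj x \<in> ?U" if "x \<in> ?U" for x
      using that by (auto simp: unipotent_subgroup_def)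
  qed
  have "?U = {g. g$1$1 = 1 \<and> g$2$2 = 1 \<and> g$3$3 = 1 \<and> g$2$1 = 0 \<and> g$3$1 = 0 \<and> g$3$2 = 0 \<and> g$1$2 = g$2$3}" (is "_ = ?S")
  proof
    show "?S \<subseteq> ?U"
    proof
      fix g assume "g \<in> ?S"
      then have "g = m3 1 (g$2$3) (g$1$3) 0 1 (g$2$3) 0 0 1" by (intro matrix3_eqI) auto
      then show "g \<in> ?U" using mem by metis
    qed
  qed (auto simp: unipotent_subgroup_def)
  moreover have "closed ?S"
    by (intro closed_Collect_conj closed_Collect_eq closed_Collect_le continuous_intros)
  ultimately have cl: "closed ?U" by simp
  have "?U = (\<lambda>p. m3 1 (fst p) (snd p) 0 1 (fst p) 0 0 1) ` UNIV"
    by (auto simp: unipotent_subgroup_def image_def)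
  moreover have "connected ((\<lambda>p. m3 1 (fst p) (snd p) 0 1 (fst p) 0 0 1) ` (UNIV :: (real \<times> real) set))"
    by (intro connected_continuous_image continuous_intros connected_UNIV)
  ultimately have conn: "connected ?U" by simp
  have dense: "\<exists>h\<in>?U. x \<le> 8 * N h \<and> N h \<le> 8 * x \<and> y \<le> 8 * N (adj h) \<and> N (adj h) \<le> 8 * y"
    if xy: "1 \<le> x" "x \<le> y" "y \<le> x\<^sup>2" for x y
  proof -
    \<comment> \<open>With corner entry s = x the corner of the inverse is r^2 - s, which this
      choice makes y; y <= x^2 keeps r below 2x, and 3 + 4 + 1 gives the constant 8.\<close>
    define r where "r = sqrt (x + y)"
    have r2: "r * r = x + y" "r \<ge> 0" using xy by (auto simp: r_def)
    have "x \<le> x\<^sup>2" using xy(1) by (simp add: power2_eq_square)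
    then have "r\<^sup>2 \<le> (2 * x)\<^sup>2" using r2 xy by (simp add: power2_eq_square)
    then have "r \<le> 2 * x" by (rule power2_le_imp_le) (use xy in simp)
    have "r \<le> 2 * y" using \<open>r \<le> 2 * x\<close> xy by simp
    have a: "adj (m3 1 r x 0 1 r 0 0 1) = m3 1 (- r) y 0 1 (- r) 0 0 1" by (simp add: r2)
    show ?thesis
      by (intro bexI[OF _ mem[of r x]], unfold a) (use xy r2 \<open>r \<le> 2 * x\<close> \<open>r \<le> 2 * y\<close> in simp)
  qed
  show ?thesis
    by (rule cds_if_dense[OF grp sub cl conn, of 8]) (simp, rule inverse_closure_dense[OF grp sub dense])
qed

text \<open>The weak inequality makes the set closed; together with the determinant it is
  automatically strict, by \<open>lower_right_positive\<close>, and the logarithm of the last entry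
  needs this.\<close>

lemma closed_lower_right_positive:
  "closed {g :: real^3^3. det g = 1 \<and> g$3$1 = 0 \<and> g$3$2 = 0 \<and> 0 \<le> g$3$3}"
  by (intro closed_Collect_conj closed_Collect_eq closed_Collect_le continuous_intros)

lemma lower_right_positive:
  assumes "det (g :: real^3^3) = 1" "g$3$1 = 0" "g$3$2 = 0" "0 \<le> g$3$3"
  shows "0 < g$3$3"
  using assms by (cases "g$3$3 = 0") (auto simp: det_3)

text \<open>Both \<open>jordan_subgroup\<close> and \<open>spiral_subgroup\<close> consist of the matrices below, \<open>B\<close> being a
  one-parameter group of planar matrices with entries \<open>B11, B12, B21, B22\<close>.\<close>

definition affine_group :: "(real \<Rightarrow> real) \<Rightarrow> (real \<Rightarrow> real) \<Rightarrow> (real \<Rightarrow> real) \<Rightarrow> (real \<Rightarrow> real) \<Rightarrow> (real^3^3) set"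
  where "affine_group B11 B12 B21 B22 =
    {m3 (B11 t) (B12 t) s (B21 t) (B22 t) r 0 0 (exp (- 2 * t)) | r s t. True}"

lemma affine_group_properties:
  assumes hom: "\<And>t u. B11 (t + u) = B11 t * B11 u + B12 t * B21 u" "\<And>t u. B12 (t + u) = B11 t * B12 u + B12 t * B22 u"
      "\<And>t u. B21 (t + u) = B21 t * B11 u + B22 t * B21 u" "\<And>t u. B22 (t + u) = B21 t * B12 u + B22 t * B22 u"
    and one: "B11 0 = 1" "B12 0 = 0" "B21 0 = 0" "B22 0 = 1"
    and det: "\<And>t. B11 t * B22 t - B12 t * B21 t = exp (2 * t)"
    and cont: "continuous_on UNIV B11" "continuous_on UNIV B12" "continuous_on UNIV B21" "continuous_on UNIV B22"
  shows "matrix_subgroup (affine_group B11 B12 B21 B22)"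
    and "affine_group B11 B12 B21 B22 \<subseteq> {g. det g = 1}"
    and "closed (affine_group B11 B12 B21 B22)" and "connected (affine_group B11 B12 B21 B22)"
proof -
  let ?G = "affine_group B11 B12 B21 B22"
  define F where "F t s r = m3 (B11 t) (B12 t) s (B21 t) (B22 t) r 0 0 (exp (- 2 * t))" for t s r
  have G: "?G = {F t s r | r s t. True}" by (simp add: affine_group_def F_def)
  have mem: "F t s r \<in> ?G" for t s r unfolding G by blast
  have detF: "det (F t s r) = 1" for t s r
  proof -
    have "det (F t s r) = (B11 t * B22 t - B12 t * B21 t) * exp (- 2 * t)" by (simp add: F_def algebra_simps)
    then show ?thesis by (simp add: det exp_add[symmetric])
  qed
  then show sub: "?G \<subseteq> {g. det g = 1}" unfolding G by auto
  have mult: "F t s r ** F t' s' r' = F (t + t') (B11 t * s' + B12 t * r' + s * exp (- 2 * t')) (B21 t * s' + B22 t * r' + r * exp (- 2 * t'))" for t s r t' s' r'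
  proof -
    have "exp (- 2 * (t + t')) = exp (- 2 * t) * exp (- 2 * t')"
      unfolding exp_add[symmetric] by (simp add: distrib_left)
    then show ?thesis unfolding F_def hom by simp
  qed
  show "matrix_subgroup ?G"
    unfolding matrix_subgroup_def
  proof (intro conjI ballI)
    have F1: "F 0 0 0 = mat 1" by (simp add: F_def one m3_one)
    then show "mat 1 \<in> ?G" using mem by metis
    show "x ** y \<in> ?G" if "x \<in> ?G" "y \<in> ?G" for x y
      using that mem unfolding G using mult by force
    show "\<exists>y\<in>?G. x ** y = mat 1" if xG: "x \<in> ?G" for x
    proof -
      obtain t s r where x: "x = F t s r" using xG G by auto
      define s' r' where "s' = - (B11 (- t) * s + B12 (- t) * r) * exp (2 * t)" and "r' = - (B21 (- t) * s + B22 (- t) * r) * exp (2 * t)"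
      have "F (- t) s' r' ** x = F 0 0 0"
        unfolding x mult by (simp add: s'_def r'_def exp_minus field_simps)
      then have "F (- t) s' r' ** x = mat 1" by (simp add: F1)
      then have "x ** F (- t) s' r' = mat 1" using matrix_left_right_inverse by blast
      then show ?thesis using mem by blast
    qed
  qed
  define S where "S = {g :: real^3^3. det g = 1 \<and> g$3$1 = 0 \<and> g$3$2 = 0 \<and> 0 \<le> g$3$3}"
  \<comment> \<open>The parameter can be read off the last entry continuously, so the group is the
    zero set in \<open>S\<close> of the deviation from the four functions at that parameter.\<close>
  define \<tau> where "\<tau> g = - ln (g$3$3) / 2" for g :: "real^3^3"
  have Spos: "g$3$3 > 0" if "g \<in> S" for g using that lower_right_positive unfolding S_def by blast
  have c\<tau>: "continuous_on S \<tau>"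
    unfolding \<tau>_def using Spos by (intro continuous_intros) (auto simp: less_imp_neq[THEN not_sym])
  have clS: "closed S" unfolding S_def by (rule closed_lower_right_positive)
  define f where "f g = \<bar>g$1$1 - B11 (\<tau> g)\<bar> + \<bar>g$1$2 - B12 (\<tau> g)\<bar> + \<bar>g$2$1 - B21 (\<tau> g)\<bar> + \<bar>g$2$2 - B22 (\<tau> g)\<bar>" for g
  have "continuous_on S f"
    unfolding f_def
    by (intro continuous_intros continuous_on_compose2[OF cont(1) c\<tau>] continuous_on_compose2[OF cont(2) c\<tau>]
        continuous_on_compose2[OF cont(3) c\<tau>] continuous_on_compose2[OF cont(4) c\<tau>]) auto
  from closed_with_function[OF clS this] have "closed {g \<in> S. f g = 0}" .
  moreover have "?G = {g \<in> S. f g = 0}"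
  proof (intro equalityI subsetI)
    fix g assume g: "g \<in> {g \<in> S. f g = 0}"
    then have S: "g \<in> S" and "f g = 0" by auto
    then have e: "g$1$1 = B11 (\<tau> g)" "g$1$2 = B12 (\<tau> g)" "g$2$1 = B21 (\<tau> g)" "g$2$2 = B22 (\<tau> g)"
      unfolding f_def by linarith+
    have "exp (- 2 * \<tau> g) = g$3$3" using Spos[OF S] by (simp add: \<tau>_def)
    then have "g = F (\<tau> g) (g$1$3) (g$2$3)"
      using e S by (intro matrix3_eqI) (auto simp: F_def S_def)
    then show "g \<in> ?G" using mem by metis
  next
    fix g assume g: "g \<in> ?G"
    then obtain t s r where gF: "g = F t s r" using G by auto
    have "\<tau> g = t" by (simp add: \<tau>_def gF F_def)
    moreover have "det g = 1" using g sub by blast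
    ultimately show "g \<in> {g \<in> S. f g = 0}" unfolding S_def f_def by (auto simp: gF F_def)
  qed
  ultimately show "closed ?G" by simp
  have "?G = (\<lambda>p. F (fst p) (fst (snd p)) (snd (snd p))) ` UNIV"
    unfolding G by (auto simp: image_def)
  moreover have "connected ((\<lambda>p. F (fst p) (fst (snd p)) (snd (snd p))) ` (UNIV :: (real \<times> real \<times> real) set))"
    unfolding F_def
    by (intro connected_continuous_image continuous_intros connected_UNIV continuous_on_compose2[OF cont(1)]
        continuous_on_compose2[OF cont(2)] continuous_on_compose2[OF cont(3)] continuous_on_compose2[OF cont(4)]) auto
  ultimately show "connected ?G" by simp
qed

lemma jordan_subgroup_eq: "jordan_subgroup = affine_group exp (\<lambda>t. t * exp t) (\<lambda>_. 0) exp"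
  by (simp add: jordan_subgroup_def affine_group_def)

lemma spiral_subgroup_eq: "spiral_subgroup p =
  affine_group (\<lambda>t. exp t * cos (p * t)) (\<lambda>t. exp t * sin (p * t)) (\<lambda>t. - (exp t * sin (p * t))) (\<lambda>t. exp t * cos (p * t))"
  by (simp add: spiral_subgroup_def affine_group_def)

lemma jordan_subgroup_properties:
  "matrix_subgroup jordan_subgroup" "jordan_subgroup \<subseteq> {g. det g = 1}" "closed jordan_subgroup" "connected jordan_subgroup"
proof -
  have hom: "exp (t + u) = exp t * exp u + t * exp t * 0" "(t + u) * exp (t + u) = exp t * (u * exp u) + t * exp t * exp u"
    "0 = 0 * exp u + exp t * (0 :: real)" "exp (t + u) = 0 * (u * exp u) + exp t * exp u" for t u :: real
    unfolding exp_add by algebra+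
  have det: "exp t * exp t - t * exp t * 0 = exp (2 * t)" for t :: real
    by (simp add: exp_double power2_eq_square)
  note props = affine_group_properties[OF hom _ _ _ _ det]
  show "matrix_subgroup jordan_subgroup" "jordan_subgroup \<subseteq> {g. det g = 1}" "closed jordan_subgroup" "connected jordan_subgroup"
    unfolding jordan_subgroup_eq
    by (rule props; (simp; fail | intro continuous_intros))+
qed

lemma spiral_subgroup_properties:
  "matrix_subgroup (spiral_subgroup p)" "spiral_subgroup p \<subseteq> {g. det g = 1}" "closed (spiral_subgroup p)" "connected (spiral_subgroup p)"
proof -
  have det: "exp t * cos (p * t) * (exp t * cos (p * t)) - exp t * sin (p * t) * - (exp t * sin (p * t)) = exp (2 * t)" for t
  proof -
    have "exp t * cos (p * t) * (exp t * cos (p * t)) - exp t * sin (p * t) * - (exp t * sin (p * t))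
        = (exp t)\<^sup>2 * ((cos (p * t))\<^sup>2 + (sin (p * t))\<^sup>2)" by algebra
    then show ?thesis by (simp only: sin_cos_squared_add2 mult_1_right exp_double)
  qed
  have hom: "exp (t + u) * cos (p * (t + u)) = exp t * cos (p * t) * (exp u * cos (p * u)) + exp t * sin (p * t) * - (exp u * sin (p * u))"
    "exp (t + u) * sin (p * (t + u)) = exp t * cos (p * t) * (exp u * sin (p * u)) + exp t * sin (p * t) * (exp u * cos (p * u))"
    "- (exp (t + u) * sin (p * (t + u))) = - (exp t * sin (p * t)) * (exp u * cos (p * u)) + exp t * cos (p * t) * - (exp u * sin (p * u))"
    "exp (t + u) * cos (p * (t + u)) = - (exp t * sin (p * t)) * (exp u * sin (p * u)) + exp t * cos (p * t) * (exp u * cos (p * u))" for t u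
    unfolding distrib_left[of p] exp_add cos_add sin_add by algebra+
  note props = affine_group_properties[OF hom _ _ _ _ det]
  show "matrix_subgroup (spiral_subgroup p)" "spiral_subgroup p \<subseteq> {g. det g = 1}" "closed (spiral_subgroup p)" "connected (spiral_subgroup p)"
    unfolding spiral_subgroup_eq
    by (rule props; (simp; fail | intro continuous_intros))+
qed

text \<open>With t = ln (y/x) and translation (x, 0), the rotation spreads the corner column of the
  inverse over two entries y cos and y sin up to sign, whose absolute sum is at least y because
  cos^2 + sin^2 = 1.\<close>

lemma cds_spiral: "cartan_decomposition_subgroup SL3 (spiral_subgroup p)" (is "cartan_decomposition_subgroup _ ?G")
proof -
  note props = spiral_subgroup_properties[of p]
  have dense: "\<exists>h\<in>?G. x \<le> 4 * N h \<and> N h \<le> 4 * 2 * x \<and> y \<le> 4 * 2 * N (adj h) \<and> N (adj h) \<le> 4 * 2 * y"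
    if xy: "1 \<le> x" "x \<le> y" "y \<le> x\<^sup>2" for x y
  proof -
    define t where "t = ln (y / x)"
    have et: "exp t = y / x" using xy by (simp add: t_def)
    have e2: "exp (- 2 * t) = x\<^sup>2 / y\<^sup>2" and e2': "exp (2 * t) = y\<^sup>2 / x\<^sup>2"
      using xy by (simp_all add: exp_minus exp_double et power_divide)
    have et1: "1 \<le> y / x" "y / x \<le> x" using xy by (simp_all add: divide_le_eq power2_eq_square)
    define c s where "c = cos (p * t)" and "s = sin (p * t)"
    have cs: "\<bar>c\<bar> \<le> 1" "\<bar>s\<bar> \<le> 1" by (simp_all add: c_def s_def)
    have "1 \<le> \<bar>c\<bar> + \<bar>s\<bar>"
    proof -
      have "c\<^sup>2 + s\<^sup>2 = 1" by (simp add: c_def s_def)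
      moreover have "c\<^sup>2 \<le> \<bar>c\<bar>" "s\<^sup>2 \<le> \<bar>s\<bar>"
        using mult_left_mono[OF cs(1), of "\<bar>c\<bar>"] mult_left_mono[OF cs(2), of "\<bar>s\<bar>"]
        by (simp_all add: power2_eq_square)
      ultimately show ?thesis by linarith
    qed
    define h where "h = m3 (exp t * c) (exp t * s) x (- (exp t * s)) (exp t * c) 0 0 0 (exp (- 2 * t))"
    have h: "h \<in> ?G" unfolding h_def spiral_subgroup_def c_def s_def by blast
    have xe: "\<bar>exp t * c\<bar> \<le> y / x" "\<bar>exp t * s\<bar> \<le> y / x"
      using mult_left_mono[OF cs(1), of "y / x"] mult_left_mono[OF cs(2), of "y / x"] et1
      by (simp_all add: abs_mult et[symmetric])
    have small: "x\<^sup>2 / y\<^sup>2 \<le> 1" using xy by (simp add: divide_le_eq_1 power_mono)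
    have a: "adj h = m3 (exp t * c * exp (- 2 * t)) (- (exp t * s * exp (- 2 * t))) (- (x * (exp t * c)))
       (exp t * s * exp (- 2 * t)) (exp t * c * exp (- 2 * t)) (- (x * (exp t * s))) 0 0 (exp (2 * t))"
    proof -
      have "(exp t * c) * (exp t * c) + (exp t * s) * (exp t * s) = (exp t)\<^sup>2 * (c\<^sup>2 + s\<^sup>2)"
        by (simp add: power2_eq_square algebra_simps)
      then have "(exp t * c) * (exp t * c) + (exp t * s) * (exp t * s) = exp (2 * t)"
        by (simp add: c_def s_def exp_double)
      then show ?thesis by (simp add: h_def)
    qed
    have b: "\<bar>exp t * c * exp (- 2 * t)\<bar> \<le> 1" "\<bar>exp t * s * exp (- 2 * t)\<bar> \<le> 1"
    proof -
      have "exp t * exp (- 2 * t) \<le> 1" unfolding exp_add[symmetric] using et et1 by (simp add: t_def)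
      then have "\<bar>c\<bar> * (exp t * exp (- 2 * t)) \<le> 1 * 1" "\<bar>s\<bar> * (exp t * exp (- 2 * t)) \<le> 1 * 1"
        using cs by (intro mult_mono; simp)+
      then show "\<bar>exp t * c * exp (- 2 * t)\<bar> \<le> 1" "\<bar>exp t * s * exp (- 2 * t)\<bar> \<le> 1" by (simp_all add: abs_mult mult_ac)
    qed
    have c3: "\<bar>x * (exp t * c)\<bar> = y * \<bar>c\<bar>" "\<bar>x * (exp t * s)\<bar> = y * \<bar>s\<bar>" using xy by (simp_all add: et abs_mult)
    have c4: "y * \<bar>c\<bar> \<le> y" "y * \<bar>s\<bar> \<le> y" using cs xy by (simp_all add: mult_left_le)
    have c5: "y \<le> y * \<bar>c\<bar> + y * \<bar>s\<bar>"
      using mult_left_mono[OF \<open>1 \<le> \<bar>c\<bar> + \<bar>s\<bar>\<close>, of y] xy by (simp add: distrib_left)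
    have c6: "exp (2 * t) \<le> y"
    proof -
      have "y\<^sup>2 / x\<^sup>2 = (y / x) * (y / x)" by (simp add: power2_eq_square)
      also have "\<dots> \<le> (y / x) * x" using et1 by (intro mult_left_mono) auto
      finally show ?thesis unfolding e2' using xy by simp
    qed
    show ?thesis
    proof (intro bexI[OF _ h] conjI)
      show "x \<le> 4 * N h" using xy by (simp add: h_def)
      show "N h \<le> 4 * 2 * x" unfolding h_def N_m3 e2 abs_minus_cancel using xe et1 xy
        by (simp, use xe small et1 xy in linarith)
      have "y * \<bar>c\<bar> + y * \<bar>s\<bar> \<le> N (adj h)" unfolding a N_m3 abs_minus_cancel c3 by simp
      then show "y \<le> 4 * 2 * N (adj h)" using c5 N_nonneg[of "adj h"] by linarith
      show "N (adj h) \<le> 4 * 2 * y" unfolding a N_m3 abs_minus_cancel c3 using b c4 c6 xy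
        by (simp, use b c4 c6 xy in linarith)
    qed
  qed
  have dense': "\<exists>h\<in>?G. x \<le> 8 * N h \<and> N h \<le> 8 * x \<and> y \<le> 8 * N (adj h) \<and> N (adj h) \<le> 8 * y"
    if xy: "1 \<le> x" "x \<le> y" "y \<le> x\<^sup>2" for x y
  proof -
    obtain h where h: "h \<in> ?G" "x \<le> 4 * N h" "N h \<le> 4 * 2 * x" "y \<le> 4 * 2 * N (adj h)" "N (adj h) \<le> 4 * 2 * y"
      using dense[OF xy] by blast
    then show ?thesis using N_nonneg[of h] by (intro bexI[of _ h]) auto
  qed
  show ?thesis
    by (rule cds_if_dense[OF props, of 8]) (simp, rule inverse_closure_dense[OF props(1,2) dense'])
qed


text \<open>For t >= 0, N h is about max((1 + t) e^t, |s|, |r|), and the corner of the inverse is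
  e^t (t r - s). As long as y <= x e^T, the parameter t is free to fit y; beyond that t stays at its
  maximum T and the second translation entry is used.\<close>

lemma cds_jordan: "cartan_decomposition_subgroup SL3 jordan_subgroup" (is "cartan_decomposition_subgroup _ ?G")
proof -
  note props = jordan_subgroup_properties
  have dense: "\<exists>h\<in>?G. x \<le> 8 * N h \<and> N h \<le> 8 * x \<and> y \<le> 8 * N (adj h) \<and> N (adj h) \<le> 8 * y"
    if xy: "1 \<le> x" "x \<le> y" "y \<le> x\<^sup>2" for x y
  proof -
    have mem: "m3 (exp t) (t * exp t) s 0 (exp t) r 0 0 (exp (- 2 * t)) \<in> ?G" for t s r
      unfolding jordan_subgroup_def by blast
    have adjm: "adj (m3 (exp t) (t * exp t) s 0 (exp t) r 0 0 (exp (- 2 * t)))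
      = m3 (exp (- t)) (- (t * exp (- t))) (exp t * (t * r - s)) 0 (exp (- t)) (- (exp t * r)) 0 0 (exp (2 * t))" for t s r
    proof -
      have e: "exp t * exp (- 2 * t) = exp (- t)" "exp t * exp t = exp (2 * t)"
        unfolding exp_add[symmetric] by simp_all
      have "t * exp t * exp (- 2 * t) = t * exp (- t)" using e(1) by simp
      then show ?thesis using e by (simp add: algebra_simps)
    qed
    \<comment> \<open>The largest t whose diagonal block, of size (1 + t) e^t, still fits under
      x.\<close>
    have "\<exists>T\<ge>0. T \<le> x \<and> (1 + T) * exp T = x"
    proof (rule IVT')
      have "1 * x \<le> (1 + x) * exp x" using xy by (intro mult_mono) (auto intro: order_trans[OF _ exp_ge_add_one_self])
      show "x \<le> (1 + x) * exp x"
      proof -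
        have "1 \<le> exp x" using xy by simp
        then have "x * 1 \<le> (1 + x) * exp x" using xy by (intro mult_mono) auto
        then show ?thesis by simp
      qed
    qed (use xy in \<open>auto intro!: continuous_intros\<close>)
    then obtain T where T: "T \<ge> 0" "(1 + T) * exp T = x" by blast
    have eT: "exp T \<le> x" "T * exp T \<le> x" using T by (auto simp: distrib_right intro: add_increasing2)
    have small: "exp (- t) \<le> 1" "exp (- (2 * t)) \<le> 1" "t * exp (- t) \<le> 1" if "t \<ge> 0" for t :: real
    proof -
      have "t \<le> exp t" using exp_ge_add_one_self[of t] by linarith
      then have "t * exp (- t) \<le> exp t * exp (- t)" by (intro mult_right_mono) auto
      then show "t * exp (- t) \<le> 1" by (simp add: exp_add[symmetric])
    qed (use that in auto)
    show ?thesis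
    proof (cases "y \<le> x * exp T")
      case True
      define t where "t = ln (y / x)"
      have et: "exp t = y / x" using xy by (simp add: t_def)
      have t0: "t \<ge> 0" unfolding t_def using xy by (simp add: ln_ge_zero)
      have "exp t \<le> exp T" unfolding et using True xy by (simp add: divide_le_eq mult.commute)
      then have tT: "t \<le> T" by simp
      have t1: "exp t \<le> x" using \<open>exp t \<le> exp T\<close> eT by linarith
      have t2: "t * exp t \<le> x" using mult_mono[OF tT \<open>exp t \<le> exp T\<close>] T t0 eT by simp
      have xt: "exp t * x = y" using et xy by simp
      have t3: "exp (2 * t) \<le> y"
      proof -
        have "exp t * exp t \<le> exp t * x" using t1 by (intro mult_left_mono) auto
        then show ?thesis unfolding xt exp_add[symmetric] by simp
      qed
      show ?thesis
        by (intro bexI[OF _ mem[of t x 0]], unfold adjm) (use xy t0 t1 t2 t3 xt in simp, insert small[OF t0], use xy t0 t1 t2 t3 in linarith)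
    next
      case False
      have "T > 0"
      proof (rule ccontr)
        assume "\<not> T > 0"
        then have "T = 0" using T by simp
        then have "x = 1" using T by simp
        then show False using False xy \<open>T = 0\<close> by simp
      qed
      \<comment> \<open>Solves e^T (T r + x) = y. The bound r <= x is exactly y <= x^2, because (1 +
        T) e^T = x.\<close>
      define r where "r = (y * exp (- T) - x) / T"
      have e1: "exp T * exp (- T) = 1" by (simp add: exp_add[symmetric])
      have r0: "r \<ge> 0"
      proof -
        have "x * exp T * exp (- T) \<le> y * exp (- T)" using False by (intro mult_right_mono) auto
        then have "x \<le> y * exp (- T)" using e1 by (simp add: mult.assoc)
        then show ?thesis using \<open>T > 0\<close> by (simp add: r_def)
      qed
      have rx: "r \<le> x"
      proof -
        have "y * exp (- T) \<le> x\<^sup>2 * exp (- T)" using xy by (intro mult_right_mono) auto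
        also have "x\<^sup>2 * exp (- T) = x * ((1 + T) * (exp T * exp (- T)))"
          using T(2) by (simp add: power2_eq_square mult.assoc[symmetric])
        finally have "y * exp (- T) - x \<le> x * T" using e1 by (simp add: algebra_simps)
        then show ?thesis using \<open>T > 0\<close> by (simp add: r_def divide_le_eq)
      qed
      have key: "exp T * (T * (- r) - x) = - y"
      proof -
        have "T * r = y * exp (- T) - x" using \<open>T > 0\<close> by (simp add: r_def)
        moreover have "exp T * (T * (- r) - x) = - (exp T * (T * r + x))" by (simp add: algebra_simps)
        ultimately have "exp T * (T * (- r) - x) = - (y * (exp T * exp (- T)))" by (simp add: mult_ac)
        then show ?thesis using e1 by simp
      qed
      have "exp T * r \<le> exp T * x" by (rule mult_left_mono[OF rx]) simp
      moreover have "exp T * x = x * exp T" by simp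
      ultimately have er: "exp T * r \<le> y" using False by linarith
      have e2: "exp (2 * T) \<le> y"
      proof -
        have "exp T * exp T \<le> x * exp T" using eT by (intro mult_right_mono) auto
        then show ?thesis using False unfolding exp_add[symmetric] by simp
      qed
      have Ng: "N (m3 (exp T) (T * exp T) x 0 (exp T) (- r) 0 0 (exp (- 2 * T))) = 2 * exp T + T * exp T + x + r + exp (- (2 * T))"
        using T(1) r0 xy by simp
      have Na: "N (m3 (exp (- T)) (- (T * exp (- T))) (- y) 0 (exp (- T)) (- (exp T * - r)) 0 0 (exp (2 * T)))
          = 2 * exp (- T) + T * exp (- T) + y + exp T * r + exp (2 * T)"
        using T(1) r0 xy by simp
      have nn: "0 \<le> T * exp T" "0 \<le> T * exp (- T)" "0 \<le> exp T * r" "0 < exp T" "0 < exp (- T)" "0 < exp (2 * T)" "0 < exp (- (2 * T))"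
        using T(1) r0 by simp_all
      note facts = nn small[OF T(1)] xy(1,2) eT r0 rx er e2
      have "x \<le> 2 * exp T + T * exp T + x + r + exp (- (2 * T))" using facts by linarith
      then have "x \<le> 8 * (2 * exp T + T * exp T + x + r + exp (- (2 * T)))" using xy(1) by simp
      moreover have "2 * exp T + T * exp T + x + r + exp (- (2 * T)) \<le> 8 * x" using facts by linarith
      moreover have "y \<le> 2 * exp (- T) + T * exp (- T) + y + exp T * r + exp (2 * T)" using facts by linarith
      then have "y \<le> 8 * (2 * exp (- T) + T * exp (- T) + y + exp T * r + exp (2 * T))" using xy(1,2) by simp
      moreover have "2 * exp (- T) + T * exp (- T) + y + exp T * r + exp (2 * T) \<le> 8 * y" using facts by linarith
      ultimately show ?thesis
        by (intro bexI[OF _ mem[of T x "- r"]], unfold adjm key Ng Na) blast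
    qed
  qed
  show ?thesis
    by (rule cds_if_dense[OF props, of 8]) (simp, rule inverse_closure_dense[OF props(1,2) dense])
qed

lemma diagonal_root_subgroup_properties:
  assumes pq: "p = 1 \<or> q = 1"
  shows "matrix_subgroup (diagonal_root_subgroup p q)" "diagonal_root_subgroup p q \<subseteq> {g. det g = 1}"
    "closed (diagonal_root_subgroup p q)" "connected (diagonal_root_subgroup p q)"
proof -
  let ?G = "diagonal_root_subgroup p q"
  define F where "F t r = m3 (exp (p * t)) r 0 0 (exp (q * t)) 0 0 0 (exp (- (p + q) * t))" for t r
  have G: "?G = {F t r | r t. True}" by (simp add: diagonal_root_subgroup_def F_def)
  have mem: "F t r \<in> ?G" for t r unfolding G by blast
  have "exp (p * t) * exp (q * t) * exp (- (p + q) * t) = 1" for t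
    unfolding exp_add[symmetric] by (simp add: algebra_simps)
  then have detF: "det (F t r) = 1" for t r by (simp add: F_def)
  then show sub: "?G \<subseteq> {g. det g = 1}" unfolding G by auto
  have mult: "F t r ** F t' r' = F (t + t') (exp (p * t) * r' + r * exp (q * t'))" for t r t' r'
  proof -
    have "exp (- (p + q) * (t + t')) = exp (- (p + q) * t) * exp (- (p + q) * t')"
      unfolding exp_add[symmetric] by (simp add: distrib_left)
    then show ?thesis unfolding F_def distrib_left[of p] distrib_left[of q] exp_add by simp
  qed
  show "matrix_subgroup ?G"
    unfolding matrix_subgroup_def
  proof (intro conjI ballI)
    have F1: "F 0 0 = mat 1" by (simp add: F_def m3_one)
    then show "mat 1 \<in> ?G" using mem by metis
    show "x ** y \<in> ?G" if "x \<in> ?G" "y \<in> ?G" for x y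
      using that mem unfolding G using mult by force
    show "\<exists>y\<in>?G. x ** y = mat 1" if xG: "x \<in> ?G" for x
    proof -
      obtain t r where x: "x = F t r" using xG G by auto
      define r' where "r' = - exp (- p * t) * r * exp (- q * t)"
      have "exp (p * t) * r' + r * exp (q * (- t)) = 0"
      proof -
        have "exp (p * t) * exp (- p * t) = 1" unfolding exp_add[symmetric] by simp
        then show ?thesis unfolding r'_def by (simp add: mult.assoc[symmetric])
      qed
      then have "x ** F (- t) r' = F 0 0" unfolding x mult by simp
      then show ?thesis using F1 mem by metis
    qed
  qed
  define S where "S = {g :: real^3^3. det g = 1 \<and> g$1$3 = 0 \<and> g$2$1 = 0 \<and> g$2$3 = 0 \<and> g$3$1 = 0 \<and> g$3$2 = 0 \<and>
      0 \<le> g$1$1 \<and> 0 \<le> g$2$2 \<and> 0 \<le> g$3$3}"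
  have clS: "closed S"
    unfolding S_def by (intro closed_Collect_conj closed_Collect_eq closed_Collect_le continuous_intros)
  have Sd: "g$1$1 * g$2$2 * g$3$3 = 1" if "g \<in> S" for g using that by (auto simp: S_def det_3)
  have Spos: "g$1$1 > 0" "g$2$2 > 0" "g$3$3 > 0" if "g \<in> S" for g
  proof -
    have "g$1$1 \<noteq> 0" "g$2$2 \<noteq> 0" "g$3$3 \<noteq> 0" using Sd[OF that] by auto
    then show "g$1$1 > 0" "g$2$2 > 0" "g$3$3 > 0" using that by (auto simp: S_def)
  qed
  \<comment> \<open>Vanishes when the first two diagonal logarithms are proportional to (p, q); the
    parameter is then read off the coordinate whose exponent is 1.\<close>
  define f where "f g = q * ln (g$1$1) - p * ln (g$2$2)" for g :: "real^3^3"
  have "continuous_on S f"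
    unfolding f_def using Spos by (intro continuous_intros) (auto simp: less_imp_neq[THEN not_sym])
  from closed_with_function[OF clS this] have "closed {g \<in> S. f g = 0}" .
  moreover have "?G = {g \<in> S. f g = 0}"
  proof (intro equalityI subsetI)
    fix g assume g: "g \<in> {g \<in> S. f g = 0}"
    then have S: "g \<in> S" and f: "q * ln (g$1$1) = p * ln (g$2$2)" by (auto simp: f_def)
    define t where "t = (if p = 1 then ln (g$1$1) else ln (g$2$2))"
    have "p * t = ln (g$1$1)" "q * t = ln (g$2$2)" using f pq by (auto simp: t_def)
    then have e: "exp (p * t) = g$1$1" "exp (q * t) = g$2$2" using Spos[OF S] by simp_all
    have "exp (p * t) * exp (q * t) * exp (- (p + q) * t) = 1"
      unfolding exp_add[symmetric] by (simp add: algebra_simps)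
    then have "g$1$1 * g$2$2 * exp (- (p + q) * t) = g$1$1 * g$2$2 * g$3$3" unfolding e Sd[OF S] .
    then have "exp (- (p + q) * t) = g$3$3" using Spos[OF S] by simp
    then have "g = F t (g$1$2)"
      using e S by (intro matrix3_eqI) (auto simp: F_def S_def)
    then show "g \<in> ?G" using mem by metis
  next
    fix g assume g: "g \<in> ?G"
    then obtain t r where gF: "g = F t r" using G by auto
    moreover have "det g = 1" using g sub by blast
    ultimately show "g \<in> {g \<in> S. f g = 0}" unfolding S_def f_def by (auto simp: F_def)
  qed
  ultimately show "closed ?G" by simp
  have "?G = (\<lambda>p. F (fst p) (snd p)) ` UNIV"
    unfolding G by (auto simp: image_def)
  moreover have "connected ((\<lambda>p. F (fst p) (snd p)) ` (UNIV :: (real \<times> real) set))"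
    unfolding F_def by (intro connected_continuous_image continuous_intros connected_UNIV)
  ultimately show "connected ?G" by simp
qed

text \<open>The entry r = x passes to the inverse as x exp(-(p + q) t) up to sign, and t is chosen
  to make this y. The normalisation max = 1 and min >= -1/2 gives p + q >= 1/2, and keeps the
  diagonal entries below x and those of the inverse below y.\<close>

lemma cds_diagonal_root:
  assumes "max p q = 1" "min p q \<ge> - 1 / 2"
  shows "cartan_decomposition_subgroup SL3 (diagonal_root_subgroup p q)" (is "cartan_decomposition_subgroup _ ?G")
proof -
  have pq: "p = 1 \<or> q = 1" "p \<le> 1" "q \<le> 1" "- 1 / 2 \<le> p" "- 1 / 2 \<le> q" using assms by (auto simp: max_def min_def split: if_splits)
  note props = diagonal_root_subgroup_properties[OF pq(1)]
  have mem: "m3 (exp (p * t)) r 0 0 (exp (q * t)) 0 0 0 (exp (- (p + q) * t)) \<in> ?G" for t r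
    unfolding diagonal_root_subgroup_def by blast
  have adjm: "adj (m3 (exp (p * t)) r 0 0 (exp (q * t)) 0 0 0 (exp (- (p + q) * t)))
      = m3 (exp (- p * t)) (- (r * exp (- (p + q) * t))) 0 0 (exp (- q * t)) 0 0 0 (exp ((p + q) * t))" for t r
  proof -
    have "exp (q * t) * exp (- (p + q) * t) = exp (- p * t)" "exp (p * t) * exp (- (p + q) * t) = exp (- q * t)"
      "exp (p * t) * exp (q * t) = exp ((p + q) * t)"
      unfolding exp_add[symmetric] by (simp_all add: algebra_simps)
    then show ?thesis by simp
  qed
  have dense: "\<exists>h\<in>?G. x \<le> 5 * N h \<and> N h \<le> 5 * x \<and> y \<le> 5 * N (adj h) \<and> N (adj h) \<le> 5 * y"
    if xy: "1 \<le> x" "x \<le> y" "y \<le> x\<^sup>2" for x y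
  proof -
    define u v where "u = ln x" and "v = ln y"
    have x: "x = exp u" and y: "y = exp v" using xy by (simp_all add: u_def v_def)
    have uv: "0 \<le> u" "u \<le> v" "v \<le> 2 * u"
      using xy ln_mono[OF xy(2)] ln_mono[OF xy(3)] by (auto simp: u_def v_def ln_realpow)
    define m where "m = p + q"
    have m: "m \<ge> 1 / 2" using pq by (auto simp: m_def)
    show ?thesis
    proof (cases "q = 1")
      case True
      define t where "t = - (v - u) / m"
      have mt: "m * t = u - v" using m by (simp add: t_def)
      have t: "t \<le> 0" using m uv by (simp add: t_def divide_nonpos_pos)
      have "v - u \<le> u" using uv by simp
      have "- t \<le> 2 * (v - u)"
      proof -
        have "(1 / 2) * (- t) \<le> m * (- t)" using m t by (intro mult_right_mono) auto
        then show ?thesis using mt by simp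
      qed
      then have t2: "- t \<le> v" using uv by simp
      have mm: "m = p + 1" using True by (simp add: m_def)
      have e: "p * t \<le> u" "t \<le> u" "- m * t \<le> u" "- p * t \<le> v" "- t \<le> v" "m * t \<le> v"
      proof -
        have "p * (- t) \<ge> (- 1 / 2) * (- t)" "p * (- t) \<le> 1 * (- t)" using t pq by (intro mult_right_mono; simp)+
        then show "p * t \<le> u" "- p * t \<le> v" using mt t2 uv unfolding mm by (simp_all add: algebra_simps)
      qed (use t t2 uv mt in auto)
      have E: "exp (p * t) \<le> exp u" "exp t \<le> exp u" "exp (- (m * t)) \<le> exp u"
        "exp (- (p * t)) \<le> exp v" "exp (- t) \<le> exp v" "exp (m * t) \<le> exp v"
        using e by simp_all
      have r: "x * exp (- m * t) = y" unfolding x y exp_add[symmetric] using mt by (simp add: algebra_simps)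
      show ?thesis
        by (intro bexI[OF _ mem[of t x]], unfold adjm, unfold m_def[symmetric] r)
          (intro conjI; simp add: True x y; insert E; smt (verit) exp_gt_zero)
    next
      case False
      then have p1: "p = 1" using pq by blast
      define t where "t = - (v - u) / m"
      have mt: "m * t = u - v" using m by (simp add: t_def)
      have t: "t \<le> 0" using m uv by (simp add: t_def divide_nonpos_pos)
      have "- t \<le> 2 * (v - u)"
      proof -
        have "(1 / 2) * (- t) \<le> m * (- t)" using m t by (intro mult_right_mono) auto
        then show ?thesis using mt by simp
      qed
      then have t2: "- t \<le> v" using uv by simp
      have mm: "m = q + 1" using p1 by (simp add: m_def)
      have e: "q * t \<le> u" "t \<le> u" "- m * t \<le> u" "- q * t \<le> v" "- t \<le> v" "m * t \<le> v"
      proof -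
        have "q * (- t) \<ge> (- 1 / 2) * (- t)" "q * (- t) \<le> 1 * (- t)" using t pq by (intro mult_right_mono; simp)+
        then show "q * t \<le> u" "- q * t \<le> v" using mt t2 uv unfolding mm by (simp_all add: algebra_simps)
      qed (use t t2 uv mt in auto)
      have E: "exp (q * t) \<le> exp u" "exp t \<le> exp u" "exp (- (m * t)) \<le> exp u"
        "exp (- (q * t)) \<le> exp v" "exp (- t) \<le> exp v" "exp (m * t) \<le> exp v"
        using e by simp_all
      have r: "x * exp (- m * t) = y" unfolding x y exp_add[symmetric] using mt by (simp add: algebra_simps)
      show ?thesis
        by (intro bexI[OF _ mem[of t x]], unfold adjm, unfold m_def[symmetric] r)
          (intro conjI; simp add: p1 x y; insert E; smt (verit) exp_gt_zero)
    qed
  qed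
  show ?thesis
    by (rule cds_if_dense[OF props, of 5]) (simp, rule inverse_closure_dense[OF props(1,2) dense])
qed

section \<open>Automorphisms\<close>

lemma cds_automorphism:
  assumes f: "f \<in> lie_automorphisms SL3" and H: "cartan_decomposition_subgroup SL3 H"
  shows "cartan_decomposition_subgroup SL3 (f ` H)"
proof -
  let ?G = "{g :: real^3^3. det g = 1}"
  have iso: "f \<in> iso SL3 SL3" and hom: "homeomorphic_map (top_of_set ?G) (top_of_set ?G) f"
    using f by (auto simp: lie_automorphisms_def)
  have HG: "H \<subseteq> ?G" "subgroup H SL3" "closedin (top_of_set ?G) H" "connected H"
    using H subgroup.subset[of H SL3] by (auto simp: cartan_decomposition_subgroup_def)
  obtain C where C: "compact C" "C \<subseteq> ?G" "C <#>\<^bsub>SL3\<^esub> H <#>\<^bsub>SL3\<^esub> C = ?G"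
    using H by (auto simp: cartan_decomposition_subgroup_def)
  have cont: "continuous_on ?G f"
    using homeomorphic_imp_continuous_map[OF hom] by (simp add: continuous_map_iff_continuous2)
  have img: "f ` ?G = ?G" using iso by (auto simp: iso_def bij_betw_def)
  have mult: "f (x ** y) = f x ** f y" if "x \<in> ?G" "y \<in> ?G" for x y
    using iso that by (auto simp: iso_def hom_def)
  have gh: "group_hom SL3 SL3 f"
    using iso by (intro group_hom.intro group_hom_axioms.intro group_SL3) (simp add: iso_def)
  have "subgroup (f ` H) SL3" by (rule group_hom.subgroup_img_is_subgroup[OF gh HG(2)])
  moreover have "closedin (top_of_set ?G) (f ` H)"
    using homeomorphic_map_closedness[OF hom, of H] HG(1,3) by simp
  moreover have "connected (f ` H)"
    using HG cont by (intro connected_continuous_image) (auto intro: continuous_on_subset)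
  moreover have "compact (f ` C)"
    using C cont by (intro compact_continuous_image) (auto intro: continuous_on_subset)
  moreover have "f ` C \<subseteq> ?G" using C(2) img by blast
  moreover have "(f ` C) <#>\<^bsub>SL3\<^esub> (f ` H) <#>\<^bsub>SL3\<^esub> (f ` C) = ?G"
  proof -
    have im: "(f ` A) <#>\<^bsub>SL3\<^esub> (f ` B) = f ` (A <#>\<^bsub>SL3\<^esub> B)" if "A \<subseteq> ?G" "B \<subseteq> ?G" for A B
    proof -
      have eq: "A <#>\<^bsub>SL3\<^esub> B = {x. \<exists>a\<in>A. \<exists>b\<in>B. x = a ** b}" for A B
        unfolding set_mult_def SL3_simps by blast
      have m: "f (a ** b) = f a ** f b" if "a \<in> A" "b \<in> B" for a b
        using mult that \<open>A \<subseteq> ?G\<close> \<open>B \<subseteq> ?G\<close> by blast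
      show ?thesis
      proof (intro equalityI subsetI)
        fix x assume "x \<in> (f ` A) <#>\<^bsub>SL3\<^esub> (f ` B)"
        then obtain a b where ab: "a \<in> A" "b \<in> B" "x = f a ** f b" unfolding eq by blast
        then have "x = f (a ** b)" using m by simp
        then show "x \<in> f ` (A <#>\<^bsub>SL3\<^esub> B)" unfolding eq using ab by blast
      next
        fix x assume "x \<in> f ` (A <#>\<^bsub>SL3\<^esub> B)"
        then obtain a b where ab: "a \<in> A" "b \<in> B" "x = f (a ** b)" unfolding eq by blast
        then have "x = f a ** f b" using m by simp
        then show "x \<in> (f ` A) <#>\<^bsub>SL3\<^esub> (f ` B)" unfolding eq using ab by blast
      qed
    qed
    have "C <#>\<^bsub>SL3\<^esub> H \<subseteq> ?G"
      using C(2) HG(1) by (auto simp: set_mult_def det_mul subset_iff)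
    then show ?thesis using im[of C H] im[of "C <#>\<^bsub>SL3\<^esub> H" C] C HG img by simp
  qed
  ultimately show ?thesis
    unfolding cartan_decomposition_subgroup_def by auto
qed

lemma lie_automorphisms_inverse:
  assumes f: "f \<in> lie_automorphisms SL3"
  shows "inv_into {g :: real^3^3. det g = 1} f \<in> lie_automorphisms SL3"
proof -
  let ?G = "{g :: real^3^3. det g = 1}"
  let ?k = "inv_into ?G f"
  have iso: "f \<in> iso SL3 SL3" and hom: "homeomorphic_map (top_of_set ?G) (top_of_set ?G) f"
    using f by (auto simp: lie_automorphisms_def)
  have bij: "bij_betw f ?G ?G" using iso by (simp add: iso_def)
  obtain k where k: "homeomorphic_maps (top_of_set ?G) (top_of_set ?G) f k"
    using hom homeomorphic_map_maps by blast
  have kk: "k x = ?k x" if "x \<in> ?G" for x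
  proof -
    have "f (k x) = x" "k x \<in> ?G"
      using k that by (auto simp: homeomorphic_maps_def continuous_map_def)
    then show ?thesis using bij by (metis bij_betw_inv_into_left)
  qed
  have "homeomorphic_map (top_of_set ?G) (top_of_set ?G) k"
    using k homeomorphic_maps_map homeomorphic_maps_sym by blast
  then have "homeomorphic_map (top_of_set ?G) (top_of_set ?G) ?k"
    by (rule homeomorphic_map_eq) (simp add: kk)
  moreover have "?k \<in> iso SL3 SL3"
    using group.iso_set_sym[OF group_SL3 iso] by simp
  ultimately show ?thesis by (simp add: lie_automorphisms_def)
qed

lemma lie_automorphismsI:
  assumes det: "\<And>x. det x = 1 \<Longrightarrow> det (f x) = 1" "\<And>x. det x = 1 \<Longrightarrow> det (k x) = 1"
    and inv: "\<And>x. det x = 1 \<Longrightarrow> k (f x) = x" "\<And>x. det x = 1 \<Longrightarrow> f (k x) = x"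
    and mult: "\<And>x y. det x = 1 \<Longrightarrow> det y = 1 \<Longrightarrow> f (x ** y) = f x ** f y"
    and cont: "continuous_on UNIV f" "continuous_on UNIV k"
  shows "f \<in> lie_automorphisms SL3"
proof -
  let ?G = "{g :: real^3^3. det g = 1}"
  have "homeomorphic_maps (top_of_set ?G) (top_of_set ?G) f k"
    unfolding homeomorphic_maps_def
    using det inv cont by (auto simp: continuous_map_iff_continuous2 intro: continuous_on_subset)
  then have "homeomorphic_map (top_of_set ?G) (top_of_set ?G) f"
    using homeomorphic_maps_map by blast
  moreover have "bij_betw f ?G ?G"
    by (rule bij_betw_byWitness[of _ k]) (use det inv in auto)
  ultimately show ?thesis
    unfolding lie_automorphisms_def iso_def hom_def using det mult by auto
qed

text \<open>P is any invertible matrix, so diagonal rescalings from GL(3) are included; these bring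
  Lie algebra elements to normal forms with coefficient one.\<close>

lemma conj_automorphism:
  assumes PQ: "P ** Q = (mat 1 :: real^3^3)"
  shows "(\<lambda>X. P ** X ** Q) \<in> lie_automorphisms SL3"
proof (rule lie_automorphismsI[of _ "\<lambda>X. Q ** X ** P"])
  have QP: "Q ** P = mat 1" using PQ matrix_left_right_inverse[of P Q] by simp
  have "det P * det Q = 1" using PQ by (metis det_I det_mul)
  then show "det (P ** x ** Q) = 1" "det (Q ** x ** P) = 1" if "det x = 1" for x
    using that by (simp_all add: det_mul mult.commute)
  show "Q ** (P ** x ** Q) ** P = x" for x
    by (metis QP matrix_mul_assoc matrix_mul_lid matrix_mul_rid)
  show "P ** (Q ** x ** P) ** Q = x" for x
    by (metis PQ matrix_mul_assoc matrix_mul_lid matrix_mul_rid)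
  show "P ** (x ** y) ** Q = P ** x ** Q ** (P ** y ** Q)" for x y
  proof -
    have "P ** x ** Q ** (P ** y ** Q) = P ** x ** (Q ** P) ** y ** Q" by (simp only: matrix_mul_assoc)
    then show ?thesis unfolding QP by (simp add: matrix_mul_assoc)
  qed
qed (intro continuous_intros)+

text \<open>The inverse transpose composed with conjugation by the antidiagonal permutation: it preserves
  upper triangular matrices.\<close>

definition rev_perm :: "real^3^3" where "rev_perm = m3 0 0 1 0 1 0 1 0 0"

definition flip :: "real^3^3 \<Rightarrow> real^3^3"
  where "flip X = rev_perm ** transpose (adj X) ** rev_perm"

text \<open>The differential of \<open>flip\<close> at the identity: inversion becomes a minus
  sign.\<close>

definition flip_lie :: "real^3^3 \<Rightarrow> real^3^3"
  where "flip_lie X = rev_perm ** (- transpose X) ** rev_perm"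

lemma rev_perm_sq: "rev_perm ** rev_perm = mat 1"
  by (simp add: rev_perm_def m3_one)

lemma flip_lie_m3 [simp]: "flip_lie (m3 a b c d e f g h k) = m3 (- k) (- f) (- c) (- h) (- e) (- b) (- g) (- d) (- a)"
  by (simp add: flip_lie_def rev_perm_def)

lemma flip_lie_flip_lie [simp]: "flip_lie (flip_lie X) = X"
  by (cases X rule: m3_cases) simp

lemma flip_mult: "flip (X ** Y) = flip X ** flip Y"
proof -
  have "flip X ** flip Y = rev_perm ** transpose (adj X) ** (rev_perm ** rev_perm) ** transpose (adj Y) ** rev_perm"
    by (simp add: flip_def matrix_mul_assoc)
  also have "\<dots> = flip (X ** Y)"
    unfolding rev_perm_sq by (simp add: flip_def adj_mult matrix_transpose_mul matrix_mul_assoc)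
  finally show ?thesis by simp
qed

lemma flip_one: "flip (mat 1) = mat 1"
  by (simp add: flip_def adj_one rev_perm_sq)

lemma det_rev_perm: "det rev_perm = - 1"
  by (simp add: rev_perm_def)

lemma det_flip: "det X = 1 \<Longrightarrow> det (flip X) = 1"
  by (simp add: flip_def det_mul det_adj det_rev_perm)

lemma flip_flip: "det X = 1 \<Longrightarrow> flip (flip X) = X"
proof -
  assume d: "det X = 1"
  have "adj (transpose Y) = transpose (adj Y)" for Y by (cases Y rule: m3_cases) simp
  moreover have "adj rev_perm = - rev_perm" by (simp add: rev_perm_def)
  moreover have "transpose (- Y) = - transpose Y" for Y :: "real^3^3" by (cases Y rule: m3_cases) simp
  moreover have "transpose rev_perm = rev_perm" by (simp add: rev_perm_def)
  ultimately have "flip (flip X) = rev_perm ** (rev_perm ** adj (adj X) ** rev_perm) ** rev_perm"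
    unfolding flip_def adj_mult matrix_transpose_mul
    by (simp add: matrix_mul_assoc matrix_mult_minus_left matrix_mult_minus_right)
  also have "\<dots> = (rev_perm ** rev_perm) ** adj (adj X) ** (rev_perm ** rev_perm)"
    by (simp only: matrix_mul_assoc)
  finally show ?thesis by (simp add: rev_perm_sq adj_adj[OF d])
qed

lemma flip_automorphism: "flip \<in> lie_automorphisms SL3"
proof (rule lie_automorphismsI[of _ flip])
  have "continuous_on UNIV (transpose :: real^3^3 \<Rightarrow> _)"
    unfolding transpose_def by (intro continuous_intros)
  then show "continuous_on UNIV flip" "continuous_on UNIV flip"
    unfolding flip_def
    by (intro continuous_intros continuous_on_compose2[OF \<open>continuous_on UNIV transpose\<close> continuous_on_adj]; simp)+
qed (auto simp: det_flip flip_flip flip_mult)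

lemma lie_conj_image:
  fixes P Q :: "real^3^3"
  assumes PQ: "P ** Q = (mat 1 :: real^3^3)"
  shows "lie ((\<lambda>X. P ** X ** Q) ` H) = (\<lambda>X. P ** X ** Q) ` lie H"
proof -
  have QP: "Q ** P = mat 1" using PQ matrix_left_right_inverse[of P Q] by simp
  have ret: "P ** (Q ** x ** P) ** Q = x" "Q ** (P ** x ** Q) ** P = x" for x
    by (metis PQ QP matrix_mul_assoc matrix_mul_lid matrix_mul_rid)+
  have m: "mexp (t *\<^sub>R (P ** X ** Q)) = P ** mexp (t *\<^sub>R X) ** Q" for t X
    using mexp_conj[OF PQ, of "t *\<^sub>R X"] by (simp add: matrix_mult_scaleR_left matrix_mult_scaleR_right)
  show ?thesis
  proof (intro equalityI subsetI)
    fix Y assume Y: "Y \<in> lie ((\<lambda>X. P ** X ** Q) ` H)"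
    define X where "X = Q ** Y ** P"
    have YX: "Y = P ** X ** Q" by (simp add: X_def ret)
    have "mexp (t *\<^sub>R X) \<in> H" for t
    proof -
      have "mexp (t *\<^sub>R Y) \<in> (\<lambda>X. P ** X ** Q) ` H" using Y by (simp add: lie_def)
      then have "P ** mexp (t *\<^sub>R X) ** Q \<in> (\<lambda>X. P ** X ** Q) ` H" unfolding YX m .
      then obtain Z where Z: "Z \<in> H" "P ** mexp (t *\<^sub>R X) ** Q = P ** Z ** Q" by blast
      have "Q ** (P ** mexp (t *\<^sub>R X) ** Q) ** P = Q ** (P ** Z ** Q) ** P" by (simp only: Z(2))
      then have "mexp (t *\<^sub>R X) = Z" by (simp only: ret(2))
      then show ?thesis using Z(1) by simp
    qed
    then have "X \<in> lie H" by (simp add: lie_def)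
    then show "Y \<in> (\<lambda>X. P ** X ** Q) ` lie H" using YX by blast
  next
    fix Y assume "Y \<in> (\<lambda>X. P ** X ** Q) ` lie H"
    then show "Y \<in> lie ((\<lambda>X. P ** X ** Q) ` H)" unfolding lie_def using m by auto
  qed
qed

text \<open>One inclusion holds for every subset of SL(3); applying it to the image as well gives
  the other, since both maps are involutions.\<close>

lemma lie_flip_image:
  assumes H: "H \<subseteq> {g. det g = 1}"
  shows "lie (flip ` H) = flip_lie ` lie H"
proof -
  have one: "flip_lie X \<in> lie (flip ` K)" if K: "K \<subseteq> {g. det g = 1}" and X: "X \<in> lie K" for X K
    unfolding lie_def
  proof (intro CollectI allI)
    fix t
    have mem: "mexp (t *\<^sub>R X) \<in> K" using X by (simp add: lie_def)
    then have "det (mexp (t *\<^sub>R X)) = 1" using K by blast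
    then have "adj (mexp (t *\<^sub>R X)) = mexp (- (t *\<^sub>R X))" using adj_unique mexp_minus by metis
    then have "flip (mexp (t *\<^sub>R X)) = rev_perm ** mexp (- transpose (t *\<^sub>R X)) ** rev_perm"
      by (simp add: flip_def mexp_transpose)
    also have "\<dots> = mexp (rev_perm ** (- transpose (t *\<^sub>R X)) ** rev_perm)"
      by (rule mexp_conj[OF rev_perm_sq, symmetric])
    also have "rev_perm ** (- transpose (t *\<^sub>R X)) ** rev_perm = t *\<^sub>R flip_lie X"
      by (cases X rule: m3_cases) (simp add: rev_perm_def)
    finally show "mexp (t *\<^sub>R flip_lie X) \<in> flip ` K" using mem by (metis imageI)
  qed
  show ?thesis
  proof
    show "flip_lie ` lie H \<subseteq> lie (flip ` H)" using one[OF H] by blast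
    have "flip ` H \<subseteq> {g. det g = 1}" using H det_flip by blast
    moreover have "flip ` flip ` H = H" using H flip_flip by force
    ultimately have "flip_lie Y \<in> lie H" if "Y \<in> lie (flip ` H)" for Y using one that by metis
    then show "lie (flip ` H) \<subseteq> flip_lie ` lie H" by (metis flip_lie_flip_lie image_eqI subsetI)
  qed
qed

lemma flip_lie_image_iff: "Y \<in> flip_lie ` S \<longleftrightarrow> flip_lie Y \<in> S"
  by (metis flip_lie_flip_lie imageE image_eqI)

definition standard :: "(real^3^3) set \<Rightarrow> bool"
  where "standard L \<longleftrightarrow> L = positive_diagonal_subgroup \<or> L = unipotent_subgroup \<or> L = jordan_subgroup \<or>
    (\<exists>p q. max p q = 1 \<and> min p q \<ge> - 1 / 2 \<and> L = diagonal_root_subgroup p q) \<or>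
    (\<exists>p. p \<noteq> 0 \<and> L = spiral_subgroup p)"

lemma cds_standard: "standard L \<Longrightarrow> cartan_decomposition_subgroup SL3 L"
  unfolding standard_def
  using cds_positive_diagonal cds_unipotent cds_jordan cds_diagonal_root cds_spiral by metis

text \<open>Only conjugations, possibly after \<open>flip\<close>, are allowed. This family is
  stable under conjugating and flipping H, so H can be replaced by such an image whenever a normal
  form is wanted, and every member is an automorphism.\<close>

definition contains_standard :: "(real^3^3) set \<Rightarrow> bool"
  where "contains_standard H \<longleftrightarrow> (\<exists>P Q L. P ** Q = mat 1 \<and> standard L \<and>
    ((\<lambda>X. P ** X ** Q) ` L \<subseteq> H \<or> (\<lambda>X. P ** flip X ** Q) ` L \<subseteq> H))"

lemma contains_standardI: "standard L \<Longrightarrow> L \<subseteq> H \<Longrightarrow> contains_standard H"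
  unfolding contains_standard_def by (intro exI[of _ "mat 1"] exI[of _ L]) auto

lemma contains_standard_conj:
  assumes PQ: "P ** Q = (mat 1 :: real^3^3)" and good: "contains_standard ((\<lambda>X. P ** X ** Q) ` H)"
  shows "contains_standard H"
proof -
  have QP: "Q ** P = mat 1" using PQ matrix_left_right_inverse[of P Q] by simp
  obtain P' Q' L where L: "P' ** Q' = mat 1" "standard L"
    "(\<lambda>X. P' ** X ** Q') ` L \<subseteq> (\<lambda>X. P ** X ** Q) ` H \<or> (\<lambda>X. P' ** flip X ** Q') ` L \<subseteq> (\<lambda>X. P ** X ** Q) ` H"
    using good unfolding contains_standard_def by blast
  have ret: "(Q ** P') ** X ** (Q' ** P) \<in> H" if X: "P' ** X ** Q' \<in> (\<lambda>X. P ** X ** Q) ` H" for X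
  proof -
    obtain Y where Y: "Y \<in> H" "P' ** X ** Q' = P ** Y ** Q" using X by blast
    have "(Q ** P') ** X ** (Q' ** P) = Q ** (P' ** X ** Q') ** P" by (simp only: matrix_mul_assoc)
    also have "\<dots> = Y" unfolding Y(2) by (metis QP matrix_mul_assoc matrix_mul_lid matrix_mul_rid)
    finally show ?thesis using Y(1) by simp
  qed
  have "(Q ** P') ** (Q' ** P) = Q ** (P' ** Q') ** P" by (simp only: matrix_mul_assoc)
  then have "(Q ** P') ** (Q' ** P) = mat 1" by (simp add: L(1) QP)
  moreover have "(\<lambda>X. (Q ** P') ** X ** (Q' ** P)) ` L \<subseteq> H \<or> (\<lambda>X. (Q ** P') ** flip X ** (Q' ** P)) ` L \<subseteq> H"
    using L(3) ret by blast
  ultimately show ?thesis unfolding contains_standard_def using L(2) by blast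
qed

lemma contains_standard_flip:
  assumes H: "H \<subseteq> {g. det g = 1}" and good: "contains_standard (flip ` H)"
  shows "contains_standard H"
proof -
  obtain P Q L where L: "P ** Q = mat 1" "standard L"
    "(\<lambda>X. P ** X ** Q) ` L \<subseteq> flip ` H \<or> (\<lambda>X. P ** flip X ** Q) ` L \<subseteq> flip ` H"
    using good unfolding contains_standard_def by blast
  have one: "flip P ** flip Q = mat 1" using L(1) flip_mult flip_one by metis
  have Ld: "det X = 1" if "X \<in> L" for X
    using cds_standard[OF L(2)] that unfolding cds_iff by blast
  have ret: "flip P ** flip X ** flip Q \<in> H" if X: "P ** X ** Q \<in> flip ` H" for X
  proof -
    obtain Y where Y: "Y \<in> H" "P ** X ** Q = flip Y" using X by blast
    have "flip P ** flip X ** flip Q = flip (flip Y)" by (simp add: flip_mult[symmetric] Y(2))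
    also have "\<dots> = Y" using H Y(1) flip_flip by blast
    finally show ?thesis using Y(1) by simp
  qed
  have "(\<lambda>X. flip P ** X ** flip Q) ` L \<subseteq> H \<or> (\<lambda>X. flip P ** flip X ** flip Q) ` L \<subseteq> H"
    using L(3)
  proof
    assume "(\<lambda>X. P ** flip X ** Q) ` L \<subseteq> flip ` H"
    then have "flip P ** flip (flip X) ** flip Q \<in> H" if "X \<in> L" for X using ret that by blast
    then have "flip P ** X ** flip Q \<in> H" if "X \<in> L" for X using flip_flip[OF Ld[OF that]] that by metis
    then show ?thesis by blast
  qed (use ret in blast)
  then show ?thesis unfolding contains_standard_def using one L(2) by blast
qed

section \<open>Lie algebras of subgroups of \<open>SL(3,\<real>)\<close>\<close>

abbreviation cds :: "(real^3^3) set \<Rightarrow> bool"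
  where "cds \<equiv> cartan_decomposition_subgroup SL3"

lemma lie_mexp: "X \<in> lie H \<Longrightarrow> mexp (t *\<^sub>R X) \<in> H"
  by (simp add: lie_def)

lemma lie_mexp1: "X \<in> lie H \<Longrightarrow> mexp X \<in> H"
  using lie_mexp[of X H 1] by simp

lemma cds_mult: "cds H \<Longrightarrow> x \<in> H \<Longrightarrow> y \<in> H \<Longrightarrow> x ** y \<in> H"
  by (simp add: cds_iff matrix_subgroup_def)

lemma cds_subspace_lie: "cds H \<Longrightarrow> subspace (lie H)"
  by (simp add: cds_iff subspace_lie)

lemma lie_lincomb: "cds H \<Longrightarrow> X \<in> lie H \<Longrightarrow> Y \<in> lie H \<Longrightarrow> a *\<^sub>R X + b *\<^sub>R Y \<in> lie H"
  by (intro subspace_add subspace_scale cds_subspace_lie)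

lemma lie_scale: "cds H \<Longrightarrow> X \<in> lie H \<Longrightarrow> a *\<^sub>R X \<in> lie H"
  by (intro subspace_scale cds_subspace_lie)

lemma cds_lie_bracket: "cds H \<Longrightarrow> X \<in> lie H \<Longrightarrow> Y \<in> lie H \<Longrightarrow> X ** Y - Y ** X \<in> lie H"
  by (simp add: cds_iff lie_bracket)

lemma cds_det: "cds H \<Longrightarrow> h \<in> H \<Longrightarrow> det h = 1"
  by (auto simp: cds_iff)

lemma cds_subset: "cds H \<Longrightarrow> matrix_subgroup Q \<Longrightarrow> (\<And>X. X \<in> lie H \<Longrightarrow> mexp X \<in> Q) \<Longrightarrow> H \<subseteq> Q"
  by (rule connected_subset_if_lie_subset) (auto simp: cds_iff)

lemma has_real_derivative_nth:
  assumes "(g has_vector_derivative X) F"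
  shows "((\<lambda>t. (g t :: real^'n^'m) $ i $ j) has_real_derivative X $ i $ j) F"
proof -
  have "bounded_linear (\<lambda>Y :: real^'n^'m. Y $ i $ j)"
    using bounded_linear_compose[OF bounded_linear_vec_nth bounded_linear_vec_nth] .
  from bounded_linear.has_vector_derivative[OF this assms] show ?thesis
    by (simp add: has_real_derivative_iff_has_vector_derivative)
qed

text \<open>The determinant is constantly one along the one-parameter group, and its derivative at
  the identity is the trace.\<close>

lemma lie_trace:
  assumes H: "cds H" and X: "X \<in> lie H"
  shows "X $ 1 $ 1 + X $ 2 $ 2 + X $ 3 $ 3 = 0"
proof -
  let ?g = "\<lambda>t. mexp (t *\<^sub>R X)"
  have d: "((\<lambda>t. ?g t $ i $ j) has_real_derivative X $ i $ j) (at 0)" for i j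
    by (rule has_real_derivative_nth[OF mexp_has_vector_derivative_0])
  have e: "mexp (0 *\<^sub>R X) = m3 1 0 0 0 1 0 0 0 1" by (simp add: m3_one)
  have "((\<lambda>t. det (?g t)) has_real_derivative X $ 1 $ 1 + X $ 2 $ 2 + X $ 3 $ 3) (at 0)"
    unfolding det_3 by (rule derivative_eq_intros d refl | simp only: e m3_nth)+ simp
  moreover have "(\<lambda>t. det (?g t)) = (\<lambda>t. 1)" using cds_det[OF H lie_mexp[OF X]] by blast
  ultimately have "((\<lambda>t. 1 :: real) has_real_derivative X $ 1 $ 1 + X $ 2 $ 2 + X $ 3 $ 3) (at 0)" by simp
  then show ?thesis using DERIV_const DERIV_unique by blast
qed

section \<open>Closed formulas for the exponentials of normal forms\<close>

lemma mexp_diagonal: "mexp (t *\<^sub>R m3 a 0 0 0 b 0 0 0 c) = m3 (exp (a * t)) 0 0 0 (exp (b * t)) 0 0 0 (exp (c * t))"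
proof (rule one_parameter_group_eq_mexp)
  show "((\<lambda>t. m3 (exp (a * t)) 0 0 0 (exp (b * t)) 0 0 0 (exp (c * t))) has_vector_derivative m3 a 0 0 0 b 0 0 0 c) (at 0)"
    by (rule has_vector_derivative_m3; auto intro!: derivative_eq_intros)
qed (simp_all add: m3_one distrib_left exp_add)

lemma mexp_strictly_upper:
  "mexp (t *\<^sub>R m3 0 a b 0 0 c 0 0 0) = m3 1 (a * t) (b * t + a * c * t\<^sup>2 / 2) 0 1 (c * t) 0 0 1"
proof (rule one_parameter_group_eq_mexp)
  show "((\<lambda>t. m3 1 (a * t) (b * t + a * c * t\<^sup>2 / 2) 0 1 (c * t) 0 0 1) has_vector_derivative m3 0 a b 0 0 c 0 0 0) (at 0)"
    by (rule has_vector_derivative_m3; auto intro!: derivative_eq_intros)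
qed (simp_all add: m3_one algebra_simps power2_eq_square)

lemma mexp_rotation_scaling:
  "mexp (t *\<^sub>R m3 a b 0 (- b) a 0 0 0 c) = m3 (exp (a * t) * cos (b * t)) (exp (a * t) * sin (b * t)) 0
    (- (exp (a * t) * sin (b * t))) (exp (a * t) * cos (b * t)) 0 0 0 (exp (c * t))"
proof (rule one_parameter_group_eq_mexp)
  show "((\<lambda>t. m3 (exp (a * t) * cos (b * t)) (exp (a * t) * sin (b * t)) 0
      (- (exp (a * t) * sin (b * t))) (exp (a * t) * cos (b * t)) 0 0 0 (exp (c * t)))
    has_vector_derivative m3 a b 0 (- b) a 0 0 0 c) (at 0)"
    by (rule has_vector_derivative_m3; auto intro!: derivative_eq_intros)
  fix s t
  have e: "cos (b * (s + t)) = cos (b * s) * cos (b * t) - sin (b * s) * sin (b * t)"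
    "sin (b * (s + t)) = sin (b * s) * cos (b * t) + cos (b * s) * sin (b * t)"
    "exp (a * (s + t)) = exp (a * s) * exp (a * t)" "exp (c * (s + t)) = exp (c * s) * exp (c * t)"
    by (simp_all add: distrib_left cos_add sin_add exp_add)
  show "m3 (exp (a * (s + t)) * cos (b * (s + t))) (exp (a * (s + t)) * sin (b * (s + t))) 0
      (- (exp (a * (s + t)) * sin (b * (s + t)))) (exp (a * (s + t)) * cos (b * (s + t))) 0 0 0 (exp (c * (s + t))) =
    m3 (exp (a * s) * cos (b * s)) (exp (a * s) * sin (b * s)) 0
      (- (exp (a * s) * sin (b * s))) (exp (a * s) * cos (b * s)) 0 0 0 (exp (c * s)) **
    m3 (exp (a * t) * cos (b * t)) (exp (a * t) * sin (b * t)) 0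
      (- (exp (a * t) * sin (b * t))) (exp (a * t) * cos (b * t)) 0 0 0 (exp (c * t))"
    unfolding e by (simp add: algebra_simps)
qed (simp_all add: m3_one)

text \<open>The corner entry is z times a divided difference of exponentials at the eigenvalues a
  and -2a, which explains 3a; for a = 0 the strictly upper triangular formula takes over.\<close>

lemma mexp_jordan:
  assumes "a \<noteq> 0"
  shows "mexp (t *\<^sub>R m3 a a z 0 a 0 0 0 (- 2 * a)) = m3 (exp (a * t)) (a * t * exp (a * t))
    (z * (exp (a * t) - exp (- 2 * a * t)) / (3 * a)) 0 (exp (a * t)) 0 0 0 (exp (- 2 * a * t))"
proof (rule one_parameter_group_eq_mexp)
  have "z * (a * 1 - (- 2 * a) * 1) / (3 * a) = z" using assms by (simp add: field_simps)
  then show "((\<lambda>t. m3 (exp (a * t)) (a * t * exp (a * t))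
    (z * (exp (a * t) - exp (- 2 * a * t)) / (3 * a)) 0 (exp (a * t)) 0 0 0 (exp (- 2 * a * t)))
    has_vector_derivative m3 a a z 0 a 0 0 0 (- 2 * a)) (at 0)"
    by (intro has_vector_derivative_m3) (auto intro!: derivative_eq_intros simp: assms)
  fix s t
  have e: "exp (a * (s + t)) = exp (a * s) * exp (a * t)" "exp (- 2 * a * (s + t)) = exp (- 2 * a * s) * exp (- 2 * a * t)"
    by (simp_all only: distrib_left exp_add)
  show "m3 (exp (a * (s + t))) (a * (s + t) * exp (a * (s + t)))
    (z * (exp (a * (s + t)) - exp (- 2 * a * (s + t))) / (3 * a)) 0 (exp (a * (s + t))) 0 0 0 (exp (- 2 * a * (s + t))) =
    m3 (exp (a * s)) (a * s * exp (a * s)) (z * (exp (a * s) - exp (- 2 * a * s)) / (3 * a)) 0 (exp (a * s)) 0 0 0 (exp (- 2 * a * s)) **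
    m3 (exp (a * t)) (a * t * exp (a * t)) (z * (exp (a * t) - exp (- 2 * a * t)) / (3 * a)) 0 (exp (a * t)) 0 0 0 (exp (- 2 * a * t))"
    unfolding e by (simp add: algebra_simps add_divide_distrib diff_divide_distrib)
qed (simp_all add: m3_one)

lemma mexp_diagonal_corner:
  assumes "a \<noteq> c"
  shows "mexp (t *\<^sub>R m3 a 0 z 0 b 0 0 0 c) = m3 (exp (a * t)) 0 (z * (exp (a * t) - exp (c * t)) / (a - c))
    0 (exp (b * t)) 0 0 0 (exp (c * t))"
proof (rule one_parameter_group_eq_mexp)
  have "z * (a * 1 - c * 1) / (a - c) = z" using assms by simp
  then show "((\<lambda>t. m3 (exp (a * t)) 0 (z * (exp (a * t) - exp (c * t)) / (a - c)) 0 (exp (b * t)) 0 0 0 (exp (c * t)))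
    has_vector_derivative m3 a 0 z 0 b 0 0 0 c) (at 0)"
    by (intro has_vector_derivative_m3) (auto intro!: derivative_eq_intros simp: assms)
  fix s t
  show "m3 (exp (a * (s + t))) 0 (z * (exp (a * (s + t)) - exp (c * (s + t))) / (a - c)) 0 (exp (b * (s + t))) 0 0 0 (exp (c * (s + t))) =
    m3 (exp (a * s)) 0 (z * (exp (a * s) - exp (c * s)) / (a - c)) 0 (exp (b * s)) 0 0 0 (exp (c * s)) **
    m3 (exp (a * t)) 0 (z * (exp (a * t) - exp (c * t)) / (a - c)) 0 (exp (b * t)) 0 0 0 (exp (c * t))"
    unfolding distrib_left exp_add by (simp add: algebra_simps add_divide_distrib diff_divide_distrib)
qed (simp_all add: m3_one)

section \<open>Subgroups containing a listed subgroup\<close>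

lemma contains_diagonal:
  assumes "\<And>a b. m3 a 0 0 0 b 0 0 0 (- a - b) \<in> lie H"
  shows "contains_standard H"
proof (rule contains_standardI[of positive_diagonal_subgroup])
  show "positive_diagonal_subgroup \<subseteq> H"
  proof
    fix g assume "g \<in> positive_diagonal_subgroup"
    then obtain a b c where g: "g = m3 a 0 0 0 b 0 0 0 c" "a > 0" "b > 0" "c > 0" "a * b * c = 1"
      unfolding positive_diagonal_subgroup_eq by blast
    have "exp (- ln a - ln b) = c" using g by (simp add: exp_diff exp_minus field_simps)
    then have "g = mexp (1 *\<^sub>R m3 (ln a) 0 0 0 (ln b) 0 0 0 (- ln a - ln b))"
      unfolding mexp_diagonal using g by simp
    then show "g \<in> H" using lie_mexp[OF assms] by metis
  qed
qed (simp add: standard_def)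

lemma contains_unipotent:
  assumes H: "cds H" and X: "m3 0 1 0 0 0 1 0 0 0 \<in> lie H" "m3 0 0 1 0 0 0 0 0 0 \<in> lie H"
  shows "contains_standard H"
proof (rule contains_standardI[of unipotent_subgroup])
  show "unipotent_subgroup \<subseteq> H"
  proof
    fix g assume "g \<in> unipotent_subgroup"
    then obtain r s where g: "g = m3 1 r s 0 1 r 0 0 1" by (auto simp: unipotent_subgroup_def)
    \<comment> \<open>The shift by r^2/2 cancels the quadratic term of the exponential.\<close>
    have "m3 0 r (s - r\<^sup>2 / 2) 0 0 r 0 0 0 \<in> lie H"
      using lie_lincomb[OF H X, of r "s - r\<^sup>2 / 2"] by simp
    moreover have "g = mexp (1 *\<^sub>R m3 0 r (s - r\<^sup>2 / 2) 0 0 r 0 0 0)"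
      unfolding mexp_strictly_upper g by (simp add: power2_eq_square)
    ultimately show "g \<in> H" using lie_mexp by metis
  qed
qed (simp add: standard_def)

lemma translation_mem:
  assumes H: "cds H" and X: "m3 0 0 1 0 0 0 0 0 0 \<in> lie H" "m3 0 0 0 0 0 1 0 0 0 \<in> lie H"
  shows "m3 1 0 x 0 1 y 0 0 1 \<in> H"
proof -
  have "m3 0 0 x 0 0 y 0 0 0 \<in> lie H" using lie_lincomb[OF H X, of x y] by simp
  from lie_mexp[OF this, of 1] show ?thesis unfolding mexp_strictly_upper by simp
qed

lemma contains_jordan:
  assumes H: "cds H" and X: "m3 0 0 1 0 0 0 0 0 0 \<in> lie H" "m3 0 0 0 0 0 1 0 0 0 \<in> lie H"
    and T: "m3 1 1 0 0 1 0 0 0 (- 2) \<in> lie H"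
  shows "contains_standard H"
proof (rule contains_standardI[of jordan_subgroup])
  show "jordan_subgroup \<subseteq> H"
  proof
    fix g assume "g \<in> jordan_subgroup"
    then obtain t r s where g: "g = m3 (exp t) (t * exp t) s 0 (exp t) r 0 0 (exp (- 2 * t))"
      by (auto simp: jordan_subgroup_def)
    have e: "exp t * exp (- t) = 1" by (simp add: exp_add[symmetric])
    have "m3 (exp t) (t * exp t) 0 0 (exp t) 0 0 0 (exp (- 2 * t)) \<in> H"
      using lie_mexp[OF T, of t] mexp_jordan[of 1 t 0] by simp
    \<comment> \<open>g factors as its block-diagonal part times a translation, whose entries are
      the inverse of the block applied to the column (s, r).\<close>
    from cds_mult[OF H this translation_mem[OF H X, of "exp (- t) * (s - t * r)" "exp (- t) * r"]]
    show "g \<in> H" unfolding g using e by (simp add: mult.assoc[symmetric]) (simp add: algebra_simps)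
  qed
qed (simp add: standard_def)

lemma contains_spiral:
  assumes H: "cds H" and X: "m3 0 0 1 0 0 0 0 0 0 \<in> lie H" "m3 0 0 0 0 0 1 0 0 0 \<in> lie H"
    and T: "m3 1 p 0 (- p) 1 0 0 0 (- 2) \<in> lie H" and p: "p \<noteq> 0"
  shows "contains_standard H"
proof (rule contains_standardI[of "spiral_subgroup p"])
  show "spiral_subgroup p \<subseteq> H"
  proof
    fix g assume "g \<in> spiral_subgroup p"
    then obtain t r s where g: "g = m3 (exp t * cos (p * t)) (exp t * sin (p * t)) s
        (- (exp t * sin (p * t))) (exp t * cos (p * t)) r 0 0 (exp (- 2 * t))"
      by (auto simp: spiral_subgroup_def)
    define u v where "u = cos (p * t)" and "v = sin (p * t)"
    have uv: "u * u + v * v = 1" unfolding u_def v_def using sin_cos_squared_add3[of "p * t"] by (simp add: power2_eq_square)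
    have e: "exp t * exp (- t) = 1" by (simp add: exp_add[symmetric])
    have 1: "m3 (exp t * u) (exp t * v) 0 (- (exp t * v)) (exp t * u) 0 0 0 (exp (- 2 * t)) \<in> H"
      using lie_mexp[OF T, of t] mexp_rotation_scaling[of t 1 p "-2"] by (simp add: u_def v_def)
    have 2: "exp t * u * (exp (- t) * (u * s - v * r)) + exp t * v * (exp (- t) * (v * s + u * r)) = s"
      "- (exp t * v) * (exp (- t) * (u * s - v * r)) + exp t * u * (exp (- t) * (v * s + u * r)) = r"
      using e uv by algebra+
    from cds_mult[OF H 1 translation_mem[OF H X, of "exp (- t) * (u * s - v * r)" "exp (- t) * (v * s + u * r)"]]
    show "g \<in> H" unfolding g u_def[symmetric] v_def[symmetric] using 2 by simp
  qed
qed (use p in \<open>auto simp: standard_def\<close>)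

lemma contains_root_normalized:
  assumes H: "cds H" and pq: "max p q = 1" "min p q \<ge> - 1 / 2"
    and X: "m3 p 0 0 0 q 0 0 0 (- (p + q)) \<in> lie H" "m3 0 1 0 0 0 0 0 0 0 \<in> lie H"
  shows "contains_standard H"
proof (rule contains_standardI[of "diagonal_root_subgroup p q"])
  show "diagonal_root_subgroup p q \<subseteq> H"
  proof
    fix g assume "g \<in> diagonal_root_subgroup p q"
    then obtain t r where g: "g = m3 (exp (p * t)) r 0 0 (exp (q * t)) 0 0 0 (exp (- (p + q) * t))"
      by (auto simp: diagonal_root_subgroup_def)
    have "m3 (exp (p * t)) 0 0 0 (exp (q * t)) 0 0 0 (exp (- (p + q) * t)) \<in> H"
      using lie_mexp[OF X(1), of t] unfolding mexp_diagonal by simp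
    moreover have "m3 1 (exp (- p * t) * r) 0 0 1 0 0 0 1 \<in> H"
      using lie_mexp[OF X(2), of "exp (- p * t) * r"] mexp_strictly_upper[of "exp (- p * t) * r" 1 0 0] by simp
    ultimately have "m3 (exp (p * t)) 0 0 0 (exp (q * t)) 0 0 0 (exp (- (p + q) * t)) ** m3 1 (exp (- p * t) * r) 0 0 1 0 0 0 1 \<in> H"
      by (rule cds_mult[OF H])
    moreover have "exp (p * t) * (exp (- p * t) * r) = r"
      by (simp add: mult.assoc[symmetric] exp_add[symmetric])
    then have "m3 (exp (p * t)) 0 0 0 (exp (q * t)) 0 0 0 (exp (- (p + q) * t)) ** m3 1 (exp (- p * t) * r) 0 0 1 0 0 0 1 = g"
      unfolding g m3_mult m3_eq_iff by auto
    ultimately show "g \<in> H" by simp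
  qed
qed (use pq in \<open>auto simp: standard_def\<close>)

text \<open>Changing the sign, one may assume p + q >= 0. As r is not strictly between p and q, it
  is at most both of them, which reads min >= -max/2; dividing by the maximum gives the listed
  parameters.\<close>

lemma contains_root:
  assumes H: "cds H" and pq: "p \<noteq> 0 \<or> q \<noteq> 0" "\<not> (p < r \<and> r < q)" "\<not> (q < r \<and> r < p)" "p + q + r = 0"
    and X: "m3 p 0 0 0 q 0 0 0 r \<in> lie H" "m3 0 1 0 0 0 0 0 0 0 \<in> lie H"
  shows "contains_standard H"
proof -
  have "contains_standard H" if pq: "p \<noteq> 0 \<or> q \<noteq> 0" "\<not> (p < r \<and> r < q)" "\<not> (q < r \<and> r < p)" "p + q + r = 0" "p + q \<ge> 0"
    and X: "m3 p 0 0 0 q 0 0 0 r \<in> lie H" for p q r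
  proof -
    define M where "M = max p q"
    have M: "M > 0" using pq by (auto simp: M_def max_def)
    have m: "max (p / M) (q / M) = 1" "min (p / M) (q / M) \<ge> - 1 / 2"
    proof -
      have "p / M \<le> 1" "q / M \<le> 1" "p / M = 1 \<or> q / M = 1"
        using M by (auto simp: M_def max_def)
      then show "max (p / M) (q / M) = 1" by (auto simp: max_def)
      have "min p q \<ge> - M / 2" using pq by (auto simp: M_def max_def min_def split: if_splits)
      then have "p / M \<ge> - 1 / 2" "q / M \<ge> - 1 / 2" using M by (auto simp: field_simps)
      then show "min (p / M) (q / M) \<ge> - 1 / 2" by simp
    qed
    have "r = - (p + q)" using pq by simp
    then have "(1 / M) *\<^sub>R m3 p 0 0 0 q 0 0 0 r = m3 (p / M) 0 0 0 (q / M) 0 0 0 (- (p / M + q / M))"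
      by (simp add: add_divide_distrib diff_divide_distrib)
    then show ?thesis using contains_root_normalized[OF H m _ \<open>m3 0 1 0 0 0 0 0 0 0 \<in> lie H\<close>] lie_scale[OF H X, of "1 / M"] by simp
  qed
  note * = this
  show ?thesis
  proof (cases "p + q \<ge> 0")
    case True
    then show ?thesis using * pq X by blast
  next
    case False
    have "m3 (- p) 0 0 0 (- q) 0 0 0 (- r) \<in> lie H" using lie_scale[OF H X(1), of "-1"] by simp
    then show ?thesis using *[of "- p" "- q" "- r"] pq False by auto
  qed
qed

section \<open>Subgroups that miss part of the Weyl chamber\<close>

lemma not_cds_balanced:
  assumes "\<And>h. h \<in> H \<Longrightarrow> N (adj h) \<le> C * N h"
  shows "\<not> cds H"
  by (rule not_cds_wall) (use assms in blast)

lemma matrix_subgroup_SL3_Int: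
  assumes "mat 1 \<in> S" "\<And>x y. x \<in> S \<Longrightarrow> y \<in> S \<Longrightarrow> x ** y \<in> S"
    and "\<And>x. det x = 1 \<Longrightarrow> x \<in> S \<Longrightarrow> adj x \<in> S"
  shows "matrix_subgroup ({g :: real^3^3. det g = 1} \<inter> S)"
  by (rule matrix_subgroupI) (use assms in \<open>auto simp: det_mul det_adj\<close>)

text \<open>For a planar block of determinant one the inverse has the same entries up to order and
  sign, so the two norms agree and the wall is missed.\<close>

lemma not_cds_sl2:
  assumes H: "cds H" and lie: "\<And>X. X \<in> lie H \<Longrightarrow> X$1$3 = 0 \<and> X$2$3 = 0 \<and> X$3$1 = 0 \<and> X$3$2 = 0 \<and> X$3$3 = 0"
  shows False
proof -
  let ?S = "{g :: real^3^3. g$1$3 = 0 \<and> g$2$3 = 0 \<and> g$3$1 = 0 \<and> g$3$2 = 0 \<and> g$3$3 = 1}"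
  let ?Q = "{g. det g = 1} \<inter> ?S"
  have cl: "closed ?S" by (intro closed_Collect_conj closed_Collect_eq continuous_intros)
  have "H \<subseteq> ?Q"
  proof (rule cds_subset[OF H])
    show "matrix_subgroup ?Q"
      by (rule matrix_subgroup_SL3_Int, simp add: mat_def, force simp: matrix3_mult_nth)
        (subst m3_collapse[symmetric], auto simp: det_3)
    fix X assume X: "X \<in> lie H"
    have "mexp (1 *\<^sub>R X) \<in> ?S"
      by (rule mexp_in_closed_semigroup_line[OF cl]) (use lie[OF X] in \<open>auto simp: matrix3_mult_nth mat_def\<close>)
    then show "mexp X \<in> ?Q" using cds_det[OF H lie_mexp1[OF X]] by simp
  qed
  moreover have "N (adj h) \<le> 1 * N h" if "h \<in> ?Q" for h
    using that by (cases h rule: m3_cases) auto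
  ultimately show False using not_cds_balanced[of H 1] H by blast
qed

text \<open>Motions of the plane: the rotation part has entries of absolute value at most one, and
  inversion only rotates the translation part up to sign, so the norm of the inverse is bounded by a
  multiple of the norm.\<close>

lemma not_cds_euclidean:
  assumes H: "cds H" and lie: "\<And>X. X \<in> lie H \<Longrightarrow> X$1$1 = 0 \<and> X$2$2 = 0 \<and> X$1$2 = - X$2$1 \<and> X$3$1 = 0 \<and> X$3$2 = 0 \<and> X$3$3 = 0"
  shows False
proof -
  let ?S = "{g :: real^3^3. g$1$1 = g$2$2 \<and> g$1$2 = - g$2$1 \<and> g$3$1 = 0 \<and> g$3$2 = 0 \<and> g$3$3 = 1}"
  let ?Q = "{g. det g = 1} \<inter> ?S"
  have cl: "closed ?S" by (intro closed_Collect_conj closed_Collect_eq continuous_intros)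
  have "H \<subseteq> ?Q"
  proof (rule cds_subset[OF H])
    show "matrix_subgroup ?Q"
      by (rule matrix_subgroup_SL3_Int, simp add: mat_def, force simp: matrix3_mult_nth)
        (subst m3_collapse[symmetric], auto simp: det_3)
    fix X assume X: "X \<in> lie H"
    have "mexp (1 *\<^sub>R X) \<in> ?S"
      by (rule mexp_in_closed_semigroup_line[OF cl]) (use lie[OF X] in \<open>auto simp: matrix3_mult_nth mat_def\<close>)
    then show "mexp X \<in> ?Q" using cds_det[OF H lie_mexp1[OF X]] by simp
  qed
  moreover have "N (adj h) \<le> 3 * N h" if h: "h \<in> ?Q" for h
  proof (cases h rule: m3_cases)
    case (1 a b c d e f g k l)
    then have e: "h = m3 a b c (- b) a f 0 0 1" "a * a + b * b = 1" using h by (auto simp: 1)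
    have "a * a \<le> 1" "b * b \<le> 1" using e(2) zero_le_square[of a] zero_le_square[of b] by linarith+
    then have "\<bar>a\<bar> \<le> 1" "\<bar>b\<bar> \<le> 1" by (auto simp: abs_square_le_1[symmetric] power2_eq_square)
    then have "\<bar>b * f\<bar> \<le> \<bar>f\<bar>" "\<bar>a * f\<bar> \<le> \<bar>f\<bar>" "\<bar>b * c\<bar> \<le> \<bar>c\<bar>" "\<bar>a * c\<bar> \<le> \<bar>c\<bar>"
      by (simp_all add: abs_mult mult_left_le_one_le)
    moreover have "\<bar>b * f - c * a\<bar> \<le> \<bar>b * f\<bar> + \<bar>a * c\<bar>" "\<bar>- (c * b) - a * f\<bar> \<le> \<bar>b * c\<bar> + \<bar>a * f\<bar>"
      by (simp_all add: mult.commute)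
    moreover have "adj h = m3 a (- b) (b * f - c * a) b a (- (c * b) - a * f) 0 0 1" using e by simp
    then have "N (adj h) = 2 * \<bar>a\<bar> + 2 * \<bar>b\<bar> + \<bar>b * f - c * a\<bar> + \<bar>- (c * b) - a * f\<bar> + 1"
      by simp
    ultimately have "N (adj h) \<le> 3 * (\<bar>a\<bar> + \<bar>b\<bar> + \<bar>c\<bar> + \<bar>f\<bar> + 1)"
      using abs_ge_zero[of a] abs_ge_zero[of b] by argo
    also have "\<dots> \<le> 3 * N h" unfolding e(1) by simp
    finally show ?thesis .
  qed
  ultimately show False using not_cds_balanced[of H 3] H by blast
qed

text \<open>With block determinant m the singular values are sqrt m twice and 1/m, so every element
  lies close to a wall, to one of them for m >= 1 and to the other for m < 1; the middle of the
  chamber is missed.\<close>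

lemma not_cds_scaled_rotations:
  assumes H: "cds H" and lie: "\<And>X. X \<in> lie H \<Longrightarrow> X$1$1 = X$2$2 \<and> X$1$2 = - X$2$1 \<and> X$3$1 = 0 \<and> X$3$2 = 0 \<and> X$1$3 = 0 \<and> X$2$3 = 0"
  shows False
proof -
  let ?S = "{g :: real^3^3. g$1$1 = g$2$2 \<and> g$1$2 = - g$2$1 \<and> g$3$1 = 0 \<and> g$3$2 = 0 \<and> g$1$3 = 0 \<and> g$2$3 = 0}"
  let ?Q = "{g. det g = 1} \<inter> ?S"
  have cl: "closed ?S" by (intro closed_Collect_conj closed_Collect_eq continuous_intros)
  have "H \<subseteq> ?Q"
  proof (rule cds_subset[OF H])
    show "matrix_subgroup ?Q"
      by (rule matrix_subgroup_SL3_Int, simp add: mat_def, force simp: matrix3_mult_nth)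
        (subst m3_collapse[symmetric], auto simp: det_3)
    fix X assume X: "X \<in> lie H"
    have "mexp (1 *\<^sub>R X) \<in> ?S"
      by (rule mexp_in_closed_semigroup_line[OF cl]) (use lie[OF X] in \<open>auto simp: matrix3_mult_nth mat_def\<close>)
    then show "mexp X \<in> ?Q" using cds_det[OF H lie_mexp1[OF X]] by simp
  qed
  moreover have "(N h)\<^sup>2 \<le> 50 * N (adj h) \<or> (N (adj h))\<^sup>2 \<le> 50 * N h" if h: "h \<in> ?Q" for h
  proof (cases h rule: m3_cases)
    case (1 a b c d e f g k l)
    define m where "m = a * a + b * b"
    have e: "h = m3 a b 0 (- b) a 0 0 0 l" "m * l = 1" using h by (auto simp: 1 m_def algebra_simps)
    have "m \<ge> 0" by (simp add: m_def)
    then have m: "m > 0" using e(2) by (cases "m = 0") auto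
    then have l: "l = 1 / m" using e(2) by (simp add: field_simps)
    have l0: "l > 0" using m unfolding l by simp
    note l = l l0
    define n where "n = \<bar>a\<bar> + \<bar>b\<bar>"
    have nm: "n * n \<le> 2 * m" "m \<le> n * n"
    proof -
      have "n * n = m + 2 * \<bar>a * b\<bar>" by (simp add: n_def m_def algebra_simps abs_mult)
      moreover have "0 \<le> (\<bar>a\<bar> - \<bar>b\<bar>) * (\<bar>a\<bar> - \<bar>b\<bar>)" by simp
      then have "2 * \<bar>a * b\<bar> \<le> m" by (simp add: m_def algebra_simps abs_mult)
      ultimately show "n * n \<le> 2 * m" "m \<le> n * n" by simp_all
    qed
    have n0: "n \<ge> 0" by (simp add: n_def)
    have Nh: "N h = 2 * n + l" using l by (simp add: e n_def)
    have Na: "N (adj h) = 2 * n * l + m"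
    proof -
      have "adj h = m3 (a * l) (- b * l) 0 (b * l) (a * l) 0 0 0 m" by (simp add: e(1) m_def)
      then show ?thesis using l m by (simp add: n_def abs_mult algebra_simps)
    qed
    show ?thesis
    proof (cases "m \<ge> 1")
      case True
      then have "l \<le> 1" using l by simp
      then have "l * l \<le> 1 * 1" "l * n \<le> 1 * n" using l n0 by (intro mult_mono; simp)+
      moreover have "n \<le> 2 * m"
      proof (cases "n \<le> 1")
        case False
        then have "1 * n \<le> n * n" by (intro mult_right_mono) auto
          then show ?thesis using nm(1) by linarith
      qed (use True in simp)
      ultimately have "(N h)\<^sup>2 \<le> 50 * m" using nm True unfolding Nh by (simp add: power2_eq_square algebra_simps)
      also have "\<dots> \<le> 50 * N (adj h)" unfolding Na using n0 l by simp
      finally show ?thesis ..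
    next
      case False
      then have n2: "n * n \<le> 2" using nm by simp
      have n1: "n \<le> 2"
      proof (rule ccontr)
        assume "\<not> n \<le> 2"
        then have "2 * 2 < n * n" by (intro mult_strict_mono) auto
        then show False using n2 by simp
      qed
      have l1: "l \<ge> 1" using l m False by simp
      have ml: "m * m \<le> 1 * 1" using m False by (intro mult_mono) auto
      have "n * n * l * l \<le> 2 * m * l * l" using nm l by (intro mult_right_mono) auto
      also have "\<dots> = 2 * l" using e(2) by simp
      finally have a1: "n * n * l * l \<le> 2 * l" .
      have a2: "n * l * m = n" using e(2) by (simp add: mult.commute mult.left_commute)
      have "(N (adj h))\<^sup>2 = 4 * (n * n * l * l) + 4 * (n * l * m) + m * m" unfolding Na by (simp add: power2_eq_square algebra_simps)
      also have "\<dots> \<le> 8 * l + 8 + 1" using a1 n1 ml unfolding a2 by linarith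
      also have "\<dots> \<le> 50 * N h" unfolding Nh using l1 n0 by simp
      finally show ?thesis ..
    qed
  qed
  ultimately show False using not_cds_middle[of H 50] H by blast
qed

lemma flip_mexp:
  assumes "det (mexp X) = 1"
  shows "flip (mexp X) = mexp (flip_lie X)"
proof -
  have "adj (mexp X) = mexp (- X)" using adj_unique[OF assms] mexp_minus(1) by metis
  then have "flip (mexp X) = rev_perm ** mexp (- transpose X) ** rev_perm"
    by (simp add: flip_def mexp_transpose)
  also have "\<dots> = mexp (flip_lie X)"
    unfolding flip_lie_def by (rule mexp_conj[OF rev_perm_sq, symmetric])
  finally show ?thesis .
qed

text \<open>The fixed points of \<open>flip\<close> followed by conjugation with \<open>D\<close>
  are isometries of an indefinite quadratic form. There the element arises from its inverse by
  transposition, permutation and sign changes, so the two norms agree.\<close>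

lemma not_cds_so21:
  assumes H: "cds H" and lie: "\<And>X. X \<in> lie H \<Longrightarrow> \<exists>a b. X = m3 a b 0 0 0 b 0 0 (- a)"
  shows False
proof -
  define D where "D = m3 1 0 0 0 (- 1) 0 0 0 (1 :: real)"
  have DD: "D ** D = mat 1" by (simp add: D_def m3_one)
  let ?S = "{g. D ** flip g ** D = g}"
  have m: "D ** flip (x ** y) ** D = (D ** flip x ** D) ** (D ** flip y ** D)" for x y
  proof -
    have "(D ** flip x ** D) ** (D ** flip y ** D) = D ** flip x ** (D ** D) ** flip y ** D"
      by (simp only: matrix_mul_assoc)
    then show ?thesis unfolding DD by (simp add: flip_mult matrix_mul_assoc)
  qed
  have one: "D ** flip (mat 1) ** D = mat 1" by (simp add: flip_one DD)
  have "H \<subseteq> {g. det g = 1} \<inter> ?S"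
  proof (rule cds_subset[OF H])
    show "matrix_subgroup ({g. det g = 1} \<inter> ?S)"
    proof (rule matrix_subgroup_SL3_Int)
      fix x assume x: "det x = 1" "x \<in> ?S"
      have "(D ** flip x ** D) ** (D ** flip (adj x) ** D) = mat 1"
        unfolding m[symmetric] adj_right[OF x(1)] by (rule one)
      moreover have "D ** flip x ** D = x" using x(2) by simp
      ultimately have "x ** (D ** flip (adj x) ** D) = mat 1" by simp
      from adj_unique[OF x(1) this] show "adj x \<in> ?S" by simp
    qed (use m one in auto)
    fix X assume X: "X \<in> lie H"
    have d: "det (mexp X) = 1" using cds_det[OF H lie_mexp1[OF X]] .
    obtain a b where "X = m3 a b 0 0 0 b 0 0 (- a)" using lie[OF X] by blast
    then have "D ** flip_lie X ** D = X" by (simp add: D_def)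
    then have "D ** flip (mexp X) ** D = mexp X"
      unfolding flip_mexp[OF d] using mexp_conj[OF DD, of "flip_lie X"] by simp
    then show "mexp X \<in> {g. det g = 1} \<inter> ?S" using d by simp
  qed
  moreover have "N (adj h) \<le> 1 * N h" if h: "h \<in> ?S" for h
  proof -
    have n: "N (D ** Y ** D) = N Y" "N (rev_perm ** transpose Y ** rev_perm) = N Y" for Y
      by (cases Y rule: m3_cases, simp add: D_def rev_perm_def)+
    have "N h = N (D ** flip h ** D)" using h by simp
    also have "\<dots> = N (adj h)" unfolding n(1) flip_def n(2) ..
    finally show ?thesis by simp
  qed
  ultimately show False using not_cds_balanced[of H 1] H by blast
qed

text \<open>The root space joins the largest and the smallest eigenvalue. Every term of N(h^(-1))
  falls short of (N h)^2 by a factor exp(delta |t|), delta being the smaller gap between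
  neighbouring eigenvalues. Elements near the wall therefore have bounded t, and for these N(h^(-1))
  is at most a multiple of N h.\<close>

lemma not_cds_middle_root:
  assumes H: "cds H" and d: "d1 > d2" "d2 > d3" "d1 + d2 + d3 = 0"
    and lie: "\<And>X. X \<in> lie H \<Longrightarrow> \<exists>t z. X = m3 (d1 * t) 0 z 0 (d2 * t) 0 0 0 (d3 * t)"
  shows False
proof -
  let ?Q = "{m3 (exp (d1 * t)) 0 z 0 (exp (d2 * t)) 0 0 0 (exp (d3 * t)) | t z. True}"
  have e1: "exp (d1 * t) * exp (d2 * t) = exp (- d3 * t)" "exp (d2 * t) * exp (d3 * t) = exp (- d1 * t)"
    "exp (d1 * t) * exp (d3 * t) = exp (- d2 * t)" for t
  proof -
    have "(d1 + d2 + d3) * t = 0" using d by simp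
    then have "d1 * t + d2 * t + d3 * t = 0" unfolding distrib_right .
    then show "exp (d1 * t) * exp (d2 * t) = exp (- d3 * t)" "exp (d2 * t) * exp (d3 * t) = exp (- d1 * t)"
      "exp (d1 * t) * exp (d3 * t) = exp (- d2 * t)"
      unfolding exp_add[symmetric] mult_minus_left by (intro arg_cong[of _ _ exp]; linarith)+
  qed
  have adjm: "adj (m3 (exp (d1 * t)) 0 z 0 (exp (d2 * t)) 0 0 0 (exp (d3 * t))) =
    m3 (exp (- d1 * t)) 0 (- (z * exp (d2 * t))) 0 (exp (- d2 * t)) 0 0 0 (exp (- d3 * t))" for t z
    using e1[of t] by simp
  have sub: "H \<subseteq> ?Q"
  proof (rule cds_subset[OF H])
    have mem: "m3 (exp (d1 * t)) 0 z 0 (exp (d2 * t)) 0 0 0 (exp (d3 * t)) \<in> ?Q" for t z by blast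
    show "matrix_subgroup ?Q"
    proof (rule matrix_subgroupI)
      show "mat 1 \<in> ?Q" using mem[of 0 0] by (simp add: m3_one)
      fix x assume "x \<in> ?Q"
      then obtain t z where x: "x = m3 (exp (d1 * t)) 0 z 0 (exp (d2 * t)) 0 0 0 (exp (d3 * t))" by blast
      have "exp (d1 * t) * exp (d2 * t) * exp (d3 * t) = 1"
        unfolding e1(1) by (simp add: exp_add[symmetric])
      then have "det x = 1" by (simp add: x)
      moreover have "adj x \<in> ?Q" unfolding x adjm using mem[of "- t" "- (z * exp (d2 * t))"] by simp
      ultimately show "det x = 1 \<and> adj x \<in> ?Q" ..
      fix y assume "y \<in> ?Q"
      then obtain t' z' where y: "y = m3 (exp (d1 * t')) 0 z' 0 (exp (d2 * t')) 0 0 0 (exp (d3 * t'))" by blast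
      show "x ** y \<in> ?Q"
        using mem[of "t + t'" "exp (d1 * t) * z' + z * exp (d3 * t')"] by (simp add: x y distrib_left exp_add)
    qed
    fix X assume "X \<in> lie H"
    then obtain t z where X: "X = m3 (d1 * t) 0 z 0 (d2 * t) 0 0 0 (d3 * t)" using lie by blast
    show "mexp X \<in> ?Q"
    proof (cases "t = 0")
      case True
      then have "mexp X = m3 1 0 z 0 1 0 0 0 1" using mexp_strictly_upper[of 1 0 z 0] by (simp add: X)
      then show ?thesis using mem[of 0 z] by simp
    next
      case False
      then have "d1 * t \<noteq> d3 * t" using d by simp
      from mexp_diagonal_corner[OF this, of 1 z "d2 * t"] show ?thesis unfolding X using mem by simp
    qed
  qed
  define \<delta> where "\<delta> = min (d1 - d2) (d2 - d3)"
  have \<delta>: "\<delta> > 0" "\<delta> \<le> d1 - d2" "\<delta> \<le> d2 - d3" using d by (auto simp: \<delta>_def)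
  have "\<exists>C. \<forall>h\<in>H. (N h)\<^sup>2 \<le> R * N (adj h) \<longrightarrow> N (adj h) \<le> C * N h" if R: "R \<ge> 1" for R
  proof -
    define M where "M = ln (4 * R) / \<delta>"
    define K where "K = \<bar>d1\<bar> + \<bar>d2\<bar> + \<bar>d3\<bar>"
    define E where "E = exp (K * M)"
    show ?thesis
    proof (intro exI[of _ "4 * E"] ballI impI)
      fix h assume h: "h \<in> H" "(N h)\<^sup>2 \<le> R * N (adj h)"
      obtain t z where e: "h = m3 (exp (d1 * t)) 0 z 0 (exp (d2 * t)) 0 0 0 (exp (d3 * t))" using h(1) sub by blast
      have Nh: "N h = exp (d1 * t) + \<bar>z\<bar> + exp (d2 * t) + exp (d3 * t)" by (simp add: e)
      have Na: "N (adj h) = exp (- d1 * t) + \<bar>z\<bar> * exp (d2 * t) + exp (- d2 * t) + exp (- d3 * t)"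
        unfolding e adjm by (simp add: abs_mult)
      have Nb: "exp (d1 * t) \<le> N h" "exp (d3 * t) \<le> N h" "\<bar>z\<bar> \<le> N h" "0 \<le> N h"
        unfolding Nh by (simp_all add: add_increasing add_increasing2)
      have key: "exp (\<delta> * \<bar>t\<bar>) * N (adj h) \<le> 4 * (N h)\<^sup>2 \<and> 1 \<le> N h"
      proof -
        \<comment> \<open>The exponent of the diagonal entry at the end of the spectrum singled out
          by the sign of t.\<close>
        define w where "w = (if t \<ge> 0 then d1 * t else d3 * t)"
        have w: "exp w \<le> N h" using Nb by (simp add: w_def)
        have d13: "d1 > 0" "d3 < 0" using d by auto
        have w0: "w \<ge> 0" using d13 by (auto simp: w_def mult_nonpos_nonpos)
        have "exp w \<ge> 1" using w0 by simp
        then have "1 \<le> N h" using w by linarith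
        have ww: "\<delta> * \<bar>t\<bar> + d2 * t \<le> w" "\<delta> * \<bar>t\<bar> - d1 * t \<le> 2 * w" "\<delta> * \<bar>t\<bar> - d2 * t \<le> 2 * w" "\<delta> * \<bar>t\<bar> - d3 * t \<le> 2 * w"
        proof -
          have "\<delta> * \<bar>t\<bar> + d2 * t \<le> w \<and> \<delta> * \<bar>t\<bar> - d1 * t \<le> 2 * w \<and> \<delta> * \<bar>t\<bar> - d2 * t \<le> 2 * w \<and> \<delta> * \<bar>t\<bar> - d3 * t \<le> 2 * w"
          proof (cases "t \<ge> 0")
            case True
            have "(\<delta> + d2) * t \<le> d1 * t" "(\<delta> - d1) * t \<le> (2 * d1) * t" "(\<delta> - d2) * t \<le> (2 * d1) * t" "(\<delta> - d3) * t \<le> (2 * d1) * t"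
              using True \<delta> d by (intro mult_right_mono; linarith)+
            then show ?thesis using True by (simp add: w_def algebra_simps)
          next
            case False
            have "(\<delta> - d2) * (- t) \<le> (- d3) * (- t)" "(\<delta> + d1) * (- t) \<le> (- 2 * d3) * (- t)"
              "(\<delta> + d2) * (- t) \<le> (- 2 * d3) * (- t)" "(\<delta> + d3) * (- t) \<le> (- 2 * d3) * (- t)"
              using False \<delta> d by (intro mult_right_mono; linarith)+
            then show ?thesis using False by (simp add: w_def algebra_simps)
          qed
          then show "\<delta> * \<bar>t\<bar> + d2 * t \<le> w" "\<delta> * \<bar>t\<bar> - d1 * t \<le> 2 * w" "\<delta> * \<bar>t\<bar> - d2 * t \<le> 2 * w" "\<delta> * \<bar>t\<bar> - d3 * t \<le> 2 * w" by blast+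
        qed
        have sq: "exp (2 * w) \<le> (N h)\<^sup>2" unfolding exp_double using w by (intro power_mono) auto
        have "exp (\<delta> * \<bar>t\<bar> - d1 * t) \<le> (N h)\<^sup>2" "exp (\<delta> * \<bar>t\<bar> - d2 * t) \<le> (N h)\<^sup>2" "exp (\<delta> * \<bar>t\<bar> - d3 * t) \<le> (N h)\<^sup>2"
          using ww sq by (auto intro: order_trans[of _ "exp (2 * w)"])
        moreover have "\<bar>z\<bar> * exp (\<delta> * \<bar>t\<bar> + d2 * t) \<le> (N h)\<^sup>2"
        proof -
          have "exp (\<delta> * \<bar>t\<bar> + d2 * t) \<le> N h" using ww(1) w by (auto intro: order_trans[of _ "exp w"])
          then have "\<bar>z\<bar> * exp (\<delta> * \<bar>t\<bar> + d2 * t) \<le> N h * N h" using Nb by (intro mult_mono) auto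
          then show ?thesis by (simp add: power2_eq_square)
        qed
        moreover have "exp (\<delta> * \<bar>t\<bar>) * N (adj h) = exp (\<delta> * \<bar>t\<bar> - d1 * t) + \<bar>z\<bar> * exp (\<delta> * \<bar>t\<bar> + d2 * t)
            + exp (\<delta> * \<bar>t\<bar> - d2 * t) + exp (\<delta> * \<bar>t\<bar> - d3 * t)"
          unfolding Na exp_diff exp_add by (simp add: exp_minus algebra_simps divide_inverse)
        ultimately show ?thesis using \<open>1 \<le> N h\<close> by linarith
      qed
      have Nap: "N (adj h) > 0" unfolding Na by (intro add_pos_nonneg add_nonneg_nonneg) auto
      have "exp (\<delta> * \<bar>t\<bar>) * N (adj h) \<le> (4 * R) * N (adj h)" using key h(2) by linarith
      then have "exp (\<delta> * \<bar>t\<bar>) \<le> 4 * R" using Nap by simp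
      then have "\<delta> * \<bar>t\<bar> \<le> ln (4 * R)" using R by (simp add: ln_ge_iff)
      then have tM: "\<bar>t\<bar> \<le> M" using \<delta> by (simp add: M_def pos_le_divide_eq mult.commute)
      have ex: "exp (c * t) \<le> E" if "\<bar>c\<bar> \<le> K" for c
      proof -
        have "c * t \<le> \<bar>c\<bar> * \<bar>t\<bar>" by (metis abs_ge_self abs_mult)
        also have "\<dots> \<le> K * M" using that tM by (intro mult_mono) auto
        finally show ?thesis by (simp add: E_def)
      qed
      have "exp (- d1 * t) \<le> E" "exp (d2 * t) \<le> E" "exp (- d2 * t) \<le> E" "exp (- d3 * t) \<le> E"
        by (rule ex; simp add: K_def)+
      moreover from this have "\<bar>z\<bar> * exp (d2 * t) \<le> N h * E" using Nb by (intro mult_mono) auto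
      moreover have "1 * E \<le> N h * E" using key by (intro mult_right_mono) (auto simp: E_def)
      ultimately have "N (adj h) \<le> 4 * (N h * E)" unfolding Na by linarith
      then show "N (adj h) \<le> 4 * E * N h" by (simp add: mult_ac)
    qed
  qed
  then show False using not_cds_wall[of H] H by blast
qed

text \<open>The same scheme for a double eigenvalue: the gap factor is no longer exponential but
  only u = 1 + |t|, which for t >= 0 comes from the Jordan entry t e^t. That is still enough to
  bound t near the wall.\<close>

lemma not_cds_jordan_corner:
  assumes H: "cds H" and lie: "\<And>X. X \<in> lie H \<Longrightarrow> \<exists>t z. X = m3 t t z 0 t 0 0 0 (- 2 * t)"
  shows False
proof -
  let ?Q = "{m3 (exp t) (t * exp t) z 0 (exp t) 0 0 0 (exp (- 2 * t)) | t z. True}"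
  have e1: "exp t * exp t = exp (2 * t)" "exp t * exp (- 2 * t) = exp (- t)" for t :: real
    unfolding exp_add[symmetric] by simp_all
  have adjm: "adj (m3 (exp t) (t * exp t) z 0 (exp t) 0 0 0 (exp (- 2 * t))) =
    m3 (exp (- t)) (- (t * exp (- t))) (- (z * exp t)) 0 (exp (- t)) 0 0 0 (exp (2 * t))" for t z
    using e1[of t] by (simp add: mult.assoc)
  have sub: "H \<subseteq> ?Q"
  proof (rule cds_subset[OF H])
    have mem: "m3 (exp t) (t * exp t) z 0 (exp t) 0 0 0 (exp (- 2 * t)) \<in> ?Q" for t z by blast
    show "matrix_subgroup ?Q"
    proof (rule matrix_subgroupI)
      show "mat 1 \<in> ?Q" using mem[of 0 0] by (simp add: m3_one)
      fix x assume "x \<in> ?Q"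
      then obtain t z where x: "x = m3 (exp t) (t * exp t) z 0 (exp t) 0 0 0 (exp (- 2 * t))" by blast
      have "exp t * exp t * exp (- 2 * t) = 1" unfolding e1(1) by (simp add: exp_add[symmetric])
      then have "det x = 1" by (simp add: x)
      moreover have "adj x \<in> ?Q" unfolding x adjm using mem[of "- t" "- (z * exp t)"] by simp
      ultimately show "det x = 1 \<and> adj x \<in> ?Q" ..
      fix y assume "y \<in> ?Q"
      then obtain t' z' where y: "y = m3 (exp t') (t' * exp t') z' 0 (exp t') 0 0 0 (exp (- 2 * t'))" by blast
      have "exp (- 2 * (t + t')) = exp (- 2 * t) * exp (- 2 * t')" unfolding exp_add[symmetric] by (simp add: distrib_left)
      then have "x ** y = m3 (exp (t + t')) ((t + t') * exp (t + t')) (exp t * z' + z * exp (- 2 * t')) 0 (exp (t + t')) 0 0 0 (exp (- 2 * (t + t')))"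
        unfolding x y exp_add by (simp add: algebra_simps)
      then show "x ** y \<in> ?Q" using mem by simp
    qed
    fix X assume "X \<in> lie H"
    then obtain t z where X: "X = m3 t t z 0 t 0 0 0 (- 2 * t)" using lie by blast
    show "mexp X \<in> ?Q"
    proof (cases "t = 0")
      case True
      then have "mexp X = m3 1 0 z 0 1 0 0 0 1" using mexp_strictly_upper[of 1 0 z 0] by (simp add: X)
      then show ?thesis using mem[of 0 z] by simp
    next
      case False
      from mexp_jordan[OF this, of 1 z] show ?thesis unfolding X using mem by simp
    qed
  qed
  have "\<exists>C. \<forall>h\<in>H. (N h)\<^sup>2 \<le> R * N (adj h) \<longrightarrow> N (adj h) \<le> C * N h" if R: "R \<ge> 1" for R
  proof -
    define E where "E = exp (8 * R)"
    show ?thesis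
    proof (intro exI[of _ "(4 + 4 * R) * E"] ballI impI)
      fix h assume h: "h \<in> H" "(N h)\<^sup>2 \<le> R * N (adj h)"
      obtain t z where e: "h = m3 (exp t) (t * exp t) z 0 (exp t) 0 0 0 (exp (- 2 * t))" using h(1) sub by blast
      have Nh: "N h = 2 * exp t + \<bar>t\<bar> * exp t + \<bar>z\<bar> + exp (- 2 * t)" by (simp add: e abs_mult)
      have Na: "N (adj h) = 2 * exp (- t) + \<bar>t\<bar> * exp (- t) + \<bar>z\<bar> * exp t + exp (2 * t)"
        unfolding e adjm by (simp add: abs_mult)
      have nn: "0 \<le> \<bar>t\<bar> * exp t" "0 < exp t" "0 < exp (- 2 * t)" by simp_all
      have Nb: "(1 + \<bar>t\<bar>) * exp t \<le> N h" "exp (- 2 * t) \<le> N h" "\<bar>z\<bar> \<le> N h" "0 \<le> N h"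
        using nn abs_ge_zero[of z] unfolding Nh distrib_right by linarith+
      define u where "u = 1 + \<bar>t\<bar>"
      have u: "u \<ge> 1" "u \<le> exp \<bar>t\<bar>" using exp_ge_add_one_self[of "\<bar>t\<bar>"] by (simp_all add: u_def)
      have key: "u * N (adj h) \<le> 4 * (N h)\<^sup>2 \<and> 1 \<le> N h"
      proof (cases "t \<ge> 0")
        case True
        have 1: "u * exp t \<le> N h" using Nb by (simp add: u_def)
        have et: "1 \<le> exp t" "exp (- t) \<le> 1" using True by simp_all
        have un: "u \<le> N h"
        proof -
          have "u * 1 \<le> u * exp t" using et u by (intro mult_left_mono) auto
          then show ?thesis using 1 by simp
        qed
        have "u * u * exp (- t) \<le> u * u * 1" using et u by (intro mult_left_mono) auto
        also have "\<dots> \<le> N h * N h" using un u by (simp add: mult_mono)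
        finally have a: "u * u * exp (- t) \<le> N h * N h" .
        have b: "\<bar>z\<bar> * (u * exp t) \<le> N h * N h" using Nb 1 u by (intro mult_mono) auto
        have "1 * exp t \<le> u * exp t" using u by (intro mult_right_mono) auto
        then have "exp t \<le> N h" using 1 by linarith
        then have c: "(u * exp t) * exp t \<le> N h * N h" using 1 Nb by (intro mult_mono) auto
        have "u * N (adj h) = u * (2 + \<bar>t\<bar>) * exp (- t) + \<bar>z\<bar> * (u * exp t) + (u * exp t) * exp t"
          unfolding Na e1[symmetric] by (simp add: algebra_simps)
        moreover have "u * (2 + \<bar>t\<bar>) * exp (- t) \<le> u * (2 * u) * exp (- t)"
          using u by (intro mult_right_mono mult_left_mono) (auto simp: u_def)
        ultimately have "u * N (adj h) \<le> 4 * (N h * N h)" using a b c by (simp add: mult_ac)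
        then show ?thesis using un u by (simp add: power2_eq_square)
      next
        case False
        define s where "s = - t"
        have s: "s > 0" "t = - s" "\<bar>t\<bar> = s" using False by (auto simp: s_def)
        have us: "u \<le> exp s" using u s by simp
        have x: "exp (2 * s) \<le> N h" using Nb s by simp
        have es: "1 \<le> exp s" "1 \<le> exp (2 * s)" "exp s \<le> exp (2 * s)" using s by simp_all
        have n1: "1 \<le> N h" using x es by linarith
        have "u * (2 + \<bar>t\<bar>) * exp s \<le> u * (2 * u) * exp s" using u by (intro mult_right_mono mult_left_mono) (auto simp: u_def)
        also have "\<dots> \<le> exp s * (2 * exp s) * exp (2 * s)" using us u es by (intro mult_mono) auto
        also have "\<dots> = 2 * (exp (2 * s) * exp (2 * s))" by (simp add: e1[symmetric])
        also have "\<dots> \<le> 2 * (N h * N h)" using x by (simp add: mult_mono)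
        finally have a: "u * (2 + \<bar>t\<bar>) * exp s \<le> 2 * (N h * N h)" .
        have "u * exp (- s) \<le> exp s * exp (- s)" using us by (intro mult_right_mono) auto
        then have u1: "u * exp (- s) \<le> 1" by (simp add: exp_add[symmetric])
        then have "\<bar>z\<bar> * (u * exp (- s)) \<le> N h * N h" using Nb n1 u by (intro mult_mono) auto
        moreover have "u * exp (- 2 * s) \<le> N h * N h"
        proof -
          have "u * exp (- 2 * s) \<le> u * exp (- s)" using u s by (intro mult_left_mono) auto
          also have "\<dots> \<le> 1 * 1" using u1 by simp
          also have "\<dots> \<le> N h * N h" using n1 by (intro mult_mono) auto
          finally show ?thesis .
        qed
        moreover have "u * N (adj h) = u * (2 + \<bar>t\<bar>) * exp s + \<bar>z\<bar> * (u * exp (- s)) + u * exp (- 2 * s)"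
          unfolding Na by (simp add: s algebra_simps)
        ultimately have "u * N (adj h) \<le> 4 * (N h * N h)" using a by linarith
        then show ?thesis using n1 by (simp add: power2_eq_square)
      qed
      have Nap: "N (adj h) > 0" unfolding Na by (intro add_nonneg_pos add_nonneg_nonneg) auto
      have "u * N (adj h) \<le> (4 * R) * N (adj h)" using key h(2) by linarith
      then have uR: "u \<le> 4 * R" using Nap by simp
      then have t: "\<bar>t\<bar> \<le> 4 * R" by (simp add: u_def)
      have ex: "exp (- t) \<le> E" "exp t \<le> E" "exp (2 * t) \<le> E" using t R by (auto simp: E_def)
      have "(2 + \<bar>t\<bar>) * exp (- t) \<le> (2 + 4 * R) * E" using ex t R by (intro mult_mono) auto
      moreover have "\<bar>z\<bar> * exp t \<le> N h * E" using Nb ex by (intro mult_mono) auto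
      moreover have "1 * ((3 + 4 * R) * E) \<le> N h * ((3 + 4 * R) * E)" using key R by (intro mult_right_mono) (auto simp: E_def)
      ultimately have "N (adj h) \<le> N h * ((3 + 4 * R) * E) + N h * E" unfolding Na using ex by (simp add: algebra_simps)
      then show "N (adj h) \<le> (4 + 4 * R) * E * N h" by (simp add: algebra_simps)
    qed
  qed
  then show False using not_cds_wall[of H] H by blast
qed

text \<open>A one-dimensional Lie algebra confines H to a one-parameter group. The first unit vector
  or the last unit covector is an eigenvector with nonzero eigenvalue, so a diagonal entry of the
  exponential grows exponentially and the two-ray argument applies.\<close>

lemma not_cds_line:
  assumes H: "cds H" and X: "X \<in> lie H" and line: "\<And>Y. Y \<in> lie H \<Longrightarrow> \<exists>c. Y = c *\<^sub>R X"
    and eig: "X$2$1 = 0 \<and> X$3$1 = 0 \<and> X$1$1 \<noteq> 0 \<or> X$3$1 = 0 \<and> X$3$2 = 0 \<and> X$3$3 \<noteq> 0"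
  shows False
proof -
  have sub: "H \<subseteq> range (\<lambda>t. mexp (t *\<^sub>R X))"
  proof (rule cds_subset[OF H])
    show "matrix_subgroup (range (\<lambda>t. mexp (t *\<^sub>R X)))"
      unfolding matrix_subgroup_def
    proof (intro conjI ballI)
      show "mat 1 \<in> range (\<lambda>t. mexp (t *\<^sub>R X))" by (rule image_eqI[of _ _ 0]) auto
      fix x assume "x \<in> range (\<lambda>t. mexp (t *\<^sub>R X))"
      then obtain s where x: "x = mexp (s *\<^sub>R X)" by blast
      have "x ** mexp ((- s) *\<^sub>R X) = mat 1" unfolding x mexp_add[symmetric] by simp
      then show "\<exists>y\<in>range (\<lambda>t. mexp (t *\<^sub>R X)). x ** y = mat 1" by blast
      fix y assume "y \<in> range (\<lambda>t. mexp (t *\<^sub>R X))"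
      then obtain t where y: "y = mexp (t *\<^sub>R X)" by blast
      show "x ** y \<in> range (\<lambda>t. mexp (t *\<^sub>R X))" unfolding x y mexp_add[symmetric] by blast
    qed
    show "mexp Y \<in> range (\<lambda>t. mexp (t *\<^sub>R X))" if "Y \<in> lie H" for Y using line[OF that] by blast
  qed
  have det: "det (mexp (t *\<^sub>R X)) = 1" for t using cds_det[OF H lie_mexp[OF X]] .
  have "\<exists>c\<noteq>0. \<forall>t. exp (c * t) \<le> N (mexp (t *\<^sub>R X))"
    using eig
  proof
    assume a: "X$2$1 = 0 \<and> X$3$1 = 0 \<and> X$1$1 \<noteq> 0"
    then have "exp (X$1$1 * t) \<le> N (mexp (t *\<^sub>R X))" for t
      using mexp_eigenvalue_11[of X t] N_entry[of "mexp (t *\<^sub>R X)" 1 1] by simp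
    then show ?thesis using a by blast
  next
    assume a: "X$3$1 = 0 \<and> X$3$2 = 0 \<and> X$3$3 \<noteq> 0"
    then have "exp (X$3$3 * t) \<le> N (mexp (t *\<^sub>R X))" for t
      using mexp_eigenvalue_33[of X t] N_entry[of "mexp (t *\<^sub>R X)" 3 3] by simp
    then show ?thesis using a by blast
  qed
  then show False using not_cds_one_parameter[OF det sub] H by blast
qed

section \<open>Conjugating Lie algebras into normal form\<close>

text \<open>The Lie algebra of Q^(-1) H Q, written as X Q = Q Y so that membership with a concrete Q
  is a matrix identity without an inverse.\<close>

definition conj_lie :: "real^3^3 \<Rightarrow> (real^3^3) set \<Rightarrow> (real^3^3) set"
  where "conj_lie Q k = {Y. \<exists>X\<in>k. X ** Q = Q ** Y}"

lemma det_nonzero_inverse: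
  assumes "det (Q :: real^3^3) \<noteq> 0"
  obtains P where "P ** Q = mat 1" "Q ** P = mat 1"
  using assms invertible_det_nz[of Q] by (auto simp: invertible_def)

lemma conj_lie_eq_image:
  fixes P Q :: "real^3^3"
  assumes "P ** Q = mat 1" "Q ** P = mat 1"
  shows "conj_lie Q k = (\<lambda>X. P ** X ** Q) ` k"
proof (intro equalityI subsetI)
  fix Y assume "Y \<in> conj_lie Q k"
  then obtain X where X: "X \<in> k" "X ** Q = Q ** Y" by (auto simp: conj_lie_def)
  have "P ** X ** Q = P ** (X ** Q)" by (simp only: matrix_mul_assoc)
  also have "\<dots> = P ** Q ** Y" unfolding X(2) by (simp only: matrix_mul_assoc)
  finally show "Y \<in> (\<lambda>X. P ** X ** Q) ` k" using X(1) assms(1) by (intro image_eqI[of _ _ X]) simp_all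
next
  fix Y assume "Y \<in> (\<lambda>X. P ** X ** Q) ` k"
  then obtain X where X: "X \<in> k" "Y = P ** X ** Q" by blast
  have "Q ** Y = Q ** P ** X ** Q" unfolding X(2) by (simp only: matrix_mul_assoc)
  then have "X ** Q = Q ** Y" using assms(2) by simp
  then show "Y \<in> conj_lie Q k" using X(1) by (auto simp: conj_lie_def)
qed

text \<open>Passage to a conjugate group whose Lie algebra has the desired normal form; the
  conclusion returns through \<open>contains_standard_conj\<close>.\<close>

lemma wlog_conj:
  assumes H: "cds H" and Q: "det Q \<noteq> 0"
    and thesis: "\<And>H'. cds H' \<Longrightarrow> lie H' = conj_lie Q (lie H) \<Longrightarrow> contains_standard H'"
  shows "contains_standard H"
proof -
  obtain P where P: "P ** Q = mat 1" "Q ** P = mat 1" using det_nonzero_inverse[OF Q] .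
  have "cds ((\<lambda>X. P ** X ** Q) ` H)" by (rule cds_automorphism[OF conj_automorphism[OF P(1)] H])
  moreover have "lie ((\<lambda>X. P ** X ** Q) ` H) = conj_lie Q (lie H)"
    unfolding lie_conj_image[OF P(1)] conj_lie_eq_image[OF P] ..
  ultimately show ?thesis using contains_standard_conj[OF P(1)] thesis by blast
qed

lemma wlog_flip:
  assumes H: "cds H"
    and thesis: "\<And>H'. cds H' \<Longrightarrow> (\<And>Y. Y \<in> lie H' \<longleftrightarrow> flip_lie Y \<in> lie H) \<Longrightarrow> contains_standard H'"
  shows "contains_standard H"
proof -
  have sub: "H \<subseteq> {g. det g = 1}" using H by (auto simp: cds_iff)
  have "contains_standard (flip ` H)"
    by (rule thesis[OF cds_automorphism[OF flip_automorphism H]]) (simp only: lie_flip_image[OF sub] flip_lie_image_iff)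
  then show ?thesis by (rule contains_standard_flip[OF sub])
qed

definition subalgebra :: "(real^3^3) set \<Rightarrow> bool"
  where "subalgebra k \<longleftrightarrow> subspace k \<and> (\<forall>X\<in>k. \<forall>Y\<in>k. X ** Y - Y ** X \<in> k)"

lemma subalgebra_lie: "cds H \<Longrightarrow> subalgebra (lie H)"
  by (simp add: subalgebra_def cds_subspace_lie cds_lie_bracket)

lemma subalgebra_lincomb: "subalgebra k \<Longrightarrow> X \<in> k \<Longrightarrow> Y \<in> k \<Longrightarrow> a *\<^sub>R X + b *\<^sub>R Y \<in> k"
  by (simp add: subalgebra_def subspace_add subspace_scale)

lemma subalgebra_scale: "subalgebra k \<Longrightarrow> X \<in> k \<Longrightarrow> a *\<^sub>R X \<in> k"
  by (simp add: subalgebra_def subspace_scale)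

lemma subalgebra_bracket: "subalgebra k \<Longrightarrow> X \<in> k \<Longrightarrow> Y \<in> k \<Longrightarrow> X ** Y - Y ** X \<in> k"
  by (simp add: subalgebra_def)

lemma subalgebra_conj_lie:
  assumes k: "subalgebra k" and Q: "det Q \<noteq> 0"
  shows "subalgebra (conj_lie Q k)"
  unfolding subalgebra_def subspace_def
proof (intro conjI ballI allI)
  have sub: "subspace k" using k by (simp add: subalgebra_def)
  show "0 \<in> conj_lie Q k" unfolding conj_lie_def
    using subspace_0[OF sub] by (auto intro!: bexI[of _ 0] simp: matrix_mult_zero_left matrix_mult_zero_right)
  fix X assume "X \<in> conj_lie Q k"
  then obtain X' where X: "X' \<in> k" "X' ** Q = Q ** X" by (auto simp: conj_lie_def)
  show "c *\<^sub>R X \<in> conj_lie Q k" for c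
    unfolding conj_lie_def using subspace_scale[OF sub X(1), of c] X(2)
    by (auto intro!: bexI[of _ "c *\<^sub>R X'"] simp: matrix_mult_scaleR_left matrix_mult_scaleR_right)
  fix Y assume "Y \<in> conj_lie Q k"
  then obtain Y' where Y: "Y' \<in> k" "Y' ** Q = Q ** Y" by (auto simp: conj_lie_def)
  show "X + Y \<in> conj_lie Q k"
    unfolding conj_lie_def using subspace_add[OF sub X(1) Y(1)] X(2) Y(2)
    by (auto intro!: bexI[of _ "X' + Y'"] simp: matrix_add_ldistrib matrix_add_rdistrib)
  have "(X' ** Y' - Y' ** X') ** Q = Q ** (X ** Y - Y ** X)"
  proof -
    have "X' ** Y' ** Q = Q ** X ** Y" "Y' ** X' ** Q = Q ** Y ** X"
      by (metis X(2) Y(2) matrix_mul_assoc)+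
    then show ?thesis by (simp add: matrix_mult_diff_left matrix_mult_diff_right matrix_mul_assoc)
  qed
  then show "X ** Y - Y ** X \<in> conj_lie Q k"
    unfolding conj_lie_def using subalgebra_bracket[OF k X(1) Y(1)] by blast
qed

lemma conj_lieI: "X \<in> k \<Longrightarrow> X ** Q = Q ** Y \<Longrightarrow> Y \<in> conj_lie Q k"
  by (auto simp: conj_lie_def)

section \<open>The planar block: normal forms of elements and of subalgebras\<close>

definition planar :: "real^3^3 \<Rightarrow> bool"
  where "planar Q \<longleftrightarrow> (\<exists>a b c d. Q = m3 a b 0 c d 0 0 0 1) \<and> det Q \<noteq> 0"

lemma planar_one: "planar (mat 1)"
  unfolding planar_def m3_one by auto

lemma conj_lie_one: "conj_lie (mat 1) k = k"
  by (auto simp: conj_lie_def)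

text \<open>The real Jordan form of a 2x2 block. For c /= 0 the sign of the discriminant n^2 + bc
  decides, with m and n half the sum and half the difference of the diagonal entries. The columns of
  Q are then the eigenvectors (n + s, c) and (n - s, c), or an eigenvector with a generalised one,
  or imaginary and real part of a complex eigenvector up to sign.\<close>

lemma planar_normal_form:
  fixes a b c d e :: real
  shows "\<exists>Q F \<alpha> \<beta>. planar Q \<and> m3 a b 0 c d 0 0 0 e ** Q = Q ** F \<and>
    (F = m3 \<alpha> 0 0 0 \<beta> 0 0 0 e \<or> F = m3 \<alpha> 1 0 0 \<alpha> 0 0 0 e \<or> \<beta> \<noteq> 0 \<and> F = m3 \<alpha> \<beta> 0 (- \<beta>) \<alpha> 0 0 0 e)"
proof -
  have mk: ?thesis
    if "x * w - y * z \<noteq> 0" "m3 a b 0 c d 0 0 0 e ** m3 x y 0 z w 0 0 0 1 = m3 x y 0 z w 0 0 0 1 ** F"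
      "F = m3 \<alpha> 0 0 0 \<beta> 0 0 0 e \<or> F = m3 \<alpha> 1 0 0 \<alpha> 0 0 0 e \<or> \<beta> \<noteq> 0 \<and> F = m3 \<alpha> \<beta> 0 (- \<beta>) \<alpha> 0 0 0 e" for x y z w F \<alpha> \<beta>
  proof -
    have "planar (m3 x y 0 z w 0 0 0 1)" unfolding planar_def using that(1) by auto
    then show ?thesis using that(2,3) by blast
  qed
  show ?thesis
  proof (cases "c = 0")
    case c0: True
    show ?thesis
    proof (cases "b = 0")
      case True
      then show ?thesis using c0 by (intro mk[of 1 1 0 0 "m3 a 0 0 0 d 0 0 0 e" a d]) auto
    next
      case b: False
      show ?thesis
      proof (cases "a = d")
        case True
        then show ?thesis using c0 b by (intro mk[of b 1 0 0 "m3 a 1 0 0 a 0 0 0 e" a]) auto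
      next
        case False
        then show ?thesis using c0
          by (intro mk[of 1 "d - a" b 0 "m3 a 0 0 0 d 0 0 0 e" a d]) (auto simp: algebra_simps)
      qed
    qed
  next
    case c: False
    define n m where "n = (a - d) / 2" and "m = (a + d) / 2"
    have ad: "a = m + n" "d = m - n" by (simp_all add: n_def m_def field_simps)
    consider (pos) "n * n + b * c > 0" | (zero) "n * n + b * c = 0" | (neg) "n * n + b * c < 0" by linarith
    then show ?thesis
    proof cases
      case pos
      define s where "s = sqrt (n * n + b * c)"
      have s: "s * s = n * n + b * c" "s > 0" using pos by (auto simp: s_def)
      have "(m + n) * (n + s) + b * c = (n + s) * (m + s)" "(m + n) * (n - s) + b * c = (n - s) * (m - s)"
        "c * (n + s) + (m - n) * c = c * (m + s)" "c * (n - s) + (m - n) * c = c * (m - s)"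
        using s(1) by algebra+
      moreover have "(n + s) * c - (n - s) * c \<noteq> 0" using c s(2) by (simp add: algebra_simps)
      ultimately show ?thesis
        by (intro mk[of "n + s" c "n - s" c "m3 (m + s) 0 0 0 (m - s) 0 0 0 e" "m + s" "m - s"]) (simp_all add: ad)
    next
      case zero
      have "(m + n) * n + b * c = n * m" using zero by algebra
      moreover have "c * n + (m - n) * c = c * m" by algebra
      ultimately show ?thesis
        using c by (intro mk[of n 0 1 c "m3 m 1 0 0 m 0 0 0 e" m]) (simp_all add: ad algebra_simps)
    next
      case neg
      define w where "w = sqrt (- (n * n + b * c))"
      have w: "w * w = - (n * n + b * c)" "w > 0" using neg by (auto simp: w_def)
      have "- ((m + n) * n) - b * c = w * w - n * m" using w(1) by algebra
      moreover have "- (c * n) - (m - n) * c = - (c * m)" by algebra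
      ultimately show ?thesis
        using c w(2) by (intro mk[of w "- c" "- n" 0 "m3 m w 0 (- w) m 0 0 0 e" m w]) (simp_all add: ad algebra_simps)
    qed
  qed
qed

definition planar_algebra :: "(real^3^3) set \<Rightarrow> bool"
  where "planar_algebra k \<longleftrightarrow> subalgebra k \<and> (\<forall>X\<in>k. \<exists>a b c d. X = m3 a b 0 c d 0 0 0 (- a - d))"

lemma planar_algebra_conj:
  assumes k: "planar_algebra k" and Q: "planar Q"
  shows "planar_algebra (conj_lie Q k)"
  unfolding planar_algebra_def
proof (intro conjI ballI)
  obtain x y z w where q: "Q = m3 x y 0 z w 0 0 0 1" "det Q \<noteq> 0" using Q by (auto simp: planar_def)
  have D: "x * w - y * z \<noteq> 0" using q by simp
  show "subalgebra (conj_lie Q k)" using k q(2) by (simp add: subalgebra_conj_lie planar_algebra_def)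
  fix Y assume "Y \<in> conj_lie Q k"
  then obtain X where X: "X \<in> k" "X ** Q = Q ** Y" by (auto simp: conj_lie_def)
  obtain a b c d where x: "X = m3 a b 0 c d 0 0 0 (- a - d)" using k X(1) by (auto simp: planar_algebra_def)
  obtain a' b' c' d' e' f' g' h' i' where y: "Y = m3 a' b' c' d' e' f' g' h' i'" by (rule m3_cases)
  have e: "x * c' + y * f' = 0" "z * c' + w * f' = 0" "g' = 0" "h' = 0" "i' = - a - d"
    "a * x + b * z = x * a' + y * d'" "a * y + b * w = x * b' + y * e'" "c * x + d * z = z * a' + w * d'" "c * y + d * w = z * b' + w * e'"
    using X(2) unfolding x y q by auto
  have "(x * w - y * z) * c' = 0" "(x * w - y * z) * f' = 0" using e(1,2) by algebra+
  then have "c' = 0" "f' = 0" using D by auto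
  moreover have "(x * w - y * z) * (a' + e' - a - d) = 0" using e(6-9) by algebra
  then have "a' + e' - a - d = 0" using D by simp
  then have "i' = - a' - e'" using e(5) by linarith
  ultimately show "\<exists>a b c d. Y = m3 a b 0 c d 0 0 0 (- a - d)" unfolding y using e(3,4) by auto
qed

text \<open>A list tailored to later use: the alternatives may overlap, and the first only records a
  nilpotent element. The matrix in the third is the spiral generator with parameter 1; algebras of
  dimension at most one form the last.\<close>

definition planar_type :: "(real^3^3) set \<Rightarrow> bool"
  where "planar_type k \<longleftrightarrow> m3 0 1 0 0 0 0 0 0 0 \<in> k \<or> (\<forall>a b. m3 a 0 0 0 b 0 0 0 (- a - b) \<in> k) \<or>
    (\<forall>X\<in>k. X$1$1 = X$2$2 \<and> X$1$2 = - X$2$1) \<and> m3 1 1 0 (- 1) 1 0 0 0 (- 2) \<in> k \<or>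
    (\<exists>X0\<in>k. (\<forall>X\<in>k. \<exists>c. X = c *\<^sub>R X0) \<and>
      ((\<exists>a b. X0 = m3 a 0 0 0 b 0 0 0 (- a - b)) \<or> (\<exists>a. a \<noteq> 0 \<and> X0 = m3 a 1 0 0 a 0 0 0 (- 2 * a)) \<or>
       (\<exists>a b. b \<noteq> 0 \<and> X0 = m3 a b 0 (- b) a 0 0 0 (- 2 * a))))"

text \<open>Cramer's rule for the first two diagonal entries; the third follows from the
  trace.\<close>

lemma span_diagonal:
  assumes k: "subalgebra k" and X: "m3 a 0 0 0 b 0 0 0 (- a - b) \<in> k" and Y: "m3 c 0 0 0 d 0 0 0 (- c - d) \<in> k"
    and D: "a * d - b * c \<noteq> 0"
  shows "m3 x 0 0 0 y 0 0 0 (- x - y) \<in> k"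
proof -
  define s t where "s = (x * d - y * c) / (a * d - b * c)" and "t = (a * y - b * x) / (a * d - b * c)"
  have st: "s * a + t * c = x" "s * b + t * d = y"
  proof -
    have "(x * d - y * c) * a + (a * y - b * x) * c = x * (a * d - b * c)" by algebra
    then show "s * a + t * c = x" using D by (simp add: s_def t_def add_divide_distrib[symmetric])
    have "(x * d - y * c) * b + (a * y - b * x) * d = y * (a * d - b * c)" by algebra
    then show "s * b + t * d = y" using D by (simp add: s_def t_def add_divide_distrib[symmetric])
  qed
  have "s * (- a - b) + t * (- c - d) = - x - y" using st by (simp add: algebra_simps)
  then show ?thesis using subalgebra_lincomb[OF k X Y, of s t] st by simp
qed

lemma planar_type_hyperbolic:
  assumes k: "planar_algebra k" and H0: "m3 1 0 0 0 (- 1) 0 0 0 0 \<in> k"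
  shows "\<exists>Q. planar Q \<and> planar_type (conj_lie Q k)"
proof -
  have sub: "subalgebra k" using k by (simp add: planar_algebra_def)
  have off: "m3 0 b 0 0 0 0 0 0 0 \<in> k \<and> m3 0 0 0 c 0 0 0 0 0 \<in> k" if X: "m3 a b 0 c d 0 0 0 e \<in> k" for a b c d e
  proof -
    \<comment> \<open>The commutator with the given diagonal element acts on the two off-diagonal
      entries with weights 2 and -2, so applying it twice separates them.\<close>
    have 1: "m3 0 (2 * b) 0 (- 2 * c) 0 0 0 0 0 \<in> k" using subalgebra_bracket[OF sub H0 X] by simp
    have 2: "m3 0 (4 * b) 0 (4 * c) 0 0 0 0 0 \<in> k" using subalgebra_bracket[OF sub H0 1] by simp
    show ?thesis using subalgebra_lincomb[OF sub 1 2, of "1/4" "1/8"] subalgebra_lincomb[OF sub 1 2, of "-1/4" "1/8"] by simp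
  qed
  show ?thesis
  proof (cases "\<exists>X\<in>k. X$1$2 \<noteq> 0 \<or> X$2$1 \<noteq> 0")
    case True
    then obtain a b c d where X: "m3 a b 0 c d 0 0 0 (- a - d) \<in> k" "b \<noteq> 0 \<or> c \<noteq> 0"
      using k unfolding planar_algebra_def by (metis m3_nth)
    show ?thesis
    proof (cases "b = 0")
      case False
      then have "m3 0 1 0 0 0 0 0 0 0 \<in> k" using off[OF X(1)] subalgebra_scale[OF sub, of "m3 0 b 0 0 0 0 0 0 0" "1/b"] by simp
      then show ?thesis using planar_one conj_lie_one unfolding planar_type_def by metis
    next
      case True
      then have E: "m3 0 0 0 1 0 0 0 0 0 \<in> k" using X(2) off[OF X(1)] subalgebra_scale[OF sub, of "m3 0 0 0 c 0 0 0 0 0" "1/c"] by simp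
      have "m3 0 1 0 0 0 0 0 0 0 \<in> conj_lie (m3 0 1 0 1 0 0 0 0 1) k" by (rule conj_lieI[OF E]) simp
      moreover have "planar (m3 0 1 0 1 0 0 0 0 1)" by (auto simp: planar_def)
      ultimately show ?thesis unfolding planar_type_def by blast
    qed
  next
    case False
    then have dg: "\<exists>a b. X = m3 a 0 0 0 b 0 0 0 (- a - b)" if "X \<in> k" for X
      using k that unfolding planar_algebra_def by (metis m3_nth)
    have "planar_type k"
    proof (cases "\<exists>X\<in>k. X$3$3 \<noteq> 0")
      case True
      then obtain a b where "m3 a 0 0 0 b 0 0 0 (- a - b) \<in> k" "- a - b \<noteq> 0" using dg by (metis m3_nth)
      then have "m3 x 0 0 0 y 0 0 0 (- x - y) \<in> k" for x y
        using span_diagonal[OF sub, of 1 "-1" a b] H0 by simp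
      then show ?thesis by (simp add: planar_type_def)
    next
      case False
      have "\<exists>c. X = c *\<^sub>R m3 1 0 0 0 (- 1) 0 0 0 0" if X: "X \<in> k" for X
      proof -
        obtain a b where x: "X = m3 a 0 0 0 b 0 0 0 (- a - b)" using dg[OF X] by blast
        have "- a - b = 0" using False X x by force
        then show ?thesis by (intro exI[of _ a]) (simp add: x)
      qed
      moreover have "m3 1 0 0 0 (- 1) 0 0 0 0 = m3 1 0 0 0 (- 1) 0 0 0 (- 1 - (- 1 :: real))" by simp
      ultimately show ?thesis unfolding planar_type_def using H0 by blast
    qed
    then show ?thesis using planar_one conj_lie_one by metis
  qed
qed

text \<open>Commutators with the rotation generator land in the symmetric traceless matrices and
  turn them by a quarter, up to scale. If k contains more than scaled rotations, a nonzero matrix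
  with coordinates p and q arises, and its quarter turns span all symmetric traceless ones; adding a
  multiple of the rotation generator gives a nilpotent.\<close>

lemma planar_type_elliptic:
  assumes k: "planar_algebra k" and J: "m3 0 1 0 (- 1) 0 0 0 0 0 \<in> k"
  shows "planar_type k"
proof -
  have sub: "subalgebra k" using k by (simp add: planar_algebra_def)
  show ?thesis
  proof (cases "\<exists>X\<in>k. \<not> (X$1$1 = X$2$2 \<and> X$1$2 = - X$2$1)")
    case True
    then obtain x y z w where X: "m3 x y 0 z w 0 0 0 (- x - w) \<in> k" "x \<noteq> w \<or> y \<noteq> - z"
      using k unfolding planar_algebra_def by (metis m3_nth)
    define p q where "p = y + z" and "q = w - x"
    have pq: "p * p + q * q > 0"
    proof -
      have "p \<noteq> 0 \<or> q \<noteq> 0" using X(2) by (auto simp: p_def q_def)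
      then show ?thesis by (simp add: sum_squares_gt_zero_iff)
    qed
    have 1: "m3 p q 0 q (- p) 0 0 0 0 \<in> k" using subalgebra_bracket[OF sub J X(1)] by (simp add: p_def q_def add.commute)
    have 2: "m3 (2 * q) (- 2 * p) 0 (- 2 * p) (- 2 * q) 0 0 0 0 \<in> k" using subalgebra_bracket[OF sub J 1] by simp
    have "m3 0 (p * p + q * q) 0 (p * p + q * q) 0 0 0 0 0 \<in> k"
      using subalgebra_lincomb[OF sub 1 2, of q "- p / 2"] by (simp add: algebra_simps)
    moreover define r where "r = p * p + q * q"
    ultimately have "m3 0 r 0 r 0 0 0 0 0 \<in> k" by simp
    from subalgebra_lincomb[OF sub this J, of "1 / (2 * r)" "1 / 2"]
    have "m3 0 1 0 0 0 0 0 0 0 \<in> k" using pq unfolding r_def[symmetric] by simp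
    then show ?thesis by (simp add: planar_type_def)
  next
    case False
    then have f: "\<forall>X\<in>k. X$1$1 = X$2$2 \<and> X$1$2 = - X$2$1" by blast
    have form: "\<exists>a b. X = m3 a b 0 (- b) a 0 0 0 (- 2 * a)" if X: "X \<in> k" for X
    proof -
      obtain a b c d where x: "X = m3 a b 0 c d 0 0 0 (- a - d)" using k X by (auto simp: planar_algebra_def)
      then show ?thesis using f X by (intro exI[of _ a] exI[of _ b]) fastforce
    qed
    show ?thesis
    proof (cases "\<exists>X\<in>k. X$1$1 \<noteq> 0")
      case True
      then obtain a b where X: "m3 a b 0 (- b) a 0 0 0 (- 2 * a) \<in> k" "a \<noteq> 0" using form by (metis m3_nth(1))
      have "m3 1 1 0 (- 1) 1 0 0 0 (- 2) \<in> k"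
        using subalgebra_lincomb[OF sub X(1) J, of "1 / a" "1 - b / a"] X(2) by (simp add: algebra_simps)
      then show ?thesis using f by (simp add: planar_type_def)
    next
      case False
      have "\<exists>c. X = c *\<^sub>R m3 0 1 0 (- 1) 0 0 0 0 0" if X: "X \<in> k" for X
      proof -
        obtain a b where x: "X = m3 a b 0 (- b) a 0 0 0 (- 2 * a)" using form[OF X] by blast
        have "a = 0" using False X x by force
        then show ?thesis by (intro exI[of _ b]) (simp add: x)
      qed
      moreover have "\<exists>a b. b \<noteq> 0 \<and> m3 0 1 0 (- 1) 0 0 0 0 0 = m3 a b 0 (- b) a 0 0 0 (- 2 * a)"
        by (rule exI[of _ 0], rule exI[of _ 1]) simp
      ultimately show ?thesis unfolding planar_type_def using J by blast
    qed
  qed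
qed

lemma conj_lie_comp: "conj_lie R (conj_lie Q k) \<subseteq> conj_lie (Q ** R) k"
  unfolding conj_lie_def
proof clarify
  fix Y Z X assume 1: "Z ** R = R ** Y" and X: "X \<in> k" "X ** Q = Q ** Z"
  have "X ** (Q ** R) = Q ** Z ** R" by (simp add: matrix_mul_assoc X(2))
  also have "\<dots> = Q ** (Z ** R)" by (simp only: matrix_mul_assoc)
  also have "\<dots> = Q ** R ** Y" unfolding 1 by (simp only: matrix_mul_assoc)
  finally show "\<exists>X\<in>k. X ** (Q ** R) = Q ** R ** Y" using X(1) by blast
qed

lemma conj_lie_comp_eq:
  assumes "det R \<noteq> 0"
  shows "conj_lie R (conj_lie Q k) = conj_lie (Q ** R) k"
proof
  obtain P where P: "P ** R = mat 1" "R ** P = mat 1" using det_nonzero_inverse[OF assms] .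
  show "conj_lie (Q ** R) k \<subseteq> conj_lie R (conj_lie Q k)"
  proof
    fix Y assume "Y \<in> conj_lie (Q ** R) k"
    then obtain X where X: "X \<in> k" "X ** (Q ** R) = Q ** R ** Y" by (auto simp: conj_lie_def)
    have "X ** Q = X ** (Q ** R) ** P" by (simp only: matrix_mul_assoc[symmetric] P matrix_mul_rid)
    also have "\<dots> = Q ** (R ** Y ** P)" unfolding X(2) by (simp only: matrix_mul_assoc)
    finally have "R ** Y ** P \<in> conj_lie Q k" using X(1) by (auto simp: conj_lie_def)
    moreover have "(R ** Y ** P) ** R = R ** Y" by (simp only: matrix_mul_assoc[symmetric] P matrix_mul_rid)
    ultimately show "Y \<in> conj_lie R (conj_lie Q k)" by (rule conj_lieI)
  qed
qed (rule conj_lie_comp)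

lemma planar_mult: "planar P \<Longrightarrow> planar Q \<Longrightarrow> planar (P ** Q)"
proof -
  assume P: "planar P" and Q: "planar Q"
  have "det (P ** Q) \<noteq> 0" using P Q by (simp add: planar_def det_mul)
  moreover have "\<exists>a b c d. P ** Q = m3 a b 0 c d 0 0 0 1" using P Q by (auto simp: planar_def)
  ultimately show ?thesis by (simp add: planar_def)
qed

text \<open>A nonzero element with vanishing (3,3) entry has a traceless block, whose normal form is
  hyperbolic, nilpotent or elliptic. Without one, the (3,3) entry is injective on k, so k has
  dimension at most one and the normal form of a generator decides.\<close>

lemma planar_algebra_classification:
  assumes k: "planar_algebra k"
  shows "\<exists>Q. planar Q \<and> planar_type (conj_lie Q k)"
proof (cases "\<exists>Y\<in>k. Y \<noteq> 0 \<and> Y$3$3 = 0")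
  case True
  then obtain Y where Y0: "Y \<in> k" "Y \<noteq> 0" "Y$3$3 = 0" by blast
  then obtain a b c d where y: "Y = m3 a b 0 c d 0 0 0 (- a - d)" using k unfolding planar_algebra_def by blast
  have "d = - a" using Y0(3) by (simp add: y)
  then have Y: "m3 a b 0 c d 0 0 0 0 \<in> k" "m3 a b 0 c d 0 0 0 0 \<noteq> 0" using Y0(1,2) y by simp_all
  obtain Q F \<alpha> \<beta> where Q: "planar Q" "m3 a b 0 c d 0 0 0 0 ** Q = Q ** F"
    and F: "F = m3 \<alpha> 0 0 0 \<beta> 0 0 0 0 \<or> F = m3 \<alpha> 1 0 0 \<alpha> 0 0 0 0 \<or> \<beta> \<noteq> 0 \<and> F = m3 \<alpha> \<beta> 0 (- \<beta>) \<alpha> 0 0 0 0"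
    using planar_normal_form[of a b c d 0] by blast
  let ?k = "conj_lie Q k"
  have k': "planar_algebra ?k" by (rule planar_algebra_conj[OF k Q(1)])
  then have sub: "subalgebra ?k" by (simp add: planar_algebra_def)
  have Fk: "F \<in> ?k" by (rule conj_lieI[OF Y(1) Q(2)])
  have F0: "F \<noteq> 0"
  proof
    assume "F = 0"
    obtain P where P: "P ** Q = mat 1" "Q ** P = mat 1" using det_nonzero_inverse Q(1) by (auto simp: planar_def)
    have "m3 a b 0 c d 0 0 0 0 = m3 a b 0 c d 0 0 0 0 ** Q ** P" by (simp only: matrix_mul_assoc[symmetric] P matrix_mul_rid)
    also have "\<dots> = 0" unfolding Q(2) \<open>F = 0\<close> by (simp add: matrix_mult_zero_left matrix_mult_zero_right)
    finally show False using Y(2) by simp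
  qed
  have tr: "F$1$1 + F$2$2 + F$3$3 = 0" using Fk k' unfolding planar_algebra_def by force
  from F consider (h) "F = m3 \<alpha> 0 0 0 \<beta> 0 0 0 0" | (n) "F = m3 \<alpha> 1 0 0 \<alpha> 0 0 0 0" | (e) "\<beta> \<noteq> 0" "F = m3 \<alpha> \<beta> 0 (- \<beta>) \<alpha> 0 0 0 0" by blast
  then show ?thesis
  proof cases
    case h
    then have "\<beta> = - \<alpha>" "\<alpha> \<noteq> 0" using tr F0 by (auto simp: m3_zero)
    then have "m3 1 0 0 0 (- 1) 0 0 0 0 \<in> ?k" using subalgebra_scale[OF sub Fk, of "1 / \<alpha>"] h by simp
    from planar_type_hyperbolic[OF k' this] obtain R where R: "planar R" "planar_type (conj_lie R ?k)" by blast
    then have "planar (Q ** R)" "planar_type (conj_lie (Q ** R) k)"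
      using planar_mult Q(1) conj_lie_comp_eq[of R Q k] by (auto simp: planar_def)
    then show ?thesis by blast
  next
    case n
    then have "\<alpha> = 0" using tr by simp
    then show ?thesis using n Fk Q(1) unfolding planar_type_def by blast
  next
    case e
    then have "\<alpha> = 0" using tr by simp
    then have "m3 0 1 0 (- 1) 0 0 0 0 0 \<in> ?k" using subalgebra_scale[OF sub Fk, of "1 / \<beta>"] e by simp
    then show ?thesis using planar_type_elliptic[OF k'] Q(1) by blast
  qed
next
  case False
  have sub: "subalgebra k" using k by (simp add: planar_algebra_def)
  show ?thesis
  proof (cases "k = {0}")
    case True
    have "m3 0 0 0 0 0 0 0 0 (- 0 - (0 :: real)) = 0" by (simp add: m3_zero)
    then have "\<exists>a b. (0 :: real^3^3) = m3 a 0 0 0 b 0 0 0 (- a - b)" by metis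
    moreover have "\<forall>X\<in>k. \<exists>c. X = c *\<^sub>R 0" using True by simp
    moreover have "0 \<in> k" using True by simp
    ultimately have "planar_type k" unfolding planar_type_def by blast
    then show ?thesis using planar_one conj_lie_one by metis
  next
    case False
    have "0 \<in> k" using sub by (simp add: subalgebra_def subspace_0)
    then obtain X1 where X1: "X1 \<in> k" "X1 \<noteq> 0" using False by blast
    then have X133: "X1$3$3 \<noteq> 0" using \<open>\<not> (\<exists>Y\<in>k. Y \<noteq> 0 \<and> Y$3$3 = 0)\<close> by blast
    have line: "\<exists>c. X = c *\<^sub>R X1" if X: "X \<in> k" for X
    proof -
      let ?Y = "1 *\<^sub>R X + (- (X$3$3 / X1$3$3)) *\<^sub>R X1"
      have "?Y \<in> k" by (rule subalgebra_lincomb[OF sub X X1(1)])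
      moreover have "?Y$3$3 = 0" using X133 by simp
      ultimately have "?Y = 0" using \<open>\<not> (\<exists>Y\<in>k. Y \<noteq> 0 \<and> Y$3$3 = 0)\<close> by blast
      then show ?thesis by (intro exI[of _ "X$3$3 / X1$3$3"]) simp
    qed
    obtain a b c d where x: "X1 = m3 a b 0 c d 0 0 0 (- a - d)" using k X1(1) by (auto simp: planar_algebra_def)
    obtain Q F \<alpha> \<beta> where Q: "planar Q" "X1 ** Q = Q ** F"
      and F: "F = m3 \<alpha> 0 0 0 \<beta> 0 0 0 (- a - d) \<or> F = m3 \<alpha> 1 0 0 \<alpha> 0 0 0 (- a - d) \<or> \<beta> \<noteq> 0 \<and> F = m3 \<alpha> \<beta> 0 (- \<beta>) \<alpha> 0 0 0 (- a - d)"
      using planar_normal_form[of a b c d "- a - d"] unfolding x by blast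
    let ?k = "conj_lie Q k"
    have k': "planar_algebra ?k" by (rule planar_algebra_conj[OF k Q(1)])
    have Fk: "F \<in> ?k" by (rule conj_lieI[OF X1(1) Q(2)])
    have tr: "F$3$3 = - F$1$1 - F$2$2" "F$3$3 \<noteq> 0"
      using Fk k' F X133 unfolding planar_algebra_def x by force+
    have lineF: "\<exists>c. Y = c *\<^sub>R F" if "Y \<in> ?k" for Y
    proof -
      obtain X where X: "X \<in> k" "X ** Q = Q ** Y" using \<open>Y \<in> ?k\<close> by (auto simp: conj_lie_def)
      obtain t where t: "X = t *\<^sub>R X1" using line[OF X(1)] by blast
      obtain P where P: "P ** Q = mat 1" "Q ** P = mat 1" using det_nonzero_inverse Q(1) by (auto simp: planar_def)
      have "Q ** Y = Q ** (t *\<^sub>R F)" unfolding X(2)[symmetric] t by (simp add: matrix_mult_scaleR_left matrix_mult_scaleR_right Q(2))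
      then have "P ** Q ** Y = P ** Q ** (t *\<^sub>R F)" by (simp only: matrix_mul_assoc[symmetric])
      then show ?thesis unfolding P by auto
    qed
    have "planar_type ?k"
    proof -
      have "(\<exists>a b. F = m3 a 0 0 0 b 0 0 0 (- a - b)) \<or> (\<exists>a. a \<noteq> 0 \<and> F = m3 a 1 0 0 a 0 0 0 (- 2 * a)) \<or>
       (\<exists>a b. b \<noteq> 0 \<and> F = m3 a b 0 (- b) a 0 0 0 (- 2 * a))"
        using F tr by auto
      then show ?thesis unfolding planar_type_def using lineF Fk by blast
    qed
    then show ?thesis using Q(1) by blast
  qed
qed

section \<open>Cartan-decomposition subgroups contain a listed subgroup\<close>

lemma conj_lie_cancel: "det (Q :: real^3^3) \<noteq> 0 \<Longrightarrow> Q ** Y = Q ** Z \<Longrightarrow> Y = Z"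
  by (metis det_nonzero_inverse matrix_mul_assoc matrix_mul_lid)

text \<open>The factor c allows B to be carried to a multiple of the normalised B'.\<close>

lemma conj_lie_span:
  assumes Q: "det Q \<noteq> 0" and span: "\<And>X. X \<in> k \<Longrightarrow> \<exists>s t. X = s *\<^sub>R A + t *\<^sub>R B"
    and A: "A ** Q = Q ** A'" and B: "B ** Q = c *\<^sub>R (Q ** B')" and Y: "Y \<in> conj_lie Q k"
  shows "\<exists>s t. Y = s *\<^sub>R A' + t *\<^sub>R B'"
proof -
  obtain X where X: "X \<in> k" "X ** Q = Q ** Y" using Y by (auto simp: conj_lie_def)
  obtain s t where st: "X = s *\<^sub>R A + t *\<^sub>R B" using span[OF X(1)] by blast
  have "Q ** Y = Q ** (s *\<^sub>R A' + (t * c) *\<^sub>R B')"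
    unfolding X(2)[symmetric] st
    by (simp add: matrix_add_ldistrib matrix_add_rdistrib matrix_mult_scaleR_left matrix_mult_scaleR_right A B)
  then show ?thesis using conj_lie_cancel[OF Q] by blast
qed

text \<open>A permutation of coordinates moves this root space to position (1,2); the eigenvalue
  that must not lie strictly between the other two is the one not involved in the root.\<close>

lemma contains_root_13:
  assumes H: "cds H" and X: "m3 p 0 0 0 q 0 0 0 r \<in> lie H" "m3 0 0 1 0 0 0 0 0 0 \<in> lie H"
    and pq: "p \<noteq> 0 \<or> r \<noteq> 0" "\<not> (p < q \<and> q < r)" "\<not> (r < q \<and> q < p)"
  shows "contains_standard H"
proof (rule wlog_conj[OF H, of "m3 1 0 0 0 0 1 0 1 0"])
  fix H' assume H': "cds H'" and l: "lie H' = conj_lie (m3 1 0 0 0 0 1 0 1 0) (lie H)"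
  have "m3 p 0 0 0 r 0 0 0 q \<in> lie H'" unfolding l by (rule conj_lieI[OF X(1)]) simp
  moreover have "m3 0 1 0 0 0 0 0 0 0 \<in> lie H'" unfolding l by (rule conj_lieI[OF X(2)]) simp
  moreover have "p + r + q = 0" using lie_trace[OF H X(1)] by simp
  ultimately show "contains_standard H'" using contains_root[OF H' pq] by blast
qed simp

lemma contains_root_23:
  assumes H: "cds H" and X: "m3 p 0 0 0 q 0 0 0 r \<in> lie H" "m3 0 0 0 0 0 1 0 0 0 \<in> lie H"
    and pq: "q \<noteq> 0 \<or> r \<noteq> 0" "\<not> (q < p \<and> p < r)" "\<not> (r < p \<and> p < q)"
  shows "contains_standard H"
proof (rule wlog_conj[OF H, of "m3 0 0 1 1 0 0 0 1 0"])
  fix H' assume H': "cds H'" and l: "lie H' = conj_lie (m3 0 0 1 1 0 0 0 1 0) (lie H)"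
  have "m3 q 0 0 0 r 0 0 0 p \<in> lie H'" unfolding l by (rule conj_lieI[OF X(1)]) simp
  moreover have "m3 0 1 0 0 0 0 0 0 0 \<in> lie H'" unfolding l by (rule conj_lieI[OF X(2)]) simp
  moreover have "q + r + p = 0" using lie_trace[OF H X(1)] by simp
  ultimately show "contains_standard H'" using contains_root[OF H' pq] by blast
qed simp

text \<open>All translations of the plane are present, so the Lie algebra is the semidirect product
  of them with the planar algebra \<open>k\<close> of elements without translation part. Planar
  conjugation preserves the translations, and each type of \<open>k\<close> yields a listed group or
  leaves H inside the Euclidean motions.\<close>

lemma affine_case:
  assumes H: "cds H" and E: "m3 0 0 1 0 0 0 0 0 0 \<in> lie H" "m3 0 0 0 0 0 1 0 0 0 \<in> lie H"
    and par: "\<And>X. X \<in> lie H \<Longrightarrow> X$3$1 = 0 \<and> X$3$2 = 0"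
  shows "contains_standard H"
proof -
  have sub: "subalgebra (lie H)" by (rule subalgebra_lie[OF H])
  define k where "k = {X \<in> lie H. X$1$3 = 0 \<and> X$2$3 = 0}"
  have k: "planar_algebra k"
    unfolding planar_algebra_def
  proof (intro conjI ballI)
    show "subalgebra k"
      unfolding subalgebra_def subspace_def
    proof (intro conjI ballI allI)
      have s: "subspace (lie H)" using sub by (simp add: subalgebra_def)
      show "0 \<in> k" using subspace_0[OF s] by (simp add: k_def)
      fix X assume X: "X \<in> k"
      then show "c *\<^sub>R X \<in> k" for c using subspace_scale[OF s] by (simp add: k_def)
      fix Y assume Y: "Y \<in> k"
      show "X + Y \<in> k" using X Y subspace_add[OF s] by (simp add: k_def)
      have "X$3$1 = 0 \<and> X$3$2 = 0" "Y$3$1 = 0 \<and> Y$3$2 = 0" using X Y par by (auto simp: k_def)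
      then show "X ** Y - Y ** X \<in> k" using X Y subalgebra_bracket[OF sub] by (simp add: k_def matrix3_mult_nth)
    qed
    fix X assume X: "X \<in> k"
    then have "X$3$3 = - X$1$1 - X$2$2" using lie_trace[OF H, of X] by (auto simp: k_def)
    with X have "X = m3 (X$1$1) (X$1$2) 0 (X$2$1) (X$2$2) 0 0 0 (- X$1$1 - X$2$2)"
      using par by (intro matrix3_eqI) (auto simp: k_def)
    then show "\<exists>a b c d. X = m3 a b 0 c d 0 0 0 (- a - d)" by blast
  qed
  obtain Q where Q: "planar Q" "planar_type (conj_lie Q k)" using planar_algebra_classification[OF k] by blast
  then obtain x y z w where q: "Q = m3 x y 0 z w 0 0 0 1" "det Q \<noteq> 0" by (auto simp: planar_def)
  show ?thesis
  proof (rule wlog_conj[OF H q(2)])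
    fix H' assume H': "cds H'" and l: "lie H' = conj_lie Q (lie H)"
    have kl: "conj_lie Q k \<subseteq> lie H'" unfolding l by (auto simp: conj_lie_def k_def)
    have xz: "m3 0 0 x 0 0 z 0 0 0 \<in> lie H" and yw: "m3 0 0 y 0 0 w 0 0 0 \<in> lie H"
      using lie_lincomb[OF H E, of x z] lie_lincomb[OF H E, of y w] by simp_all
    have E': "m3 0 0 1 0 0 0 0 0 0 \<in> lie H'" "m3 0 0 0 0 0 1 0 0 0 \<in> lie H'"
      unfolding l by (rule conj_lieI[OF xz], simp add: q, rule conj_lieI[OF yw], simp add: q)
    have proj: "m3 (Y$1$1) (Y$1$2) 0 (Y$2$1) (Y$2$2) 0 0 0 (Y$3$3) \<in> conj_lie Q k \<and> Y$3$1 = 0 \<and> Y$3$2 = 0"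
      if Y: "Y \<in> lie H'" for Y
    proof -
      obtain X where X: "X \<in> lie H" "X ** Q = Q ** Y" using Y unfolding l by (auto simp: conj_lie_def)
      obtain a b c d e f g h i where m: "X = m3 a b c d e f g h i" by (rule m3_cases)
      obtain a' b' c' d' e' f' g' h' i' where y: "Y = m3 a' b' c' d' e' f' g' h' i'" by (rule m3_cases)
      have gh: "g = 0" "h = 0" using par[OF X(1)] by (simp_all add: m)
      have eq: "a * x + b * z = x * a' + y * d'" "a * y + b * w = x * b' + y * e'" "d * x + e * z = z * a' + w * d'"
        "d * y + e * w = z * b' + w * e'" "g' = 0" "h' = 0" "i = i'"
        using X(2) unfolding m y q gh by auto
      have "m3 a b 0 d e 0 0 0 i \<in> lie H"
        using subalgebra_lincomb[OF sub X(1) subalgebra_lincomb[OF sub E, of "- c" "- f"], of 1 1] by (simp add: m gh)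
      then have "m3 a b 0 d e 0 0 0 i \<in> k" by (simp add: k_def)
      then have "m3 a' b' 0 d' e' 0 0 0 i' \<in> conj_lie Q k" by (rule conj_lieI) (simp add: q eq)
      then show ?thesis using eq by (simp add: y)
    qed
    show "contains_standard H'"
      using Q(2) unfolding planar_type_def
    proof (elim disjE bexE conjE exE)
      assume "m3 0 1 0 0 0 0 0 0 0 \<in> conj_lie Q k"
      then have "m3 0 1 0 0 0 1 0 0 0 \<in> lie H'" using kl lie_lincomb[OF H' _ E'(2), of _ 1 1] by fastforce
      then show ?thesis using contains_unipotent[OF H' _ E'(1)] by blast
    next
      assume "\<forall>a b. m3 a 0 0 0 b 0 0 0 (- a - b) \<in> conj_lie Q k"
      then show ?thesis using contains_diagonal kl by blast
    next
      assume "m3 1 1 0 (- 1) 1 0 0 0 (- 2) \<in> conj_lie Q k"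
      then show ?thesis using contains_spiral[OF H' E', of 1] kl by auto
    next
      fix X0 a b assume X0: "X0 \<in> conj_lie Q k" "\<forall>X\<in>conj_lie Q k. \<exists>c. X = c *\<^sub>R X0" and x: "X0 = m3 a 0 0 0 b 0 0 0 (- a - b)"
      show ?thesis
      proof (cases "a = 0 \<and> b = 0")
        case True
        have "X$1$1 = 0 \<and> X$2$2 = 0 \<and> X$1$2 = - X$2$1 \<and> X$3$1 = 0 \<and> X$3$2 = 0 \<and> X$3$3 = 0" if X: "X \<in> lie H'" for X
        proof -
          obtain c where "m3 (X$1$1) (X$1$2) 0 (X$2$1) (X$2$2) 0 0 0 (X$3$3) = c *\<^sub>R X0" using X0(2) proj[OF X] by blast
          then show ?thesis using proj[OF X] True by (simp add: x)
        qed
        then show ?thesis using not_cds_euclidean[OF H'] by blast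
      next
        case False
        have X0': "m3 a 0 0 0 b 0 0 0 (- a - b) \<in> lie H'" using X0(1) kl x by blast
        \<comment> \<open>Two different entries cannot both lie strictly between the other two, so
          at least one of the two translation directions gives an admissible root.\<close>
        consider "\<not> (a < b \<and> b < - a - b) \<and> \<not> (- a - b < b \<and> b < a)" | "\<not> (b < a \<and> a < - a - b) \<and> \<not> (- a - b < a \<and> a < b)"
          by linarith
        then show ?thesis
        proof cases
          case 1
          then show ?thesis using contains_root_13[OF H' X0' E'(1)] False by force
        next
          case 2
          then show ?thesis using contains_root_23[OF H' X0' E'(2)] False by force
        qed
      qed
    next
      fix X0 a assume X0: "X0 \<in> conj_lie Q k" and a: "a \<noteq> 0" and x: "X0 = m3 a 1 0 0 a 0 0 0 (- 2 * a)"
      have X: "m3 a 1 0 0 a 0 0 0 (- 2 * a) \<in> lie H'" using X0 kl x by blast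
      show ?thesis
      \<comment> \<open>Rescaling the second coordinate makes the nilpotent entry equal to the
        eigenvalue once the latter is normalised to 1.\<close>
      proof (rule wlog_conj[OF H', of "m3 1 0 0 0 a 0 0 0 1"])
        fix K assume K: "cds K" and lK: "lie K = conj_lie (m3 1 0 0 0 a 0 0 0 1) (lie H')"
        have "m3 1 1 0 0 1 0 0 0 (- 2) \<in> lie K"
          unfolding lK by (rule conj_lieI[OF lie_scale[OF H' X, of "1 / a"]]) (simp add: a)
        moreover have "m3 0 0 1 0 0 0 0 0 0 \<in> lie K" unfolding lK by (rule conj_lieI[OF E'(1)]) simp
        moreover have "m3 0 0 0 0 0 1 0 0 0 \<in> lie K"
          unfolding lK by (rule conj_lieI[OF lie_scale[OF H' E'(2), of a]]) simp
        ultimately show "contains_standard K" using contains_jordan[OF K] by blast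
      qed (use a in simp)
    next
      fix X0 a b assume X0: "X0 \<in> conj_lie Q k" "\<forall>X\<in>conj_lie Q k. \<exists>c. X = c *\<^sub>R X0"
        and b: "b \<noteq> 0" and x: "X0 = m3 a b 0 (- b) a 0 0 0 (- 2 * a)"
      show ?thesis
      proof (cases "a = 0")
        case True
        have "X$1$1 = 0 \<and> X$2$2 = 0 \<and> X$1$2 = - X$2$1 \<and> X$3$1 = 0 \<and> X$3$2 = 0 \<and> X$3$3 = 0" if X: "X \<in> lie H'" for X
        proof -
          obtain c where "m3 (X$1$1) (X$1$2) 0 (X$2$1) (X$2$2) 0 0 0 (X$3$3) = c *\<^sub>R X0" using X0(2) proj[OF X] by blast
          then show ?thesis using proj[OF X] True by (simp add: x)
        qed
        then show ?thesis using not_cds_euclidean[OF H'] by blast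
      next
        case False
        have "m3 1 (b / a) 0 (- (b / a)) 1 0 0 0 (- 2) \<in> lie H'"
          using lie_scale[OF H', of X0 "1 / a"] X0(1) kl x False by auto
        then show ?thesis using contains_spiral[OF H' E', of "b / a"] b False by simp
      qed
    qed
  qed
qed

section \<open>Upper triangular Lie algebras containing the corner root\<close>

definition upper :: "real^3^3 \<Rightarrow> bool"
  where "upper X \<longleftrightarrow> X$2$1 = 0 \<and> X$3$1 = 0 \<and> X$3$2 = 0"

lemma upper_conj:
  assumes up: "\<And>X. X \<in> k \<Longrightarrow> upper X" and Q: "Q = m3 p a b 0 q c 0 0 r" "det Q \<noteq> 0" and Y: "Y \<in> conj_lie Q k"
  shows "upper Y"
proof -
  obtain X where X: "X \<in> k" "X ** Q = Q ** Y" using Y by (auto simp: conj_lie_def)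
  obtain a' b' c' d' e' f' g' h' i' where y: "Y = m3 a' b' c' d' e' f' g' h' i'" by (rule m3_cases)
  have nz: "p \<noteq> 0" "q \<noteq> 0" "r \<noteq> 0" using Q by auto
  have "X$2$1 = 0" "X$3$1 = 0" "X$3$2 = 0" using up[OF X(1)] by (auto simp: upper_def)
  then have x: "X = m3 (X$1$1) (X$1$2) (X$1$3) 0 (X$2$2) (X$2$3) 0 0 (X$3$3)" by (intro matrix3_eqI) auto
  have "r * g' = 0" "r * h' = 0" "q * d' + c * g' = 0"
    using X(2) unfolding y Q(1) by (subst (asm) x, simp)+
  then show ?thesis using nz by (auto simp: upper_def y)
qed

lemma upper_form:
  assumes H: "cds H" and X: "X \<in> lie H" "upper X"
  obtains a b c d e where "X = m3 a b c 0 d e 0 0 (- a - d)"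
proof
  show "X = m3 (X$1$1) (X$1$2) (X$1$3) 0 (X$2$2) (X$2$3) 0 0 (- X$1$1 - X$2$2)"
    using X(2) lie_trace[OF H X(1)] by (intro matrix3_eqI) (auto simp: upper_def)
qed

lemma upper_flip: "upper (flip_lie Y) \<longleftrightarrow> upper Y"
  by (cases Y rule: m3_cases) (auto simp: upper_def)

text \<open>The corner entry can be subtracted. One nonzero superdiagonal entry then completes the
  translations, directly or after \<open>flip\<close>; two of them can be rescaled to the regular
  nilpotent of \<open>unipotent_subgroup\<close>.\<close>

lemma triangular_nilpotent:
  assumes H: "cds H" and up: "\<And>X. X \<in> lie H \<Longrightarrow> upper X" and E: "m3 0 0 1 0 0 0 0 0 0 \<in> lie H"
    and X: "m3 0 x z 0 0 y 0 0 0 \<in> lie H" and xy: "x \<noteq> 0 \<or> y \<noteq> 0"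
  shows "contains_standard H"
proof -
  have X': "m3 0 x 0 0 0 y 0 0 0 \<in> lie H" using lie_lincomb[OF H X E, of 1 "- z"] by simp
  consider (y) "x = 0" "y \<noteq> 0" | (x) "x \<noteq> 0" "y = 0" | (both) "x \<noteq> 0" "y \<noteq> 0" using xy by blast
  then show ?thesis
  proof cases
    case y
    then have "m3 0 0 0 0 0 1 0 0 0 \<in> lie H" using lie_scale[OF H X', of "1 / y"] by simp
    then show ?thesis using affine_case[OF H E] up by (auto simp: upper_def)
  next
    case x
    have E12: "m3 0 (- 1) 0 0 0 0 0 0 0 \<in> lie H" using lie_scale[OF H X', of "- 1 / x"] x by simp
    have E13: "m3 0 0 (- 1) 0 0 0 0 0 0 \<in> lie H" using lie_scale[OF H E, of "- 1"] by simp
    show ?thesis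
    proof (rule wlog_flip[OF H])
      fix H' assume H': "cds H'" and l: "\<And>Y. Y \<in> lie H' \<longleftrightarrow> flip_lie Y \<in> lie H"
      have "m3 0 0 1 0 0 0 0 0 0 \<in> lie H'" "m3 0 0 0 0 0 1 0 0 0 \<in> lie H'"
        unfolding l using E12 E13 by simp_all
      moreover have "upper Y" if "Y \<in> lie H'" for Y using up l that upper_flip by blast
      ultimately show "contains_standard H'" using affine_case[OF H'] by (auto simp: upper_def)
    qed
  next
    case both
    show ?thesis
    proof (rule wlog_conj[OF H, of "m3 (x * y) 0 0 0 y 0 0 0 1"])
      fix H' assume H': "cds H'" and l: "lie H' = conj_lie (m3 (x * y) 0 0 0 y 0 0 0 1) (lie H)"
      have "m3 0 1 0 0 0 1 0 0 0 \<in> lie H'" unfolding l by (rule conj_lieI[OF X']) simp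
      moreover have "m3 0 0 1 0 0 0 0 0 0 \<in> lie H'" unfolding l by (rule conj_lieI[OF lie_scale[OF H E, of "x * y"]]) simp
      ultimately show "contains_standard H'" by (rule contains_unipotent[OF H'])
    qed (use both in simp)
  qed
qed

lemma diagonalize_upper:
  fixes d1 d2 d3 x y z :: real
  assumes "d1 \<noteq> d2" "d2 \<noteq> d3" "d1 \<noteq> d3"
  shows "\<exists>u v w. m3 d1 x z 0 d2 y 0 0 d3 ** m3 1 u w 0 1 v 0 0 1 = m3 1 u w 0 1 v 0 0 1 ** m3 d1 0 0 0 d2 0 0 0 d3"
proof -
  define u v w where "u = x / (d2 - d1)" and "v = y / (d3 - d2)" and "w = (x * (y / (d3 - d2)) + z) / (d3 - d1)"
  have "(d2 - d1) * u = x" "(d3 - d2) * v = y" "(d3 - d1) * w = x * v + z" using assms by (simp_all add: u_def v_def w_def)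
  then have "d1 * u + x = u * d2" "d2 * v + y = v * d3" "d1 * w + x * v + z = w * d3" by (simp_all add: algebra_simps)
  then show ?thesis by (intro exI[of _ u] exI[of _ v] exI[of _ w]) simp
qed

text \<open>Commutators with the regular diagonal element turn any superdiagonal entry into a
  nilpotent. Otherwise everything is diagonal plus corner: either all diagonal matrices occur, or
  the diagonal part is a line, and the position of the middle eigenvalue decides between a listed
  group and \<open>not_cds_middle_root\<close>.\<close>

lemma triangular_diagonal:
  assumes H: "cds H" and up: "\<And>X. X \<in> lie H \<Longrightarrow> upper X" and E: "m3 0 0 1 0 0 0 0 0 0 \<in> lie H"
    and D: "m3 d1 0 0 0 d2 0 0 0 d3 \<in> lie H" and d: "d1 \<noteq> d2" "d2 \<noteq> d3" "d1 \<noteq> d3"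
  shows "contains_standard H"
proof (cases "\<exists>Y\<in>lie H. Y$1$2 \<noteq> 0 \<or> Y$2$3 \<noteq> 0")
  case True
  then obtain Y where Y: "Y \<in> lie H" "Y$1$2 \<noteq> 0 \<or> Y$2$3 \<noteq> 0" by blast
  obtain a b c e f where y: "Y = m3 a b c 0 e f 0 0 (- a - e)" using upper_form[OF H Y(1) up[OF Y(1)]] .
  have "m3 0 ((d1 - d2) * b) ((d1 - d3) * c) 0 0 ((d2 - d3) * f) 0 0 0 \<in> lie H"
    using cds_lie_bracket[OF H D Y(1)] by (simp add: y algebra_simps)
  then show ?thesis using triangular_nilpotent[OF H up E] Y(2) d by (simp add: y)
next
  case False
  have d3: "d3 = - d1 - d2" using lie_trace[OF H D] by simp
  have form: "\<exists>a b z. Y = m3 a 0 z 0 b 0 0 0 (- a - b) \<and> m3 a 0 0 0 b 0 0 0 (- a - b) \<in> lie H" if Y: "Y \<in> lie H" for Y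
  proof -
    obtain a b c e f where y: "Y = m3 a b c 0 e f 0 0 (- a - e)" using upper_form[OF H Y up[OF Y]] .
    have "b = 0" "f = 0" using False Y y by force+
    moreover have "m3 a b 0 0 e f 0 0 (- a - e) \<in> lie H" using lie_lincomb[OF H Y E, of 1 "- c"] by (simp add: y)
    ultimately show ?thesis unfolding y by auto
  qed
  show ?thesis
  proof (cases "\<exists>a b. m3 a 0 0 0 b 0 0 0 (- a - b) \<in> lie H \<and> d1 * b - d2 * a \<noteq> 0")
    case True
    then obtain a b where ab: "m3 a 0 0 0 b 0 0 0 (- a - b) \<in> lie H" "d1 * b - d2 * a \<noteq> 0" by blast
    have "m3 d1 0 0 0 d2 0 0 0 (- d1 - d2) \<in> lie H" using D d3 by simp
    then show ?thesis using contains_diagonal span_diagonal[OF subalgebra_lie[OF H] _ ab] by blast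
  next
    case par: False
    have line: "\<exists>t z. Y = m3 (d1 * t) 0 z 0 (d2 * t) 0 0 0 (d3 * t)" if Y: "Y \<in> lie H" for Y
    proof -
      obtain a b z where y: "Y = m3 a 0 z 0 b 0 0 0 (- a - b)" "m3 a 0 0 0 b 0 0 0 (- a - b) \<in> lie H" using form[OF Y] by blast
      then have e: "d1 * b = d2 * a" using par by auto
      define t where "t = (if d1 = 0 then b / d2 else a / d1)"
      have "d1 * t = a" "d2 * t = b" using e d by (auto simp: t_def field_simps)
      then show ?thesis unfolding y(1) d3 by (intro exI[of _ t] exI[of _ z]) (simp add: algebra_simps)
    qed
    have sum: "d1 + d2 + d3 = 0" using d3 by simp
    consider "d1 > d2 \<and> d2 > d3" | "d1 < d2 \<and> d2 < d3" | "\<not> (d1 < d2 \<and> d2 < d3)" "\<not> (d3 < d2 \<and> d2 < d1)" by blast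
    then show ?thesis
    proof cases
      case 1
      then show ?thesis using not_cds_middle_root[OF H _ _ sum line] by blast
    next
      case 2
      have "\<exists>t z. Y = m3 ((- d1) * t) 0 z 0 ((- d2) * t) 0 0 0 ((- d3) * t)" if Y: "Y \<in> lie H" for Y
      proof -
        obtain t z where "Y = m3 (d1 * t) 0 z 0 (d2 * t) 0 0 0 (d3 * t)" using line[OF Y] by blast
        then show ?thesis by (intro exI[of _ "- t"] exI[of _ z]) simp
      qed
      moreover have "- d1 > - d2" "- d2 > - d3" "- d1 + - d2 + - d3 = 0" using 2 sum by auto
      ultimately show ?thesis using not_cds_middle_root[OF H, of "- d2" "- d1" "- d3"] by blast
    next
      case 3
      then show ?thesis using contains_root_13[OF H D E] d by auto
    qed
  qed
qed

text \<open>The eigenvalue gap 3d lets a conjugation clear the last column. If the double eigenvalue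
  is semisimple, the corner root and the diagonal element generate a listed group up to conjugation;
  otherwise rescaling leads to the algebra excluded by \<open>not_cds_jordan_corner\<close>.\<close>

lemma triangular_double_eigenvalue:
  assumes H: "cds H" and E: "m3 0 0 1 0 0 0 0 0 0 \<in> lie H" and X: "m3 d x z 0 d y 0 0 (- 2 * d) \<in> lie H" and d: "d \<noteq> 0"
    and span: "\<And>Y. Y \<in> lie H \<Longrightarrow> \<exists>s t. Y = s *\<^sub>R m3 d x z 0 d y 0 0 (- 2 * d) + t *\<^sub>R m3 0 0 1 0 0 0 0 0 0"
  shows "contains_standard H"
proof -
  define v where "v = - y / (3 * d)"
  define w where "w = - (x * v + z) / (3 * d)"
  let ?Q = "m3 1 0 w 0 1 v 0 0 1"
  have "3 * d * v = - y" "3 * d * w = - (x * v + z)" using d by (simp_all add: v_def w_def)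
  then have "d * v + y = - 2 * d * v" "d * w + x * v + z = - 2 * d * w" by linarith+
  then have XQ: "m3 d x z 0 d y 0 0 (- 2 * d) ** ?Q = ?Q ** m3 d x 0 0 d 0 0 0 (- 2 * d)" by (simp add: mult.commute)
  have EQ: "m3 0 0 1 0 0 0 0 0 0 ** ?Q = ?Q ** m3 0 0 1 0 0 0 0 0 0" by simp
  have detQ: "det ?Q \<noteq> 0" by simp
  show ?thesis
  proof (rule wlog_conj[OF H detQ])
    fix H' assume H': "cds H'" and l: "lie H' = conj_lie ?Q (lie H)"
    have X': "m3 d x 0 0 d 0 0 0 (- 2 * d) \<in> lie H'" unfolding l by (rule conj_lieI[OF X XQ])
    have E': "m3 0 0 1 0 0 0 0 0 0 \<in> lie H'" unfolding l by (rule conj_lieI[OF E EQ])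
    have span': "\<exists>s t. Y = s *\<^sub>R m3 d x 0 0 d 0 0 0 (- 2 * d) + t *\<^sub>R m3 0 0 1 0 0 0 0 0 0" if "Y \<in> lie H'" for Y
      by (rule conj_lie_span[OF detQ span XQ _ that[unfolded l], of 1]) (simp_all add: EQ[simplified])
    show "contains_standard H'"
    proof (cases "x = 0")
      case True
      then show ?thesis using contains_root_13[OF H' _ E', of d d "- 2 * d"] X' d by auto
    next
      case False
      let ?R = "m3 x 0 0 0 d 0 0 0 1"
      have detR: "det ?R \<noteq> 0" using False d by simp
      have XR: "m3 d x 0 0 d 0 0 0 (- 2 * d) ** ?R = ?R ** m3 d d 0 0 d 0 0 0 (- 2 * d)" by simp
      have ER: "m3 0 0 1 0 0 0 0 0 0 ** ?R = (1 / x) *\<^sub>R (?R ** m3 0 0 1 0 0 0 0 0 0)" using False by simp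
      show ?thesis
      proof (rule wlog_conj[OF H' detR])
        fix K assume K: "cds K" and lK: "lie K = conj_lie ?R (lie H')"
        have "\<exists>t z. Y = m3 t t z 0 t 0 0 0 (- 2 * t)" if Y: "Y \<in> lie K" for Y
        proof -
          obtain s t where "Y = s *\<^sub>R m3 d d 0 0 d 0 0 0 (- 2 * d) + t *\<^sub>R m3 0 0 1 0 0 0 0 0 0"
            using conj_lie_span[OF detR span' XR ER Y[unfolded lK]] by blast
          then show ?thesis by (intro exI[of _ "s * d"] exI[of _ t]) simp
        qed
        then show "contains_standard K" using not_cds_jordan_corner[OF K] by blast
      qed
    qed
  qed
qed

text \<open>If the diagonals of X and Y were independent, a combination would have diagonal (1, 0,
  -1), with three different entries.\<close>

lemma proportional_diagonals:
  assumes H: "cds H" and X: "X \<in> lie H" and Y: "Y \<in> lie H"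
    and rep: "\<not> (\<exists>X\<in>lie H. X$1$1 \<noteq> X$2$2 \<and> X$2$2 \<noteq> X$3$3 \<and> X$1$1 \<noteq> X$3$3)"
  shows "X$1$1 * Y$2$2 - X$2$2 * Y$1$1 = 0"
proof (rule ccontr)
  define r where "r = X$1$1 * Y$2$2 - X$2$2 * Y$1$1"
  assume "X$1$1 * Y$2$2 - X$2$2 * Y$1$1 \<noteq> 0"
  then have r: "r \<noteq> 0" by (simp add: r_def)
  let ?Z = "(Y$2$2 / r) *\<^sub>R X + (- X$2$2 / r) *\<^sub>R Y"
  have Z: "?Z \<in> lie H" by (rule lie_lincomb[OF H X Y])
  have e1: "?Z$1$1 = 1"
  proof -
    have "?Z$1$1 = (X$1$1 * Y$2$2 - X$2$2 * Y$1$1) / r" by (simp add: diff_divide_distrib mult.commute)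
    then show ?thesis using r by (simp add: r_def)
  qed
  have e2: "?Z$2$2 = 0" by simp
  have "?Z$3$3 = -1" using lie_trace[OF H Z] e1 e2 by linarith
  then show False using rep Z e1 e2 by (metis one_neq_neg_one zero_neq_one zero_neq_neg_one)
qed

text \<open>Without further nilpotents and without an element having three distinct diagonal
  entries, the diagonals are proportional, so the Lie algebra is spanned by the corner and at most
  one more element X. Two of the eigenvalues of X coincide; the three possible positions are treated
  separately, the second being the \<open>flip\<close> of the first.\<close>

lemma triangular_with_root:
  assumes H: "cds H" and up: "\<And>X. X \<in> lie H \<Longrightarrow> upper X" and E: "m3 0 0 1 0 0 0 0 0 0 \<in> lie H"
  shows "contains_standard H"
proof (cases "\<exists>x y z. m3 0 x z 0 0 y 0 0 0 \<in> lie H \<and> (x \<noteq> 0 \<or> y \<noteq> 0)")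
  case True
  then show ?thesis using triangular_nilpotent[OF H up E] by blast
next
  case nil: False
  show ?thesis
  proof (cases "\<exists>X\<in>lie H. X$1$1 \<noteq> X$2$2 \<and> X$2$2 \<noteq> X$3$3 \<and> X$1$1 \<noteq> X$3$3")
    case True
    then obtain X where X: "X \<in> lie H" "X$1$1 \<noteq> X$2$2" "X$2$2 \<noteq> X$3$3" "X$1$1 \<noteq> X$3$3" by blast
    obtain a b c d e where x: "X = m3 a b c 0 d e 0 0 (- a - d)" using upper_form[OF H X(1) up[OF X(1)]] .
    have dis: "a \<noteq> d" "d \<noteq> - a - d" "a \<noteq> - a - d" using X unfolding x by simp_all
    obtain u v w where Q: "X ** m3 1 u w 0 1 v 0 0 1 = m3 1 u w 0 1 v 0 0 1 ** m3 a 0 0 0 d 0 0 0 (- a - d)"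
      using diagonalize_upper[OF dis, of b c e] unfolding x by blast
    let ?Q = "m3 1 u w 0 1 v 0 0 1"
    show ?thesis
    proof (rule wlog_conj[OF H, of ?Q])
      fix H' assume H': "cds H'" and l: "lie H' = conj_lie ?Q (lie H)"
      have "upper Y" if "Y \<in> lie H'" for Y using upper_conj[OF up, of "lie H" ?Q 1 u w 1 v 1 Y] that unfolding l by simp
      moreover have "m3 0 0 1 0 0 0 0 0 0 \<in> lie H'" unfolding l by (rule conj_lieI[OF E]) simp
      moreover have "m3 a 0 0 0 d 0 0 0 (- a - d) \<in> lie H'" unfolding l by (rule conj_lieI[OF X(1) Q])
      ultimately show "contains_standard H'" using triangular_diagonal[OF H'] dis by blast
    qed simp
  next
    case rep: False
    show ?thesis
    proof (cases "\<exists>X\<in>lie H. X$1$1 \<noteq> 0 \<or> X$2$2 \<noteq> 0")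
      case False
      have "X$1$1 = 0 \<and> X$2$2 = 0 \<and> X$1$2 = - X$2$1 \<and> X$3$1 = 0 \<and> X$3$2 = 0 \<and> X$3$3 = 0" if X: "X \<in> lie H" for X
      proof -
        obtain a b c d e where x: "X = m3 a b c 0 d e 0 0 (- a - d)" using upper_form[OF H X up[OF X]] .
        have "a = 0" "d = 0" using False X x by force+
        then have "b = 0" using nil X x by auto
        then show ?thesis using \<open>a = 0\<close> \<open>d = 0\<close> by (simp add: x)
      qed
      then show ?thesis using not_cds_euclidean[OF H] by blast
    next
      case True
      then obtain X where X: "X \<in> lie H" "X$1$1 \<noteq> 0 \<or> X$2$2 \<noteq> 0" by blast
      obtain a b c d e where x: "X = m3 a b c 0 d e 0 0 (- a - d)" using upper_form[OF H X(1) up[OF X(1)]] .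
      have ad: "a \<noteq> 0 \<or> d \<noteq> 0" using X(2) by (simp add: x)
      have span: "\<exists>s t. Y = s *\<^sub>R X + t *\<^sub>R m3 0 0 1 0 0 0 0 0 0" if Y: "Y \<in> lie H" for Y
      proof -
        obtain a' b' c' d' e' where y: "Y = m3 a' b' c' 0 d' e' 0 0 (- a' - d')" using upper_form[OF H Y up[OF Y]] .
        have det0: "a * d' - d * a' = 0" using proportional_diagonals[OF H X(1) Y rep] by (simp add: x y)
        define t where "t = (if a = 0 then d' / d else a' / a)"
        have t: "t * a = a'" "t * d = d'" using det0 ad by (auto simp: t_def field_simps)
        let ?Z = "1 *\<^sub>R Y + (- t) *\<^sub>R X"
        have Z: "?Z \<in> lie H" by (rule lie_lincomb[OF H Y X(1)])
        have z: "?Z = m3 0 (b' - t * b) (c' - t * c) 0 0 (e' - t * e) 0 0 0"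
          using t by (simp add: x y algebra_simps)
        have "\<not> (b' - t * b \<noteq> 0 \<or> e' - t * e \<noteq> 0)" using nil Z unfolding z by blast
        then have "Y = t *\<^sub>R X + (c' - t * c) *\<^sub>R m3 0 0 1 0 0 0 0 0 0" using t by (simp add: x y algebra_simps)
        then show ?thesis by blast
      qed
      have "a = d \<or> d = - a - d \<or> a = - a - d" using rep X(1) by (auto simp: x)
      then consider "a = d" | "d = - a - d" "a \<noteq> d" | "a = - a - d" "a \<noteq> d" by blast
      then show ?thesis
      proof cases
        case 1
        then have "X = m3 a b c 0 a e 0 0 (- 2 * a)" by (simp add: x)
        then show ?thesis using triangular_double_eigenvalue[OF H E, of a b c e] X(1) ad 1 span by simp
      next
        case 2
        then have a: "a = - 2 * d" "d \<noteq> 0" using ad by auto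
        have xf: "flip_lie X = m3 (- d) (- e) (- c) 0 (- d) (- b) 0 0 (- 2 * (- d))" using a by (simp add: x)
        show ?thesis
        proof (rule wlog_flip[OF H])
          fix H' assume H': "cds H'" and l: "\<And>Y. Y \<in> lie H' \<longleftrightarrow> flip_lie Y \<in> lie H"
          have E': "m3 0 0 1 0 0 0 0 0 0 \<in> lie H'" unfolding l using lie_scale[OF H E, of "- 1"] by simp
          have X': "flip_lie X \<in> lie H'" unfolding l using X(1) by simp
          have "\<exists>s t. Y = s *\<^sub>R flip_lie X + t *\<^sub>R m3 0 0 1 0 0 0 0 0 0" if Y: "Y \<in> lie H'" for Y
          proof -
            obtain s t where st: "flip_lie Y = s *\<^sub>R X + t *\<^sub>R m3 0 0 1 0 0 0 0 0 0" using span Y l by blast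
            have "Y = flip_lie (flip_lie Y)" by simp
            also have "\<dots> = s *\<^sub>R flip_lie X + (- t) *\<^sub>R m3 0 0 1 0 0 0 0 0 0" unfolding st by (simp add: x algebra_simps)
            finally show ?thesis by blast
          qed
          then show "contains_standard H'"
            using triangular_double_eigenvalue[OF H' E', of "- d" "- e" "- c" "- b"] X' a unfolding xf by simp
        qed
      next
        case 3
        then have d: "d = - 2 * a" "a \<noteq> 0" using ad by auto
        \<comment> \<open>With the equal eigenvalues at the ends, both superdiagonal entries can be
          cleared, and the corner entry is removed by means of the root itself.\<close>
        define u v where "u = - b / (3 * a)" and "v = e / (3 * a)"
        have "3 * a * u = - b" "3 * a * v = e" using d by (simp_all add: u_def v_def)
        then have uv: "a * u + b = u * d" "d * v + e = v * a" using d by (simp_all add: algebra_simps)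
        let ?Q = "m3 1 u 0 0 1 v 0 0 1"
        have XQ: "X ** ?Q = ?Q ** m3 a 0 (b * v + c) 0 d 0 0 0 a" using uv d by (simp add: x)
        show ?thesis
        proof (rule wlog_conj[OF H, of ?Q])
          fix H' assume H': "cds H'" and l: "lie H' = conj_lie ?Q (lie H)"
          have E': "m3 0 0 1 0 0 0 0 0 0 \<in> lie H'" unfolding l by (rule conj_lieI[OF E]) simp
          have "m3 a 0 (b * v + c) 0 d 0 0 0 a \<in> lie H'" unfolding l by (rule conj_lieI[OF X(1) XQ])
          from lie_lincomb[OF H' this E', of 1 "- (b * v + c)"] have "m3 a 0 0 0 d 0 0 0 a \<in> lie H'" by simp
          then show "contains_standard H'" using contains_root_13[OF H' _ E'] d by auto
        qed simp
      qed
    qed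
  qed
qed

section \<open>Lie algebras containing a rank-one nilpotent\<close>

lemma contains_heisenberg:
  assumes H: "cds H" and Q: "det Q \<noteq> 0" and X: "X \<in> lie H" "X ** Q = Q ** m3 0 c 0 0 0 0 0 0 0" "c \<noteq> 0"
    and Y: "Y \<in> lie H" "Y ** Q = Q ** m3 0 0 0 0 0 d 0 0 0" "d \<noteq> 0"
  shows "contains_standard H"
proof (rule wlog_conj[OF H Q])
  fix H' assume H': "cds H'" and l: "lie H' = conj_lie Q (lie H)"
  have 1: "m3 0 c 0 0 0 0 0 0 0 \<in> lie H'" "m3 0 0 0 0 0 d 0 0 0 \<in> lie H'"
    unfolding l using X Y conj_lieI by blast+
  have 2: "m3 0 1 0 0 0 1 0 0 0 \<in> lie H'" using lie_lincomb[OF H' 1, of "1 / c" "1 / d"] X(3) Y(3) by simp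
  \<comment> \<open>The commutator of the two nilpotents supplies the corner root, so the
    three-dimensional Heisenberg algebra is present.\<close>
  have "m3 0 0 (c * d) 0 0 0 0 0 0 \<in> lie H'" using cds_lie_bracket[OF H' 1] by simp
  from lie_scale[OF H' this, of "1 / (c * d)"] have "m3 0 0 1 0 0 0 0 0 0 \<in> lie H'" using X(3) Y(3) by simp
  then show "contains_standard H'" using contains_unipotent[OF H' 2] by blast
qed

text \<open>The rest of the Lie algebra decomposes under commutators with diag(1, -1, 0) into a
  central diagonal part and parts of weight 1 and -1. A central part completes the diagonal
  matrices; a vector of weight 1 yields a Heisenberg algebra or, through further commutators, a
  central part. If nothing is left, H lies in the planar block.\<close>

lemma sl2_case:
  assumes H: "cds H" and E: "m3 0 1 0 0 0 0 0 0 0 \<in> lie H" and F: "m3 0 0 0 1 0 0 0 0 0 \<in> lie H"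
  shows "contains_standard H"
proof -
  have H0: "m3 1 0 0 0 (- 1) 0 0 0 0 \<in> lie H" using cds_lie_bracket[OF H E F] by simp
  have central: "contains_standard H" if D: "m3 m 0 0 0 m 0 0 0 (- 2 * m) \<in> lie H" and m: "m \<noteq> 0" for m
  proof -
    have "m3 a 0 0 0 b 0 0 0 (- a - b) \<in> lie H" for a b
      using span_diagonal[OF subalgebra_lie[OF H], of 1 "-1" m m a b] H0 D m by simp
    then show ?thesis by (rule contains_diagonal)
  qed
  have weight: "contains_standard H" if Y: "m3 0 0 c 0 0 0 0 h 0 \<in> lie H" and ch: "c \<noteq> 0 \<or> h \<noteq> 0" for c h
  proof -
    have Z: "m3 0 0 0 0 0 c (- h) 0 0 \<in> lie H" using cds_lie_bracket[OF H F Y] by simp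
    consider "h = 0" "c \<noteq> 0" | "c = 0" "h \<noteq> 0" | "c \<noteq> 0" "h \<noteq> 0" using ch by blast
    then show ?thesis
    proof cases
      case 1
      show ?thesis by (rule contains_heisenberg[OF H _ E _ _ Z, of "mat 1" 1 c]) (use 1 in auto)
    next
      case 2
      show ?thesis
        by (rule contains_heisenberg[OF H _ Z _ _ E, of "m3 0 1 0 0 0 1 1 0 0" "- h" 1]) (use 2 in auto)
    next
      case 3
      have "m3 (- (c * h)) 0 0 0 (- (c * h)) 0 0 0 (- 2 * (- (c * h))) \<in> lie H"
        using cds_lie_bracket[OF H Y Z] by (simp add: algebra_simps)
      then show ?thesis by (rule central) (use 3 in simp)
    qed
  qed
  show ?thesis
  proof (cases "\<forall>X\<in>lie H. X$1$3 = 0 \<and> X$2$3 = 0 \<and> X$3$1 = 0 \<and> X$3$2 = 0 \<and> X$3$3 = 0")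
    case True
    then show ?thesis using not_cds_sl2[OF H] by blast
  next
    case False
    then obtain X where X: "X \<in> lie H" "\<not> (X$1$3 = 0 \<and> X$2$3 = 0 \<and> X$3$1 = 0 \<and> X$3$2 = 0 \<and> X$3$3 = 0)" by blast
    obtain a b c d e f g h i where x: "X = m3 a b c d e f g h i" by (rule m3_cases)
    define m n where "m = (a + e) / 2" and "n = (a - e) / 2"
    have ae: "a = m + n" "e = m - n" by (simp_all add: m_def n_def field_simps)
    have i: "i = - 2 * m" using lie_trace[OF H X(1)] by (simp add: x ae)
    have X1: "m3 m 0 c 0 m f g h (- 2 * m) \<in> lie H"
      using lie_lincomb[OF H X(1) lie_lincomb[OF H lie_lincomb[OF H E F, of "- b" "- d"] H0, of 1 "- n"], of 1 1]
      by (simp add: x i ae)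
    have X2: "m3 0 0 c 0 0 (- f) (- g) h 0 \<in> lie H" using cds_lie_bracket[OF H H0 X1] by simp
    \<comment> \<open>Applied twice, the commutator with diag(1, -1, 0) is the identity on both
      weight parts and zero on the central part, which separates all three.\<close>
    have X3: "m3 0 0 c 0 0 f g h 0 \<in> lie H" using cds_lie_bracket[OF H H0 X2] by simp
    have D: "m3 m 0 0 0 m 0 0 0 (- 2 * m) \<in> lie H" using lie_lincomb[OF H X1 X3, of 1 "-1"] by simp
    have Y: "m3 0 0 c 0 0 0 0 h 0 \<in> lie H" using lie_lincomb[OF H X2 X3, of "1/2" "1/2"] by simp
    have Y': "m3 0 0 0 0 0 f g 0 0 \<in> lie H" using lie_lincomb[OF H X2 X3, of "-1/2" "1/2"] by simp
    have Y'': "m3 0 0 f 0 0 0 0 (- g) 0 \<in> lie H" using cds_lie_bracket[OF H E Y'] by simp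
    have "m \<noteq> 0 \<or> (c \<noteq> 0 \<or> h \<noteq> 0) \<or> (f \<noteq> 0 \<or> - g \<noteq> 0)" using X(2) by (auto simp: x i ae)
    then show ?thesis using central[OF D] weight[OF Y] weight[OF Y''] by blast
  qed
qed

lemma lie_entry_derivative:
  "((\<lambda>t. mexp (t *\<^sub>R X) $ i $ j) has_real_derivative X $ i $ j) (at 0)" for X :: "real^3^3"
  by (rule has_real_derivative_nth[OF mexp_has_vector_derivative_0])

text \<open>Equations that hold on the group are differentiated along its one-parameter
  subgroups.\<close>

lemma lie_relation:
  assumes X: "X \<in> lie H" and F: "\<And>h. h \<in> H \<Longrightarrow> F h = (k :: real)"
    and D: "((\<lambda>t. F (mexp (t *\<^sub>R X))) has_real_derivative d) (at 0)"
  shows "d = 0"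
proof -
  have "((\<lambda>t. k) has_real_derivative d) (at 0)" using D by (simp add: F lie_mexp[OF X])
  then show ?thesis using DERIV_const DERIV_unique by blast
qed

lemma lie_entry_const:
  assumes X: "X \<in> lie H" and F: "\<And>h. h \<in> H \<Longrightarrow> h$i$j = k"
  shows "(X :: real^3^3)$i$j = 0"
  by (rule lie_relation[OF X, of "\<lambda>h. h$i$j" k]) (auto simp: F intro!: lie_entry_derivative)

lemma lie_entry_zero: "(\<And>h. h \<in> H \<Longrightarrow> h$i$j = 0) \<Longrightarrow> X \<in> lie H \<Longrightarrow> (X :: real^3^3)$i$j = 0"
  by (rule lie_entry_const)

text \<open>Products h g inherit the vanishing (3,1) entry, which forces every (3,2) entry to
  vanish. Conjugating the root by g then produces the second translation.\<close>

lemma root_affine: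
  assumes H: "cds H" and E: "m3 0 0 1 0 0 0 0 0 0 \<in> lie H" and z: "\<And>g. g \<in> H \<Longrightarrow> g$3$1 = 0"
    and g: "g \<in> H" "g$2$1 \<noteq> 0"
  shows "contains_standard H"
proof -
  have z2: "h$3$2 = 0" if h: "h \<in> H" for h
    using z[OF cds_mult[OF H h g(1)]] z[OF h] z[OF g(1)] g(2) by (simp add: matrix3_mult_nth)
  obtain a b c d e f k l m where x: "g = m3 a b c d e f k l m" by (rule m3_cases)
  have kl: "k = 0" "l = 0" "d \<noteq> 0" using z[OF g(1)] z2[OF g(1)] g(2) by (simp_all add: x)
  have det: "det g = 1" by (rule cds_det[OF H g(1)])
  then have I: "a * e - b * d \<noteq> 0" by (auto simp: x kl)
  define I where "I = a * e - b * d"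
  have "g ** m3 0 0 1 0 0 0 0 0 0 ** adj g \<in> lie H"
    using H lie_conj[OF _ g(1) adj_right[OF det] E] by (simp add: cds_iff)
  then have "m3 0 0 (a * I) 0 0 (d * I) 0 0 0 \<in> lie H" by (simp add: x kl I_def)
  from lie_lincomb[OF H this E, of "1 / (d * I)" "- a / d"]
  have "m3 0 0 0 0 0 1 0 0 0 \<in> lie H" using kl I by (simp add: I_def)
  then show ?thesis using affine_case[OF H E] lie_entry_zero[of H, OF z] lie_entry_zero[of H, OF z2] by blast
qed

text \<open>If some group element has nonzero (3,1) entry, the conjugate of the root is a second
  rank-one nilpotent not commuting with the first: a column times an orthogonal row, with alpha /= 0
  giving a planar sl(2) and alpha = 0 a Heisenberg algebra. If that entry vanishes on all of H,
  either H has an affine form, possibly after \<open>flip\<close>, or its Lie algebra is upper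
  triangular.\<close>

lemma root_case:
  assumes H: "cds H" and E: "m3 0 0 1 0 0 0 0 0 0 \<in> lie H"
  shows "contains_standard H"
proof (cases "\<forall>g\<in>H. g$3$1 = 0")
  case False
  then obtain g where g: "g \<in> H" "g$3$1 \<noteq> 0" by blast
  have det: "det g = 1" by (rule cds_det[OF H g(1)])
  define a b c where "a = g$1$1" and "b = g$2$1" and "c = g$3$1"
  define \<alpha> \<beta> \<gamma> where "\<alpha> = adj g$3$1" and "\<beta> = adj g$3$2" and "\<gamma> = adj g$3$3"
  have c: "c \<noteq> 0" using g(2) by (simp add: c_def)
  have orth: "\<alpha> * a + \<beta> * b + \<gamma> * c = 0"
    using arg_cong[OF adj_left[OF det], of "\<lambda>X. X$3$1"] by (simp add: matrix3_mult_nth \<alpha>_def \<beta>_def \<gamma>_def a_def b_def c_def mat_def)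
  have nz: "\<alpha> \<noteq> 0 \<or> \<beta> \<noteq> 0 \<or> \<gamma> \<noteq> 0"
    using arg_cong[OF adj_left[OF det], of "\<lambda>X. X$3$3"] by (auto simp: matrix3_mult_nth \<alpha>_def \<beta>_def \<gamma>_def mat_def)
  have "g ** m3 0 0 1 0 0 0 0 0 0 ** adj g = m3 (a*\<alpha>) (a*\<beta>) (a*\<gamma>) (b*\<alpha>) (b*\<beta>) (b*\<gamma>) (c*\<alpha>) (c*\<beta>) (c*\<gamma>)"
    by (rule matrix3_eqI) (simp_all add: matrix3_mult_nth a_def b_def c_def \<alpha>_def \<beta>_def \<gamma>_def)
  then have Ng: "m3 (a*\<alpha>) (a*\<beta>) (a*\<gamma>) (b*\<alpha>) (b*\<beta>) (b*\<gamma>) (c*\<alpha>) (c*\<beta>) (c*\<gamma>) \<in> lie H"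
    using H lie_conj[OF _ g(1) adj_right[OF det] E] by (simp add: cds_iff)
  show ?thesis
  proof (cases "\<alpha> = 0")
    case True
    have \<beta>: "\<beta> \<noteq> 0" using True nz orth c by auto
    have bc: "\<beta> * b + \<gamma> * c = 0" using orth True by simp
    have "a * \<beta> * b + a * \<gamma> * c = 0" "b * \<beta> * b + b * \<gamma> * c = 0" "c * \<beta> * b + c * \<gamma> * c = 0" using bc by algebra+
    then show ?thesis
      using c \<beta> by (intro contains_heisenberg[OF H _ E _ c Ng, of "m3 1 a 0 0 b (1 / \<beta>) 0 c 0" 1]) (simp_all add: True)
  next
    case False
    \<comment> \<open>The columns span the images of the two nilpotents, followed by a vector killed
      by both.\<close>
    let ?Q = "m3 1 a (- \<beta>) 0 b \<alpha> 0 c 0"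
    have detQ: "det ?Q \<noteq> 0" using c False by simp
    show ?thesis
    proof (rule wlog_conj[OF H detQ])
      fix H' assume H': "cds H'" and l: "lie H' = conj_lie ?Q (lie H)"
      have "m3 0 c 0 0 0 0 0 0 0 \<in> lie H'" unfolding l by (rule conj_lieI[OF E]) simp
      from lie_scale[OF H' this, of "1 / c"] have 1: "m3 0 1 0 0 0 0 0 0 0 \<in> lie H'" using c by simp
      have "a * \<alpha> * a + a * \<beta> * b + a * \<gamma> * c = 0" "b * \<alpha> * a + b * \<beta> * b + b * \<gamma> * c = 0" "c * \<alpha> * a + c * \<beta> * b + c * \<gamma> * c = 0"
        using orth by algebra+
      then have "m3 0 0 0 \<alpha> 0 0 0 0 0 \<in> lie H'" unfolding l by (intro conj_lieI[OF Ng]) simp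
      from lie_scale[OF H' this, of "1 / \<alpha>"] have "m3 0 0 0 1 0 0 0 0 0 \<in> lie H'" using False by simp
      then show "contains_standard H'" by (rule sl2_case[OF H' 1])
    qed
  qed
next
  case z: True
  have sub: "H \<subseteq> {g. det g = 1}" and grp: "matrix_subgroup H" using H by (auto simp: cds_iff)
  have up: "X$3$1 = 0" if "X \<in> lie H" for X using lie_entry_zero[of H 3 1 X] z that by blast
  consider (l) "\<exists>g\<in>H. g$2$1 \<noteq> 0" | (r) "\<exists>g\<in>H. g$3$2 \<noteq> 0" | (t) "\<forall>g\<in>H. g$2$1 = 0" "\<forall>g\<in>H. g$3$2 = 0" by blast
  then show ?thesis
  proof cases
    case l
    then show ?thesis using root_affine[OF H E] z by blast
  next
    case r
    then obtain g where g: "g \<in> H" "g$3$2 \<noteq> 0" by blast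
    have det: "det g = 1" by (rule cds_det[OF H g(1)])
    have fl: "flip X$3$1 = adj X$3$1" "flip X$2$1 = adj X$3$2" for X
      by (cases X rule: m3_cases, simp add: flip_def rev_perm_def)+
    have adjH: "adj x \<in> H" if "x \<in> H" for x using matrix_subgroup_adj[OF grp that] sub that by blast
    have "contains_standard (flip ` H)"
    proof (rule root_affine)
      show "cds (flip ` H)" by (rule cds_automorphism[OF flip_automorphism H])
      show "m3 0 0 1 0 0 0 0 0 0 \<in> lie (flip ` H)"
        unfolding lie_flip_image[OF sub] flip_lie_image_iff using lie_scale[OF H E, of "- 1"] by simp
      show "h$3$1 = 0" if "h \<in> flip ` H" for h using that z adjH fl by auto
      show "flip (adj g) \<in> flip ` H" using adjH g(1) by blast
      show "flip (adj g)$2$1 \<noteq> 0" using g(2) by (simp add: fl adj_adj[OF det])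
    qed
    then show ?thesis by (rule contains_standard_flip[OF sub])
  next
    case t
    have "upper X" if "X \<in> lie H" for X
      unfolding upper_def using lie_entry_zero[of H _ _ X] t z that by blast
    then show ?thesis using triangular_with_root[OF H _ E] by blast
  qed
qed

lemma corner_normal_form:
  assumes "x \<noteq> 0 \<or> y \<noteq> (0 :: real)"
  shows "\<exists>Q. det Q \<noteq> 0 \<and> m3 0 0 x 0 0 y 0 0 0 ** Q = Q ** m3 0 0 1 0 0 0 0 0 0"
proof (cases "x = 0")
  case True
  then show ?thesis using assms by (intro exI[of _ "m3 0 1 0 y 0 0 0 0 1"]) simp
next
  case False
  then show ?thesis by (intro exI[of _ "m3 x 0 0 y 1 0 0 0 1"]) simp
qed

lemma corner_case:
  assumes H: "cds H" and X: "m3 0 0 x 0 0 y 0 0 0 \<in> lie H" and xy: "x \<noteq> 0 \<or> y \<noteq> 0"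
  shows "contains_standard H"
proof -
  obtain Q where Q: "det Q \<noteq> 0" "m3 0 0 x 0 0 y 0 0 0 ** Q = Q ** m3 0 0 1 0 0 0 0 0 0"
    using corner_normal_form[OF xy] by blast
  show ?thesis
    by (rule wlog_conj[OF H Q(1)]) (use root_case conj_lieI[OF X Q(2)] in blast)
qed

text \<open>Conjugating by elements \<open>h = c\<inverse> diag(T, T, 1/T^2) c'\<inverse>\<close> of \<open>H\<close> with \<open>c\<close> and \<open>c'\<close> in a fixed compact
  set and letting \<open>T\<close> tend to infinity expands exactly the entries \<open>(1,3)\<close> and \<open>(2,3)\<close>; after rescaling, the limits
  are elements of the Lie algebra of rank at most one.\<close>

lemma rank_one_or_common_eigenvector:
  assumes H: "cds H"
  shows "contains_standard H \<or> (\<exists>Q. det Q \<noteq> 0 \<and> (\<forall>Y\<in>conj_lie Q (lie H). Y$1$3 = 0 \<and> Y$2$3 = 0))"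
proof -
  obtain C where C: "compact C" "C \<subseteq> {g. det g = 1}"
    and G: "\<And>g. det g = 1 \<Longrightarrow> \<exists>c\<in>C. \<exists>h\<in>H. \<exists>c'\<in>C. g = c ** h ** c'"
    using H unfolding cds_iff by blast
  define T where "T n = real (Suc n)" for n
  define A where "A n = m3 (T n) 0 0 0 (T n) 0 0 0 (1 / (T n)\<^sup>2)" for n
  have T: "T n > 0" for n by (simp add: T_def)
  have detA: "det (A n) = 1" for n using T[of n] by (simp add: A_def power2_eq_square)
  have adjA: "adj (A n) = m3 (1 / T n) 0 0 0 (1 / T n) 0 0 0 ((T n)\<^sup>2)" for n
    using T[of n] by (simp add: A_def power2_eq_square)
  have "\<forall>n. \<exists>c h c'. c \<in> C \<and> h \<in> H \<and> c' \<in> C \<and> A n = c ** h ** c'" using G[OF detA] by blast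
  then obtain c h c' where ch: "\<And>n. c n \<in> C" "\<And>n. h n \<in> H" "\<And>n. c' n \<in> C" "\<And>n. A n = c n ** h n ** c' n" by metis
  have "seq_compact (C \<times> C)" by (rule compact_imp_seq_compact[OF compact_Times[OF C(1) C(1)]])
  moreover have "\<forall>n. (c n, c' n) \<in> C \<times> C" using ch by simp
  ultimately obtain l r where l: "l \<in> C \<times> C" "strict_mono r" "((\<lambda>n. (c n, c' n)) \<circ> r) \<longlonglongrightarrow> l"
    by (rule seq_compactE)
  have cr: "(\<lambda>n. c (r n)) \<longlonglongrightarrow> fst l" and cr': "(\<lambda>n. c' (r n)) \<longlonglongrightarrow> snd l"
    using tendsto_fst[OF l(3)] tendsto_snd[OF l(3)] by (simp_all add: o_def)
  have acr: "(\<lambda>n. adj (c (r n))) \<longlonglongrightarrow> adj (fst l)" and acr': "(\<lambda>n. adj (c' (r n))) \<longlonglongrightarrow> adj (snd l)"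
    by (rule continuous_on_tendsto_compose[OF continuous_on_adj]; simp add: cr cr')+
  have dl: "det (fst l) = 1" "det (snd l) = 1" using l(1) C(2) by auto
  have dc: "det (c n) = 1" "det (c' n) = 1" "det (h n) = 1" for n using ch C(2) cds_det[OF H] by blast+
  have limit: "m3 0 0 (Y$1$3) 0 0 (Y$2$3) 0 0 0 \<in> conj_lie (adj (fst l)) (lie H)"
    if X: "X \<in> lie H" and Y: "Y = adj (snd l) ** X ** snd l" for X Y
  proof -
    define Y' where "Y' n = adj (c' (r n)) ** X ** c' (r n)" for n
    have Y': "Y' \<longlonglongrightarrow> Y" unfolding Y'_def Y by (intro tendsto_intros acr' cr')
    \<comment> \<open>Conjugation by \<open>A\<close> multiplies the entries (1,3) and (2,3) by T^3
      and the entries (3,1) and (3,2) by T^(-3) and fixes the others; hence the scaling.\<close>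
    define W where "W n = (1 / T (r n) ^ 3) *\<^sub>R (A (r n) ** Y' n ** adj (A (r n)))" for n
    define p1 p2 p3 where "p1 Z = m3 (Z$1$1) (Z$1$2) 0 (Z$2$1) (Z$2$2) 0 0 0 (Z$3$3)"
      and "p2 Z = m3 0 0 0 0 0 0 (Z$3$1) (Z$3$2) 0" and "p3 Z = m3 0 0 (Z$1$3) 0 0 (Z$2$3) 0 0 0" for Z :: "real^3^3"
    have pl: "(\<lambda>n. p1 (Y' n)) \<longlonglongrightarrow> p1 Y" "(\<lambda>n. p2 (Y' n)) \<longlonglongrightarrow> p2 Y" "(\<lambda>n. p3 (Y' n)) \<longlonglongrightarrow> p3 Y"
    proof -
      have "continuous_on UNIV p1" "continuous_on UNIV p2" "continuous_on UNIV p3"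
        unfolding p1_def p2_def p3_def by (intro continuous_intros)+
      from this[THEN continuous_on_tendsto_compose, OF Y']
      show "(\<lambda>n. p1 (Y' n)) \<longlonglongrightarrow> p1 Y" "(\<lambda>n. p2 (Y' n)) \<longlonglongrightarrow> p2 Y" "(\<lambda>n. p3 (Y' n)) \<longlonglongrightarrow> p3 Y"
        by simp_all
    qed
    have W: "W n = (1 / T (r n) ^ 3) *\<^sub>R p1 (Y' n) + ((1 / T (r n) ^ 3) * (1 / T (r n) ^ 3)) *\<^sub>R p2 (Y' n) + p3 (Y' n)" for n
      unfolding W_def adjA unfolding A_def using T[of "r n"]
      by (cases "Y' n" rule: m3_cases) (simp add: p1_def p2_def p3_def power2_eq_square power3_eq_cube)
    have Tlim: "(\<lambda>n. 1 / T (r n) ^ 3) \<longlonglongrightarrow> 0"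
    proof -
      have "filterlim (\<lambda>n. T (r n)) at_top sequentially"
        unfolding T_def by (rule filterlim_compose[OF filterlim_real_Suc filterlim_subseq[OF l(2)]])
      then have "(\<lambda>n. inverse (T (r n))) \<longlonglongrightarrow> 0" by (rule tendsto_inverse_0_at_top)
      from tendsto_power[OF this, of 3] show ?thesis by (simp add: power_inverse divide_inverse)
    qed
    have "W \<longlonglongrightarrow> 0 *\<^sub>R p1 Y + (0 * 0) *\<^sub>R p2 Y + p3 Y"
      unfolding W by (intro tendsto_intros pl Tlim)
    then have Wl: "W \<longlonglongrightarrow> p3 Y" by simp
    have mem: "adj (c (r n)) ** W n ** c (r n) \<in> lie H" for n
    proof -
      let ?n = "r n"
      have h: "h ?n = adj (c ?n) ** A ?n ** adj (c' ?n)"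
      proof -
        have "adj (c ?n) ** A ?n ** adj (c' ?n) = (adj (c ?n) ** c ?n) ** h ?n ** (c' ?n ** adj (c' ?n))"
          unfolding ch(4) by (simp only: matrix_mul_assoc)
        then show ?thesis using dc by (simp add: adj_left adj_right)
      qed
      have ah: "adj (h ?n) = c' ?n ** adj (A ?n) ** c ?n"
        unfolding h adj_mult using dc by (simp add: adj_adj matrix_mul_assoc)
      have "h ?n ** X ** adj (h ?n) \<in> lie H"
        using H lie_conj[OF _ ch(2) adj_right[OF dc(3)] X] by (simp add: cds_iff)
      moreover have "h ?n ** X ** adj (h ?n) = adj (c ?n) ** (A ?n ** Y' n ** adj (A ?n)) ** c ?n"
        unfolding ah unfolding h Y'_def by (simp only: matrix_mul_assoc)
      ultimately have "(1 / T ?n ^ 3) *\<^sub>R (adj (c ?n) ** (A ?n ** Y' n ** adj (A ?n)) ** c ?n) \<in> lie H"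
        using lie_scale[OF H] by simp
      then show ?thesis unfolding W_def by (simp add: matrix_mult_scaleR_left matrix_mult_scaleR_right)
    qed
    have "(\<lambda>n. adj (c (r n)) ** W n ** c (r n)) \<longlonglongrightarrow> adj (fst l) ** p3 Y ** fst l"
      by (intro tendsto_intros Wl cr acr)
    then have "adj (fst l) ** p3 Y ** fst l \<in> lie H"
      by (rule closed_sequentially[OF closed_subspace[OF cds_subspace_lie[OF H]] mem])
    moreover have "(adj (fst l) ** p3 Y ** fst l) ** adj (fst l) = adj (fst l) ** p3 Y"
      by (simp only: matrix_mul_assoc[symmetric] adj_right[OF dl(1)] matrix_mul_rid)
    ultimately show ?thesis unfolding p3_def[symmetric] by (rule conj_lieI)
  qed
  show ?thesis
  proof (cases "\<exists>X\<in>lie H. (adj (snd l) ** X ** snd l)$1$3 \<noteq> 0 \<or> (adj (snd l) ** X ** snd l)$2$3 \<noteq> 0")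
    case True
    then obtain X where X: "X \<in> lie H" "(adj (snd l) ** X ** snd l)$1$3 \<noteq> 0 \<or> (adj (snd l) ** X ** snd l)$2$3 \<noteq> 0" by blast
    have "det (adj (fst l)) \<noteq> 0" using det_adj[OF dl(1)] by simp
    then have "contains_standard H"
      by (rule wlog_conj[OF H]) (use limit[OF X(1) refl] corner_case X(2) in blast)
    then show ?thesis ..
  next
    case False
    \<comment> \<open>No limit survives, so the third column of \<open>snd l\<close> is a common
      eigenvector of the Lie algebra.\<close>
    have "\<forall>Y\<in>conj_lie (snd l) (lie H). Y$1$3 = 0 \<and> Y$2$3 = 0"
      unfolding conj_lie_eq_image[OF adj_left[OF dl(2)] adj_right[OF dl(2)]] using False by blast
    then show ?thesis using dl(2) by (intro disjI2 exI[of _ "snd l"]) simp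
  qed
qed

text \<open>The Lie algebra is planar. Beyond the types settled by earlier cases, scaled rotations
  stay near the walls, and a line is excluded by its (3,3) entry: zero puts H into the planar block,
  nonzero gives exponential growth.\<close>

lemma block_case:
  assumes H: "cds H" and bl: "\<And>X. X \<in> lie H \<Longrightarrow> X$1$3 = 0 \<and> X$2$3 = 0 \<and> X$3$1 = 0 \<and> X$3$2 = 0"
  shows "contains_standard H"
proof -
  have k: "planar_algebra (lie H)"
    unfolding planar_algebra_def
  proof (intro conjI ballI)
    show "subalgebra (lie H)" by (rule subalgebra_lie[OF H])
    fix X assume X: "X \<in> lie H"
    then have "X$3$3 = - X$1$1 - X$2$2" using lie_trace[OF H X] by linarith
    with X have "X = m3 (X$1$1) (X$1$2) 0 (X$2$1) (X$2$2) 0 0 0 (- X$1$1 - X$2$2)"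
      using bl[OF X] by (intro matrix3_eqI) auto
    then show "\<exists>a b c d. X = m3 a b 0 c d 0 0 0 (- a - d)" by blast
  qed
  obtain Q where Q: "planar Q" "planar_type (conj_lie Q (lie H))" using planar_algebra_classification[OF k] by blast
  have detQ: "det Q \<noteq> 0" using Q(1) by (simp add: planar_def)
  show ?thesis
  proof (rule wlog_conj[OF H detQ])
    fix H' assume H': "cds H'" and l: "lie H' = conj_lie Q (lie H)"
    have k': "planar_algebra (lie H')" unfolding l by (rule planar_algebra_conj[OF k Q(1)])
    have bl': "X$1$3 = 0 \<and> X$2$3 = 0 \<and> X$3$1 = 0 \<and> X$3$2 = 0" if X: "X \<in> lie H'" for X
      using k' X unfolding planar_algebra_def by force
    have line: "contains_standard H'" if X0: "X0 \<in> lie H'" "\<forall>X\<in>lie H'. \<exists>c. X = c *\<^sub>R X0" for X0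
    proof (cases "X0$3$3 = 0")
      case True
      have "X$1$3 = 0 \<and> X$2$3 = 0 \<and> X$3$1 = 0 \<and> X$3$2 = 0 \<and> X$3$3 = 0" if X: "X \<in> lie H'" for X
        using X0(2) X bl'[OF X] True by fastforce
      then show ?thesis using not_cds_sl2[OF H'] by blast
    next
      case False
      then show ?thesis using not_cds_line[OF H' X0(1)] X0 bl'[OF X0(1)] by blast
    qed
    show "contains_standard H'"
      using Q(2) unfolding l[symmetric] planar_type_def
    proof (elim disjE)
      assume E: "m3 0 1 0 0 0 0 0 0 0 \<in> lie H'"
      show ?thesis
      proof (rule wlog_conj[OF H', of "m3 1 0 0 0 0 1 0 1 0"])
        fix K assume K: "cds K" and lK: "lie K = conj_lie (m3 1 0 0 0 0 1 0 1 0) (lie H')"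
        have "m3 0 0 1 0 0 0 0 0 0 \<in> lie K" unfolding lK by (rule conj_lieI[OF E]) simp
        then show "contains_standard K" by (rule root_case[OF K])
      qed simp
    next
      assume "\<forall>a b. m3 a 0 0 0 b 0 0 0 (- a - b) \<in> lie H'"
      then show ?thesis using contains_diagonal by blast
    next
      assume "(\<forall>X\<in>lie H'. X$1$1 = X$2$2 \<and> X$1$2 = - X$2$1) \<and> m3 1 1 0 (- 1) 1 0 0 0 (- 2) \<in> lie H'"
      then show ?thesis using not_cds_scaled_rotations[OF H'] bl' by blast
    qed (use line in blast)
  qed
qed

section \<open>Arbitrary upper triangular Lie algebras\<close>

lemma rank_one_upper:
  assumes H: "cds H" and X: "m3 0 x z 0 0 y 0 0 0 \<in> lie H" and "x = 0 \<or> y = 0" "x \<noteq> 0 \<or> y \<noteq> 0 \<or> z \<noteq> 0"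
  shows "contains_standard H"
proof (cases "x = 0")
  case True
  then show ?thesis using corner_case[OF H, of z y] assms by auto
next
  case False
  then have y: "y = 0" using assms by simp
  show ?thesis
  proof (rule wlog_flip[OF H])
    fix H' assume H': "cds H'" and l: "\<And>Y. Y \<in> lie H' \<longleftrightarrow> flip_lie Y \<in> lie H"
    have "m3 0 0 (- z) 0 0 (- x) 0 0 0 \<in> lie H'" unfolding l using X y by simp
    then show "contains_standard H'" using corner_case[OF H'] False by simp
  qed
qed

text \<open>The commutator of Z with the regular nilpotent, corrected by a multiple of that
  nilpotent, has entries b - e and 3d in the last column. Unless both vanish it is a rank-one
  nilpotent, a case already settled.\<close>

lemma regular_nilpotent_form:
  assumes H: "cds H" and up: "\<And>X. X \<in> lie H \<Longrightarrow> upper X" and E: "m3 0 1 0 0 0 1 0 0 0 \<in> lie H"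
    and no: "\<not> contains_standard H" and Z: "Z \<in> lie H"
  shows "\<exists>a b c. Z = m3 a b c 0 0 b 0 0 (- a)"
proof -
  obtain a b c d e where z: "Z = m3 a b c 0 d e 0 0 (- a - d)" using upper_form[OF H Z up[OF Z]] .
  have "m3 0 (a - d) (b - e) 0 0 (2 * d + a) 0 0 0 \<in> lie H"
    using cds_lie_bracket[OF H Z E] by (simp add: z algebra_simps)
  from lie_lincomb[OF H this E, of 1 "- (a - d)"]
  have "m3 0 0 (b - e) 0 0 (3 * d) 0 0 0 \<in> lie H" by (simp add: algebra_simps)
  then have "b = e" "d = 0" using rank_one_upper[OF H] no by force+
  then show ?thesis unfolding z by simp
qed

text \<open>All elements have the form given by \<open>regular_nilpotent_form\<close>, and a nonzero
  corner would be a rank-one nilpotent. What remains lies in the upper triangular part of an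
  orthogonal algebra of signature (2,1), which misses a wall.\<close>

lemma triangular_regular_diagonal:
  assumes H: "cds H" and up: "\<And>X. X \<in> lie H \<Longrightarrow> upper X" and E: "m3 0 1 0 0 0 1 0 0 0 \<in> lie H"
    and D: "m3 a 0 0 0 0 0 0 0 (- a) \<in> lie H"
    and zero: "a = 0 \<Longrightarrow> \<forall>X\<in>lie H. X$1$1 = 0"
  shows "contains_standard H"
proof (rule ccontr)
  assume no: "\<not> contains_standard H"
  have "\<exists>a b. Z = m3 a b 0 0 0 b 0 0 (- a)" if Z: "Z \<in> lie H" for Z
  proof -
    obtain a' b c where z: "Z = m3 a' b c 0 0 b 0 0 (- a')" using regular_nilpotent_form[OF H up E no Z] by blast
    \<comment> \<open>For a = 0 the quotient is 0 by convention, and \<open>zero\<close> makes a'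
      vanish as well.\<close>
    have a: "a' / a * a = a'" using zero Z by (cases "a = 0") (auto simp: z)
    have "1 *\<^sub>R Z + (- 1) *\<^sub>R (b *\<^sub>R m3 0 1 0 0 0 1 0 0 0 + (a' / a) *\<^sub>R m3 a 0 0 0 0 0 0 0 (- a)) \<in> lie H"
      by (intro lie_lincomb[OF H] Z E D)
    moreover have "1 *\<^sub>R Z + (- 1) *\<^sub>R (b *\<^sub>R m3 0 1 0 0 0 1 0 0 0 + (a' / a) *\<^sub>R m3 a 0 0 0 0 0 0 0 (- a)) = m3 0 0 c 0 0 0 0 0 0"
      using a by (simp add: z)
    ultimately have "c = 0" using rank_one_upper[OF H, of 0 c 0] no by auto
    then show ?thesis using z by blast
  qed
  then show False by (rule not_cds_so21[OF H])
qed

text \<open>The corner entry c of an element with a /= 0 can be conjugated away without disturbing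
  the regular nilpotent, since the corner root commutes with it.\<close>

lemma triangular_regular:
  assumes H: "cds H" and up: "\<And>X. X \<in> lie H \<Longrightarrow> upper X" and E: "m3 0 1 0 0 0 1 0 0 0 \<in> lie H"
  shows "contains_standard H"
proof (rule ccontr)
  assume no: "\<not> contains_standard H"
  show False
  proof (cases "\<forall>X\<in>lie H. X$1$1 = 0")
    case True
    have "m3 0 0 0 0 0 0 0 0 (- 0) \<in> lie H" using lie_scale[OF H E, of 0] by simp
    then show False using triangular_regular_diagonal[OF H up E] True no by blast
  next
    case False
    then obtain Z where Z: "Z \<in> lie H" "Z$1$1 \<noteq> 0" by blast
    obtain a b c where z: "Z = m3 a b c 0 0 b 0 0 (- a)" using regular_nilpotent_form[OF H up E no Z(1)] by blast
    have a: "a \<noteq> 0" using Z(2) by (simp add: z)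
    have Z': "m3 a 0 c 0 0 0 0 0 (- a) \<in> lie H" using lie_lincomb[OF H Z(1) E, of 1 "- b"] by (simp add: z)
    define w where "w = - c / (2 * a)"
    have w: "a * w + c = - (a * w)" using a by (simp add: w_def field_simps)
    let ?Q = "m3 1 0 w 0 1 0 0 0 1"
    have "contains_standard H"
    proof (rule wlog_conj[OF H, of ?Q])
      fix H' assume H': "cds H'" and l: "lie H' = conj_lie ?Q (lie H)"
      have "upper Y" if "Y \<in> lie H'" for Y using upper_conj[OF up, of "lie H" ?Q 1 0 w 1 0 1 Y] that unfolding l by simp
      moreover have "m3 0 1 0 0 0 1 0 0 0 \<in> lie H'" unfolding l by (rule conj_lieI[OF E]) simp
      moreover have "m3 a 0 0 0 0 0 0 0 (- a) \<in> lie H'" unfolding l by (rule conj_lieI[OF Z']) (simp add: w mult.commute)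
      ultimately show "contains_standard H'" using triangular_regular_diagonal[OF H'] a by blast
    qed simp
    then show False using no by blast
  qed
qed

lemma triangular_with_nilpotent:
  assumes H: "cds H" and up: "\<And>X. X \<in> lie H \<Longrightarrow> upper X"
    and X: "m3 0 x z 0 0 y 0 0 0 \<in> lie H" and nz: "x \<noteq> 0 \<or> y \<noteq> 0 \<or> z \<noteq> 0"
  shows "contains_standard H"
proof (cases "x = 0 \<or> y = 0")
  case True
  then show ?thesis using rank_one_upper[OF H X] nz by blast
next
  case False
  let ?Q = "m3 (x * y) z 0 0 y 0 0 0 1"
  have detQ: "det ?Q \<noteq> 0" using False by simp
  show ?thesis
  proof (rule wlog_conj[OF H detQ])
    fix H' assume H': "cds H'" and l: "lie H' = conj_lie ?Q (lie H)"
    have "upper Y" if "Y \<in> lie H'" for Y using upper_conj[OF up refl detQ] that unfolding l by blast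
    moreover have "m3 0 1 0 0 0 1 0 0 0 \<in> lie H'" unfolding l by (rule conj_lieI[OF X]) simp
    ultimately show "contains_standard H'" by (rule triangular_regular[OF H'])
  qed
qed

text \<open>With nilpotents excluded, commutators with the regular diagonal element force every
  element to be diagonal; the Lie algebra is then the full diagonal algebra or a line, which
  \<open>not_cds_line\<close> rules out.\<close>

lemma triangular_regular_semisimple:
  assumes H: "cds H" and up: "\<And>X. X \<in> lie H \<Longrightarrow> upper X"
    and D: "m3 d1 0 0 0 d2 0 0 0 d3 \<in> lie H" and d: "d1 \<noteq> d2" "d2 \<noteq> d3" "d1 \<noteq> d3"
  shows "contains_standard H"
proof (rule ccontr)
  assume no: "\<not> contains_standard H"
  have d3: "d3 = - d1 - d2" using lie_trace[OF H D] by simp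
  have form: "\<exists>a b. Y = m3 a 0 0 0 b 0 0 0 (- a - b)" if Y: "Y \<in> lie H" for Y
  proof -
    obtain a b c e f where y: "Y = m3 a b c 0 e f 0 0 (- a - e)" using upper_form[OF H Y up[OF Y]] .
    have "m3 0 ((d1 - d2) * b) ((d1 - d3) * c) 0 0 ((d2 - d3) * f) 0 0 0 \<in> lie H"
      using cds_lie_bracket[OF H D Y] by (simp add: y algebra_simps)
    then have "\<not> ((d1 - d2) * b \<noteq> 0 \<or> (d2 - d3) * f \<noteq> 0 \<or> (d1 - d3) * c \<noteq> 0)"
      using triangular_with_nilpotent[OF H up] no by blast
    then show ?thesis using d by (auto simp: y)
  qed
  show False
  proof (cases "\<exists>a b. m3 a 0 0 0 b 0 0 0 (- a - b) \<in> lie H \<and> d1 * b - d2 * a \<noteq> 0")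
    case True
    then obtain a b where "m3 a 0 0 0 b 0 0 0 (- a - b) \<in> lie H" "d1 * b - d2 * a \<noteq> 0" by blast
    then have "m3 x 0 0 0 y 0 0 0 (- x - y) \<in> lie H" for x y
      using span_diagonal[OF subalgebra_lie[OF H] D[unfolded d3]] by blast
    then show False using contains_diagonal no by blast
  next
    case False
    have "\<exists>t. Y = t *\<^sub>R m3 d1 0 0 0 d2 0 0 0 d3" if Y: "Y \<in> lie H" for Y
    proof -
      obtain a b where y: "Y = m3 a 0 0 0 b 0 0 0 (- a - b)" using form[OF Y] by blast
      then have e: "d1 * b = d2 * a" using False Y by auto
      define t where "t = (if d1 = 0 then b / d2 else a / d1)"
      have "d1 * t = a" "d2 * t = b" using e d d3 by (auto simp: t_def field_simps)
      then show ?thesis unfolding y d3 by (intro exI[of _ t]) (simp add: algebra_simps)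
    qed
    then show False by (rule not_cds_line[OF H D]) (use d in auto)
  qed
qed

text \<open>Without nilpotents an element is determined by its diagonal. Either some diagonal has
  distinct entries and its element can be diagonalised, or all diagonals are proportional and the
  Lie algebra is at most a line.\<close>

lemma triangular_case:
  assumes H: "cds H" and up: "\<And>X. X \<in> lie H \<Longrightarrow> upper X"
  shows "contains_standard H"
proof (rule ccontr)
  assume no: "\<not> contains_standard H"
  have nil: "x = 0 \<and> y = 0 \<and> z = 0" if "m3 0 x z 0 0 y 0 0 0 \<in> lie H" for x y z
    using triangular_with_nilpotent[OF H up that] no by blast
  show False
  proof (cases "\<exists>X\<in>lie H. X$1$1 \<noteq> X$2$2 \<and> X$2$2 \<noteq> X$3$3 \<and> X$1$1 \<noteq> X$3$3")
    case True
    then obtain X where X: "X \<in> lie H" "X$1$1 \<noteq> X$2$2" "X$2$2 \<noteq> X$3$3" "X$1$1 \<noteq> X$3$3" by blast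
    obtain a b c d e where x: "X = m3 a b c 0 d e 0 0 (- a - d)" using upper_form[OF H X(1) up[OF X(1)]] .
    have dis: "a \<noteq> d" "d \<noteq> - a - d" "a \<noteq> - a - d" using X unfolding x by simp_all
    obtain u v w where Q: "X ** m3 1 u w 0 1 v 0 0 1 = m3 1 u w 0 1 v 0 0 1 ** m3 a 0 0 0 d 0 0 0 (- a - d)"
      using diagonalize_upper[OF dis, of b c e] unfolding x by blast
    let ?Q = "m3 1 u w 0 1 v 0 0 1"
    have "contains_standard H"
    proof (rule wlog_conj[OF H, of ?Q])
      fix H' assume H': "cds H'" and l: "lie H' = conj_lie ?Q (lie H)"
      have "upper Y" if "Y \<in> lie H'" for Y using upper_conj[OF up, of "lie H" ?Q 1 u w 1 v 1 Y] that unfolding l by simp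
      moreover have "m3 a 0 0 0 d 0 0 0 (- a - d) \<in> lie H'" unfolding l by (rule conj_lieI[OF X(1) Q])
      ultimately show "contains_standard H'" using triangular_regular_semisimple[OF H'] dis by blast
    qed simp
    then show False using no by blast
  next
    case rep: False
    show False
    proof (cases "\<exists>X\<in>lie H. X$1$1 \<noteq> 0 \<or> X$2$2 \<noteq> 0")
      case False
      have "X$1$3 = 0 \<and> X$2$3 = 0 \<and> X$3$1 = 0 \<and> X$3$2 = 0 \<and> X$3$3 = 0" if X: "X \<in> lie H" for X
      proof -
        obtain a b c d e where x: "X = m3 a b c 0 d e 0 0 (- a - d)" using upper_form[OF H X up[OF X]] .
        have "a = 0" "d = 0" using False X x by force+
        then show ?thesis using nil[of b c e] X by (simp add: x)
      qed
      then show False by (rule not_cds_sl2[OF H])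
    next
      case True
      then obtain X where X: "X \<in> lie H" "X$1$1 \<noteq> 0 \<or> X$2$2 \<noteq> 0" by blast
      obtain a b c d e where x: "X = m3 a b c 0 d e 0 0 (- a - d)" using upper_form[OF H X(1) up[OF X(1)]] .
      have ad: "a \<noteq> 0 \<or> d \<noteq> 0" using X(2) by (simp add: x)
      have "\<exists>t. Y = t *\<^sub>R X" if Y: "Y \<in> lie H" for Y
      proof -
        obtain a' b' c' d' e' where y: "Y = m3 a' b' c' 0 d' e' 0 0 (- a' - d')" using upper_form[OF H Y up[OF Y]] .
        have det0: "a * d' - d * a' = 0" using proportional_diagonals[OF H X(1) Y rep] by (simp add: x y)
        define t where "t = (if a = 0 then d' / d else a' / a)"
        have t: "t * a = a'" "t * d = d'" using det0 ad by (auto simp: t_def field_simps)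
        have z: "1 *\<^sub>R Y + (- t) *\<^sub>R X = m3 0 (b' - t * b) (c' - t * c) 0 0 (e' - t * e) 0 0 0"
          using t by (simp add: x y algebra_simps)
        have "m3 0 (b' - t * b) (c' - t * c) 0 0 (e' - t * e) 0 0 0 \<in> lie H"
          unfolding z[symmetric] by (rule lie_lincomb[OF H Y X(1)])
        then have "b' = t * b" "c' = t * c" "e' = t * e" using nil by force+
        then show ?thesis using t by (intro exI[of _ t]) (simp add: x y algebra_simps)
      qed
      then show False by (rule not_cds_line[OF H X(1)]) (use ad in \<open>auto simp: x\<close>)
    qed
  qed
qed

text \<open>The dichotomy is applied a second time and yields a common eigenvector v besides the
  common plane. If v lies outside the plane the Lie algebra is block diagonal; if it lies inside,
  the two form a flag and the Lie algebra is triangular.\<close>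

lemma common_covector_case:
  assumes H: "cds H" and row: "\<And>X. X \<in> lie H \<Longrightarrow> X$1$2 = 0 \<and> X$1$3 = 0"
  shows "contains_standard H"
proof (cases "\<exists>Q. det Q \<noteq> 0 \<and> (\<forall>Y\<in>conj_lie Q (lie H). Y$1$3 = 0 \<and> Y$2$3 = 0)")
  case False
  then show ?thesis using rank_one_or_common_eigenvector[OF H] by blast
next
  case True
  then obtain Q where detQ: "det Q \<noteq> 0" and Q: "\<And>Y. Y \<in> conj_lie Q (lie H) \<Longrightarrow> Y$1$3 = 0 \<and> Y$2$3 = 0" by blast
  define v1 v2 v3 where v: "v1 = Q$1$3" "v2 = Q$2$3" "v3 = Q$3$3"
  have nz: "v1 \<noteq> 0 \<or> v2 \<noteq> 0 \<or> v3 \<noteq> 0"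
    using detQ unfolding v by (cases Q rule: m3_cases) auto
  have ev: "\<exists>a d e f g h i \<mu>. X = m3 a 0 0 d e f g h i \<and> a * v1 = \<mu> * v1 \<and> d * v1 + e * v2 + f * v3 = \<mu> * v2 \<and> g * v1 + h * v2 + i * v3 = \<mu> * v3"
    if X: "X \<in> lie H" for X
  proof -
    obtain a b c d e f g h i where x: "X = m3 a b c d e f g h i" by (rule m3_cases)
    have bc: "b = 0" "c = 0" using row[OF X] by (simp_all add: x)
    obtain P where P: "P ** Q = mat 1" "Q ** P = mat 1" using det_nonzero_inverse[OF detQ] .
    define Y where "Y = P ** X ** Q"
    have "Y \<in> conj_lie Q (lie H)" unfolding Y_def conj_lie_eq_image[OF P] using X by blast
    then have Y: "Y$1$3 = 0" "Y$2$3 = 0" using Q by blast+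
    have "Q ** Y = (Q ** P) ** (X ** Q)" unfolding Y_def by (simp only: matrix_mul_assoc)
    then have XQ: "X ** Q = Q ** Y" using P by simp
    have "(X ** Q)$1$3 = Y$3$3 * v1" "(X ** Q)$2$3 = Y$3$3 * v2" "(X ** Q)$3$3 = Y$3$3 * v3"
      unfolding XQ by (simp_all add: matrix3_mult_nth Y v)
    then have "a * v1 = Y$3$3 * v1" "d * v1 + e * v2 + f * v3 = Y$3$3 * v2" "g * v1 + h * v2 + i * v3 = Y$3$3 * v3"
      by (simp_all add: x bc matrix3_mult_nth v[symmetric])
    then show ?thesis using x bc by blast
  qed
  have triangular: "contains_standard H" if R: "det R \<noteq> 0" and Y: "\<And>Y. Y \<in> conj_lie R (lie H) \<Longrightarrow> upper Y" for R
    by (rule wlog_conj[OF H R]) (use triangular_case Y in blast)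
  consider "v1 \<noteq> 0" | "v1 = 0" "v3 \<noteq> 0" | "v1 = 0" "v3 = 0" "v2 \<noteq> 0" using nz by blast
  then show ?thesis
  proof cases
    case 1
    \<comment> \<open>A basis of the plane followed by the eigenvector.\<close>
    let ?R = "m3 0 0 v1 1 0 v2 0 1 v3"
    have R: "det ?R \<noteq> 0" using 1 by simp
    show ?thesis
    proof (rule wlog_conj[OF H R])
      fix H' assume H': "cds H'" and l: "lie H' = conj_lie ?R (lie H)"
      show "contains_standard H'"
      proof (rule block_case[OF H'])
        fix Y assume "Y \<in> lie H'"
        then obtain X where X: "X \<in> lie H" "X ** ?R = ?R ** Y" unfolding l by (auto simp: conj_lie_def)
        obtain a d e f g h i \<mu> where x: "X = m3 a 0 0 d e f g h i"
          and e: "a * v1 = \<mu> * v1" "d * v1 + e * v2 + f * v3 = \<mu> * v2" "g * v1 + h * v2 + i * v3 = \<mu> * v3"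
          using ev[OF X(1)] by blast
        obtain a' b' c' d' e' f' g' h' i' where y: "Y = m3 a' b' c' d' e' f' g' h' i'" by (rule m3_cases)
        have "g' = 0" "h' = 0" "i' = \<mu>" "c' + v2 * i' = \<mu> * v2" "f' + v3 * i' = \<mu> * v3"
          using X(2) e 1 unfolding x y by auto
        then show "Y$1$3 = 0 \<and> Y$2$3 = 0 \<and> Y$3$1 = 0 \<and> Y$3$2 = 0" by (simp add: y)
      qed
    qed
  next
    case 2
    show ?thesis
    \<comment> \<open>A basis adapted to the flag: v, a second vector of the plane, and the first
      unit vector.\<close>
    proof (rule triangular[of "m3 0 0 1 v2 1 0 v3 0 0"])
      fix Y assume "Y \<in> conj_lie (m3 0 0 1 v2 1 0 v3 0 0) (lie H)"
      then obtain X where X: "X \<in> lie H" "X ** m3 0 0 1 v2 1 0 v3 0 0 = m3 0 0 1 v2 1 0 v3 0 0 ** Y" by (auto simp: conj_lie_def)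
      obtain a d e f g h i \<mu> where x: "X = m3 a 0 0 d e f g h i"
        and e: "a * v1 = \<mu> * v1" "d * v1 + e * v2 + f * v3 = \<mu> * v2" "g * v1 + h * v2 + i * v3 = \<mu> * v3"
        using ev[OF X(1)] by blast
      obtain a' b' c' d' e' f' g' h' i' where y: "Y = m3 a' b' c' d' e' f' g' h' i'" by (rule m3_cases)
      have "g' = 0" "h' = 0" "v3 * a' = \<mu> * v3" "v2 * a' + d' = \<mu> * v2"
        using X(2) e 2 unfolding x y by auto
      then show "upper Y" using 2 by (simp add: y upper_def)
    qed (use 2 in simp)
  next
    case 3
    show ?thesis
    proof (rule triangular[of "m3 0 0 1 v2 0 0 0 1 0"])
      fix Y assume "Y \<in> conj_lie (m3 0 0 1 v2 0 0 0 1 0) (lie H)"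
      then obtain X where X: "X \<in> lie H" "X ** m3 0 0 1 v2 0 0 0 1 0 = m3 0 0 1 v2 0 0 0 1 0 ** Y" by (auto simp: conj_lie_def)
      obtain a d e f g h i \<mu> where x: "X = m3 a 0 0 d e f g h i"
        and e: "a * v1 = \<mu> * v1" "d * v1 + e * v2 + f * v3 = \<mu> * v2" "g * v1 + h * v2 + i * v3 = \<mu> * v3"
        using ev[OF X(1)] by blast
      obtain a' b' c' d' e' f' g' h' i' where y: "Y = m3 a' b' c' d' e' f' g' h' i'" by (rule m3_cases)
      have "g' = 0" "h' = 0" "d' = 0"
        using X(2) e 3 unfolding x y by auto
      then show "upper Y" by (simp add: y upper_def)
    qed (use 3 in simp)
  qed
qed

text \<open>A common eigenvector becomes a common invariant plane under \<open>flip\<close>, which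
  is the situation of \<open>common_covector_case\<close>.\<close>

theorem cds_contains_standard:
  assumes H: "cds H"
  shows "contains_standard H"
  using rank_one_or_common_eigenvector[OF H]
proof (elim disjE exE conjE)
  fix Q assume Q: "det Q \<noteq> 0" "\<forall>Y\<in>conj_lie Q (lie H). Y$1$3 = 0 \<and> Y$2$3 = 0"
  show ?thesis
  proof (rule wlog_conj[OF H Q(1)])
    fix H1 assume H1: "cds H1" and l1: "lie H1 = conj_lie Q (lie H)"
    show "contains_standard H1"
    proof (rule wlog_flip[OF H1])
      fix H2 assume H2: "cds H2" and l2: "\<And>Y. Y \<in> lie H2 \<longleftrightarrow> flip_lie Y \<in> lie H1"
      show "contains_standard H2"
      proof (rule common_covector_case[OF H2])
        fix X assume "X \<in> lie H2"
        then have "flip_lie X$1$3 = 0 \<and> flip_lie X$2$3 = 0" using Q(2) unfolding l2 l1 by blast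
        then show "X$1$2 = 0 \<and> X$1$3 = 0" by (cases X rule: m3_cases) simp
      qed
    qed
  qed
qed

section \<open>Minimality\<close>

lemma lie_mono: "H \<subseteq> K \<Longrightarrow> lie H \<subseteq> lie K"
  by (auto simp: lie_def)

lemma lie_entry_diff:
  assumes X: "X \<in> lie H" and F: "\<And>h. h \<in> H \<Longrightarrow> h$i$j = h$k$l"
  shows "(X :: real^3^3)$i$j = X$k$l"
proof -
  have "X$i$j - X$k$l = 0"
    by (rule lie_relation[OF X, of "\<lambda>h. h$i$j - h$k$l" 0])
      (auto simp: F intro!: derivative_intros lie_entry_derivative)
  then show ?thesis by simp
qed

lemma mexp_0_nth: "mexp (0 *\<^sub>R X) $ i $ j = (if i = j then 1 else 0)" for X :: "real^3^3"
  by (simp add: mat_def)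

section \<open>Lie algebras of the listed groups\<close>

lemma lie_positive_diagonal: "lie positive_diagonal_subgroup = range (\<lambda>(a, b). m3 a 0 0 0 b 0 0 0 (- a - b))"
proof (intro equalityI subsetI)
  fix X assume X: "X \<in> lie positive_diagonal_subgroup"
  have c: "cds positive_diagonal_subgroup" by (rule cds_positive_diagonal)
  have z: "X$1$2 = 0" "X$1$3 = 0" "X$2$1 = 0" "X$2$3 = 0" "X$3$1 = 0" "X$3$2 = 0"
    by (rule lie_entry_zero[OF _ X], force simp: positive_diagonal_subgroup_eq)+
  have "X$3$3 = - X$1$1 - X$2$2" using lie_trace[OF c X] by linarith
  with z have "X = m3 (X$1$1) 0 0 0 (X$2$2) 0 0 0 (- X$1$1 - X$2$2)" by (intro matrix3_eqI) auto
  then show "X \<in> range (\<lambda>(a, b). m3 a 0 0 0 b 0 0 0 (- a - b))" by (auto intro!: image_eqI[of _ _ "(X$1$1, X$2$2)"])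
next
  fix X :: "real^3^3" assume "X \<in> range (\<lambda>(a, b). m3 a 0 0 0 b 0 0 0 (- a - b))"
  then obtain a b where X: "X = m3 a 0 0 0 b 0 0 0 (- a - b)" by auto
  have "mexp (t *\<^sub>R X) \<in> positive_diagonal_subgroup" for t
    unfolding X mexp_diagonal positive_diagonal_subgroup_eq
    by (auto simp: exp_add[symmetric] algebra_simps)
  then show "X \<in> lie positive_diagonal_subgroup" by (simp add: lie_def)
qed

lemma lie_unipotent: "lie unipotent_subgroup = range (\<lambda>(a, b). m3 0 a b 0 0 a 0 0 0)"
proof (intro equalityI subsetI)
  fix X assume X: "X \<in> lie unipotent_subgroup"
  have z: "X$2$1 = 0" "X$3$1 = 0" "X$3$2 = 0"
    by (rule lie_entry_zero[OF _ X], force simp: unipotent_subgroup_def)+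
  have d: "X$1$1 = 0" "X$2$2 = 0" "X$3$3 = 0"
    by (rule lie_entry_const[OF X, of _ _ 1], force simp: unipotent_subgroup_def)+
  have "X$2$3 = X$1$2" by (rule lie_entry_diff[OF X]) (auto simp: unipotent_subgroup_def)
  with z d have "X = m3 0 (X$1$2) (X$1$3) 0 0 (X$1$2) 0 0 0" by (intro matrix3_eqI) auto
  then show "X \<in> range (\<lambda>(a, b). m3 0 a b 0 0 a 0 0 0)" by (auto intro!: image_eqI[of _ _ "(X$1$2, X$1$3)"])
next
  fix X :: "real^3^3" assume "X \<in> range (\<lambda>(a, b). m3 0 a b 0 0 a 0 0 0)"
  then obtain a b where X: "X = m3 0 a b 0 0 a 0 0 0" by auto
  have "mexp (t *\<^sub>R X) \<in> unipotent_subgroup" for t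
    unfolding X mexp_strictly_upper by (auto simp: unipotent_subgroup_def)
  then show "X \<in> lie unipotent_subgroup" by (simp add: lie_def)
qed

lemma lie_diagonal_root:
  assumes pq: "max p q = 1" "min p q \<ge> - 1 / 2"
  shows "lie (diagonal_root_subgroup p q) = range (\<lambda>(a, r). m3 (p * a) r 0 0 (q * a) 0 0 0 (- (p + q) * a))"
proof (intro equalityI subsetI)
  have c: "cds (diagonal_root_subgroup p q)" by (rule cds_diagonal_root[OF pq])
  {
    fix X assume X: "X \<in> lie (diagonal_root_subgroup p q)"
    have z: "X$1$3 = 0" "X$2$1 = 0" "X$2$3 = 0" "X$3$1 = 0" "X$3$2 = 0"
      by (rule lie_entry_zero[OF _ X], force simp: diagonal_root_subgroup_def)+
    \<comment> \<open>Differentiates the equation q ln a = p ln b between the first two diagonal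
      entries a and b.\<close>
    have "q * X$1$1 - p * X$2$2 = 0"
      by (rule lie_relation[OF X, of "\<lambda>h. q * ln (h$1$1) - p * ln (h$2$2)" 0])
        (auto simp: diagonal_root_subgroup_def mexp_0_nth[simplified] intro!: derivative_eq_intros lie_entry_derivative)
    then have e: "q * X$1$1 = p * X$2$2" by simp
    define a where "a = (if p = 1 then X$1$1 else X$2$2)"
    have "X$1$1 = p * a" "X$2$2 = q * a" using e pq by (auto simp: a_def max_def split: if_splits)
    moreover have "X$3$3 = - X$1$1 - X$2$2" using lie_trace[OF c X] by linarith
    ultimately have "X = m3 (p * a) (X$1$2) 0 0 (q * a) 0 0 0 (- (p + q) * a)"
      using z by (intro matrix3_eqI) (auto simp: algebra_simps)
    then show "X \<in> range (\<lambda>(a, r). m3 (p * a) r 0 0 (q * a) 0 0 0 (- (p + q) * a))" by (auto intro!: image_eqI[of _ _ "(a, X$1$2)"])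
  next
    fix X :: "real^3^3" assume "X \<in> range (\<lambda>(a, r). m3 (p * a) r 0 0 (q * a) 0 0 0 (- (p + q) * a))"
    then obtain a r where X: "X = m3 (p * a) r 0 0 (q * a) 0 0 0 (- (p + q) * a)" by auto
    have "mexp (t *\<^sub>R m3 p 0 0 0 q 0 0 0 (- (p + q))) \<in> diagonal_root_subgroup p q" for t
      unfolding mexp_diagonal diagonal_root_subgroup_def by auto
    moreover have "mexp (t *\<^sub>R m3 0 1 0 0 0 0 0 0 0) \<in> diagonal_root_subgroup p q" for t
      unfolding mexp_strictly_upper diagonal_root_subgroup_def by (auto intro!: exI[of _ 0])
    ultimately have "a *\<^sub>R m3 p 0 0 0 q 0 0 0 (- (p + q)) + r *\<^sub>R m3 0 1 0 0 0 0 0 0 0 \<in> lie (diagonal_root_subgroup p q)"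
      by (intro lie_lincomb[OF c]) (simp_all add: lie_def)
    then show "X \<in> lie (diagonal_root_subgroup p q)" by (simp add: X mult.commute)
  }
qed

lemma lie_jordan: "lie jordan_subgroup = range (\<lambda>(a, s, r). m3 a a s 0 a r 0 0 (- 2 * a))"
proof (intro equalityI subsetI)
  fix X assume X: "X \<in> lie jordan_subgroup"
  have z: "X$2$1 = 0" "X$3$1 = 0" "X$3$2 = 0"
    by (rule lie_entry_zero[OF _ X], force simp: jordan_subgroup_def)+
  have e: "X$2$2 = X$1$1" by (rule lie_entry_diff[OF X]) (auto simp: jordan_subgroup_def)
  \<comment> \<open>The Jordan entry t e^t equals a ln a for a = e^t.\<close>
  have "X$1$2 - X$1$1 = 0"
    by (rule lie_relation[OF X, of "\<lambda>h. h$1$2 - h$1$1 * ln (h$1$1)" 0])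
      (auto simp: jordan_subgroup_def mexp_0_nth[simplified] intro!: derivative_eq_intros lie_entry_derivative)
  moreover have "X$3$3 = - X$1$1 - X$2$2" using lie_trace[OF cds_jordan X] by linarith
  ultimately have "X = m3 (X$1$1) (X$1$1) (X$1$3) 0 (X$1$1) (X$2$3) 0 0 (- 2 * X$1$1)"
    using z e by (intro matrix3_eqI) auto
  then show "X \<in> range (\<lambda>(a, s, r). m3 a a s 0 a r 0 0 (- 2 * a))" by (auto intro!: image_eqI[of _ _ "(X$1$1, X$1$3, X$2$3)"])
next
  fix X :: "real^3^3" assume "X \<in> range (\<lambda>(a, s, r). m3 a a s 0 a r 0 0 (- 2 * a))"
  then obtain a s r where X: "X = m3 a a s 0 a r 0 0 (- 2 * a)" by auto
  have "mexp (t *\<^sub>R m3 1 1 0 0 1 0 0 0 (- 2)) \<in> jordan_subgroup" for t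
    using mexp_jordan[of 1 t 0] by (auto simp: jordan_subgroup_def)
  moreover have "mexp (t *\<^sub>R m3 0 0 s 0 0 r 0 0 0) \<in> jordan_subgroup" for t
    unfolding mexp_strictly_upper jordan_subgroup_def by (auto intro!: exI[of _ 0])
  ultimately have "a *\<^sub>R m3 1 1 0 0 1 0 0 0 (- 2) + 1 *\<^sub>R m3 0 0 s 0 0 r 0 0 0 \<in> lie jordan_subgroup"
    by (intro lie_lincomb[OF cds_jordan]) (simp_all add: lie_def)
  then show "X \<in> lie jordan_subgroup" by (simp add: X mult.commute)
qed

lemma lie_spiral:
  assumes p: "p \<noteq> 0"
  shows "lie (spiral_subgroup p) = range (\<lambda>(a, s, r). m3 a (p * a) s (- (p * a)) a r 0 0 (- 2 * a))"
proof (intro equalityI subsetI)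
  have c: "cds (spiral_subgroup p)" by (rule cds_spiral)
  {
    fix X assume X: "X \<in> lie (spiral_subgroup p)"
    have z: "X$3$1 = 0" "X$3$2 = 0"
      by (rule lie_entry_zero[OF _ X], force simp: spiral_subgroup_def)+
    have e: "X$2$2 = X$1$1" by (rule lie_entry_diff[OF X]) (auto simp: spiral_subgroup_def)
    have t: "X$3$3 = - 2 * X$1$1" using lie_trace[OF c X] e by linarith
    \<comment> \<open>Both e^t and the angle p t are functions of the last entry e^(-2t).\<close>
    have "X$1$2 + p * X$3$3 / 2 = 0"
      by (rule lie_relation[OF X, of "\<lambda>h. h$1$2 - exp (- ln (h$3$3) / 2) * sin (- p * ln (h$3$3) / 2)" 0])
        (auto simp: spiral_subgroup_def mexp_0_nth[simplified] intro!: derivative_eq_intros lie_entry_derivative)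
    moreover have "X$2$1 - p * X$3$3 / 2 = 0"
      by (rule lie_relation[OF X, of "\<lambda>h. h$2$1 + exp (- ln (h$3$3) / 2) * sin (- p * ln (h$3$3) / 2)" 0])
        (auto simp: spiral_subgroup_def mexp_0_nth[simplified] intro!: derivative_eq_intros lie_entry_derivative)
    ultimately have "X = m3 (X$1$1) (p * X$1$1) (X$1$3) (- (p * X$1$1)) (X$1$1) (X$2$3) 0 0 (- 2 * X$1$1)"
      using z e t by (intro matrix3_eqI) auto
    then show "X \<in> range (\<lambda>(a, s, r). m3 a (p * a) s (- (p * a)) a r 0 0 (- 2 * a))"
      by (auto intro!: image_eqI[of _ _ "(X$1$1, X$1$3, X$2$3)"])
  next
    fix X :: "real^3^3" assume "X \<in> range (\<lambda>(a, s, r). m3 a (p * a) s (- (p * a)) a r 0 0 (- 2 * a))"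
    then obtain a s r where X: "X = m3 a (p * a) s (- (p * a)) a r 0 0 (- 2 * a)" by auto
    have "mexp (t *\<^sub>R m3 1 p 0 (- p) 1 0 0 0 (- 2)) \<in> spiral_subgroup p" for t
      unfolding mexp_rotation_scaling by (auto simp: spiral_subgroup_def)
    moreover have "mexp (t *\<^sub>R m3 0 0 s 0 0 r 0 0 0) \<in> spiral_subgroup p" for t
      unfolding mexp_strictly_upper spiral_subgroup_def by (auto intro!: exI[of _ 0])
    ultimately have "a *\<^sub>R m3 1 p 0 (- p) 1 0 0 0 (- 2) + 1 *\<^sub>R m3 0 0 s 0 0 r 0 0 0 \<in> lie (spiral_subgroup p)"
      by (intro lie_lincomb[OF c]) (simp_all add: lie_def)
    then show "X \<in> lie (spiral_subgroup p)" by (simp add: X mult.commute)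
  }
qed

section \<open>Dimensions, and comparison of dimension two with dimension three\<close>

lemma dim_range:
  fixes f :: "'a::euclidean_space \<Rightarrow> 'b::euclidean_space"
  shows "linear f \<Longrightarrow> inj f \<Longrightarrow> dim (range f) = DIM('a)"
  using dim_image_eq[of f UNIV] by simp

lemma dim_lie_positive_diagonal: "dim (lie positive_diagonal_subgroup) = 2"
  unfolding lie_positive_diagonal
  by (subst dim_range) (auto intro!: linearI injI simp: algebra_simps)

lemma dim_lie_unipotent: "dim (lie unipotent_subgroup) = 2"
  unfolding lie_unipotent
  by (subst dim_range) (auto intro!: linearI injI simp: algebra_simps)

lemma dim_lie_diagonal_root:
  assumes "max p q = 1" "min p q \<ge> - 1 / 2"
  shows "dim (lie (diagonal_root_subgroup p q)) = 2"
  unfolding lie_diagonal_root[OF assms]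
proof (subst dim_range)
  have "p \<noteq> 0 \<or> q \<noteq> 0" using assms(1) by (auto simp: max_def)
  then show "inj (\<lambda>(a, r). m3 (p * a) r 0 0 (q * a) 0 0 0 (- (p + q) * a))" by (auto intro!: injI)
qed (auto intro!: linearI simp: algebra_simps)

lemma dim_lie_jordan: "dim (lie jordan_subgroup) = 3"
  unfolding lie_jordan
  by (subst dim_range) (auto intro!: linearI injI simp: algebra_simps)

lemma dim_lie_spiral: "p \<noteq> 0 \<Longrightarrow> dim (lie (spiral_subgroup p)) = 3"
  by (subst lie_spiral, assumption, subst dim_range) (auto intro!: linearI injI simp: algebra_simps)

text \<open>The union of the Lie algebras of \<open>jordan_subgroup\<close> and of all
  \<open>spiral_subgroup p\<close> with p /= 0. It is not a subspace and only serves to treat both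
  three-dimensional families at once.\<close>

definition corner_algebra :: "(real^3^3) set"
  where "corner_algebra = {Y. (\<exists>a s r. Y = m3 a a s 0 a r 0 0 (- 2 * a)) \<or>
    (\<exists>p a s r. p \<noteq> 0 \<and> Y = m3 a (p * a) s (- (p * a)) a r 0 0 (- 2 * a))}"

text \<open>Unless a = 0, the planar block has the eigenvalue a with a one-dimensional eigenspace in
  the Jordan case, and no real eigenvalue in the spiral case. So a real eigenvector for a value
  other than -2a points along the first axis.\<close>

lemma corner_algebra_eigenvector:
  fixes x y z d :: real
  assumes Y: "Y \<in> corner_algebra" and nz: "x \<noteq> 0 \<or> y \<noteq> 0 \<or> z \<noteq> 0"
    and e: "Y$1$1 * x + Y$1$2 * y + Y$1$3 * z = d * x" "Y$2$1 * x + Y$2$2 * y + Y$2$3 * z = d * y"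
      "Y$3$1 * x + Y$3$2 * y + Y$3$3 * z = d * z"
  shows "d = - 2 * Y$1$1 \<or> d = Y$1$1 \<and> (Y$1$1 \<noteq> 0 \<longrightarrow> y = 0 \<and> z = 0)"
proof (cases "d = - 2 * Y$1$1")
  case d: False
  from Y show ?thesis
    unfolding corner_algebra_def mem_Collect_eq
  proof (elim disjE exE conjE)
    fix a s r assume y: "Y = m3 a a s 0 a r 0 0 (- 2 * a)"
    have "(d + 2 * a) * z = 0" "d + 2 * a \<noteq> 0" using e(3) d by (auto simp: y algebra_simps)
    then have z: "z = 0" by simp
    have "(d - a) * y = 0" "(d - a) * x = a * y" using e z by (auto simp: y algebra_simps)
    moreover from this have "d = a" using nz z by (cases "y = 0") auto
    ultimately show ?thesis using z by (auto simp: y)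
  next
    fix p a s r assume p: "p \<noteq> 0" and y: "Y = m3 a (p * a) s (- (p * a)) a r 0 0 (- 2 * a)"
    have "(d + 2 * a) * z = 0" "d + 2 * a \<noteq> 0" using e(3) d by (auto simp: y algebra_simps)
    then have z: "z = 0" by simp
    have 1: "(d - a) * x = p * a * y" "(d - a) * y = - (p * a * x)" using e z by (simp_all add: y algebra_simps)
    have "((d - a)\<^sup>2 + (p * a)\<^sup>2) * x = 0" "((d - a)\<^sup>2 + (p * a)\<^sup>2) * y = 0" using 1 by algebra+
    then have "(d - a)\<^sup>2 + (p * a)\<^sup>2 = 0" using nz z by auto
    then have "d = a" "p * a = 0" by (simp_all add: sum_power2_eq_zero_iff)
    then show ?thesis using p by (simp add: y)
  qed
qed simp

lemma corner_algebra_nilpotent: "Y \<in> corner_algebra \<Longrightarrow> Y$1$1 = 0 \<Longrightarrow> Y ** Y = 0"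
  by (auto simp: corner_algebra_def m3_zero)

text \<open>The columns of P are independent eigenvectors. If a /= 0, trace zero gives the
  eigenvalue a twice, and two columns would be multiples of the first unit vector.\<close>

lemma corner_algebra_no_diagonal:
  assumes Y: "Y \<in> corner_algebra" and P: "det P \<noteq> 0" and YP: "Y ** P = P ** m3 d1 0 0 0 d2 0 0 0 d3" and d: "d1 + d2 + d3 = 0"
  shows "d1 = 0 \<and> d2 = 0 \<and> d3 = 0"
proof -
  obtain x1 x2 x3 y1 y2 y3 z1 z2 z3 where p: "P = m3 x1 x2 x3 y1 y2 y3 z1 z2 z3" by (rule m3_cases)
  have nz: "x1 \<noteq> 0 \<or> y1 \<noteq> 0 \<or> z1 \<noteq> 0" "x2 \<noteq> 0 \<or> y2 \<noteq> 0 \<or> z2 \<noteq> 0" "x3 \<noteq> 0 \<or> y3 \<noteq> 0 \<or> z3 \<noteq> 0"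
    using P by (auto simp: p)
  have e: "(Y ** P)$i$j = (P ** m3 d1 0 0 0 d2 0 0 0 d3)$i$j" for i j by (simp add: YP)
  note e = e[of 1 1] e[of 2 1] e[of 3 1] e[of 1 2] e[of 2 2] e[of 3 2] e[of 1 3] e[of 2 3] e[of 3 3]
  note e = e[unfolded p matrix3_mult_nth, simplified m3_nth mult_zero_right add_0_left add_0_right, simplified mult.commute]
  define a where "a = Y$1$1"
  have 1: "d1 = - 2 * a \<or> d1 = a \<and> (a \<noteq> 0 \<longrightarrow> y1 = 0 \<and> z1 = 0)"
    unfolding a_def by (rule corner_algebra_eigenvector[OF Y nz(1)]) (use e in \<open>simp_all add: mult.commute\<close>)
  have 2: "d2 = - 2 * a \<or> d2 = a \<and> (a \<noteq> 0 \<longrightarrow> y2 = 0 \<and> z2 = 0)"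
    unfolding a_def by (rule corner_algebra_eigenvector[OF Y nz(2)]) (use e in \<open>simp_all add: mult.commute\<close>)
  have 3: "d3 = - 2 * a \<or> d3 = a \<and> (a \<noteq> 0 \<longrightarrow> y3 = 0 \<and> z3 = 0)"
    unfolding a_def by (rule corner_algebra_eigenvector[OF Y nz(3)]) (use e in \<open>simp_all add: mult.commute\<close>)
  have "a = 0"
  proof (rule ccontr)
    assume a: "a \<noteq> 0"
    consider "d1 = a" "d2 = a" "d3 = - 2 * a" | "d1 = a" "d3 = a" "d2 = - 2 * a" | "d2 = a" "d3 = a" "d1 = - 2 * a"
      using 1 2 3 d a by (elim disjE) auto
    then show False
      by cases (use 1 2 3 a P in \<open>auto simp: p\<close>)
  qed
  then show ?thesis using 1 2 3 by auto
qed

text \<open>The first column of P is in the kernel of Y, so a = 0 and Y squares to zero, whereas the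
  square of a regular nilpotent does not vanish.\<close>

lemma corner_algebra_no_regular_nilpotent:
  assumes Y: "Y \<in> corner_algebra" and P: "det P \<noteq> 0" and YP: "Y ** P = P ** m3 0 c 0 0 0 c 0 0 0"
  shows "c = 0"
proof (rule ccontr)
  assume c: "c \<noteq> 0"
  obtain x1 x2 x3 y1 y2 y3 z1 z2 z3 where p: "P = m3 x1 x2 x3 y1 y2 y3 z1 z2 z3" by (rule m3_cases)
  have nz: "x1 \<noteq> 0 \<or> y1 \<noteq> 0 \<or> z1 \<noteq> 0" using P by (auto simp: p)
  have e: "(Y ** P)$i$1 = (P ** m3 0 c 0 0 0 c 0 0 0)$i$1" for i by (simp add: YP)
  have "0 = - 2 * Y$1$1 \<or> 0 = Y$1$1 \<and> (Y$1$1 \<noteq> 0 \<longrightarrow> y1 = 0 \<and> z1 = 0)"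
    by (rule corner_algebra_eigenvector[OF Y nz]) (use e[of 1] e[of 2] e[of 3] in \<open>simp_all add: p matrix3_mult_nth\<close>)
  then have YY: "Y ** Y = 0" using corner_algebra_nilpotent[OF Y] by auto
  have "P ** (m3 0 c 0 0 0 c 0 0 0 ** m3 0 c 0 0 0 c 0 0 0) = Y ** Y ** P"
    by (metis YP matrix_mul_assoc)
  also have "\<dots> = 0" unfolding YY by (simp add: matrix_mult_zero_left)
  finally have "P ** (m3 0 c 0 0 0 c 0 0 0 ** m3 0 c 0 0 0 c 0 0 0) = 0" .
  then show False using c nz by (simp add: p m3_zero)
qed

lemma lie_jordan_spiral: "lie jordan_subgroup \<subseteq> corner_algebra" "p \<noteq> 0 \<Longrightarrow> lie (spiral_subgroup p) \<subseteq> corner_algebra"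
  unfolding lie_jordan by (auto simp: lie_spiral corner_algebra_def)

lemma linear_conj: "linear (\<lambda>X. P ** X ** Q)" for P Q :: "real^3^3"
  by (rule linearI) (simp_all add: matrix_add_ldistrib matrix_add_rdistrib matrix_mult_scaleR_left matrix_mult_scaleR_right)

lemma linear_flip_lie: "linear flip_lie"
proof (rule linearI)
  show "flip_lie (X + Y) = flip_lie X + flip_lie Y" for X Y
    by (cases X rule: m3_cases, cases Y rule: m3_cases) simp
  show "flip_lie (c *\<^sub>R X) = c *\<^sub>R flip_lie X" for c X
    by (cases X rule: m3_cases) simp
qed

text \<open>Inclusions of groups pass to Lie algebras, and conjugation and \<open>flip_lie\<close>
  are injective linear maps, so dimensions can be compared.\<close>

lemma contains_standard_lie:
  assumes "contains_standard K"
  shows "\<exists>P g L. det P \<noteq> 0 \<and> standard L \<and> g \<in> {id, flip_lie} \<and> (\<forall>Z\<in>lie L. \<exists>Y\<in>lie K. Y ** P = P ** g Z) \<and>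
    dim (lie L) \<le> dim (lie K)"
proof -
  obtain P Q L where PQ: "P ** Q = mat 1" and L: "standard L"
    and sub: "(\<lambda>X. P ** X ** Q) ` L \<subseteq> K \<or> (\<lambda>X. P ** flip X ** Q) ` L \<subseteq> K"
    using assms unfolding contains_standard_def by blast
  have QP: "Q ** P = mat 1" using PQ matrix_left_right_inverse[of P Q] by simp
  have detP: "det P \<noteq> 0" using PQ by (metis det_I det_mul mult_zero_left zero_neq_one)
  have L1: "L \<subseteq> {g. det g = 1}" using cds_standard[OF L] by (auto simp: cds_iff)
  have fin: ?thesis if g: "g \<in> {id, flip_lie}" and im: "(\<lambda>X. P ** X ** Q) ` g ` lie L \<subseteq> lie K" for g
  proof -
    have "linear g" using g linear_flip_lie by (auto simp: linear_id)
    then have "linear ((\<lambda>X. P ** X ** Q) \<circ> g)" by (rule linear_compose[OF _ linear_conj])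
    moreover have "inj ((\<lambda>X. P ** X ** Q) \<circ> g)"
    proof (rule inj_compose)
      have "Q ** (P ** X ** Q) ** P = X" for X by (metis QP matrix_mul_assoc matrix_mul_lid matrix_mul_rid)
      then show "inj (\<lambda>X. P ** X ** Q)" by (rule inj_on_inverseI)
      show "inj g" using g by (intro inj_on_inverseI[of _ g]) auto
    qed
    ultimately have "dim (((\<lambda>X. P ** X ** Q) \<circ> g) ` lie L) = dim (lie L)"
      by (intro dim_image_eq) (auto intro: inj_on_subset)
    then have "dim (lie L) \<le> dim (lie K)" using dim_subset[OF im] by (simp add: image_comp)
    moreover have "\<forall>Z\<in>lie L. \<exists>Y\<in>lie K. Y ** P = P ** g Z"
    proof
      fix Z assume "Z \<in> lie L"
      then have "P ** g Z ** Q \<in> lie K" using im by blast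
      moreover have "P ** g Z ** Q ** P = P ** g Z" by (metis QP matrix_mul_assoc matrix_mul_rid)
      ultimately show "\<exists>Y\<in>lie K. Y ** P = P ** g Z" by blast
    qed
    ultimately show ?thesis using detP L g by blast
  qed
  from sub show ?thesis
  proof
    assume "(\<lambda>X. P ** X ** Q) ` L \<subseteq> K"
    from lie_mono[OF this] show ?thesis unfolding lie_conj_image[OF PQ] by (intro fin[of id]) auto
  next
    assume "(\<lambda>X. P ** flip X ** Q) ` L \<subseteq> K"
    then have "(\<lambda>X. P ** X ** Q) ` flip ` L \<subseteq> K" by (simp add: image_image)
    from lie_mono[OF this] show ?thesis unfolding lie_conj_image[OF PQ] lie_flip_image[OF L1] by (intro fin[of flip_lie]) auto
  qed
qed

text \<open>Each two-dimensional Lie algebra comes with a witness, a nonzero diagonal element or the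
  regular nilpotent, that has no conjugate in \<open>corner_algebra\<close>.\<close>

lemma standard_cases:
  assumes "standard L"
  obtains (two) "dim (lie L) = 2" "(\<exists>a b. (a \<noteq> 0 \<or> b \<noteq> 0) \<and> m3 a 0 0 0 b 0 0 0 (- a - b) \<in> lie L) \<or> m3 0 1 0 0 0 1 0 0 0 \<in> lie L"
    | (three) "dim (lie L) = 3" "lie L \<subseteq> corner_algebra"
  using assms unfolding standard_def
proof (elim disjE exE conjE)
  assume L: "L = positive_diagonal_subgroup"
  have "m3 1 0 0 0 0 0 0 0 (- 1 - 0) \<in> lie L" unfolding L lie_positive_diagonal by (rule image_eqI[of _ _ "(1, 0)"]) simp_all
  then show thesis using two dim_lie_positive_diagonal L one_neq_zero by blast
next
  assume L: "L = unipotent_subgroup"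
  have "m3 0 1 0 0 0 1 0 0 0 \<in> lie L" unfolding L lie_unipotent by (rule image_eqI[of _ _ "(1, 0)"]) simp_all
  then show thesis using two dim_lie_unipotent L by blast
next
  assume "L = jordan_subgroup"
  then show thesis using three dim_lie_jordan lie_jordan_spiral by blast
next
  fix p q :: real assume pq: "max p q = 1" "min p q \<ge> - 1 / 2" and L: "L = diagonal_root_subgroup p q"
  have "m3 p 0 0 0 q 0 0 0 (- p - q) \<in> lie L" unfolding L lie_diagonal_root[OF pq] by (rule image_eqI[of _ _ "(1, 0)"]) simp_all
  moreover have "p \<noteq> 0 \<or> q \<noteq> 0" using pq(1) by (auto simp: max_def)
  ultimately show thesis using two dim_lie_diagonal_root[OF pq] L by blast
next
  fix p :: real assume "p \<noteq> 0" "L = spiral_subgroup p"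
  then show thesis using three dim_lie_spiral lie_jordan_spiral by blast
qed

text \<open>K itself contains an image of some listed L'. Only a two-dimensional L' inside a
  three-dimensional L could make the dimension drop, and its witness, possibly flipped, would be
  conjugate to an element of \<open>corner_algebra\<close>.\<close>

lemma dim_lie_standard_le:
  assumes L: "standard L" and K: "cds K" and sub: "lie K \<subseteq> lie L"
  shows "dim (lie L) \<le> dim (lie K)"
proof -
  obtain P g L' where P: "det P \<noteq> 0" and L': "standard L'" and g: "g \<in> {id, flip_lie}"
    and im: "\<And>Z. Z \<in> lie L' \<Longrightarrow> \<exists>Y\<in>lie K. Y ** P = P ** g Z" and dim: "dim (lie L') \<le> dim (lie K)"
    using contains_standard_lie[OF cds_contains_standard[OF K]] by blast
  from L' show ?thesis
  proof (cases rule: standard_cases)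
    case three
    from L show ?thesis by (cases rule: standard_cases) (use three dim in auto)
  next
    case two
    from L show ?thesis
    proof (cases rule: standard_cases)
      case three
      from two(2) consider
        (diagonal) a b where "a \<noteq> 0 \<or> b \<noteq> 0" "m3 a 0 0 0 b 0 0 0 (- a - b) \<in> lie L'"
        | (nilpotent) "m3 0 1 0 0 0 1 0 0 0 \<in> lie L'" by blast
      then have False
      proof cases
        case diagonal
        note ab = diagonal(1) and Z = diagonal(2)
        obtain Y where Y: "Y \<in> corner_algebra" "Y ** P = P ** g (m3 a 0 0 0 b 0 0 0 (- a - b))"
          using im[OF Z] sub three by blast
        from g consider "g = id" | "g = flip_lie" by blast
        then show False
        proof cases
          case 1
          then show False using corner_algebra_no_diagonal[OF Y(1) P, of a b "- a - b"] Y(2) ab by simp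
        next
          case 2
          have "b + a = 0 \<and> - b = 0 \<and> - a = 0"
            by (rule corner_algebra_no_diagonal[OF Y(1) P]) (use Y(2) 2 in simp_all)
          then show False using ab by simp
        qed
      next
        case Z: nilpotent
        obtain Y where Y: "Y \<in> corner_algebra" "Y ** P = P ** g (m3 0 1 0 0 0 1 0 0 0)"
          using im[OF Z] sub three by blast
        from g consider "g = id" | "g = flip_lie" by blast
        then show False
        proof cases
          case 1
          then show False using corner_algebra_no_regular_nilpotent[OF Y(1) P, of 1] Y(2) by simp
        next
          case 2
          then show False using corner_algebra_no_regular_nilpotent[OF Y(1) P, of "- 1"] Y(2) by simp
        qed
      qed
      then show ?thesis ..
    qed (use two dim in auto)
  qed
qed

text \<open>Equal dimensions force equal Lie algebras, and a closed connected group is determined by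
  its Lie algebra.\<close>

lemma standard_minimal:
  assumes L: "standard L" and K: "cds K" and KL: "K \<subseteq> L"
  shows "K = L"
proof -
  have c: "cds L" by (rule cds_standard[OF L])
  have sub: "lie K \<subseteq> lie L" by (rule lie_mono[OF KL])
  have "lie K = lie L"
    by (rule subspace_dim_equal[OF cds_subspace_lie[OF K] cds_subspace_lie[OF c] sub dim_lie_standard_le[OF L K sub]])
  then have "L \<subseteq> K" using K lie_mexp1 by (intro cds_subset[OF c]) (auto simp: cds_iff)
  then show ?thesis using KL by blast
qed

lemma lie_automorphisms_compose:
  assumes f: "f \<in> lie_automorphisms SL3" and g: "g \<in> lie_automorphisms SL3"
  shows "g \<circ> f \<in> lie_automorphisms SL3"
proof -
  have "g \<circ> f \<in> hom SL3 SL3" using f g unfolding lie_automorphisms_def iso_def by (auto intro: hom_compose)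
  moreover have "bij_betw (g \<circ> f) (carrier SL3) (carrier SL3)"
    using f g unfolding lie_automorphisms_def iso_def by (auto intro: bij_betw_trans)
  ultimately show ?thesis
    using f g homeomorphic_map_compose unfolding lie_automorphisms_def iso_def by blast
qed

theorem theorem1p8:
  fixes H :: "(real^3^3) set"
  shows "minimal_cartan_decomposition_subgroup SL3 H \<longleftrightarrow>
    (\<exists>f \<in> lie_automorphisms SL3. \<exists>L. H = f ` L \<and>
      (L = positive_diagonal_subgroup \<or>
       L = unipotent_subgroup \<or>
       L = jordan_subgroup \<or>
       (\<exists>p q. max p q = 1 \<and> min p q \<ge> - 1 / 2 \<and> L = diagonal_root_subgroup p q) \<or>
       (\<exists>p. p \<noteq> 0 \<and> L = spiral_subgroup p)))"
  unfolding standard_def[symmetric]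
proof
  assume "minimal_cartan_decomposition_subgroup SL3 H"
  then have H: "cds H" and min: "\<And>K. cds K \<Longrightarrow> K \<subseteq> H \<Longrightarrow> K = H"
    unfolding minimal_cartan_decomposition_subgroup_def by blast+
  obtain P Q L where PQ: "P ** Q = mat 1" and L: "standard L"
    and sub: "(\<lambda>X. P ** X ** Q) ` L \<subseteq> H \<or> (\<lambda>X. P ** flip X ** Q) ` L \<subseteq> H"
    using cds_contains_standard[OF H] unfolding contains_standard_def by blast
  have "(\<lambda>X. P ** flip X ** Q) \<in> lie_automorphisms SL3"
    using lie_automorphisms_compose[OF flip_automorphism conj_automorphism[OF PQ]] by (simp add: o_def)
  with sub obtain f where f: "f \<in> lie_automorphisms SL3" "f ` L \<subseteq> H"
    using conj_automorphism[OF PQ] by blast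
  \<comment> \<open>By minimality the image of the listed group, itself a Cartan-decomposition
    subgroup, fills H.\<close>
  have "f ` L = H" by (rule min[OF cds_automorphism[OF f(1) cds_standard[OF L]] f(2)])
  then show "\<exists>f\<in>lie_automorphisms SL3. \<exists>L. H = f ` L \<and> standard L" using f(1) L by blast
next
  assume "\<exists>f\<in>lie_automorphisms SL3. \<exists>L. H = f ` L \<and> standard L"
  then obtain f L where f: "f \<in> lie_automorphisms SL3" and H: "H = f ` L" and L: "standard L" by blast
  let ?G = "{g :: real^3^3. det g = 1}"
  have bij: "bij_betw f ?G ?G" using f by (simp add: lie_automorphisms_def iso_def SL3_def)
  have c: "cds H" unfolding H by (rule cds_automorphism[OF f cds_standard[OF L]])
  have LG: "L \<subseteq> ?G" using cds_standard[OF L] by (auto simp: cds_iff)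
  have "K = H" if K: "cds K" and KH: "K \<subseteq> H" for K
  proof -
    have KG: "K \<subseteq> ?G" using K by (auto simp: cds_iff)
    \<comment> \<open>A smaller subgroup is pulled back by the inverse automorphism into the listed
      group, where minimality is known.\<close>
    have "inv_into ?G f ` K \<subseteq> inv_into ?G f ` f ` L" using KH H by blast
    also have "\<dots> = L" using bij LG by (simp add: bij_betw_def inv_into_image_cancel)
    finally have "inv_into ?G f ` K = L"
      by (rule standard_minimal[OF L cds_automorphism[OF lie_automorphisms_inverse[OF f] K]])
    then show "K = H" unfolding H using bij KG by (metis bij_betw_def image_inv_into_cancel)
  qed
  then show "minimal_cartan_decomposition_subgroup SL3 H"
    using c unfolding minimal_cartan_decomposition_subgroup_def by blast
qed

end
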